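(* Assume (H1)–(H3) and let $P\in C([0,T];\mathbb S^n)$ be the unique strongly regular solution of the Riccati equation $(\ast)$. Then the matrix $\bar\Sigma:=R+\bar R+(D+\bar D)^\top P(D+\bar D)$ is invertible a.e. with bounded inverse, and the Riccati equation $$\begin{aligned}&\dot\Pi+\Pi(A+\bar A)+(A+\bar A)^\top\Pi+Q+\bar Q+(C+\bar C)^\top P(C+\bar C)\\&\quad-\big[\Pi(B+\bar B)+(C+\bar C)^\top P(D+\bar D)+(S+\bar S)^\top\big]\bar\Sigma^{-1}\big[(B+\bar B)^\top\Pi+(D+\bar D)^\top P(C+\bar C)+S+\bar S\big]=0,\\&\Pi(T)=G+\bar G\end{aligned}$$ has a unique solution $\Pi\in C([0,T];\mathbb S^n)$ (absolutely continuous, satisfying the equation a.e.).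
   Context: Setting: complete probability space with one-dimensional Brownian motion $W$ and augmented filtration $\mathbb F$; $T>0$; $\mathcal U_i$ ($i=1,2$) = square-integrable $\mathbb F$-progressively measurable $\mathbb R^{m_i}$-valued processes on $[0,T]$. State equation: $dX=\{AX+\bar A\mathbb E[X]+B_1u_1+\bar B_1\mathbb E[u_1]+B_2u_2+\bar B_2\mathbb E[u_2]\}ds+\{CX+\bar C\mathbb E[X]+D_1u_1+\bar D_1\mathbb E[u_1]+D_2u_2+\bar D_2\mathbb E[u_2]\}dW$, $X(0)=x$. Functional: $J(x;u_1,u_2)=\mathbb E\{\langle GX(T),X(T)\rangle+\langle\bar G\mathbb E[X(T)],\mathbb E[X(T)]\rangle+\int_0^T\langle \mathbf Q (X,u_1,u_2),(X,u_1,u_2)\rangle ds+\int_0^T\langle\bar{\mathbf Q}(\mathbb E X,\mathbb E u_1,\mathbb E u_2),(\mathbb E X,\mathbb E u_1,\mathbb E u_2)\rangle ds\}$ with $\mathbf Q=\begin{pmatrix}Q&S_1^\top&S_2^\top\\S_1&R_{11}&R_{12}\\S_2&R_{21}&R_{22}\end{pmatrix}$, $\bar{\mathbf Q}$ the same with all entries barred. (H1): all coefficients $A,\bar A,C,\bar C\in L^\infty(0,T;\mathbb R^{n\times n})$, $B_i,\bar B_i,D_i,\bar D_i\in L^\infty(0,T;\mathbb R^{n\times m_i})$ deterministic. (H2): $G,\bar G\in\mathbb S^n$; $Q,\bar Q\in L^\infty(0,T;\mathbb S^n)$; $S_i,\bar S_i\in L^\infty(0,T;\mathbb R^{m_i\times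 n})$; $R_{ij},\bar R_{ij}\in L^\infty(0,T;\mathbb R^{m_i\times m_j})$ with $R_{ij}^\top=R_{ji}$, $\bar R_{ij}^\top=\bar R_{ji}$. (H3): there is $\alpha>0$ with $J(0;u_1,0)\ge\alpha\mathbb E\int_0^T|u_1|^2ds$ for all $u_1$ and $J(0;0,u_2)\le-\alpha\mathbb E\int_0^T|u_2|^2ds$ for all $u_2$. Notation: $B=(B_1,B_2)$, $D=(D_1,D_2)$, $S=\begin{pmatrix}S_1\\S_2\end{pmatrix}$, $R=\begin{pmatrix}R_{11}&R_{12}\\R_{21}&R_{22}\end{pmatrix}$; $\bar B,\bar D,\bar S,\bar R$ analogously. $F\gg0$ means $F(s)\ge\delta I$ a.e. for some $\delta>0$. Riccati equation $(\ast)$: $\dot P+PA+A^\top P+C^\top PC+Q-(PB+C^\top PD+S^\top)(R+D^\top PD)^{-1}(B^\top P+D^\top PC+S)=0$, $P(T)=G$. A strongly regular solution is an absolutely continuous $P:[0,T]\to\mathbb S^n$ with $(-1)^{i+1}[R_{ii}+D_i^\top PD_i]\gg0$ ($i=1,2$) satisfying $(\ast)$ a.e.; under (H1)–(H3) it exists and is unique. *)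

theory Defs
  imports "HOL-Probability.Probability"
begin

definition symm :: "real^'n^'n \<Rightarrow> bool" where
  "symm M \<longleftrightarrow> transpose M = M"

definition Linf :: "real \<Rightarrow> (real \<Rightarrow> 'a::{real_normed_vector,second_countable_topology}) \<Rightarrow> bool" where
  "Linf T f \<longleftrightarrow> set_borel_measurable lborel {0..T} f \<and>
     (\<exists>K. AE t in lborel. t \<in> {0..T} \<longrightarrow> norm (f t) \<le> K)"

definition unif_pos :: "real \<Rightarrow> (real \<Rightarrow> real^'m^'m) \<Rightarrow> bool" where
  "unif_pos T F \<longleftrightarrow> (\<exists>\<delta>>0. AE t in lborel. t \<in> {0..T} \<longrightarrow>
      (\<forall>v. \<delta> * (v \<bullet> v) \<le> v \<bullet> (F t *v v)))"

definition abs_cont_on :: "real \<Rightarrow> real \<Rightarrow> (real \<Rightarrow> 'a::real_normed_vector) \<Rightarrow> bool" where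
  "abs_cont_on a b f \<longleftrightarrow> (\<forall>\<epsilon>>0. \<exists>\<delta>>0. \<forall>(k::nat) (l::nat \<Rightarrow> real) (r::nat \<Rightarrow> real).
      (\<forall>i<k. a \<le> l i \<and> l i \<le> r i \<and> r i \<le> b) \<and>
      (\<forall>i<k. \<forall>j<k. i \<noteq> j \<longrightarrow> r i \<le> l j \<or> r j \<le> l i) \<and>
      (\<Sum>i<k. r i - l i) < \<delta> \<longrightarrow> (\<Sum>i<k. norm (f (r i) - f (l i))) < \<epsilon>)"

definition hcat :: "real^'m1^'n \<Rightarrow> real^'m2^'n \<Rightarrow> real^('m1 + 'm2)^'n" where
  "hcat X Y = (\<chi> i j. case j of Inl k \<Rightarrow> X $ i $ k | Inr k \<Rightarrow> Y $ i $ k)"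

definition vcat :: "real^'n^'m1 \<Rightarrow> real^'n^'m2 \<Rightarrow> real^'n^('m1 + 'm2)" where
  "vcat X Y = (\<chi> j i. case j of Inl k \<Rightarrow> X $ k $ i | Inr k \<Rightarrow> Y $ k $ i)"

definition block :: "real^'m1^'m1 \<Rightarrow> real^'m2^'m1 \<Rightarrow> real^'m1^'m2 \<Rightarrow> real^'m2^'m2
    \<Rightarrow> real^('m1 + 'm2)^('m1 + 'm2)" where
  "block X11 X12 X21 X22 = (\<chi> a b. case a of
      Inl i \<Rightarrow> (case b of Inl j \<Rightarrow> X11 $ i $ j | Inr j \<Rightarrow> X12 $ i $ j)
    | Inr i \<Rightarrow> (case b of Inl j \<Rightarrow> X21 $ i $ j | Inr j \<Rightarrow> X22 $ i $ j))"

definition strongly_regular ::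
  "real \<Rightarrow> (real \<Rightarrow> real^'n^'n) \<Rightarrow> (real \<Rightarrow> real^'n^'n)
   \<Rightarrow> (real \<Rightarrow> real^'m1^'n) \<Rightarrow> (real \<Rightarrow> real^'m2^'n)
   \<Rightarrow> (real \<Rightarrow> real^'m1^'n) \<Rightarrow> (real \<Rightarrow> real^'m2^'n)
   \<Rightarrow> real^'n^'n \<Rightarrow> (real \<Rightarrow> real^'n^'n)
   \<Rightarrow> (real \<Rightarrow> real^'n^'m1) \<Rightarrow> (real \<Rightarrow> real^'n^'m2)
   \<Rightarrow> (real \<Rightarrow> real^'m1^'m1) \<Rightarrow> (real \<Rightarrow> real^'m2^'m1) \<Rightarrow> (real \<Rightarrow> real^'m1^'m2) \<Rightarrow> (real \<Rightarrow> real^'m2^'m2)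
   \<Rightarrow> (real \<Rightarrow> real^'n^'n) \<Rightarrow> bool" where
  "strongly_regular T A C B1 B2 D1 D2 G Q S1 S2 R11 R12 R21 R22 P \<longleftrightarrow>
     abs_cont_on 0 T P \<and> (\<forall>t\<in>{0..T}. symm (P t)) \<and> P T = G \<and>
     unif_pos T (\<lambda>t. R11 t + transpose (D1 t) ** P t ** D1 t) \<and>
     unif_pos T (\<lambda>t. - (R22 t + transpose (D2 t) ** P t ** D2 t)) \<and>
     (AE t in lborel. t \<in> {0..T} \<longrightarrow> (\<exists>P'. (P has_vector_derivative P') (at t) \<and>
        (let B = hcat (B1 t) (B2 t); D = hcat (D1 t) (D2 t); S = vcat (S1 t) (S2 t);
             R = block (R11 t) (R12 t) (R21 t) (R22 t) in
         P' + P t ** A t + transpose (A t) ** P t + transpose (C t) ** P t ** C t + Q t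
         - (P t ** B + transpose (C t) ** P t ** D + transpose S)
             ** matrix_inv (R + transpose D ** P t ** D)
             ** (transpose B ** P t + transpose D ** P t ** C t + S) = 0)))"

definition brownian_motion :: "'w measure \<Rightarrow> (real \<Rightarrow> 'w \<Rightarrow> real) \<Rightarrow> bool" where
  "brownian_motion M W \<longleftrightarrow>
     (\<forall>t. W t \<in> borel_measurable M) \<and>
     (AE \<omega> in M. W 0 \<omega> = 0 \<and> continuous_on {0..} (\<lambda>t. W t \<omega>)) \<and>
     (\<forall>s t. 0 \<le> s \<and> s < t \<longrightarrow>
        distributed M lborel (\<lambda>\<omega>. W t \<omega> - W s \<omega>) (\<lambda>x. ennreal (normal_density 0 (sqrt (t - s)) x))) \<and>
     (\<forall>(k::nat) (\<tau>::nat \<Rightarrow> real). 0 \<le> \<tau> 0 \<and> (\<forall>i<k. \<tau> i < \<tau> (Suc i)) \<longrightarrow>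
        prob_space.indep_vars M (\<lambda>_. borel) (\<lambda>i \<omega>. W (\<tau> (Suc i)) \<omega> - W (\<tau> i) \<omega>) {..<k})"

definition aug_filtration :: "'w measure \<Rightarrow> (real \<Rightarrow> 'w \<Rightarrow> real) \<Rightarrow> real \<Rightarrow> 'w set set" where
  "aug_filtration M W t = sigma_sets (space M)
     ({W s -` B \<inter> space M | s B. 0 \<le> s \<and> s \<le> t \<and> B \<in> sets borel} \<union> null_sets M)"

definition progressive :: "'w measure \<Rightarrow> (real \<Rightarrow> 'w set set) \<Rightarrow> real
    \<Rightarrow> (real \<Rightarrow> 'w \<Rightarrow> 'a::{real_normed_vector,second_countable_topology}) \<Rightarrow> bool" where
  "progressive M F T u \<longleftrightarrow> (\<forall>t\<in>{0..T}.
     (\<lambda>(s, \<omega>). u s \<omega>) \<in> borel_measurable (restrict_space lborel {0..t} \<Otimes>\<^sub>M sigma (space M) (F t)))"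

definition sq_int :: "'w measure \<Rightarrow> real \<Rightarrow> (real \<Rightarrow> 'w \<Rightarrow> 'a::real_normed_vector) \<Rightarrow> bool" where
  "sq_int M T u \<longleftrightarrow> (\<integral>\<^sup>+\<omega>. (\<integral>\<^sup>+s\<in>{0..T}. ennreal ((norm (u s \<omega>))\<^sup>2) \<partial>lborel) \<partial>M) < \<infinity>"

definition admissible :: "'w measure \<Rightarrow> (real \<Rightarrow> 'w set set) \<Rightarrow> real
    \<Rightarrow> (real \<Rightarrow> 'w \<Rightarrow> 'a::{real_normed_vector,second_countable_topology}) \<Rightarrow> bool" where
  "admissible M F T u \<longleftrightarrow> progressive M F T u \<and> sq_int M T u"

definition simple_integrand :: "'w measure \<Rightarrow> (real \<Rightarrow> 'w set set) \<Rightarrow> real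
    \<Rightarrow> nat \<Rightarrow> (nat \<Rightarrow> real) \<Rightarrow> (nat \<Rightarrow> 'w \<Rightarrow> 'a::{real_normed_vector,second_countable_topology}) \<Rightarrow> bool" where
  "simple_integrand M F T k \<tau> \<xi> \<longleftrightarrow> \<tau> 0 = 0 \<and> \<tau> k = T \<and> (\<forall>i<k. \<tau> i < \<tau> (Suc i)) \<and>
     (\<forall>i<k. \<xi> i \<in> borel_measurable (sigma (space M) (F (\<tau> i))) \<and>
            (\<exists>K. \<forall>\<omega>\<in>space M. norm (\<xi> i \<omega>) \<le> K))"

definition step_proc :: "nat \<Rightarrow> (nat \<Rightarrow> real) \<Rightarrow> (nat \<Rightarrow> 'w \<Rightarrow> 'a::real_normed_vector) \<Rightarrow> real \<Rightarrow> 'w \<Rightarrow> 'a" where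
  "step_proc k \<tau> \<xi> s \<omega> = (\<Sum>i<k. indicator {\<tau> i<..\<tau> (Suc i)} s *\<^sub>R \<xi> i \<omega>)"

definition step_ito :: "(real \<Rightarrow> 'w \<Rightarrow> real) \<Rightarrow> nat \<Rightarrow> (nat \<Rightarrow> real) \<Rightarrow> (nat \<Rightarrow> 'w \<Rightarrow> 'a::real_normed_vector)
    \<Rightarrow> real \<Rightarrow> 'w \<Rightarrow> 'a" where
  "step_ito W k \<tau> \<xi> t \<omega> = (\<Sum>i<k. (W (min t (\<tau> (Suc i))) \<omega> - W (min t (\<tau> i)) \<omega>) *\<^sub>R \<xi> i \<omega>)"

definition ito_integral :: "'w measure \<Rightarrow> (real \<Rightarrow> 'w set set) \<Rightarrow> (real \<Rightarrow> 'w \<Rightarrow> real) \<Rightarrow> real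
    \<Rightarrow> (real \<Rightarrow> 'w \<Rightarrow> 'a::{real_normed_vector,second_countable_topology}) \<Rightarrow> (real \<Rightarrow> 'w \<Rightarrow> 'a) \<Rightarrow> bool" where
  "ito_integral M F W T H I \<longleftrightarrow> (\<exists>k \<tau> \<xi>. (\<forall>n. simple_integrand M F T (k n) (\<tau> n) (\<xi> n)) \<and>
     ((\<lambda>n. \<integral>\<^sup>+\<omega>. (\<integral>\<^sup>+s\<in>{0..T}. ennreal ((norm (step_proc (k n) (\<tau> n) (\<xi> n) s \<omega> - H s \<omega>))\<^sup>2) \<partial>lborel) \<partial>M)
        \<longlonglongrightarrow> 0) \<and>
     (\<forall>t\<in>{0..T}. (\<lambda>n. \<integral>\<^sup>+\<omega>. ennreal ((norm (step_ito W (k n) (\<tau> n) (\<xi> n) t \<omega> - I t \<omega>))\<^sup>2) \<partial>M)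
        \<longlonglongrightarrow> 0))"

definition Ex :: "'w measure \<Rightarrow> (real \<Rightarrow> 'w \<Rightarrow> 'a::{banach,second_countable_topology}) \<Rightarrow> real \<Rightarrow> 'a" where
  "Ex M X s = (\<integral>\<omega>. X s \<omega> \<partial>M)"

definition mf_state ::
  "'w measure \<Rightarrow> (real \<Rightarrow> 'w set set) \<Rightarrow> (real \<Rightarrow> 'w \<Rightarrow> real) \<Rightarrow> real
   \<Rightarrow> (real \<Rightarrow> real^'n^'n) \<Rightarrow> (real \<Rightarrow> real^'n^'n)
   \<Rightarrow> (real \<Rightarrow> real^'m1^'n) \<Rightarrow> (real \<Rightarrow> real^'m1^'n) \<Rightarrow> (real \<Rightarrow> real^'m2^'n) \<Rightarrow> (real \<Rightarrow> real^'m2^'n)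
   \<Rightarrow> (real \<Rightarrow> real^'n^'n) \<Rightarrow> (real \<Rightarrow> real^'n^'n)
   \<Rightarrow> (real \<Rightarrow> real^'m1^'n) \<Rightarrow> (real \<Rightarrow> real^'m1^'n) \<Rightarrow> (real \<Rightarrow> real^'m2^'n) \<Rightarrow> (real \<Rightarrow> real^'m2^'n)
   \<Rightarrow> real^'n \<Rightarrow> (real \<Rightarrow> 'w \<Rightarrow> real^'m1) \<Rightarrow> (real \<Rightarrow> 'w \<Rightarrow> real^'m2) \<Rightarrow> (real \<Rightarrow> 'w \<Rightarrow> real^'n) \<Rightarrow> bool" where
  "mf_state M F W T A Ab B1 B1b B2 B2b C Cb D1 D1b D2 D2b x u1 u2 X \<longleftrightarrow>
     progressive M F T X \<and> sq_int M T X \<and>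
     (\<forall>t\<in>{0..T}. integrable M (\<lambda>\<omega>. (norm (X t \<omega>))\<^sup>2)) \<and>
     (let b = (\<lambda>s \<omega>. A s *v X s \<omega> + Ab s *v Ex M X s + B1 s *v u1 s \<omega> + B1b s *v Ex M u1 s
                     + B2 s *v u2 s \<omega> + B2b s *v Ex M u2 s);
          \<sigma> = (\<lambda>s \<omega>. C s *v X s \<omega> + Cb s *v Ex M X s + D1 s *v u1 s \<omega> + D1b s *v Ex M u1 s
                     + D2 s *v u2 s \<omega> + D2b s *v Ex M u2 s)
      in (AE \<omega> in M. set_integrable lborel {0..T} (\<lambda>s. b s \<omega>)) \<and>
         (\<exists>I. ito_integral M F W T \<sigma> I \<and>
            (\<forall>t\<in>{0..T}. AE \<omega> in M. X t \<omega> = x + (LINT s:{0..t}|lborel. b s \<omega>) + I t \<omega>)))"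

text \<open>Quadratic form <Q(X,u1,u2),(X,u1,u2)> for the block matrix Q, written out blockwise.\<close>
definition qform :: "real^'n^'n \<Rightarrow> real^'n^'m1 \<Rightarrow> real^'n^'m2
    \<Rightarrow> real^'m1^'m1 \<Rightarrow> real^'m2^'m1 \<Rightarrow> real^'m1^'m2 \<Rightarrow> real^'m2^'m2
    \<Rightarrow> real^'n \<Rightarrow> real^'m1 \<Rightarrow> real^'m2 \<Rightarrow> real" where
  "qform Q S1 S2 R11 R12 R21 R22 x v1 v2 =
     (Q *v x + transpose S1 *v v1 + transpose S2 *v v2) \<bullet> x
   + (S1 *v x + R11 *v v1 + R12 *v v2) \<bullet> v1
   + (S2 *v x + R21 *v v1 + R22 *v v2) \<bullet> v2"

definition cost ::
  "'w measure \<Rightarrow> real \<Rightarrow> real^'n^'n \<Rightarrow> real^'n^'n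
   \<Rightarrow> (real \<Rightarrow> real^'n^'n) \<Rightarrow> (real \<Rightarrow> real^'n^'m1) \<Rightarrow> (real \<Rightarrow> real^'n^'m2)
   \<Rightarrow> (real \<Rightarrow> real^'m1^'m1) \<Rightarrow> (real \<Rightarrow> real^'m2^'m1) \<Rightarrow> (real \<Rightarrow> real^'m1^'m2) \<Rightarrow> (real \<Rightarrow> real^'m2^'m2)
   \<Rightarrow> (real \<Rightarrow> real^'n^'n) \<Rightarrow> (real \<Rightarrow> real^'n^'m1) \<Rightarrow> (real \<Rightarrow> real^'n^'m2)
   \<Rightarrow> (real \<Rightarrow> real^'m1^'m1) \<Rightarrow> (real \<Rightarrow> real^'m2^'m1) \<Rightarrow> (real \<Rightarrow> real^'m1^'m2) \<Rightarrow> (real \<Rightarrow> real^'m2^'m2)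
   \<Rightarrow> (real \<Rightarrow> 'w \<Rightarrow> real^'m1) \<Rightarrow> (real \<Rightarrow> 'w \<Rightarrow> real^'m2) \<Rightarrow> (real \<Rightarrow> 'w \<Rightarrow> real^'n) \<Rightarrow> real" where
  "cost M T G Gb Q S1 S2 R11 R12 R21 R22 Qb S1b S2b R11b R12b R21b R22b u1 u2 X =
     (\<integral>\<omega>. (G *v X T \<omega>) \<bullet> X T \<omega>
        + (Gb *v Ex M X T) \<bullet> Ex M X T
        + (LINT s:{0..T}|lborel. qform (Q s) (S1 s) (S2 s) (R11 s) (R12 s) (R21 s) (R22 s)
                                   (X s \<omega>) (u1 s \<omega>) (u2 s \<omega>))
        + (LINT s:{0..T}|lborel. qform (Qb s) (S1b s) (S2b s) (R11b s) (R12b s) (R21b s) (R22b s)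
                                   (Ex M X s) (Ex M u1 s) (Ex M u2 s)) \<partial>M)"

definition sq_norm :: "'w measure \<Rightarrow> real \<Rightarrow> (real \<Rightarrow> 'w \<Rightarrow> 'a::real_normed_vector) \<Rightarrow> real" where
  "sq_norm M T u = (\<integral>\<omega>. (LINT s:{0..T}|lborel. (norm (u s \<omega>))\<^sup>2) \<partial>M)"

end

theory Submission
  imports Defs
begin

text \<open>
  Let player 1 use the feedback control \<open>u = v + K (X - E X)\<close> with \<open>v\<close> deterministic and \<open>K\<close> read off from the saddle
  point of the Riccati equation of \<open>P\<close>, and let player 2 do nothing. Then \<open>y = E X\<close> solves the deterministic mean equation,
  the centred part \<open>X - y\<close> solves a linear equation driven by the mean, and completing squares with \<open>P\<close> shows that its
  contribution to the cost is, up to a quadratic form of \<open>(y, v)\<close>, the integral of the (negative) diagonal block of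
  player 2. So (H3) carries over to the deterministic problem for \<open>(y, v)\<close> whose weights are completed by \<open>P\<close>, and likewise
  for player 2. Concentrating \<open>v\<close> on small sets bounds the diagonal blocks of \<open>Sig\<close> from below and above, so \<open>Sig\<close> is a
  saddle matrix with bounded inverse.

  The equation for \<open>Pi\<close> is that of the deterministic game. Its Hamiltonian system, solved backward from \<open>(I, G + Gb)\<close>, gives
  \<open>(X, Y)\<close>. If \<open>X t0 x = 0\<close>, split \<open>y = X x\<close> on \<open>[t0, T]\<close> into the responses \<open>y1\<close>, \<open>y2\<close> to the two controls; differentiating
  the pairing of \<open>Y x\<close> with \<open>y1 - y2\<close> shows that the cost of player 1 at \<open>y1\<close> equals the cost of player 2 at \<open>y2\<close>. The first
  is coercive from above zero, the second from below, so both controls vanish and \<open>x = 0\<close>. Hence \<open>X\<close> is invertible and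
  \<open>Pi\<close> is \<open>Y\<close> times the inverse of \<open>X\<close>; uniqueness and symmetry follow from the Gronwall inequality.
\<close>

section \<open>Absolutely continuous functions\<close>

text \<open>(H3) yields information only along state processes that have been exhibited: progressive
  ones whose noise term is a mean-square limit of integrals of bounded step processes. Hence a
  linear stochastic equation is solved by Euler schemes, and the controls are chosen to keep it
  simple. As the feedback acts on \<open>X - E X\<close> alone, the gain is absent from the mean
  equation, the centred part \<open>Z\<close> has mean zero, and \<open>E X\<close>,
  \<open>E u\<close> are known functions. Cost terms linear in \<open>Z\<close> vanish in
  expectation; the others need only the second moment \<open>V\<close>, whose Lyapunov equation is
  the limit of an exact recursion on the grid and does the work of Ito's formula. Its source is
  \<open>N N^T\<close> with \<open>N = (C + Cb) y + (D + Db) v\<close>; pairing it with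
  \<open>P\<close> is the origin of all terms of the form \<open>(C + Cb)^T P (C + Cb)\<close> or
  \<open>(D + Db)^T P (D + Db)\<close> in the equation for \<open>Pi\<close>. The deterministic game
  is indefinite, so \<open>Pi\<close> is not the value of a convex minimisation; therefore
  invertibility of \<open>X\<close> rests on comparing two controls of opposite sign.\<close>

lemma abs_cont_on_finite:
  fixes f :: "real => 'a::real_normed_vector"
  assumes "abs_cont_on a b f" "0 < e"
  shows "\<exists>d>0. \<forall>(I::'i set) l r. finite I \<longrightarrow> (\<forall>i\<in>I. a \<le> l i \<and> l i \<le> r i \<and> r i \<le> b) \<longrightarrow>
      (\<forall>i\<in>I. \<forall>j\<in>I. i \<noteq> j \<longrightarrow> r i \<le> l j \<or> r j \<le> l i) \<longrightarrow>
      (\<Sum>i\<in>I. r i - l i) < d \<longrightarrow> (\<Sum>i\<in>I. norm (f (r i) - f (l i))) < e"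
proof -
  from assms(1)[unfolded abs_cont_on_def, rule_format, OF assms(2)]
  obtain d where "d > 0" and d: "\<forall>(k::nat) (l::nat => real) (r::nat => real).
      (\<forall>i<k. a \<le> l i \<and> l i \<le> r i \<and> r i \<le> b) \<and>
      (\<forall>i<k. \<forall>j<k. i \<noteq> j \<longrightarrow> r i \<le> l j \<or> r j \<le> l i) \<and>
      (\<Sum>i<k. r i - l i) < d \<longrightarrow> (\<Sum>i<k. norm (f (r i) - f (l i))) < e"
    by (elim exE conjE)
  show ?thesis
  proof (rule exI[of _ d], intro conjI \<open>d > 0\<close> allI impI)
    fix I :: "'i set" and l r
    assume I: "finite I" "\<forall>i\<in>I. a \<le> l i \<and> l i \<le> r i \<and> r i \<le> b"
      "\<forall>i\<in>I. \<forall>j\<in>I. i \<noteq> j \<longrightarrow> r i \<le> l j \<or> r j \<le> l i"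
      "(\<Sum>i\<in>I. r i - l i) < d"
    obtain h where h: "bij_betw h {..<card I} I"
      using ex_bij_betw_nat_finite[OF I(1)] by (auto simp: atLeast0LessThan)
    have hI: "h i \<in> I" if "i < card I" for i
      using h that by (auto simp: bij_betw_def)
    have hne: "h i \<noteq> h j" if "i < card I" "j < card I" "i \<noteq> j" for i j
      using h that by (auto simp: bij_betw_def inj_on_def)
    have s: "(\<Sum>i<card I. g (h i)) = (\<Sum>i\<in>I. g i)" for g :: "'i => real"
      using sum.reindex_bij_betw[OF h] by simp
    have "(\<Sum>i<card I. norm (f (r (h i)) - f (l (h i)))) < e"
      by (rule d[rule_format, where r = "\<lambda>i. r (h i)" and l = "\<lambda>i. l (h i)"])
        (use I hI hne s[of "\<lambda>i. r i - l i"] in auto)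
    then show "(\<Sum>i\<in>I. norm (f (r i) - f (l i))) < e"
      using s[of "\<lambda>i. norm (f (r i) - f (l i))"] by simp
  qed
qed

text \<open>Gauge argument: at tags outside the null set \<open>N\<close> the derivative controls the Riemann sum; the intervals with a tag in \<open>N\<close>
  lie in an open set of small measure, where absolute continuity applies.\<close>

lemma abs_cont_on_has_integral:
  fixes f g :: "real => 'a::banach"
  assumes ab: "a \<le> b" and ac: "abs_cont_on a b f" and N: "negligible N"
    and der: "\<And>x. x \<in> {a..b} - N ==> (f has_vector_derivative g x) (at x within {a..b})"
  shows "(g has_integral (f b - f a)) {a..b}"
proof (cases "a = b")
  case True then show ?thesis using has_integral_refl(2)[of g a] by simp
next
  case False
  with ab have ab: "a < b" by simp
  \<comment> \<open>The values of \<open>g\<close> on \<open>N\<close> are arbitrary; with zero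
    there, a tag in \<open>N\<close> contributes nothing but the increment of
    \<open>f\<close>.\<close>
  define g0 where "g0 x = (if x \<in> N then 0 else g x)" for x
  have "(g0 has_integral (f b - f a)) {a..b}"
    unfolding has_integral_factor_content_real
  proof (intro allI impI)
    fix e :: real assume "e > 0"
    then have e2: "e/2 > 0" "e * (b - a) / 2 > 0" using ab by auto
    from abs_cont_on_finite[OF ac e2(2)] obtain \<delta> where "\<delta> > 0" and
      \<delta>: "\<forall>(I::(real \<times> real set) set) l r. finite I \<longrightarrow> (\<forall>i\<in>I. a \<le> l i \<and> l i \<le> r i \<and> r i \<le> b) \<longrightarrow>
      (\<forall>i\<in>I. \<forall>j\<in>I. i \<noteq> j \<longrightarrow> r i \<le> l j \<or> r j \<le> l i) \<longrightarrow>
      (\<Sum>i\<in>I. r i - l i) < \<delta> \<longrightarrow> (\<Sum>i\<in>I. norm (f (r i) - f (l i))) < e * (b - a) / 2"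
      by blast
    have "N \<in> sets lebesgue" using N by (simp add: negligible_imp_sets)
    from sets_lebesgue_outer_open[OF this \<open>\<delta> > 0\<close>] obtain V where
      V: "open V" "N \<subseteq> V" "V - N \<in> lmeasurable" "emeasure lebesgue (V - N) < ennreal \<delta>" by metis
    have VN: "V \<in> lmeasurable" "measure lebesgue V < \<delta>"
    proof -
      have N0: "N \<in> lmeasurable" "measure lebesgue N = 0"
        using N by (auto simp: negligible_iff_measure)
      have "V = (V - N) \<union> N" using V by auto
      then show l: "V \<in> lmeasurable" using V(3) N0 by (metis fmeasurable.Un)
      have "measure lebesgue V = measure lebesgue (V - N)"
        using measurable_measure_Diff[OF l _ V(2)] N0 \<open>N \<in> sets lebesgue\<close> by simp
      also have "\<dots> < \<delta>"
        using V(3,4) by (simp add: emeasure_eq_measure2 ennreal_less_iff)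
      finally show "measure lebesgue V < \<delta>" .
    qed
    have "\<exists>d>0. (x \<in> N \<longrightarrow> ball x d \<subseteq> V) \<and> (x \<in> {a..b} - N \<longrightarrow>
         (\<forall>y\<in>{a..b}. norm (y-x) < d \<longrightarrow> norm (f y - f x - (y-x) *\<^sub>R g x) \<le> e/2 * norm (y-x)))" for x
    proof (cases "x \<in> N")
      case True
      then show ?thesis using V(1,2) open_contains_ball by blast
    next
      case False
      show ?thesis
      proof (cases "x \<in> {a..b}")
        case True
        with False der[of x] have "\<forall>e>0. \<exists>d>0. \<forall>y\<in>{a..b}. norm (y-x) < d \<longrightarrow>
            norm (f y - f x - (y-x) *\<^sub>R g x) \<le> e * norm (y-x)"
          unfolding has_vector_derivative_def has_derivative_within_alt by blast
        with e2(1) False show ?thesis by meson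
      qed (use False in \<open>auto intro: exI[of _ 1]\<close>)
    qed
    then obtain d where d: "\<And>x. 0 < d x" "\<And>x. x \<in> N ==> ball x (d x) \<subseteq> V"
      "\<And>x y. x \<in> {a..b} - N ==> y \<in> {a..b} ==> norm (y-x) < d x ==>
         norm (f y - f x - (y-x) *\<^sub>R g x) \<le> e/2 * norm (y-x)"
      by metis
    show "\<exists>d. gauge d \<and> (\<forall>p. p tagged_division_of {a..b} \<and> d fine p \<longrightarrow>
      norm ((\<Sum>(x, k)\<in>p. measure lborel k *\<^sub>R g0 x) - (f b - f a)) \<le> e * measure lborel {a..b})"
    proof (intro exI conjI allI impI; (elim conjE)?)
      show "gauge (\<lambda>x. ball x (d x))" using d(1) by (rule gauge_ball_dependent[rule_format])
      fix p assume p: "p tagged_division_of {a..b}" and fine: "(\<lambda>x. ball x (d x)) fine p"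
      have fin: "finite p" using p by auto
      have pK: "\<exists>u v. u \<le> v \<and> K = {u..v} \<and> a \<le> u \<and> v \<le> b \<and> x \<in> {u..v}" if "(x, K) \<in> p" for x K
        using tagged_division_ofD(2-4)[OF p that] by (auto simp: subset_iff) 
      have ba: "b - a = (\<Sum>(x,K)\<in>p. Sup K - Inf K)" "f b - f a = (\<Sum>(x,K)\<in>p. f(Sup K) - f(Inf K))"
        by (rule additive_tagged_division_1[OF less_imp_le[OF ab] p, symmetric, where f = "\<lambda>x. x"],
            rule additive_tagged_division_1[OF less_imp_le[OF ab] p, symmetric])
      define p1 p2 where "p1 = {(x,K) \<in> p. x \<notin> N}" and "p2 = {(x,K) \<in> p. x \<in> N}"
      have pp: "p = p1 \<union> p2" "p1 \<inter> p2 = {}" "finite p1" "finite p2"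
        using fin by (auto simp: p1_def p2_def intro: finite_subset[OF _ fin])
      let ?D = "\<lambda>p. \<Sum>(x, K) \<in> p. (measure lborel K *\<^sub>R g0 x) - (f (Sup K) - f (Inf K))"
      have "norm (?D p1)
          \<le> (\<Sum>(x,K)\<in>p1. e/2 * (Sup K - Inf K))"
      proof (rule sum_norm_le, safe)
        fix x K assume "(x, K) \<in> p1"
        then have xK: "(x, K) \<in> p" "x \<notin> N" by (auto simp: p1_def)
        obtain u v where K: "u \<le> v" "K = {u..v}" "a \<le> u" "v \<le> b" "x \<in> {u..v}" using pK[OF xK(1)] by auto
        have ball: "{u..v} \<subseteq> ball x (d x)" using fine xK(1) K by auto
        have uv: "norm (u - x) < d x" "norm (v - x) < d x"
          using subsetD[OF ball, of u] subsetD[OF ball, of v] K(1) by (auto simp: dist_real_def)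
        \<comment> \<open>Straddle argument: the tag lies in \<open>{u..v}\<close>, so the errors at
          \<open>u\<close> and at \<open>v\<close> add up to a multiple of
          \<open>v - u\<close>.\<close>
        have "norm ((v - u) *\<^sub>R g x - (f v - f u)) = norm (f u - f x - (u - x) *\<^sub>R g x - (f v - f x - (v - x) *\<^sub>R g x))"
          by (auto simp: algebra_simps)
        also have "\<dots> \<le> norm (f u - f x - (u - x) *\<^sub>R g x) + norm (f v - f x - (v - x) *\<^sub>R g x)"
          by (rule norm_triangle_ineq4)
        also have "\<dots> \<le> e/2 * norm (u - x) + e/2 * norm (v - x)"
          by (intro add_mono d(3)) (use uv K xK in auto)
        also have "\<dots> = e/2 * (v - u)" using K by (simp add: field_simps)
        finally show "norm (measure lborel K *\<^sub>R g0 x - (f (Sup K) - f (Inf K))) \<le> e/2 * (Sup K - Inf K)"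
          using K xK by (simp add: g0_def)
      qed
      also have "\<dots> \<le> (\<Sum>(x,K)\<in>p. e/2 * (Sup K - Inf K))"
      proof (rule sum_mono2[OF fin])
        show "p1 \<subseteq> p" using pp by auto
        fix z assume "z \<in> p - p1"
        moreover obtain x K where "z = (x,K)" by (cases z)
        ultimately have "(x,K) \<in> p" "z = (x,K)" by auto
        then show "0 \<le> (case z of (x, K) => e/2 * (Sup K - Inf K))"
          using pK[of x K] \<open>e > 0\<close> by auto
      qed
      also have "\<dots> = e/2 * (b - a)"
        unfolding ba(1) sum_distrib_left by (auto intro!: sum.cong)
      finally have 1: "norm (?D p1) \<le> e/2 * (b - a)" .
      have ne: "r1 \<le> l2 \<or> r2 \<le> l1" if "interior {l1..r1} \<inter> interior {l2..r2} = {}" "l1 < r1" "l2 < r2"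
        for l1 r1 l2 r2 :: real
      proof (rule ccontr)
        assume "\<not> ?thesis"
        then have "max l1 l2 < min r1 r2" using that by auto
        then obtain z where "max l1 l2 < z" "z < min r1 r2" using dense by blast
        then have "z \<in> interior {l1..r1} \<inter> interior {l2..r2}" by auto
        then show False using that by auto
      qed
      \<comment> \<open>Degenerate intervals are set aside: disjoint interiors say nothing about
        their order, and their increments of \<open>f\<close> vanish.\<close>
      define p3 where "p3 = {z \<in> p2. Inf (snd z) < Sup (snd z)}"
      have p3: "finite p3" "p3 \<subseteq> p2" using pp by (auto simp: p3_def)
      have p3K: "\<exists>u v. u < v \<and> snd z = {u..v} \<and> a \<le> u \<and> v \<le> b \<and> {u..v} \<subseteq> V \<and> z \<in> p" if "z \<in> p3" for z
      proof -
        obtain x K where z: "z = (x,K)" by (cases z)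
        have xK: "(x,K) \<in> p" "x \<in> N" using that z by (auto simp: p3_def p2_def)
        obtain u v where K: "u \<le> v" "K = {u..v}" "a \<le> u" "v \<le> b" "x \<in> {u..v}" using pK[OF xK(1)] by auto
        have "{u..v} \<subseteq> V" using d(2)[OF xK(2)] fine xK(1) K by blast
        moreover have "u < v" using that z K by (auto simp: p3_def)
        ultimately show ?thesis using K z xK by auto
      qed
      have int0: "interior (snd z) \<inter> interior (snd w) = {}" if "z \<in> p3" "w \<in> p3" "z \<noteq> w" for z w
        using tagged_division_ofD(5)[OF p, of "fst z" "snd z" "fst w" "snd w"] p3K[OF that(1)] p3K[OF that(2)] that(3)
        by (auto simp: prod_eq_iff)
      \<comment> \<open>The total length is the measure of the union of the disjoint interiors,
        which lies in \<open>V\<close> and is therefore below \<open>\<delta>\<close>.\<close>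
      have "(\<Sum>z\<in>p3. Sup (snd z) - Inf (snd z)) = (\<Sum>z\<in>p3. measure lebesgue (interior (snd z)))"
        by (rule sum.cong) (use p3K in fastforce)+
      also have "\<dots> = measure lebesgue (\<Union>z\<in>p3. interior (snd z))"
      proof (rule measure_finite_Union[symmetric])
        show "disjoint_family_on (\<lambda>z. interior (snd z)) p3" using int0 by (auto simp: disjoint_family_on_def)
        show "emeasure lebesgue (interior (snd z)) \<noteq> \<infinity>" if "z \<in> p3" for z using p3K[OF that] by auto
      qed (use p3 in auto)
      also have "\<dots> \<le> measure lebesgue V"
      proof (rule measure_mono_fmeasurable)
        show "(\<Union>z\<in>p3. interior (snd z)) \<subseteq> V" using p3K interior_subset by fastforce
        show "(\<Union>z\<in>p3. interior (snd z)) \<in> sets lebesgue" using p3 by (intro sets.finite_UN) auto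
      qed (use VN in auto)
      also have "\<dots> < \<delta>" by (rule VN)
      finally have small: "(\<Sum>z\<in>p3. Sup (snd z) - Inf (snd z)) < \<delta>" .
      have 2: "(\<Sum>z\<in>p3. norm (f (Sup (snd z)) - f (Inf (snd z)))) < e * (b - a) / 2"
      proof (rule \<delta>[rule_format, OF p3(1) _ _ small])
        fix z assume "z \<in> p3"
        then show "a \<le> Inf (snd z) \<and> Inf (snd z) \<le> Sup (snd z) \<and> Sup (snd z) \<le> b" using p3K by fastforce
      next
        fix z w assume zw: "z \<in> p3" "w \<in> p3" "z \<noteq> w"
        obtain u v u' v' where "u < v" "snd z = {u..v}" "u' < v'" "snd w = {u'..v'}" using p3K zw by meson
        then show "Sup (snd z) \<le> Inf (snd w) \<or> Sup (snd w) \<le> Inf (snd z)"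
          using ne[of u v u' v'] int0[OF zw] by auto
      qed
      have "norm (?D p2) \<le> (\<Sum>z\<in>p2. norm (f (Sup (snd z)) - f (Inf (snd z))))"
        by (rule sum_norm_le) (auto simp: p2_def g0_def norm_minus_commute)
      also have "\<dots> = (\<Sum>z\<in>p3. norm (f (Sup (snd z)) - f (Inf (snd z))))"
      proof (rule sum.mono_neutral_right[OF pp(4) p3(2)], safe)
        fix x K assume "(x,K) \<in> p2" "(x,K) \<notin> p3"
        then have "Inf K = Sup K" using pK[of x K] by (auto simp: p2_def p3_def)
        then show "norm (f (Sup (snd (x,K))) - f (Inf (snd (x,K)))) = 0" by simp
      qed
      finally have 3: "norm (?D p2) \<le> e/2 * (b - a)" using 2 by simp
      have "(\<Sum>(x, k)\<in>p. measure lborel k *\<^sub>R g0 x) - (f b - f a) = ?D p"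
        unfolding ba(2) by (simp add: sum_subtractf split_def)
      also have "\<dots> = ?D p1 + ?D p2"
        using pp by (simp add: sum.union_disjoint)
      finally have "norm ((\<Sum>(x, k)\<in>p. measure lborel k *\<^sub>R g0 x) - (f b - f a)) \<le> e/2 * (b - a) + e/2 * (b - a)"
        using norm_triangle_mono[OF 1 3] by (simp only:)
      then show "norm ((\<Sum>(x, k)\<in>p. measure lborel k *\<^sub>R g0 x) - (f b - f a)) \<le> e * measure lborel {a..b}"
        using ab by (simp add: algebra_simps)
    qed
  qed
  then show ?thesis
    by (rule has_integral_spike[OF N, rotated]) (auto simp: g0_def)
qed

text \<open>The set \<open>E c\<close> of points that end arbitrarily short intervals whose mean is off by more than \<open>c\<close> is null: a Vitali
  cover by such intervals has small total length by the Henstock lemma.\<close>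

lemma lebesgue_differentiation_real:
  fixes g :: "real => 'a::euclidean_space"
  assumes g: "g integrable_on {a..b}"
  obtains N where "negligible N"
    "\<And>x. x \<in> {a<..<b} - N ==> ((\<lambda>t. integral {a..t} g) has_vector_derivative g x) (at x)"
proof -
  \<comment> \<open>The tag is an endpoint of the interval, so that the absence of short bad
    intervals controls both one-sided difference quotients at \<open>x\<close>.\<close>
  define bad where "bad c x u v \<longleftrightarrow> u < v \<and> (x = u \<or> x = v) \<and> {u..v} \<subseteq> {a..b} \<and>
     norm ((v - u) *\<^sub>R g x - integral {u..v} g) > c * (v - u)" for c x u v
  define E where "E c = {x. \<forall>d>0. \<exists>u v. bad c x u v \<and> v - u < d}" for c
  have negE: "negligible (E c)" if "c > 0" for c
    unfolding negligible_outer_le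
  proof (intro allI impI)
    fix e :: real assume "e > 0"
    then have "c * e > 0" using that by simp
    from Henstock_lemma[of g a b, OF _ this] g obtain \<gamma> where \<gamma>: "gauge \<gamma>"
      "\<And>p. p tagged_partial_division_of {a..b} ==> \<gamma> fine p ==>
             (\<Sum>(x,k)\<in>p. norm(measure lborel k *\<^sub>R g x - integral k g)) < c * e"
      by (auto simp: box_real)
    \<comment> \<open>Intervals are indexed together with their tags: the Vitali theorem speaks of
      indexed balls, the Henstock lemma of tagged intervals.\<close>
    define K where "K = {(x,u,v). bad c x u v \<and> {u..v} \<subseteq> \<gamma> x}"
    define m where "m = (\<lambda>(x::real,u::real,v). (u+v)/2)"
    define r where "r = (\<lambda>(x::real,u::real,v). (v-u)/2)"
    have cb: "cball (m (x,u,v)) (r (x,u,v)) = {u..v}" for x u v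
      by (auto simp: m_def r_def cball_def dist_real_def abs_le_iff field_simps)
    obtain C where C: "countable C" "C \<subseteq> K"
      "pairwise (\<lambda>i j. disjnt (cball (m i) (r i)) (cball (m j) (r j))) C"
      "negligible (E c - (\<Union>i\<in>C. cball (m i) (r i)))"
    proof (rule Vitali_covering_theorem_cballs[of K r "E c" m])
      show "0 < r i" if "i \<in> K" for i using that by (auto simp: K_def r_def bad_def)
      fix x d :: real assume x: "x \<in> E c" and "0 < d"
      obtain s where s: "s > 0" "ball x s \<subseteq> \<gamma> x"
        using \<gamma>(1) unfolding gauge_def by (metis open_contains_ball)
      obtain u v where uv: "bad c x u v" "v - u < min d s"
        using x \<open>0 < d\<close> s(1) unfolding E_def by (auto dest: spec[of _ "min d s"])
      then have "{u..v} \<subseteq> ball x s" by (auto simp: bad_def dist_real_def)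
      then have "(x,u,v) \<in> K" using uv s(2) by (auto simp: K_def)
      moreover have "x \<in> cball (m (x,u,v)) (r (x,u,v))" using uv by (auto simp: cb bad_def)
      moreover have "r (x,u,v) < d" using uv by (auto simp: r_def bad_def)
      ultimately show "\<exists>i. i \<in> K \<and> x \<in> cball (m i) (r i) \<and> r i < d" by blast
    qed (rule that)
    have fin: "measure lebesgue (\<Union>i\<in>F. cball (m i) (r i)) \<le> e" if F: "F \<subseteq> C" "finite F" for F
    proof -
      define q where "q = (\<lambda>(x::real,u::real,v::real). (x,{u..v}))"
      have FK: "F \<subseteq> K" using F C by auto
      have uv: "u < v" if "(x,u,v) \<in> F" for x u v using FK that by (auto simp: K_def bad_def)
      have inj: "inj_on q F"
      proof (rule inj_onI, unfold split_paired_all)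
        fix x u v x' u' v' assume *: "(x,u,v) \<in> F" "(x',u',v') \<in> F" "q (x,u,v) = q (x',u',v')"
        then have "x = x'" "{u..v} = {u'..v'}" by (auto simp: q_def)
        then show "(x,u,v) = (x',u',v')" using uv[OF *(1)] uv[OF *(2)] by (auto simp: Icc_eq_Icc)
      qed
      have disj: "{u..v} \<inter> {u'..v'} = {}" if "(x,u,v) \<in> F" "(x',u',v') \<in> F" "(x,u,v) \<noteq> (x',u',v')" for x u v x' u' v'
      proof -
        have "disjnt (cball (m (x,u,v)) (r (x,u,v))) (cball (m (x',u',v')) (r (x',u',v')))"
          using pairwiseD[OF C(3) subsetD[OF F(1) that(1)] subsetD[OF F(1) that(2)] that(3)] .
        then show ?thesis unfolding cb by (simp add: disjnt_def)
      qed
      have tp: "q ` F tagged_partial_division_of {a..b}"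
        unfolding tagged_partial_division_of_def
      proof (intro conjI allI impI; (elim conjE)?)
        show "finite (q ` F)" using F by auto
        fix x k assume "(x,k) \<in> q ` F"
        then obtain u v where "(x,u,v) \<in> F" "k = {u..v}" by (auto simp: q_def)
        then show "x \<in> k" "k \<subseteq> {a..b}" "\<exists>a b. k = cbox a b" using FK by (auto simp: K_def bad_def intro: exI[of _ u] exI[of _ v])
        fix x' k' assume "(x',k') \<in> q ` F" and ne: "(x,k) \<noteq> (x',k')"
        then obtain u' v' where "(x',u',v') \<in> F" "k' = {u'..v'}" by (auto simp: q_def)
        with \<open>(x,u,v) \<in> F\<close> \<open>k = {u..v}\<close> ne have "k \<inter> k' = {}" using disj by blast
        then show "interior k \<inter> interior k' = {}" using interior_subset by blast
      qed
      have "\<gamma> fine q ` F" using FK by (auto simp: fine_def q_def K_def)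
      from \<gamma>(2)[OF tp this] have "(\<Sum>i\<in>F. case q i of (x,k) => norm(measure lborel k *\<^sub>R g x - integral k g)) < c * e"
        by (simp add: sum.reindex[OF inj])
      \<comment> \<open>A bad interval of length \<open>2 * r i\<close> has a Henstock defect of at
        least \<open>c\<close> times that length; this is why the tolerance was chosen as
        \<open>c * e\<close>.\<close>
      moreover have "(\<Sum>i\<in>F. c * (2 * r i)) \<le> (\<Sum>i\<in>F. case q i of (x,k) => norm(measure lborel k *\<^sub>R g x - integral k g))"
      proof (rule sum_mono, unfold split_paired_all)
        fix x u v assume "(x,u,v) \<in> F"
        with FK have "bad c x u v" by (auto simp: K_def)
        then show "c * (2 * r (x,u,v)) \<le> (case q (x,u,v) of (x,k) =>
            norm (measure lborel k *\<^sub>R g x - integral k g))"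
          using mult_left_mono[of "v - u" "v - u" c] unfolding q_def r_def bad_def
          by (auto simp: right_diff_distrib)
      qed
      ultimately have "c * (\<Sum>i\<in>F. 2 * r i) < c * e" by (simp add: sum_distrib_left)
      then have le: "(\<Sum>i\<in>F. 2 * r i) \<le> e" using \<open>c > 0\<close> by simp
      have "measure lebesgue (\<Union>i\<in>F. cball (m i) (r i)) \<le> (\<Sum>i\<in>F. measure lebesgue (cball (m i) (r i)))"
        by (rule measure_UNION_le) (use F in auto)
      also have "\<dots> = (\<Sum>i\<in>F. 2 * r i)"
      proof (rule sum.cong[OF refl], safe)
        fix x u v assume "(x,u,v) \<in> F"
        from uv[OF this] show "measure lebesgue (cball (m (x,u,v)) (r (x,u,v))) = 2 * r (x,u,v)"
          unfolding cb by (simp add: r_def)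
      qed
      finally show ?thesis using le by simp
    qed
    let ?U = "\<Union>i\<in>C. cball (m i) (r i)"
    have U: "?U \<in> lmeasurable" "measure lebesgue ?U \<le> e"
      by (rule fmeasurable_UN_bound[OF C(1) _ fin], auto)
        (rule measure_UN_bound[OF C(1) _ fin], auto)
    have N: "E c - ?U \<in> lmeasurable" "measure lebesgue (E c - ?U) = 0"
      using C(4) by (auto simp: negligible_iff_measure)
    show "\<exists>T. E c \<subseteq> T \<and> T \<in> lmeasurable \<and> measure lebesgue T \<le> e"
    proof (intro exI conjI)
      show "E c \<subseteq> (E c - ?U) \<union> ?U" by auto
      show "(E c - ?U) \<union> ?U \<in> lmeasurable" using N(1) U(1) by (rule fmeasurable.Un)
      have "measure lebesgue ((E c - ?U) \<union> ?U) \<le> measure lebesgue (E c - ?U) + measure lebesgue ?U"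
        using N(1) U(1) by (intro measure_Un_le) auto
      then show "measure lebesgue ((E c - ?U) \<union> ?U) \<le> e" using N U by simp
    qed
  qed
  show thesis
  proof (rule that[of "\<Union>n::nat. E (1 / (Suc n))"])
    show "negligible (\<Union>n::nat. E (1 / (Suc n)))"
      by (rule negligible_Union_nat) (auto intro!: negE)
    fix x assume x: "x \<in> {a<..<b} - (\<Union>n::nat. E (1 / (Suc n)))"
    show "((\<lambda>t. integral {a..t} g) has_vector_derivative g x) (at x)"
      unfolding has_vector_derivative_def has_derivative_at_alt
    proof (intro conjI bounded_linear_scaleR_left allI impI)
      fix e :: real assume "e > 0"
      then obtain n :: nat where n: "1 / real (Suc n) < e"
        using reals_Archimedean by (auto simp: inverse_eq_divide)
      obtain d where d: "d > 0" "\<And>u v. bad (1 / Suc n) x u v ==> v - u \<ge> d"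
        using x unfolding E_def by (force simp: not_less)
      define d' where "d' = min d (min (x - a) (b - x))"
      have "d' > 0" using d x by (auto simp: d'_def)
      show "\<exists>d>0. \<forall>y. norm (y - x) < d \<longrightarrow>
         norm (integral {a..y} g - integral {a..x} g - (y - x) *\<^sub>R g x) \<le> e * norm (y - x)"
      proof (intro exI[of _ d'] conjI \<open>d' > 0\<close> allI impI)
        fix y assume y: "norm (y - x) < d'"
        then have ya: "a < y" "y < b" "\<bar>y - x\<bar> < d" using x by (auto simp: d'_def)
        have comb: "integral {a..v} g - integral {a..u} g = integral {u..v} g" if "a \<le> u" "u \<le> v" "v \<le> b" for u v
          using Henstock_Kurzweil_Integration.integral_combine[of a u v g] that
            integrable_subinterval_real[OF g, of a v] by (auto simp: algebra_simps)
        have en: "1 / real (Suc n) * t \<le> e * t" if "t \<ge> 0" for t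
          using n that by (intro mult_right_mono) auto
        consider "y = x" | "y < x" | "x < y" by linarith
        then show "norm (integral {a..y} g - integral {a..x} g - (y - x) *\<^sub>R g x) \<le> e * norm (y - x)"
        proof cases
          case 1 then show ?thesis by simp
        next
          case 2
          have "\<not> bad (1 / Suc n) x y x" using d(2)[of y x] ya 2 by auto
          then have "norm ((x - y) *\<^sub>R g x - integral {y..x} g) \<le> 1 / Suc n * (x - y)"
            using 2 ya x by (auto simp: bad_def)
          also have "\<dots> \<le> e * (x - y)" using 2 en[of "x - y"] by auto
          finally show ?thesis using comb[of y x] 2 ya x
            by (simp add: norm_minus_commute algebra_simps)
        next
          case 3
          have "\<not> bad (1 / Suc n) x x y" using d(2)[of x y] ya 3 by auto
          then have "norm ((y - x) *\<^sub>R g x - integral {x..y} g) \<le> 1 / Suc n * (y - x)"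
            using 3 ya x by (auto simp: bad_def)
          also have "\<dots> \<le> e * (y - x)" using 3 en[of "y - x"] by auto
          finally show ?thesis using comb[of x y] 3 ya x
            by (simp add: norm_minus_commute algebra_simps)
        qed
      qed
    qed
  qed
qed

section \<open>Primitives of bounded functions\<close>

abbreviation "tr \<equiv> transpose"

text \<open>Essentially bounded coefficients are replaced by bounded Borel functions on the whole line, so that integrability side
  conditions disappear.\<close>

definition bmf :: "(real => 'a::euclidean_space) => bool" where
  "bmf f \<longleftrightarrow> f \<in> borel_measurable borel \<and> (\<exists>K. \<forall>t. norm (f t) \<le> K)"

lemma bmfI: "f \<in> borel_measurable borel ==> (\<And>t. norm (f t) \<le> K) ==> bmf f"
  by (auto simp: bmf_def)

lemma bmf_measurable [measurable_dest]: "bmf f ==> f \<in> borel_measurable borel"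
  by (simp add: bmf_def)

lemma bmf_bound:
  assumes "bmf f" obtains K where "0 < K" "\<And>t. norm (f t) \<le> K"
proof -
  from assms obtain K where "\<And>t. norm (f t) \<le> K" by (auto simp: bmf_def)
  then have "norm (f t) \<le> max K 1" for t by (meson max.coboundedI1)
  then show thesis by (intro that[of "max K 1"]) auto
qed

lemma bmf_const: "bmf (\<lambda>t. c)" by (rule bmfI[of _ "norm c"]) auto

lemma bmf_bilinear:
  assumes B: "bounded_bilinear B" and f: "bmf f" and g: "bmf g"
  shows "bmf (\<lambda>t. B (f t) (g t))"
proof -
  interpret bounded_bilinear B by fact
  obtain K where K: "K > 0" "\<And>t. norm (f t) \<le> K" using bmf_bound[OF f] by blast
  obtain L where L: "L > 0" "\<And>t. norm (g t) \<le> L" using bmf_bound[OF g] by blast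
  obtain M where M: "M \<ge> 0" "\<And>a b. norm (B a b) \<le> norm a * norm b * M"
    using nonneg_bounded by blast
  show ?thesis
  proof (rule bmfI)
    show "norm (B (f t) (g t)) \<le> K * L * M" for t
      by (rule order_trans[OF M(2)]) (use K L M in \<open>auto intro!: mult_mono\<close>)
    have "continuous_on UNIV (\<lambda>p. B (fst p) (snd p))"
      by (intro continuous_on continuous_intros)
    then have "(\<lambda>p. B (fst p) (snd p)) \<in> borel_measurable borel"
      by (rule borel_measurable_continuous_onI)
    moreover have "(\<lambda>t. (f t, g t)) \<in> borel_measurable borel"
      using f g by (intro borel_measurable_Pair) (auto simp: bmf_def)
    ultimately have "(\<lambda>p. B (fst p) (snd p)) \<circ> (\<lambda>t. (f t, g t)) \<in> borel_measurable borel"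
      by (rule measurable_comp[rotated])
    then show "(\<lambda>t. B (f t) (g t)) \<in> borel_measurable borel" by (simp add: o_def)
  qed
qed

lemma bmf_linear:
  assumes B: "bounded_linear B" and f: "bmf f"
  shows "bmf (\<lambda>t. B (f t))"
proof -
  interpret bounded_linear B by fact
  obtain K where K: "K > 0" "\<And>t. norm (f t) \<le> K" using bmf_bound[OF f] by blast
  obtain M where M: "M \<ge> 0" "\<And>a. norm (B a) \<le> norm a * M"
    using nonneg_bounded by blast
  show ?thesis
  proof (rule bmfI)
    show "norm (B (f t)) \<le> K * M" for t
      by (rule order_trans[OF M(2)]) (use K M in \<open>auto intro!: mult_mono\<close>)
    have "B \<in> borel_measurable borel"
      using B by (simp add: borel_measurable_continuous_onI linear_continuous_on)
    from measurable_compose[OF bmf_measurable[OF f] this]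
    show "(\<lambda>t. B (f t)) \<in> borel_measurable borel" .
  qed
qed

lemma bmf_add: "bmf f ==> bmf g ==> bmf (\<lambda>t. f t + g t)"
proof -
  assume f: "bmf f" and g: "bmf g"
  obtain K where K: "K > 0" "\<And>t. norm (f t) \<le> K" using bmf_bound[OF f] by blast
  obtain L where L: "L > 0" "\<And>t. norm (g t) \<le> L" using bmf_bound[OF g] by blast
  show ?thesis
    by (rule bmfI[of _ "K + L"]) (use f g K L in \<open>auto intro!: norm_triangle_mono simp: bmf_measurable\<close>)
qed

lemma bmf_minus: "bmf f ==> bmf (\<lambda>t. - f t)"
  by (rule bmf_linear[OF bounded_linear_minus[OF bounded_linear_ident]])

lemma bmf_diff: "bmf f ==> bmf g ==> bmf (\<lambda>t. f t - g t)"
  using bmf_add[of f "\<lambda>t. - g t"] bmf_minus by auto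

lemma bmf_scaleR: "bmf f ==> bmf g ==> bmf (\<lambda>t. f t *\<^sub>R g t)"
  by (rule bmf_bilinear[OF bounded_bilinear_scaleR])

lemma bmf_inner: "bmf f ==> bmf g ==> bmf (\<lambda>t. f t \<bullet> g t)"
  by (rule bmf_bilinear[OF bounded_bilinear_inner])

lemma bmf_indicator: "S \<in> sets borel ==> bmf (indicator S :: real => real)"
  by (rule bmfI[of _ 1]) (auto simp: indicator_def)

lemma bmf_norm: "bmf f ==> bmf (\<lambda>t. norm (f t))"
  by (auto simp: bmf_def)

lemma bilinear_matrix_mult: "bounded_bilinear (\<lambda>(A::real^'b^'c) (B::real^'a^'b). A ** B)"
  by (simp add: bilinear_conv_bounded_bilinear[symmetric] bilinear_def linear_iff vec_eq_iff
      matrix_matrix_mult_def sum.distrib algebra_simps sum_distrib_left)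

lemma bilinear_matrix_vector: "bounded_bilinear (\<lambda>(A::real^'a^'b) x. A *v x)"
  by (simp add: bilinear_conv_bounded_bilinear[symmetric] bilinear_def linear_iff vec_eq_iff
      matrix_vector_mult_def sum.distrib algebra_simps sum_distrib_left)

lemma linear_transpose: "bounded_linear (tr :: real^'a^'b => _)"
  by (intro linear_conv_bounded_linear[THEN iffD1] linearI)
     (auto simp: transpose_def vec_eq_iff)

lemmas bmf_mm = bmf_bilinear[OF bilinear_matrix_mult]
lemmas bmf_mv = bmf_bilinear[OF bilinear_matrix_vector]
lemmas bmf_transpose = bmf_linear[OF linear_transpose]
lemmas bmf_intros = bmf_const bmf_add bmf_diff bmf_minus bmf_mm bmf_mv bmf_transpose
  bmf_scaleR bmf_inner

lemma integrable_indicator_Icc: "integrable lborel (indicat_real {a..b::real})"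
  by (rule integrable_real_indicator) (auto simp: emeasure_lborel_Icc_eq)

lemma bmf_set_integrable: "bmf f ==> set_integrable lborel {a..b} f"
proof -
  assume f: "bmf f"
  obtain K where K: "K > 0" "\<And>t. norm (f t) \<le> K" using bmf_bound[OF f] by blast
  have "set_integrable lborel {a..b} (\<lambda>t. K)" by (simp add: set_integrable_def integrable_indicator_Icc)
  then show ?thesis
    by (rule set_integrable_bound) (use f K in \<open>auto simp: set_borel_measurable_def bmf_def\<close>)
qed

lemma bmf_integral: "bmf f ==> (LBINT s:{a..b}. f s) = integral {a..b} f"
  by (rule set_borel_integral_eq_integral(2)[OF bmf_set_integrable])

lemma bmf_integrable_on: "bmf f ==> f integrable_on {a..b}"
  by (rule set_borel_integral_eq_integral(1)[OF bmf_set_integrable])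

lemma bmf_integral_combine:
  assumes "bmf f" "a \<le> b" "b \<le> c"
  shows "(LBINT s:{a..b}. f s) + (LBINT s:{b..c}. f s) = (LBINT s:{a..c}. f s)"
  using Henstock_Kurzweil_Integration.integral_combine[OF assms(2,3) bmf_integrable_on[OF assms(1)]]
  by (simp add: bmf_integral[OF assms(1)])

lemma bmf_integral_norm:
  assumes "bmf f" "a \<le> b" "\<And>t. t \<in> {a..b} ==> norm (f t) \<le> K"
  shows "norm (LBINT s:{a..b}. f s) \<le> K * (b - a)"
proof -
  have "norm (integral {a..b} f) \<le> integral {a..b} (\<lambda>_. K)"
    by (rule integral_norm_bound_integral) (use assms in \<open>auto intro: bmf_integrable_on\<close>)
  also have "\<dots> = K * (b - a)" using assms(2) by simp
  finally show ?thesis unfolding bmf_integral[OF assms(1)] .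
qed

lemma bmf_integral_refl [simp]: "bmf f ==> (LBINT s:{a}. f s) = 0"
  using bmf_integral[of f a a] by simp

text \<open>Clamping the upper limit to \<open>{0..T}\<close> makes the primitive bounded on the
  whole line; this is the form in which Picard iterates stay \<open>bmf\<close>.\<close>

lemma bmf_primitive:
  fixes g :: "real => 'a::euclidean_space"
  assumes "bmf g" "0 \<le> T"
  shows "bmf (\<lambda>t. LBINT s:{0..max 0 (min t T)}. g s)"
proof -
  obtain K where K: "K > 0" "\<And>t. norm (g t) \<le> K" using bmf_bound[OF assms(1)] by blast
  show ?thesis
  proof (rule bmfI)
    show "norm (LBINT s:{0..max 0 (min t T)}. g s) \<le> K * T" for t
    proof -
      have "norm (LBINT s:{0..max 0 (min t T)}. g s) \<le> K * (max 0 (min t T) - 0)"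
        using K assms by (intro bmf_integral_norm) auto
      also have "\<dots> \<le> K * T" using K assms by (intro mult_left_mono) auto
      finally show ?thesis .
    qed
    \<comment> \<open>With the interval written as a jointly measurable factor, measurability in
      \<open>t\<close> is that of a parameter integral.\<close>
    have "(\<lambda>t. LBINT s. (if 0 \<le> s \<and> s \<le> max 0 (min t T) then 1 else 0) *\<^sub>R g s) \<in> borel_measurable borel"
      using assms(1)[THEN bmf_measurable] by measurable
    also have "(\<lambda>t. LBINT s. (if 0 \<le> s \<and> s \<le> max 0 (min t T) then 1 else 0) *\<^sub>R g s) =
       (\<lambda>t. LBINT s:{0..max 0 (min t T)}. g s)"
      unfolding set_lebesgue_integral_def
      by (intro ext Bochner_Integration.integral_cong) (auto simp: indicator_def)
    finally show "(\<lambda>t. LBINT s:{0..max 0 (min t T)}. g s) \<in> borel_measurable borel" .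
  qed
qed

text \<open>The equation \<open>f' = g\<close> in integral form. As \<open>g\<close> is bounded,
  \<open>f\<close> is Lipschitz on \<open>{0..T}\<close>, and identities hold at every time instead
  of almost everywhere.\<close>

definition prim_on :: "real => (real => 'a::euclidean_space) => (real => 'a) => bool" where
  "prim_on T f g \<longleftrightarrow> bmf g \<and> (\<forall>t\<in>{0..T}. f t = f 0 + (LBINT s:{0..t}. g s))"

lemma prim_onD: "prim_on T f g ==> t \<in> {0..T} ==> f t = f 0 + (LBINT s:{0..t}. g s)"
  unfolding prim_on_def by blast

lemma prim_on_bmf: "prim_on T f g ==> bmf g"
  unfolding prim_on_def by blast

lemma prim_on_diff:
  assumes "prim_on T f g" "0 \<le> s" "s \<le> t" "t \<le> T"
  shows "f t - f s = (LBINT u:{s..t}. g u)"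
proof -
  have "f s = f 0 + (LBINT u:{0..s}. g u)" "f t = f 0 + (LBINT u:{0..t}. g u)"
    using assms by (auto intro!: prim_onD[OF assms(1)])
  then show ?thesis using bmf_integral_combine[OF prim_on_bmf[OF assms(1)] assms(2,3), symmetric] by simp
qed

lemma prim_on_lipschitz:
  assumes "prim_on T f g"
  obtains L where "0 < L" "\<And>s t. s \<in> {0..T} ==> t \<in> {0..T} ==> norm (f t - f s) \<le> L * \<bar>t - s\<bar>"
proof -
  have g: "bmf g" using assms by (rule prim_on_bmf)
  obtain K where K: "K > 0" "\<And>t. norm (g t) \<le> K" using bmf_bound[OF g] by blast
  have 1: "norm (f t - f s) \<le> K * \<bar>t - s\<bar>" if "s \<in> {0..T}" "t \<in> {0..T}" "s \<le> t" for s t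
    using bmf_integral_norm[OF g that(3), of K] K that prim_on_diff[OF assms, of s t] by auto
  show thesis
  proof (rule that[OF K(1)])
    fix s t assume "s \<in> {0..T}" "t \<in> {0..T}"
    then show "norm (f t - f s) \<le> K * \<bar>t - s\<bar>"
      using 1[of s t] 1[of t s] by (cases "s \<le> t") (auto simp: norm_minus_commute)
  qed
qed

lemma lipschitz_abs_cont_on:
  fixes f :: "real => 'a::real_normed_vector"
  assumes "0 < L" and L: "\<And>s t. s \<in> {a..b} ==> t \<in> {a..b} ==> norm (f t - f s) \<le> L * \<bar>t - s\<bar>"
  shows "abs_cont_on a b f"
  unfolding abs_cont_on_def
proof (intro allI impI)
  fix e :: real assume "e > 0"
  show "\<exists>\<delta>>0. \<forall>(k::nat) (l::nat => real) (r::nat => real).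
      (\<forall>i<k. a \<le> l i \<and> l i \<le> r i \<and> r i \<le> b) \<and>
      (\<forall>i<k. \<forall>j<k. i \<noteq> j \<longrightarrow> r i \<le> l j \<or> r j \<le> l i) \<and>
      (\<Sum>i<k. r i - l i) < \<delta> \<longrightarrow> (\<Sum>i<k. norm (f (r i) - f (l i))) < e"
  proof (intro exI[of _ "e / L"] conjI allI impI; (elim conjE)?)
    show "e / L > 0" using \<open>e > 0\<close> \<open>0 < L\<close> by simp
    fix k :: nat and l r :: "nat => real"
    assume lr: "\<forall>i<k. a \<le> l i \<and> l i \<le> r i \<and> r i \<le> b" and s: "(\<Sum>i<k. r i - l i) < e / L"
    have "(\<Sum>i<k. norm (f (r i) - f (l i))) \<le> (\<Sum>i<k. L * (r i - l i))"
    proof (rule sum_mono)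
      fix i assume "i \<in> {..<k}"
      with lr have "a \<le> l i" "l i \<le> r i" "r i \<le> b" by auto
      then show "norm (f (r i) - f (l i)) \<le> L * (r i - l i)" using L[of "l i" "r i"] by simp
    qed
    also have "\<dots> = L * (\<Sum>i<k. r i - l i)" by (simp add: sum_distrib_left)
    also have "\<dots> < e" using s \<open>0 < L\<close> by (simp add: field_simps)
    finally show "(\<Sum>i<k. norm (f (r i) - f (l i))) < e" .
  qed
qed

lemma prim_on_abs_cont: "prim_on T f g ==> abs_cont_on 0 T f"
  by (elim prim_on_lipschitz) (rule lipschitz_abs_cont_on)

lemma prim_on_continuous: "prim_on T f g ==> continuous_on {0..T} f"
proof (elim prim_on_lipschitz)
  fix L assume L: "0 < L" "\<And>s t. s \<in> {0..T} ==> t \<in> {0..T} ==> norm (f t - f s) \<le> L * \<bar>t - s\<bar>"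
  then have "L-lipschitz_on {0..T} f" by (intro lipschitz_onI) (auto simp: dist_norm)
  then show ?thesis by (rule lipschitz_on_continuous_on)
qed

text \<open>Lebesgue differentiation leads from the integral form back to the almost-everywhere
  equation that the theorem asks for.\<close>

lemma prim_on_AE_derivative:
  fixes f :: "real => 'a::euclidean_space"
  assumes "prim_on T f g"
  shows "AE t in lborel. t \<in> {0..T} \<longrightarrow> (f has_vector_derivative g t) (at t)"
proof -
  have g: "bmf g" using assms by (rule prim_on_bmf)
  obtain N where N: "negligible N"
    "\<And>x. x \<in> {0<..<T} - N ==> ((\<lambda>t. integral {0..t} g) has_vector_derivative g x) (at x)"
    using lebesgue_differentiation_real[OF bmf_integrable_on[OF g]] by blast
  \<comment> \<open>\<open>at t\<close> demands a two-sided derivative and nothing is known about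
    \<open>f\<close> outside \<open>{0..T}\<close>, so the endpoints join the null set.\<close>
  have "negligible (N \<union> {0, T})" using N by (simp add: negligible_Un)
  then have "AE t in lebesgue. t \<notin> N \<union> {0,T}"
    unfolding negligible_iff_null_sets by (rule AE_not_in)
  then have "AE t in lborel. t \<notin> N \<union> {0,T}" by (simp only: AE_completion_iff)
  then show ?thesis
  proof eventually_elim
    fix t assume t: "t \<notin> N \<union> {0,T}"
    show "t \<in> {0..T} \<longrightarrow> (f has_vector_derivative g t) (at t)"
    proof
      assume "t \<in> {0..T}"
      with t have t: "t \<in> {0<..<T} - N" by auto
      have "((\<lambda>t. f 0 + integral {0..t} g) has_vector_derivative 0 + g t) (at t)"
        by (intro has_vector_derivative_add has_vector_derivative_const N t)
      from this have "(f has_vector_derivative 0 + g t) (at t)"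
      proof (rule has_vector_derivative_transform_within_open)
        show "open {0<..<T}" "t \<in> {0<..<T}" using t by auto
        show "f 0 + integral {0..s} g = f s" if "s \<in> {0<..<T}" for s
        using prim_onD[OF assms, of s] that bmf_integral[OF g, of 0 s] by simp
      qed
      then show "(f has_vector_derivative g t) (at t)" by simp
    qed
  qed
qed

lemma abs_cont_on_subset:
  assumes ac: "abs_cont_on a b f" and "t \<le> b"
  shows "abs_cont_on a t f"
  unfolding abs_cont_on_def
proof (intro allI impI)
  fix e :: real assume "e > 0"
  from ac[unfolded abs_cont_on_def, rule_format, OF this]
  obtain \<delta> where \<delta>: "\<delta> > 0" "\<forall>(k::nat) (l::nat => real) (r::nat => real).
    (\<forall>i<k. a \<le> l i \<and> l i \<le> r i \<and> r i \<le> b) \<and>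
    (\<forall>i<k. \<forall>j<k. i \<noteq> j \<longrightarrow> r i \<le> l j \<or> r j \<le> l i) \<and>
    (\<Sum>i<k. r i - l i) < \<delta> \<longrightarrow> (\<Sum>i<k. norm (f (r i) - f (l i))) < e" by (elim exE conjE)
  show "\<exists>\<delta>>0. \<forall>(k::nat) (l::nat => real) (r::nat => real).
    (\<forall>i<k. a \<le> l i \<and> l i \<le> r i \<and> r i \<le> t) \<and>
    (\<forall>i<k. \<forall>j<k. i \<noteq> j \<longrightarrow> r i \<le> l j \<or> r j \<le> l i) \<and>
    (\<Sum>i<k. r i - l i) < \<delta> \<longrightarrow> (\<Sum>i<k. norm (f (r i) - f (l i))) < e"
  proof (rule exI[of _ \<delta>], intro conjI \<delta>(1) allI impI, elim conjE)
    fix k :: nat and l r :: "nat => real"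
    assume *: "\<forall>i<k. a \<le> l i \<and> l i \<le> r i \<and> r i \<le> t"
      "\<forall>i<k. \<forall>j<k. i \<noteq> j \<longrightarrow> r i \<le> l j \<or> r j \<le> l i" "(\<Sum>i<k. r i - l i) < \<delta>"
    have "\<forall>i<k. a \<le> l i \<and> l i \<le> r i \<and> r i \<le> b" using *(1) \<open>t \<le> b\<close> by force
    with * show "(\<Sum>i<k. norm (f (r i) - f (l i))) < e" using \<delta>(2) by blast
  qed
qed

text \<open>The passage in the other direction: an absolutely continuous function is recovered from
  its derivative, which brings \<open>P\<close> and the candidates for \<open>Pi\<close> into the
  calculus of primitives.\<close>

lemma abs_cont_on_prim:
  fixes f :: "real => 'a::euclidean_space"
  assumes ac: "abs_cont_on 0 T f" and g: "bmf g"
    and der: "AE t in lborel. t \<in> {0..T} \<longrightarrow> (f has_vector_derivative g t) (at t)"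
  shows "prim_on T f g"
  unfolding prim_on_def
proof (intro conjI g ballI)
  fix t assume t: "t \<in> {0..T}"
  have "AE t in lebesgue. t \<in> {0..T} \<longrightarrow> (f has_vector_derivative g t) (at t)"
    using der by (rule AE_completion)
  then obtain N where N: "N \<in> null_sets lebesgue"
      "\<And>x. x \<in> {0..T} - N ==> (f has_vector_derivative g x) (at x)"
    unfolding eventually_ae_filter by auto
  have ac': "abs_cont_on 0 t f" using t by (auto intro: abs_cont_on_subset[OF ac])
  have der': "(f has_vector_derivative g x) (at x within {0..t})" if "x \<in> {0..t} - N" for x
    using N(2)[of x] that t by (auto intro: has_vector_derivative_at_within)
  have "(g has_integral (f t - f 0)) {0..t}"
    by (rule abs_cont_on_has_integral[OF _ ac' _ der'])
      (use t N(1) in \<open>auto simp: negligible_iff_null_sets\<close>)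
  then show "f t = f 0 + (LBINT s:{0..t}. g s)"
    unfolding bmf_integral[OF g] by (simp add: integral_unique)
qed

lemma prim_on_cong:
  assumes "prim_on T f g" "\<And>t. t \<in> {0..T} ==> f t = f' t" "bmf g'"
    "AE t in lborel. t \<in> {0..T} \<longrightarrow> g t = g' t"
  shows "prim_on T f' g'"
  unfolding prim_on_def
proof (intro conjI assms(3) ballI)
  fix t assume t: "t \<in> {0..T}"
  have "(LBINT s:{0..t}. g s) = (LBINT s:{0..t}. g' s)"
    unfolding set_lebesgue_integral_def
    using bmf_measurable[OF prim_on_bmf[OF assms(1)]] bmf_measurable[OF assms(3)]
    by (intro integral_cong_AE)
      (use assms(4) t in \<open>auto simp: indicator_def elim!: eventually_mono\<close>)
  then show "f' t = f' 0 + (LBINT s:{0..t}. g' s)"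
    using prim_onD[OF assms(1) t] t assms(2)[of 0] assms(2)[of t] by auto
qed

text \<open>Solutions are prescribed on \<open>{0..T}\<close> only; cut off to zero elsewhere they
  become \<open>bmf\<close> and can stand inside coefficients.\<close>

definition ext0T :: "real => (real => 'a::real_vector) => real => 'a" where
  "ext0T T f t = indicator {0..T} t *\<^sub>R f t"

lemma ext0T_in [simp]: "t \<in> {0..T} ==> ext0T T f t = f t"
  by (simp add: ext0T_def)

lemma bmf_ext0T:
  fixes f :: "real => 'a::euclidean_space"
  assumes "continuous_on {0..T} f" shows "bmf (ext0T T f)"
proof -
  have "compact (f ` {0..T})" using assms by (intro compact_continuous_image) auto
  then obtain K where K: "\<And>t. t \<in> {0..T} ==> norm (f t) \<le> K"
    using compact_imp_bounded bounded_iff by (metis imageI)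
  have "norm (ext0T T f t) \<le> max K 0" for t
    using K[of t] by (cases "t \<in> {0..T}") (auto simp: ext0T_def)
  moreover have "ext0T T f \<in> borel_measurable borel"
    using borel_measurable_continuous_on_indicator[OF _ assms] by (simp add: ext0T_def[abs_def])
  ultimately show ?thesis by (rule bmfI[rotated])
qed

text \<open>Product rule: a product of Lipschitz functions is Lipschitz, hence determined by its
  derivative. It serves for the pairing of \<open>P\<close> with the covariance, of the costate with
  a trajectory, and for matrix products.\<close>

lemma prim_on_bilinear:
  assumes B: "bounded_bilinear B" and f: "prim_on T f f'" and g: "prim_on T g g'"
  shows "prim_on T (\<lambda>t. B (f t) (g t)) (\<lambda>t. B (ext0T T f t) (g' t) + B (f' t) (ext0T T g t))"
proof (rule abs_cont_on_prim)
  interpret bounded_bilinear B by fact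
  note bf = bmf_ext0T[OF prim_on_continuous[OF f]] bmf_ext0T[OF prim_on_continuous[OF g]]
    prim_on_bmf[OF f] prim_on_bmf[OF g]
  show "bmf (\<lambda>t. B (ext0T T f t) (g' t) + B (f' t) (ext0T T g t))"
    by (intro bmf_add bmf_bilinear[OF B] bf)
  obtain K where K: "K > 0" "\<And>t. norm (ext0T T f t) \<le> K" using bmf_bound[OF bf(1)] by blast
  obtain L where L: "L > 0" "\<And>t. norm (ext0T T g t) \<le> L" using bmf_bound[OF bf(2)] by blast
  obtain M where M: "M > 0" "\<And>a b. norm (B a b) \<le> norm a * norm b * M"
    using pos_bounded by blast
  obtain F where F: "F > 0" "\<And>s t. s \<in> {0..T} ==> t \<in> {0..T} ==> norm (f t - f s) \<le> F * \<bar>t - s\<bar>"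
    using prim_on_lipschitz[OF f] by blast
  obtain G where G: "G > 0" "\<And>s t. s \<in> {0..T} ==> t \<in> {0..T} ==> norm (g t - g s) \<le> G * \<bar>t - s\<bar>"
    using prim_on_lipschitz[OF g] by blast
  show "abs_cont_on 0 T (\<lambda>t. B (f t) (g t))"
  proof (rule lipschitz_abs_cont_on)
    show "0 < K * G * M + F * L * M" using K L M F G by (simp add: add_pos_pos)
    fix s t assume st: "s \<in> {0..T}" "t \<in> {0..T}"
    have "B (f t) (g t) - B (f s) (g s) = B (f t) (g t - g s) + B (f t - f s) (g s)"
      by (simp add: diff_right diff_left)
    also have "norm \<dots> \<le> norm (f t) * norm (g t - g s) * M + norm (f t - f s) * norm (g s) * M"
      by (intro norm_triangle_mono M)
    also have "\<dots> \<le> K * (G * \<bar>t - s\<bar>) * M + (F * \<bar>t - s\<bar>) * L * M"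
      using K(1) K(2)[of t] L(1) L(2)[of s] M(1) F G st by (intro add_mono mult_right_mono mult_mono) auto
    finally show "norm (B (f t) (g t) - B (f s) (g s)) \<le> (K * G * M + F * L * M) * \<bar>t - s\<bar>"
      by (simp add: algebra_simps)
  qed
  show "AE t in lborel. t \<in> {0..T} \<longrightarrow> ((\<lambda>t. B (f t) (g t)) has_vector_derivative
      B (ext0T T f t) (g' t) + B (f' t) (ext0T T g t)) (at t)"
    using prim_on_AE_derivative[OF f] prim_on_AE_derivative[OF g]
    by eventually_elim (auto intro!: has_vector_derivative)
qed

lemma prim_on_add:
  assumes f: "prim_on T f f'" and g: "prim_on T g g'"
  shows "prim_on T (\<lambda>t. f t + g t) (\<lambda>t. f' t + g' t)"
  unfolding prim_on_def
proof (intro conjI ballI bmf_add prim_on_bmf[OF f] prim_on_bmf[OF g])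
  fix t assume "t \<in> {0..T}"
  from prim_onD[OF f this] prim_onD[OF g this]
  show "f t + g t = f 0 + g 0 + (LBINT s:{0..t}. f' s + g' s)"
    by (simp add: set_integral_add bmf_set_integrable prim_on_bmf[OF f] prim_on_bmf[OF g])
qed

lemma prim_on_diff_fun:
  assumes f: "prim_on T f f'" and g: "prim_on T g g'"
  shows "prim_on T (\<lambda>t. f t - g t) (\<lambda>t. f' t - g' t)"
  unfolding prim_on_def
proof (intro conjI ballI bmf_diff prim_on_bmf[OF f] prim_on_bmf[OF g])
  fix t assume "t \<in> {0..T}"
  from prim_onD[OF f this] prim_onD[OF g this]
  show "f t - g t = f 0 - g 0 + (LBINT s:{0..t}. f' s - g' s)"
    by (simp add: set_integral_diff bmf_set_integrable prim_on_bmf[OF f] prim_on_bmf[OF g])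
qed

lemma prim_on_linear:
  assumes "bounded_linear B" "prim_on T f f'" shows "prim_on T (\<lambda>t. B (f t)) (\<lambda>t. B (f' t))"
  unfolding prim_on_def
proof (intro conjI ballI)
  show "bmf (\<lambda>t. B (f' t))" by (rule bmf_linear[OF assms(1) prim_on_bmf[OF assms(2)]])
  fix t assume "t \<in> {0..T}"
  have "set_integrable lborel {0..t} f'" by (rule bmf_set_integrable[OF prim_on_bmf[OF assms(2)]])
  then have "B (LBINT s:{0..t}. f' s) = (LBINT s:{0..t}. B (f' s))"
    unfolding set_lebesgue_integral_def set_integrable_def
    using integral_bounded_linear[OF assms(1)] linear_scale[OF bounded_linear.linear[OF assms(1)]]
    by (metis (no_types, lifting) Bochner_Integration.integral_cong)
  then show "B (f t) = B (f 0) + (LBINT s:{0..t}. B (f' s))"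
    using prim_onD[OF assms(2) \<open>t \<in> {0..T}\<close>] linear_add[OF bounded_linear.linear[OF assms(1)]] by metis
qed

lemma prim_on_const: "prim_on T (\<lambda>t. c) (\<lambda>t. 0)"
  by (auto simp: prim_on_def bmf_const set_lebesgue_integral_def)

text \<open>With the weight \<open>exp (- (2 * C * s))\<close> the supremum \<open>m\<close>
  satisfies \<open>m \<le> A + max m 0 / 2\<close>, an argument that suits bounded measurable
  \<open>\<phi>\<close>. Its price is the factor 2 and the doubled exponent.\<close>

lemma gronwall:
  fixes \<phi> :: "real => real"
  assumes \<phi>: "bmf \<phi>" and C: "0 < C" and A: "0 \<le> A"
    and le: "\<And>t. t \<in> {0..T} ==> \<phi> t \<le> A + C * (LBINT s:{0..t}. \<phi> s)"
  shows "t \<in> {0..T} ==> \<phi> t \<le> 2 * A * exp (2 * C * t)"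
proof -
  assume t: "t \<in> {0..T}"
  obtain K where K: "K > 0" "\<And>t. norm (\<phi> t) \<le> K" using bmf_bound[OF \<phi>] by blast
  define m where "m = (SUP s\<in>{0..T}. \<phi> s * exp (- (2 * C * s)))"
  have bdd: "bdd_above ((\<lambda>s. \<phi> s * exp (- (2 * C * s))) ` {0..T})"
  proof (rule bdd_aboveI2)
    fix s assume "s \<in> {0..T}"
    then have "\<phi> s * exp (- (2 * C * s)) \<le> K * 1"
      using K(1) K(2)[of s] C by (intro mult_mono) (auto simp: abs_le_iff)
    then show "\<phi> s * exp (- (2 * C * s)) \<le> K" by simp
  qed
  have pt: "\<phi> s \<le> m * exp (2 * C * s)" if "s \<in> {0..T}" for s
  proof -
    have "\<phi> s * exp (- (2 * C * s)) \<le> m" unfolding m_def using that by (intro cSUP_upper bdd)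
    then show ?thesis by (simp add: exp_minus field_simps)
  qed
  have "m \<le> A + max m 0 / 2"
  proof -
    have "\<phi> s * exp (- (2 * C * s)) \<le> A + max m 0 / 2" if s: "s \<in> {0..T}" for s
    proof -
      have "((\<lambda>r. max m 0 * exp (2 * C * r)) has_integral
         max m 0 / (2 * C) * exp (2 * C * s) - max m 0 / (2 * C) * exp (2 * C * 0)) {0..s}"
        using s C by (intro fundamental_theorem_of_calculus)
          (auto intro!: derivative_eq_intros simp: has_real_derivative_iff_has_vector_derivative[symmetric])
      moreover have "\<phi> r \<le> max m 0 * exp (2 * C * r)" if "r \<in> {0..s}" for r
        by (rule order_trans[OF pt]) (use that s in \<open>auto intro!: mult_right_mono\<close>)
      ultimately have "integral {0..s} \<phi> \<le> max m 0 / (2 * C) * exp (2 * C * s) - max m 0 / (2 * C)"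
        using has_integral_le[OF integrable_integral[OF bmf_integrable_on[OF \<phi>]]] by auto
      also have "\<dots> \<le> max m 0 / (2 * C) * exp (2 * C * s)" using C by simp
      finally have "C * integral {0..s} \<phi> \<le> max m 0 / 2 * exp (2 * C * s)" using C
        by (simp add: field_simps)
      then have "\<phi> s \<le> A + max m 0 / 2 * exp (2 * C * s)"
        using le[OF s] by (simp add: bmf_integral[OF \<phi>])
      also have "\<dots> \<le> A * exp (2 * C * s) + max m 0 / 2 * exp (2 * C * s)"
        using mult_left_mono[OF _ A, of 1 "exp (2 * C * s)"] s C by simp
      finally have "\<phi> s \<le> (A + max m 0 / 2) * exp (2 * C * s)" by (simp add: algebra_simps)
      then show ?thesis by (simp add: exp_minus field_simps)
    qed
    then show "m \<le> A + max m 0 / 2" unfolding m_def using t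
      by (intro cSUP_least) auto
  qed
  then have "m \<le> 2 * A" using A by (auto simp: max_def split: if_splits)
  then have "m * exp (2 * C * t) \<le> 2 * A * exp (2 * C * t)" by (intro mult_right_mono) auto
  with pt[OF t] show ?thesis by linarith
qed

text \<open>Picard iteration. In the norm weighted with \<open>exp (- (2 * C * t))\<close> each step
  halves the distance, so the iterates converge on all of \<open>{0..T}\<close> at once.\<close>

lemma ode_exists:
  fixes F :: "real => 'a::euclidean_space => 'a"
  assumes T: "0 \<le> T" and F: "\<And>y. bmf y ==> bmf (\<lambda>s. F s (y s))"
    and C: "0 < C" "\<And>s x y. norm (F s x - F s y) \<le> C * norm (x - y)"
  obtains y where "bmf y" "y 0 = x0" "prim_on T y (\<lambda>s. F s (y s))"
proof -
  define Y where "Y = rec_nat (\<lambda>t. x0) (\<lambda>_ y t. x0 + (LBINT s:{0..max 0 (min t T)}. F s (y s)))"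
  have Y0: "Y 0 = (\<lambda>t. x0)" and YS: "Y (Suc k) = (\<lambda>t. x0 + (LBINT s:{0..max 0 (min t T)}. F s (Y k s)))" for k
    by (auto simp: Y_def)
  have bY: "bmf (Y k)" for k
    by (induction k) (auto simp: Y0 YS intro!: bmf_const bmf_add bmf_primitive F T)
  \<comment> \<open>Off \<open>{0..T}\<close> the iterates repeat their value at the nearest
    endpoint, so estimates on \<open>{0..T}\<close> hold on the whole line.\<close>
  have min_in: "\<exists>t'\<in>{0..T}. \<forall>k. Y k t = Y k t'" for t
  proof (intro bexI[of _ "max 0 (min t T)"] allI)
    fix k show "Y k t = Y k (max 0 (min t T))"
      using T by (cases k) (simp_all add: Y0 YS)
  qed (use T in auto)
  obtain M where M: "M > 0" "\<And>t. norm (Y 1 t - Y 0 t) \<le> M"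
    using bmf_bound[OF bmf_diff[OF bY bY]] by metis
  have step: "norm (Y (Suc k) t - Y k t) \<le> M / 2^k * exp (2 * C * t)" if "t \<in> {0..T}" for k t
    using that
  proof (induction k arbitrary: t)
    case 0
    have "M * 1 \<le> M * exp (2 * C * t)" using M(1) 0 C by (intro mult_left_mono) auto
    then show ?case using M(2)[of t] by simp
  next
    case (Suc k)
    have b: "bmf (\<lambda>s. F s (Y (Suc k) s) - F s (Y k s))" by (intro bmf_diff F bY)
    have "Y (Suc (Suc k)) t - Y (Suc k) t = (LBINT s:{0..t}. F s (Y (Suc k) s) - F s (Y k s))"
      using Suc.prems by (subst (1) YS, subst (2) YS)
        (simp add: set_integral_diff bmf_set_integrable F bY max_def)
    also have "\<dots> = integral {0..t} (\<lambda>s. F s (Y (Suc k) s) - F s (Y k s))" by (rule bmf_integral[OF b])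
    also have "norm \<dots> \<le> integral {0..t} (\<lambda>s. C * (M / 2^k) * exp (2 * C * s))"
    proof (rule integral_norm_bound_integral[OF bmf_integrable_on[OF b]])
      show "(\<lambda>s. C * (M / 2^k) * exp (2 * C * s)) integrable_on {0..t}"
        by (intro integrable_continuous_real continuous_intros)
      fix s assume "s \<in> {0..t}"
      then have "C * norm (Y (Suc k) s - Y k s) \<le> C * (M / 2^k * exp (2 * C * s))"
        using Suc.prems C(1) by (intro mult_left_mono Suc.IH) auto
      then show "norm (F s (Y (Suc k) s) - F s (Y k s)) \<le> C * (M / 2^k) * exp (2 * C * s)"
        using C(2)[of s "Y (Suc k) s" "Y k s"] by (simp add: algebra_simps)
    qed
    also have "\<dots> = M / 2^(Suc k) * exp (2 * C * t) - M / 2^(Suc k) * exp (2 * C * 0)"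
      using Suc.prems C by (intro integral_unique fundamental_theorem_of_calculus)
        (auto intro!: derivative_eq_intros simp: has_real_derivative_iff_has_vector_derivative[symmetric])
    also have "\<dots> \<le> M / 2^(Suc k) * exp (2 * C * t)" using M by simp
    finally show ?case .
  qed
  define E where "E = M * exp (2 * C * T)"
  have E: "E > 0" using M by (simp add: E_def)
  have step': "norm (Y (Suc k) t - Y k t) \<le> E * (1/2)^k" for k t
  proof -
    obtain t' where t': "t' \<in> {0..T}" "\<And>k. Y k t = Y k t'" using min_in by metis
    have "M / 2^k * exp (2 * C * t') \<le> M / 2^k * exp (2 * C * T)"
      using t' C M by (intro mult_left_mono) auto
    then show ?thesis using step[OF t'(1), of k] by (simp add: t' E_def field_simps)
  qed
  define y where "y t = Y 0 t + (\<Sum>k. Y (Suc k) t - Y k t)" for t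
  have sm: "summable (\<lambda>k. norm (Y (Suc k) t - Y k t))" for t
    by (rule summable_comparison_test'[where g = "\<lambda>k. E * (1/2)^k" and N = 0])
      (use step' in \<open>auto intro!: summable_mult summable_geometric\<close>)
  have lim: "(\<lambda>n. Y n t) \<longlonglongrightarrow> y t" for t
  proof -
    have "(\<lambda>n. \<Sum>k<n. Y (Suc k) t - Y k t) \<longlonglongrightarrow> (\<Sum>k. Y (Suc k) t - Y k t)"
      by (rule summable_LIMSEQ[OF summable_norm_cancel[OF sm]])
    then have "(\<lambda>n. Y 0 t + (\<Sum>k<n. Y (Suc k) t - Y k t)) \<longlonglongrightarrow> y t"
      unfolding y_def by (intro tendsto_intros)
    then show ?thesis by (simp add: sum_lessThan_telescope[of "\<lambda>k. Y k t"])
  qed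
  have bd: "norm (Y n t) \<le> norm x0 + 2 * E" for n t
  proof -
    have "norm (\<Sum>k<n. Y (Suc k) t - Y k t) \<le> (\<Sum>k<n. E * (1/2)^k)"
      by (intro sum_norm_le step')
    also have "\<dots> \<le> E * 2"
      using sum_le_suminf[OF summable_mult[OF summable_geometric[of "1/2::real"]], of "{..<n}" E] E
      by (simp add: suminf_mult suminf_geometric summable_geometric)
    finally have "norm (Y n t - Y 0 t) \<le> 2 * E" by (simp add: sum_lessThan_telescope[of "\<lambda>k. Y k t"])
    then show ?thesis using norm_triangle_sub[of "Y n t" "Y 0 t"] by (simp add: Y0)
  qed
  have by': "bmf y"
  proof (rule bmfI)
    show "y \<in> borel_measurable borel"
      by (rule borel_measurable_LIMSEQ_metric[of Y]) (use lim bY in \<open>auto simp: bmf_def\<close>)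
    show "norm (y t) \<le> norm x0 + 2 * E" for t
      by (rule LIMSEQ_le_const2[OF tendsto_norm[OF lim]]) (use bd in auto)
  qed
  have "prim_on T y (\<lambda>s. F s (y s))" and y0: "y 0 = x0"
  proof -
    have "y t = x0 + (LBINT s:{0..t}. F s (y s))" if t: "t \<in> {0..T}" for t
    proof -
      obtain K where K: "K > 0" "\<And>s. norm (F s (y s)) \<le> K" using bmf_bound[OF F[OF by']] by blast
      have "(\<lambda>n. LBINT s:{0..t}. F s (Y n s)) \<longlonglongrightarrow> (LBINT s:{0..t}. F s (y s))"
        unfolding set_lebesgue_integral_def
      proof (rule integral_dominated_convergence)
        let ?B = "K + C * ((norm x0 + 2 * E) + (norm x0 + 2 * E))"
        show "integrable lborel (\<lambda>s. indicator {0..t} s *\<^sub>R ?B)"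
          by (rule integrable_scaleR_left) (simp add: integrable_indicator_Icc)
        show "AE s in lborel. (\<lambda>n. indicator {0..t} s *\<^sub>R F s (Y n s)) \<longlonglongrightarrow> indicator {0..t} s *\<^sub>R F s (y s)"
        proof (intro AE_I2 tendsto_intros)
          fix s
          have "(\<lambda>n. C * norm (Y n s - y s)) \<longlonglongrightarrow> C * norm (y s - y s)"
            by (intro tendsto_intros lim)
          then have "(\<lambda>n. C * norm (Y n s - y s)) \<longlonglongrightarrow> 0" by simp
          then have "(\<lambda>n. F s (Y n s) - F s (y s)) \<longlonglongrightarrow> 0"
            by (rule Lim_null_comparison[rotated]) (use C in auto)
          then show "(\<lambda>n. F s (Y n s)) \<longlonglongrightarrow> F s (y s)" by (simp add: LIM_zero_iff)
        qed
        fix n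
        show "AE s in lborel. norm (indicator {0..t} s *\<^sub>R F s (Y n s)) \<le> indicator {0..t} s *\<^sub>R ?B"
        proof (intro AE_I2)
          fix s
          have "norm (y s) \<le> norm x0 + 2 * E"
            by (rule LIMSEQ_le_const2[OF tendsto_norm[OF lim]]) (use bd in auto)
          then have "norm (Y n s - y s) \<le> (norm x0 + 2 * E) + (norm x0 + 2 * E)"
            by (rule order_trans[OF norm_triangle_ineq4 add_mono[OF bd]])
          then have "C * norm (Y n s - y s) \<le> C * ((norm x0 + 2 * E) + (norm x0 + 2 * E))" using C by simp
          then have "norm (F s (Y n s) - F s (y s)) \<le> C * ((norm x0 + 2 * E) + (norm x0 + 2 * E))" using C(2) order_trans by blast
          then have "norm (F s (Y n s)) \<le> ?B"
            using K(2)[of s] norm_triangle_sub[of "F s (Y n s)" "F s (y s)"] by linarith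
          then show "norm (indicator {0..t} s *\<^sub>R F s (Y n s)) \<le> indicator {0..t} s *\<^sub>R ?B"
            by (auto simp: indicator_def)
        qed
        show "(\<lambda>s. indicator {0..t} s *\<^sub>R F s (Y n s)) \<in> borel_measurable lborel"
          using bmf_measurable[OF F[OF bY]] by measurable
      next
        show "(\<lambda>s. indicator {0..t} s *\<^sub>R F s (y s)) \<in> borel_measurable lborel"
          using bmf_measurable[OF F[OF by']] by measurable
      qed
      then have "(\<lambda>n. Y (Suc n) t) \<longlonglongrightarrow> x0 + (LBINT s:{0..t}. F s (y s))"
        unfolding YS using t by (auto intro!: tendsto_intros simp: max_def)
      moreover have "(\<lambda>n. Y (Suc n) t) \<longlonglongrightarrow> y t" using lim by (rule LIMSEQ_Suc)
      ultimately show ?thesis using LIMSEQ_unique by blast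
    qed
    moreover from this[of 0] T show y0: "y 0 = x0" by (simp add: bmf_integral_refl[OF F[OF by'], of 0])
    ultimately show "prim_on T y (\<lambda>s. F s (y s))"
      unfolding prim_on_def y0 using F[OF by'] by auto
  qed
  with by' show thesis by (intro that)
qed

section \<open>Brownian increments\<close>

locale brownian = prob_space M for M :: "'w measure" +
  fixes W :: "real => 'w => real"
  assumes BM: "brownian_motion M W"
begin

abbreviation LM :: "(real \<times> 'w) measure" where "LM \<equiv> lborel \<Otimes>\<^sub>M M"

abbreviation FS :: "real => 'w measure" where
  "FS t \<equiv> sigma (space M) (aug_filtration M W t)"

lemma W_measurable [measurable]: "W t \<in> borel_measurable M"
  using BM by (auto simp: brownian_motion_def)

lemma W_0: "AE w in M. W 0 w = 0"
  using BM by (auto simp: brownian_motion_def elim: eventually_mono)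

lemma aug_filtration_sets: "aug_filtration M W t \<subseteq> sets M"
  unfolding aug_filtration_def
  by (rule sets.sigma_sets_subset) (auto intro: null_setsD2)

lemma sets_FS: "sets (FS t) = aug_filtration M W t"
proof -
  have "aug_filtration M W t \<subseteq> Pow (space M)"
    using aug_filtration_sets sets.sets_into_space by blast
  then have "sets (FS t) = sigma_sets (space M) (aug_filtration M W t)" by (rule sets_measure_of)
  also have "\<dots> = aug_filtration M W t" unfolding aug_filtration_def
    by (rule sigma_sets_sigma_sets_eq) (auto dest: sets.sets_into_space intro: null_setsD2)
  finally show ?thesis .
qed

lemma space_FS [simp]: "space (FS t) = space M"
  by (simp add: space_measure_of_conv)

lemma FS_subset: "sets (FS t) \<subseteq> sets M"
  unfolding sets_FS by (rule aug_filtration_sets)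

lemma FS_mono: "s \<le> t ==> sets (FS s) \<subseteq> sets (FS t)"
  unfolding sets_FS unfolding aug_filtration_def
proof (rule sigma_sets_mono', rule Un_mono[OF _ order_refl], safe)
  fix r and B :: "real set" assume "s \<le> t" "0 \<le> r" "r \<le> s" "B \<in> sets borel"
  then show "\<exists>s B'. W r -` B \<inter> space M = W s -` B' \<inter> space M \<and> 0 \<le> s \<and> s \<le> t \<and> B' \<in> sets borel"
    by (intro exI[of _ r] exI[of _ B]) auto
qed

lemma FS_measurable_M: "f \<in> borel_measurable (FS t) ==> f \<in> borel_measurable M"
  using FS_subset[of t] by (auto simp: measurable_def)

lemma FS_measurable_mono: "f \<in> borel_measurable (FS s) ==> s \<le> t ==> f \<in> borel_measurable (FS t)"
  using FS_mono[of s t] by (auto simp: measurable_def)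

lemma W_FS: "0 \<le> s ==> s \<le> t ==> W s \<in> borel_measurable (FS t)"
proof -
  assume "0 \<le> s" "s \<le> t"
  then have "W s -` B \<inter> space M \<in> sets (FS t)" if "B \<in> sets borel" for B
    unfolding sets_FS unfolding aug_filtration_def by (intro sigma_sets.Basic) (use that in blast)
  then show ?thesis by (intro measurableI) auto
qed

lemma increment_distr:
  assumes "0 \<le> s" "s < t"
  shows "distributed M lborel (\<lambda>w. W t w - W s w) (\<lambda>x. ennreal (normal_density 0 (sqrt (t - s)) x))"
  using BM assms unfolding brownian_motion_def by blast

lemma increment_moment:
  assumes st: "0 \<le> s" "s < t"
  shows "integrable M (\<lambda>w. W t w - W s w)" "expectation (\<lambda>w. W t w - W s w) = 0"
    "integrable M (\<lambda>w. (W t w - W s w)^2)" "expectation (\<lambda>w. (W t w - W s w)^2) = t - s"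
proof -
  note D = increment_distr[OF st]
  have s: "sqrt (t - s) > 0" using st by simp
  note I = distributed_integrable[OF D, symmetric] and E = distributed_integral[OF D, symmetric]
  show "integrable M (\<lambda>w. W t w - W s w)"
    using I[of "\<lambda>x. x"] integrable_normal_moment[OF s, of 0 1] by simp
  show "expectation (\<lambda>w. W t w - W s w) = 0"
    using E[of "\<lambda>x. x"] integral_normal_moment_odd[OF s, of 0 0] by simp
  show "integrable M (\<lambda>w. (W t w - W s w)^2)"
    using I[of "\<lambda>x. x^2"] integrable_normal_moment[OF s, of 0 2] by simp
  show "expectation (\<lambda>w. (W t w - W s w)^2) = t - s"
    using E[of "\<lambda>x. x^2"] integral_normal_moment_even[OF s, of 0 1] st by simp
qed

lemma increments_indep:
  assumes "0 \<le> \<tau> 0" "\<And>i. i < k ==> \<tau> i < \<tau> (Suc i)"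
  shows "indep_vars (\<lambda>_. borel) (\<lambda>i w. W (\<tau> (Suc i)) w - W (\<tau> i) w) {..<k::nat}"
  using BM assms unfolding brownian_motion_def by blast

text \<open>A generator of the augmented filtration that is stable under intersections: describing
  events only up to almost sure equality lets the null sets in alongside the cylinder sets.\<close>

definition cyl :: "real => 'w set set" where
  "cyl s = {E \<in> events. \<exists>J Bs. finite J \<and> J \<subseteq> {0..s} \<and> (\<forall>j\<in>J. Bs j \<in> sets borel) \<and>
      (AE w in M. w \<in> E \<longleftrightarrow> (\<forall>j\<in>J. W j w \<in> Bs j))}"

lemma Int_stable_cyl: "Int_stable (cyl s)"
  unfolding Int_stable_def
proof (intro ballI)
  fix E E' assume "E \<in> cyl s" "E' \<in> cyl s"
  then obtain J Bs J' Bs' where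
    E: "E \<in> events" "finite J" "J \<subseteq> {0..s}" "\<forall>j\<in>J. Bs j \<in> sets borel"
      "AE w in M. w \<in> E \<longleftrightarrow> (\<forall>j\<in>J. W j w \<in> Bs j)"
    and E': "E' \<in> events" "finite J'" "J' \<subseteq> {0..s}" "\<forall>j\<in>J'. Bs' j \<in> sets borel"
      "AE w in M. w \<in> E' \<longleftrightarrow> (\<forall>j\<in>J'. W j w \<in> Bs' j)"
    unfolding cyl_def by auto
  define C where "C j = (if j \<in> J then Bs j else UNIV) \<inter> (if j \<in> J' then Bs' j else UNIV)" for j
  have "AE w in M. w \<in> E \<inter> E' \<longleftrightarrow> (\<forall>j\<in>J \<union> J'. W j w \<in> C j)"
    using E(5) E'(5) by eventually_elim (auto simp: C_def split: if_splits)
  moreover have "\<forall>j\<in>J \<union> J'. C j \<in> sets borel" using E(4) E'(4) by (auto simp: C_def)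
  ultimately show "E \<inter> E' \<in> cyl s"
    unfolding cyl_def using E(1-3) E'(1-3) by (auto intro!: exI[of _ "J \<union> J'"] exI[of _ C])
qed

text \<open>The definition of Brownian motion speaks of finitely many consecutive increments. As
  \<open>W 0 = 0\<close> almost surely, the values of \<open>W\<close> up to time \<open>s\<close>
  are partial sums of increments before \<open>s\<close>, and the increment after \<open>s\<close>
  is one more member of the same independent family.\<close>

lemma cyl_indep:
  assumes st: "0 \<le> s" "s < t" and E: "E \<in> cyl s" and B: "B \<in> sets borel"
  shows "prob (E \<inter> ((\<lambda>w. W t w - W s w) -` B \<inter> space M)) =
    prob E * prob ((\<lambda>w. W t w - W s w) -` B \<inter> space M)"
proof -
  obtain J Bs where E: "E \<in> events" "finite J" "J \<subseteq> {0..s}" "\<forall>j\<in>J. Bs j \<in> sets borel"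
      "AE w in M. w \<in> E \<longleftrightarrow> (\<forall>j\<in>J. W j w \<in> Bs j)"
    using E unfolding cyl_def by auto
  \<comment> \<open>With \<open>0\<close> and \<open>s\<close> among the times, the grid starts
    where \<open>W\<close> vanishes and ends at \<open>s\<close>, so that \<open>W t - W s\<close>
    is the next increment.\<close>
  define J' where "J' = insert 0 (insert s J)"
  define C where "C j = (if j \<in> J then Bs j else UNIV)" for j
  have J': "finite J'" "J' \<subseteq> {0..s}" "0 \<in> J'" "s \<in> J'" using E st by (auto simp: J'_def)
  have C: "C j \<in> sets borel" for j using E(4) by (auto simp: C_def)
  define L where "L = sorted_list_of_set J'"
  define n where "n = length L"
  have L: "set L = J'" "sorted_wrt (<) L" using J' by (auto simp: L_def)
  have n: "n > 0" using L J' by (auto simp: n_def)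
  \<comment> \<open>Index \<open>n\<close> carries the time \<open>t\<close>; the sum of the
    increments below \<open>j\<close> is then \<open>W (\<tau> j)\<close>, and the one with index
    \<open>n - 1\<close> is \<open>W t - W s\<close>.\<close>
  define \<tau> where "\<tau> i = (if i < n then L ! i else t + real (i - n))" for i
  have \<tau>s: "\<tau> i < \<tau> j" if "i < j" "j < n" for i j
    using L(2) that by (auto simp: sorted_wrt_iff_nth_less \<tau>_def n_def)
  have \<tau>J: "\<tau> ` {..<n} = J'"
    using L(1) by (auto simp: \<tau>_def n_def set_conv_nth)
  have last: "\<tau> (n - 1) = s"
  proof -
    obtain i where i: "i < n" "\<tau> i = s" using \<tau>J J' by auto
    have "\<tau> (n-1) \<le> s" using \<tau>J J' n by (metis atLeastAtMost_iff diff_less imageI lessThan_iff subsetD zero_less_one)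
    have "i = n - 1"
    proof (rule ccontr)
      assume "i \<noteq> n - 1"
      then have "\<tau> i < \<tau> (n - 1)" using i by (intro \<tau>s) auto
      then show False using \<open>\<tau> (n - 1) \<le> s\<close> i by simp
    qed
    then show ?thesis using i by simp
  qed
  have first: "\<tau> 0 = 0"
  proof -
    obtain i where i: "i < n" "\<tau> i = 0" using \<tau>J J' by auto
    have "0 \<le> \<tau> 0" using \<tau>J J' n by (metis atLeastAtMost_iff imageI lessThan_iff subsetD)
    then show ?thesis using i \<tau>s[of 0 i] by (cases "i = 0") auto
  qed
  have \<tau>n: "\<tau> n = t" by (simp add: \<tau>_def)
  define X where "X i w = W (\<tau> (Suc i)) w - W (\<tau> i) w" for i w
  have "indep_vars (\<lambda>_. borel) X {..<n}"
    unfolding X_def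
  proof (rule increments_indep)
    fix i assume "i < n"
    then show "\<tau> i < \<tau> (Suc i)"
      using \<tau>s[of i "Suc i"] last \<tau>n st n by (cases "Suc i = n") auto
  qed (simp add: first)
  then have iv: "indep_var (PiM {..<n-1} (\<lambda>_. borel)) (\<lambda>w. restrict (\<lambda>i. X i w) {..<n-1})
      (PiM {n-1} (\<lambda>_. borel)) (\<lambda>w. restrict (\<lambda>i. X i w) {n-1})"
    by (rule indep_var_restrict) (use n in auto)
  define E1 where "E1 = {x \<in> space (PiM {..<n-1} (\<lambda>_. borel)). \<forall>j\<in>{..<n}. (\<Sum>i<j. x i) \<in> C (\<tau> j)}"
  define E2 where "E2 = {x \<in> space (PiM {n-1} (\<lambda>_. borel)). x (n-1) \<in> B}"
  have E1: "E1 \<in> sets (PiM {..<n-1} (\<lambda>_. borel :: real measure))"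
    unfolding E1_def
  proof (intro sets.sets_Collect_finite_All)
    fix j assume j: "j \<in> {..<n}"
    have "(\<lambda>x. \<Sum>i<j. x i) \<in> borel_measurable (PiM {..<n-1} (\<lambda>_. borel :: real measure))"
      by (intro borel_measurable_sum measurable_component_singleton) (use j in auto)
    from measurable_sets[OF this C[of "\<tau> j"]]
    show "{x \<in> space (PiM {..<n-1} (\<lambda>_. borel)). (\<Sum>i<j. x i) \<in> C (\<tau> j)} \<in> sets (PiM {..<n-1} (\<lambda>_. borel :: real measure))"
      by (simp add: vimage_def Int_def conj_commute)
  qed simp
  have E2: "E2 \<in> sets (PiM {n-1} (\<lambda>_. borel :: real measure))"
    unfolding E2_def using B by measurable
  define \<Phi> where "\<Phi> w = restrict (\<lambda>i. X i w) {..<n-1}" for w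
  define \<Psi> where "\<Psi> w = restrict (\<lambda>i. X i w) {n-1}" for w
  have "prob ((\<lambda>w. (\<Phi> w, \<Psi> w)) -` (E1 \<times> E2) \<inter> space M) =
      prob (\<Phi> -` E1 \<inter> space M) * prob (\<Psi> -` E2 \<inter> space M)"
    unfolding \<Phi>_def \<Psi>_def by (rule indep_varD[OF iv E1 E2])
  moreover have \<Psi>: "\<Psi> -` E2 \<inter> space M = (\<lambda>w. W t w - W s w) -` B \<inter> space M"
    using n by (auto simp: \<Psi>_def E2_def X_def last[unfolded One_nat_def] \<tau>n space_PiM)
  moreover have \<Phi>: "AE w in M. w \<in> \<Phi> -` E1 \<inter> space M \<longleftrightarrow> w \<in> E"
    using E(5) W_0 AE_space
  proof eventually_elim
    case (elim w)
    have "(\<Sum>i<j. \<Phi> w i) = W (\<tau> j) w" if "j < n" for j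
    proof -
      have "(\<Sum>i<j. \<Phi> w i) = (\<Sum>i<j. X i w)"
        by (rule sum.cong) (use that in \<open>auto simp: \<Phi>_def\<close>)
      also have "\<dots> = W (\<tau> j) w - W (\<tau> 0) w"
        unfolding X_def using sum_lessThan_telescope[of "\<lambda>i. W (\<tau> i) w" j] by simp
      finally show ?thesis using elim(2) first by simp
    qed
    then have "w \<in> \<Phi> -` E1 \<inter> space M \<longleftrightarrow> (\<forall>j\<in>{..<n}. W (\<tau> j) w \<in> C (\<tau> j))"
      using elim(3) by (auto simp: E1_def \<Phi>_def space_PiM)
    also have "\<dots> \<longleftrightarrow> (\<forall>j\<in>J'. W j w \<in> C j)" unfolding \<tau>J[symmetric] by auto
    also have "\<dots> \<longleftrightarrow> w \<in> E" using elim(1) by (auto simp: C_def J'_def)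
    finally show ?case .
  qed
  moreover have m1: "\<Phi> -` E1 \<inter> space M \<in> events"
    using indep_var_rv1[OF iv] E1 unfolding \<Phi>_def by (rule measurable_sets)
  have D: "(\<lambda>w. W t w - W s w) -` B \<inter> space M \<in> events"
    using B by measurable
  have "prob (\<Phi> -` E1 \<inter> space M) = prob E"
    by (rule finite_measure_eq_AE) (use \<Phi> m1 E(1) in auto)
  moreover have "prob ((\<lambda>w. (\<Phi> w, \<Psi> w)) -` (E1 \<times> E2) \<inter> space M) =
     prob (E \<inter> ((\<lambda>w. W t w - W s w) -` B \<inter> space M))"
  proof (rule finite_measure_eq_AE)
    have eq: "(\<lambda>w. (\<Phi> w, \<Psi> w)) -` (E1 \<times> E2) \<inter> space M = (\<Phi> -` E1 \<inter> space M) \<inter> (\<Psi> -` E2 \<inter> space M)"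
      by auto
    show "(\<lambda>w. (\<Phi> w, \<Psi> w)) -` (E1 \<times> E2) \<inter> space M \<in> events"
      unfolding eq \<Psi> using m1 D by auto
    show "E \<inter> ((\<lambda>w. W t w - W s w) -` B \<inter> space M) \<in> events" using E(1) D by auto
    show "AE w in M. (w \<in> (\<lambda>w. (\<Phi> w, \<Psi> w)) -` (E1 \<times> E2) \<inter> space M) =
        (w \<in> E \<inter> ((\<lambda>w. W t w - W s w) -` B \<inter> space M))"
      unfolding eq \<Psi> using \<Phi> by eventually_elim auto
  qed
  ultimately show ?thesis by simp
qed

text \<open>Both generators are stable under intersections, so independence extends from cylinder
  events to the generated sigma algebras.\<close>

lemma FS_indep:
  assumes st: "0 \<le> s" "s < t"
  shows "indep_set (sets (FS s)) (sigma_sets (space M) {(\<lambda>w. W t w - W s w) -` B \<inter> space M | B. B \<in> sets borel})"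
proof -
  let ?D = "{(\<lambda>w. W t w - W s w) -` B \<inter> space M | B. B \<in> sets borel}"
  have ev: "?D \<subseteq> events" by auto
  have "indep_set (cyl s) ?D"
    unfolding indep_sets2_eq
  proof (intro conjI ballI ev)
    fix a b assume a: "a \<in> cyl s" and "b \<in> ?D"
    then obtain B where "B \<in> sets borel" "b = (\<lambda>w. W t w - W s w) -` B \<inter> space M" by blast
    then show "prob (a \<inter> b) = prob a * prob b" using cyl_indep[OF st a] by simp
  qed (auto simp: cyl_def)
  moreover have "Int_stable ?D"
  proof (rule Int_stableI)
    fix a b assume "a \<in> ?D" "b \<in> ?D"
    then obtain A B where "A \<in> sets borel" "B \<in> sets borel"
      "a = (\<lambda>w. W t w - W s w) -` A \<inter> space M" "b = (\<lambda>w. W t w - W s w) -` B \<inter> space M" by auto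
    then show "a \<inter> b \<in> ?D" by (auto intro!: exI[of _ "A \<inter> B"])
  qed
  ultimately have i: "indep_set (sigma_sets (space M) (cyl s)) (sigma_sets (space M) ?D)"
    by (intro indep_set_sigma_sets Int_stable_cyl)
  have "sets (FS s) \<subseteq> sigma_sets (space M) (cyl s)"
    unfolding sets_FS unfolding aug_filtration_def
  proof (rule sigma_sets_mono', safe)
    fix r B assume "0 \<le> r" "r \<le> s" "(B :: real set) \<in> sets borel"
    then show "W r -` B \<inter> space M \<in> cyl s"
      unfolding cyl_def by (auto intro!: exI[of _ "{r}"] exI[of _ "\<lambda>_. B"])
  next
    fix N assume "N \<in> null_sets M"
    then show "N \<in> cyl s"
      unfolding cyl_def using st by (auto intro!: exI[of _ "{0}"] exI[of _ "\<lambda>_. {}"] AE_not_in)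
  qed
  with i show ?thesis unfolding indep_sets2_eq by blast
qed

lemma FS_indep_var:
  assumes st: "0 \<le> s" "s < t" and X: "X \<in> borel_measurable (FS s)"
  shows "indep_var borel X borel (\<lambda>w. W t w - W s w)"
  unfolding indep_var_eq
proof (intro conjI)
  show "X \<in> borel_measurable M" using X by (rule FS_measurable_M)
  show "indep_set (sigma_sets (space M) {X -` A \<inter> space M |A. A \<in> sets borel})
     (sigma_sets (space M) {(\<lambda>w. W t w - W s w) -` A \<inter> space M |A. A \<in> sets borel})"
  proof -
    have "sigma_sets (space (FS s)) {X -` A \<inter> space M |A. A \<in> sets borel} \<subseteq> sets (FS s)"
      by (rule sets.sigma_sets_subset) (use measurable_sets[OF X] in auto)
    then show ?thesis
      using FS_indep[OF st] unfolding indep_sets2_eq by simp blast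
  qed
qed simp

lemma FS_expectation:
  assumes st: "0 \<le> s" "s < t" and X: "X \<in> borel_measurable (FS s)" "integrable M X"
  shows "integrable M (\<lambda>w. X w * (W t w - W s w))" "expectation (\<lambda>w. X w * (W t w - W s w)) = 0"
    "integrable M (\<lambda>w. X w * (W t w - W s w)^2)"
    "expectation (\<lambda>w. X w * (W t w - W s w)^2) = expectation X * (t - s)"
proof -
  note i = FS_indep_var[OF st X(1)]
  note m = increment_moment[OF st]
  have i2: "indep_var borel X borel (\<lambda>w. (W t w - W s w)^2)"
    using indep_var_compose[OF i, of "\<lambda>x. x" borel "\<lambda>x. x^2" borel] by (simp add: o_def)
  show "integrable M (\<lambda>w. X w * (W t w - W s w))" by (rule indep_var_integrable[OF i X(2) m(1)])
  show "expectation (\<lambda>w. X w * (W t w - W s w)) = 0"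
    using indep_var_lebesgue_integral[OF i X(2) m(1)] m(2) by simp
  show "integrable M (\<lambda>w. X w * (W t w - W s w)^2)" by (rule indep_var_integrable[OF i2 X(2) m(3)])
  show "expectation (\<lambda>w. X w * (W t w - W s w)^2) = expectation X * (t - s)"
    using indep_var_lebesgue_integral[OF i2 X(2) m(3)] m(4) by simp
qed

end

section \<open>Step integrals on dyadic grids\<close>

context brownian begin

definition L2 :: "('w => 'a::euclidean_space) => bool" where
  "L2 f \<longleftrightarrow> f \<in> borel_measurable M \<and> integrable M (\<lambda>w. (norm (f w))^2)"

definition n2 :: "('w => 'a::euclidean_space) => real" where
  "n2 f = expectation (\<lambda>w. (norm (f w))^2)"

lemma L2_measurable [measurable_dest]: "L2 f ==> f \<in> borel_measurable M"
  by (simp add: L2_def)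

lemma L2_int: "L2 f ==> integrable M (\<lambda>w. (norm (f w))^2)"
  by (simp add: L2_def)

lemma n2_nonneg [simp]: "0 \<le> n2 f"
  by (simp add: n2_def)

lemma L2I_bound:
  assumes "f \<in> borel_measurable M" "integrable M g" "\<And>w. (norm (f w))^2 \<le> g w"
  shows "L2 f" "n2 f \<le> expectation g"
proof -
  have "0 \<le> g w" for w using assms(3)[of w] by (meson order_trans zero_le_power2)
  then have "integrable M (\<lambda>w. (norm (f w))^2)"
    by (intro Bochner_Integration.integrable_bound[OF assms(2)]) (use assms in auto)
  then show "L2 f" "n2 f \<le> expectation g"
    using assms by (auto simp: L2_def n2_def intro!: integral_mono)
qed

lemma norm_add_sq: "(norm (x + y :: 'a::real_inner))^2 \<le> 2 * (norm x)^2 + 2 * (norm y)^2"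
proof -
  have "(norm (x + y))^2 + (norm (x - y))^2 = 2 * (norm x)^2 + 2 * (norm y)^2"
    by (simp add: power2_norm_eq_inner inner_add_left inner_add_right inner_diff_left inner_diff_right inner_commute)
  then show ?thesis using zero_le_power2[of "norm (x - y)"] by linarith
qed

text \<open>Estimates are made for squared norms, so this inequality replaces the triangle
  inequality; its repeated use produces the numerical factors of the later constants.\<close>

lemma L2_add:
  assumes f: "L2 f" and g: "L2 g"
  shows "L2 (\<lambda>w. f w + g w)" "n2 (\<lambda>w. f w + g w) \<le> 2 * n2 f + 2 * n2 g"
proof -
  have m: "(\<lambda>w. f w + g w) \<in> borel_measurable M" using f g by (auto simp: L2_def)
  have i: "integrable M (\<lambda>w. 2 * (norm (f w))^2 + 2 * (norm (g w))^2)" using f g by (auto simp: L2_def)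
  note * = L2I_bound[OF m i norm_add_sq]
  show "L2 (\<lambda>w. f w + g w)" by (rule *)
  show "n2 (\<lambda>w. f w + g w) \<le> 2 * n2 f + 2 * n2 g"
    using *(2) f g by (simp add: n2_def L2_def)
qed

lemma L2_bounded:
  assumes f: "f \<in> borel_measurable M" and g: "L2 g" and le: "\<And>w. norm (f w) \<le> K * norm (g w)"
  shows "L2 f" "n2 f \<le> K^2 * n2 g"
proof -
  have "(norm (f w))^2 \<le> K^2 * (norm (g w))^2" for w
    using power_mono[OF le[of w], of 2] by (simp add: power_mult_distrib)
  note * = L2I_bound[OF f _ this]
  have i: "integrable M (\<lambda>w. K^2 * (norm (g w))^2)" using g by (auto simp: L2_def)
  show "L2 f" by (rule *[OF i])
  show "n2 f \<le> K^2 * n2 g" using *(2)[OF i] by (simp add: n2_def)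
qed

lemma L2_linear:
  assumes B: "bounded_linear B" and f: "L2 f" shows "L2 (\<lambda>w. B (f w))"
proof -
  interpret bounded_linear B by fact
  obtain K where K: "\<And>x. norm (B x) \<le> norm x * K" using bounded by blast
  have "B \<in> borel_measurable borel"
    using B by (simp add: borel_measurable_continuous_onI linear_continuous_on)
  from measurable_compose[OF L2_measurable[OF f] this]
  have "(\<lambda>w. B (f w)) \<in> borel_measurable M" .
  then show ?thesis by (rule L2_bounded(1)[OF _ f, of _ K]) (use K in \<open>simp add: mult.commute\<close>)
qed

lemma L2_scaleR: "L2 f ==> L2 (\<lambda>w. c *\<^sub>R f w)"
  by (rule L2_linear[OF bounded_linear_scaleR_right])

lemma L2_mv: "L2 f ==> L2 (\<lambda>w. (A::real^'n^'m) *v f w)"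
  by (rule L2_linear[OF matrix_vector_mul_bounded_linear])

lemma n2_scaleR: "n2 (\<lambda>w. c *\<^sub>R f w) = c^2 * n2 f"
  by (simp add: n2_def power_mult_distrib)

lemma L2_uminus: "L2 f ==> L2 (\<lambda>w. - f w)"
  using L2_scaleR[of f "-1"] by simp

lemma n2_uminus: "n2 (\<lambda>w. - f w) = n2 f"
  by (simp add: n2_def)

lemma n2_minus_commute: "n2 (\<lambda>w. f w - g w) = n2 (\<lambda>w. g w - f w)"
  by (simp add: n2_def norm_minus_commute)

lemma L2_diff: "L2 f ==> L2 g ==> L2 (\<lambda>w. f w - g w)"
  using L2_add(1)[of f "\<lambda>w. - g w"] L2_uminus[of g] by simp

lemma L2_const: "L2 (\<lambda>w. c)" by (simp add: L2_def)

lemma n2_const: "n2 (\<lambda>w. c) = (norm c)^2" by (simp add: n2_def prob_space)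

lemma L2_sum: "(\<And>i. i \<in> I ==> L2 (f i)) ==> L2 (\<lambda>w. \<Sum>i\<in>I. f i w)"
  by (induction I rule: infinite_finite_induct) (auto intro: L2_const L2_add)

lemma L2_inner:
  fixes f g :: "'w => 'b::euclidean_space"
  assumes f: "L2 f" and g: "L2 g" shows "integrable M (\<lambda>w. f w \<bullet> g w)"
proof (rule Bochner_Integration.integrable_bound)
  show "integrable M (\<lambda>w. (norm (f w))^2 + (norm (g w))^2)" using f g by (auto simp: L2_def)
  show "(\<lambda>w. f w \<bullet> g w) \<in> borel_measurable M"
    using L2_measurable[OF f] L2_measurable[OF g] by measurable
  have "\<bar>x \<bullet> y\<bar> \<le> (norm x)^2 + (norm y)^2" for x y :: 'b
  proof -
    have "\<bar>x \<bullet> y\<bar> \<le> norm x * norm y" by (rule Cauchy_Schwarz_ineq2)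
    moreover have "2 * (norm x * norm y) \<le> (norm x)^2 + (norm y)^2"
      using sum_squares_bound[of "norm x" "norm y"] by simp
    moreover have "0 \<le> norm x * norm y" by simp
    ultimately show ?thesis by linarith
  qed
  then show "AE w in M. norm (f w \<bullet> g w) \<le> norm ((norm (f w))^2 + (norm (g w))^2)"
    by (auto intro!: AE_I2)
qed

lemma L2_integrable: assumes f: "L2 f" shows "integrable M f"
proof (rule Bochner_Integration.integrable_bound)
  show "integrable M (\<lambda>w. 1 + (norm (f w))^2)" using f by (auto simp: L2_def)
  have "t \<le> 1 + t^2" for t :: real
  proof -
    have "2 * t \<le> t^2 + 1" using zero_le_power2[of "t - 1"] by (simp add: power2_diff)
    then show ?thesis using zero_le_power2[of t] by linarith
  qed
  then show "AE w in M. norm (f w) \<le> norm (1 + (norm (f w))^2)" by (auto intro!: AE_I2)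
qed (use f in \<open>simp add: L2_def\<close>)

lemma n2_add_orth:
  assumes f: "L2 f" and g: "L2 g" and o: "expectation (\<lambda>w. f w \<bullet> g w) = 0"
  shows "n2 (\<lambda>w. f w + g w) = n2 f + n2 g"
proof -
  have "(norm (f w + g w))^2 = (norm (f w))^2 + (norm (g w))^2 + 2 * (f w \<bullet> g w)" for w
    by (simp add: power2_norm_eq_inner inner_add_left inner_add_right inner_commute)
  then show ?thesis
    unfolding n2_def using f g o L2_inner[OF f g] by (simp add: L2_def)
qed

lemma incr_L2:
  assumes st: "0 \<le> s" "s < t" and \<xi>: "\<xi> \<in> borel_measurable (FS s)" "L2 \<xi>"
  shows "L2 (\<lambda>w. (W t w - W s w) *\<^sub>R \<xi> w)" "n2 (\<lambda>w. (W t w - W s w) *\<^sub>R \<xi> w) = (t - s) * n2 \<xi>"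
proof -
  have m: "(\<lambda>w. (norm (\<xi> w))^2) \<in> borel_measurable (FS s)" using \<xi>(1) by measurable
  note * = FS_expectation(3,4)[OF st m L2_int[OF \<xi>(2)]]
  have eq: "(norm ((W t w - W s w) *\<^sub>R \<xi> w))^2 = (norm (\<xi> w))^2 * (W t w - W s w)^2" for w
    by (simp add: power_mult_distrib)
  have "\<xi> \<in> borel_measurable M" using \<xi>(1) by (rule FS_measurable_M)
  then show "L2 (\<lambda>w. (W t w - W s w) *\<^sub>R \<xi> w)" using *(1) unfolding L2_def eq by auto
  show "n2 (\<lambda>w. (W t w - W s w) *\<^sub>R \<xi> w) = (t - s) * n2 \<xi>"
    unfolding n2_def eq using *(2) by simp
qed

lemma incr_orth:
  assumes st: "0 \<le> s" "s < t" and \<xi>: "\<xi> \<in> borel_measurable (FS s)" "L2 \<xi>"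
    and \<eta>: "\<eta> \<in> borel_measurable (FS s)" "L2 \<eta>"
  shows "expectation (\<lambda>w. \<eta> w \<bullet> ((W t w - W s w) *\<^sub>R \<xi> w)) = 0"
proof -
  have m: "(\<lambda>w. \<eta> w \<bullet> \<xi> w) \<in> borel_measurable (FS s)" using \<xi>(1) \<eta>(1) by measurable
  show ?thesis
    using FS_expectation(2)[OF st m L2_inner[OF \<eta>(2) \<xi>(2)]] by (simp add: mult.commute)
qed

lemma incr_expectation:
  assumes st: "0 \<le> s" "s < t" and \<xi>: "\<xi> \<in> borel_measurable (FS s)" "L2 \<xi>"
  shows "expectation (\<lambda>w. (W t w - W s w) *\<^sub>R \<xi> w) = 0"
proof (rule euclidean_eqI)
  fix b
  have "expectation (\<lambda>w. (W t w - W s w) *\<^sub>R \<xi> w) \<bullet> b = expectation (\<lambda>w. ((W t w - W s w) *\<^sub>R \<xi> w) \<bullet> b)"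
    by (rule integral_inner_left[symmetric], rule L2_integrable[OF incr_L2(1)[OF st \<xi>]])
  also have "\<dots> = expectation (\<lambda>w. b \<bullet> ((W t w - W s w) *\<^sub>R \<xi> w))" by (simp add: inner_commute)
  also have "\<dots> = 0" by (rule incr_orth[OF st \<xi> _ L2_const]) simp
  finally show "expectation (\<lambda>w. (W t w - W s w) *\<^sub>R \<xi> w) \<bullet> b = 0 \<bullet> b" by simp
qed

lemma ito_sum:
  assumes \<sigma>0: "0 \<le> \<sigma> 0" and \<sigma>: "\<And>i. i < k ==> \<sigma> i \<le> \<sigma> (Suc i)"
    and \<xi>: "\<And>i. i < k ==> \<sigma> i < \<sigma> (Suc i) ==> \<xi> i \<in> borel_measurable (FS (\<sigma> i)) \<and> L2 (\<xi> i)"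
  shows "0 \<le> \<sigma> k \<and> L2 (\<lambda>w. \<Sum>i<k. (W (\<sigma> (Suc i)) w - W (\<sigma> i) w) *\<^sub>R \<xi> i w) \<and>
    (\<lambda>w. \<Sum>i<k. (W (\<sigma> (Suc i)) w - W (\<sigma> i) w) *\<^sub>R \<xi> i w) \<in> borel_measurable (FS (\<sigma> k)) \<and>
    n2 (\<lambda>w. \<Sum>i<k. (W (\<sigma> (Suc i)) w - W (\<sigma> i) w) *\<^sub>R \<xi> i w) = (\<Sum>i<k. (\<sigma> (Suc i) - \<sigma> i) * n2 (\<xi> i))"
  using \<sigma> \<xi>
proof (induction k)
  case 0
  then show ?case using \<sigma>0 by (simp add: L2_const n2_const)
next
  case (Suc k)
  let ?S = "\<lambda>w. \<Sum>i<k. (W (\<sigma> (Suc i)) w - W (\<sigma> i) w) *\<^sub>R \<xi> i w"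
  let ?d = "\<lambda>w. (W (\<sigma> (Suc k)) w - W (\<sigma> k) w) *\<^sub>R \<xi> k w"
  have IH: "0 \<le> \<sigma> k" "L2 ?S" "?S \<in> borel_measurable (FS (\<sigma> k))"
    "n2 ?S = (\<Sum>i<k. (\<sigma> (Suc i) - \<sigma> i) * n2 (\<xi> i))"
    using Suc.IH Suc.prems by (simp_all add: less_Suc_eq)
  have le: "\<sigma> k \<le> \<sigma> (Suc k)" using Suc.prems(1)[of k] by simp
  show ?case
  proof (cases "\<sigma> k < \<sigma> (Suc k)")
    case False
    then have "\<sigma> (Suc k) = \<sigma> k" using le by simp
    then show ?thesis using IH by simp
  next
    case True
    have \<xi>: "\<xi> k \<in> borel_measurable (FS (\<sigma> k))" "L2 (\<xi> k)" using Suc.prems(2)[of k] True by auto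
    note d = incr_L2[OF IH(1) True \<xi>]
    have Sm: "?S \<in> borel_measurable (FS (\<sigma> (Suc k)))" "\<xi> k \<in> borel_measurable (FS (\<sigma> (Suc k)))"
      using FS_measurable_mono[OF _ le] IH(3) \<xi>(1) by auto
    have Wm: "W (\<sigma> (Suc k)) \<in> borel_measurable (FS (\<sigma> (Suc k)))" "W (\<sigma> k) \<in> borel_measurable (FS (\<sigma> (Suc k)))"
      by (rule W_FS; use IH(1) le in auto)+
    have dm: "?d \<in> borel_measurable (FS (\<sigma> (Suc k)))"
      by (intro borel_measurable_scaleR borel_measurable_diff Wm Sm)
    have "n2 (\<lambda>w. ?S w + ?d w) = n2 ?S + n2 ?d"
      by (rule n2_add_orth[OF IH(2) d(1) incr_orth[OF IH(1) True \<xi> IH(3,2)]])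
    then show ?thesis
      using IH le d L2_add(1)[OF IH(2) d(1)] borel_measurable_add[OF Sm(1) dm] by simp
  qed
qed

lemma ito_sum_expectation:
  assumes \<sigma>0: "0 \<le> \<sigma> 0" and \<sigma>: "\<And>i. i < k ==> \<sigma> i \<le> \<sigma> (Suc i)"
    and \<xi>: "\<And>i. i < k ==> \<sigma> i < \<sigma> (Suc i) ==> \<xi> i \<in> borel_measurable (FS (\<sigma> i)) \<and> L2 (\<xi> i)"
  shows "expectation (\<lambda>w. \<Sum>i<k. (W (\<sigma> (Suc i)) w - W (\<sigma> i) w) *\<^sub>R \<xi> i w) = 0"
proof -
  have \<sigma>nn: "0 \<le> \<sigma> i" if "i \<le> k" for i
    using that by (induction i) (use \<sigma>0 \<sigma> in \<open>auto intro: order_trans simp: Suc_le_eq\<close>)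
  have 1: "integrable M (\<lambda>w. (W (\<sigma> (Suc i)) w - W (\<sigma> i) w) *\<^sub>R \<xi> i w) \<and>
      expectation (\<lambda>w. (W (\<sigma> (Suc i)) w - W (\<sigma> i) w) *\<^sub>R \<xi> i w) = 0" if "i < k" for i
  proof (cases "\<sigma> i < \<sigma> (Suc i)")
    case True
    have "0 \<le> \<sigma> i" "\<xi> i \<in> borel_measurable (FS (\<sigma> i))" "L2 (\<xi> i)"
      using \<sigma>nn[of i] that \<xi>[OF that True] by auto
    then show ?thesis using L2_integrable[OF incr_L2(1)[OF _ True]] incr_expectation[OF _ True] by blast
  next
    case False
    then have "\<sigma> (Suc i) = \<sigma> i" using \<sigma>[OF that] by simp
    then show ?thesis by simp
  qed
  then show ?thesis by (subst Bochner_Integration.integral_sum) auto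
qed

end

locale brownian_T = brownian M W for M :: "'w measure" and W +
  fixes T :: real
  assumes Tpos: "T > 0"
begin

text \<open>Dyadic grids \<open>gr\<close>; \<open>cell n s\<close> is the index of the grid interval, open on the left, that contains \<open>s\<close>. For a process that
  is constant on cells, \<open>SI\<close> is the stochastic and \<open>DI\<close> the Lebesgue integral.\<close>

definition gr :: "nat => nat => real" where "gr n i = real i * T / 2^n"

definition cell :: "nat => real => nat" where
  "cell n s = min (2^n - 1) (nat (\<lceil>s * 2^n / T\<rceil> - 1))"

lemma gr_0 [simp]: "gr n 0 = 0" and gr_end [simp]: "gr n (2^n) = T"
  by (auto simp: gr_def)

lemma gr_mono: "i \<le> j ==> gr n i \<le> gr n j"
  using Tpos by (simp add: gr_def divide_right_mono)

lemma gr_strict: "i < j ==> gr n i < gr n j"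
  using Tpos by (simp add: gr_def divide_strict_right_mono)

lemma gr_nonneg [simp]: "0 \<le> gr n i"
  using Tpos by (simp add: gr_def)

lemma gr_Suc: "gr n (Suc i) = gr n i + T / 2^n"
  by (simp add: gr_def add_divide_distrib algebra_simps)

lemma gr_le_T: "i \<le> 2^n ==> gr n i \<le> T"
  using gr_mono[of i "2^n" n] by simp

lemma gr_refine: "n \<le> m ==> gr m (i * 2^(m-n)) = gr n i"
proof -
  assume "n \<le> m"
  then obtain k where "m = n + k" using le_Suc_ex by blast
  then show ?thesis by (simp add: gr_def power_add)
qed

lemma cell_less: "cell n s < 2^n"
proof -
  have "cell n s \<le> 2^n - 1" unfolding cell_def by (rule min.cobounded1)
  then show ?thesis by (simp add: Nat.le_diff_conv2 less_eq_Suc_le)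
qed

lemma cell_bounds:
  assumes "s \<in> {0<..T}"
  shows "gr n (cell n s) < s" "s \<le> gr n (Suc (cell n s))"
proof -
  define z where "z = s * 2^n / T"
  have z: "0 < z" "z \<le> 2^n" using assms Tpos by (auto simp: z_def field_simps)
  have c: "1 \<le> \<lceil>z\<rceil>" "\<lceil>z\<rceil> \<le> 2^n" using z by (auto simp: ceiling_le_iff)
  have e: "int (cell n s) = \<lceil>z\<rceil> - 1"
  proof -
    have "nat (\<lceil>z\<rceil> - 1) \<le> 2^n - 1" using c by (simp add: nat_le_iff of_nat_diff)
    then show ?thesis unfolding cell_def z_def[symmetric] using c by (simp add: min_absorb2)
  qed
  have "real (cell n s) = of_int \<lceil>z\<rceil> - 1" using e by (metis of_int_1 of_int_diff of_int_of_nat_eq)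
  then have "real (cell n s) < z" "z \<le> real (cell n s) + 1" by linarith+
  then show "gr n (cell n s) < s" "s \<le> gr n (Suc (cell n s))"
    using Tpos by (auto simp: gr_def z_def field_simps)
qed

lemma cell_unique:
  assumes "s \<in> {0<..T}" "gr n i < s" "s \<le> gr n (Suc i)"
  shows "cell n s = i"
  using cell_bounds[OF assms(1), of n] assms gr_mono[of "Suc i" "cell n s" n] gr_mono[of "Suc (cell n s)" i n]
  by (cases "cell n s" i rule: linorder_cases) auto

lemma cell_refine:
  assumes "n \<le> m" "s \<in> {0<..T}"
  shows "cell n s = cell m s div 2^(m-n)"
proof (rule cell_unique[OF assms(2)])
  let ?q = "2^(m-n) :: nat" and ?j = "cell m s"
  have "gr n (?j div ?q) = gr m (?j div ?q * ?q)" using gr_refine[OF assms(1)] by simp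
  also have "\<dots> \<le> gr m ?j" by (rule gr_mono) simp
  finally show "gr n (?j div ?q) < s" using cell_bounds(1)[OF assms(2), of m] by simp
  have "?j < Suc (?j div ?q) * ?q"
    using dividend_less_div_times[of ?q ?j] by simp
  then have "Suc ?j \<le> Suc (?j div ?q) * ?q" by (rule Suc_leI)
  then have "gr m (Suc ?j) \<le> gr m (Suc (?j div ?q) * ?q)" by (rule gr_mono)
  also have "\<dots> = gr n (Suc (?j div ?q))" by (rule gr_refine[OF assms(1)])
  finally show "s \<le> gr n (Suc (?j div ?q))" using cell_bounds(2)[OF assms(2), of m] by simp
qed

lemma cell_measurable [measurable]: "cell n \<in> measurable borel (count_space UNIV)"
  unfolding cell_def by measurable

text \<open>The cap in \<open>cell\<close> leaves finitely many indices even for times outside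
  \<open>{0..T}\<close>, hence any function of the cell is bounded.\<close>

lemma bmf_cell: "bmf (\<lambda>s. f (cell n s))"
proof (rule bmfI)
  show "(\<lambda>s. f (cell n s)) \<in> borel_measurable borel"
    by (rule measurable_compose[OF cell_measurable]) simp
  show "norm (f (cell n s)) \<le> (\<Sum>i<2^n. norm (f i))" for s
    by (rule member_le_sum) (auto simp: cell_less)
qed

lemma min_gr_le: "min t (gr n i) \<le> min t (gr n (Suc i))"
  using gr_mono[of i "Suc i" n] by auto

lemma integrable_indicator_Ioc: "integrable lborel (indicat_real {a<..b::real})"
  by (cases "a \<le> b") (auto intro!: integrable_real_indicator)

text \<open>Turns sums over the grid, cut off at \<open>t\<close>, into Lebesgue integrals, so that
  \<open>gronwall\<close> and dominated convergence apply to the scheme.\<close>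

lemma step_integral:
  fixes f :: "nat => 'b::euclidean_space"
  assumes t: "t \<in> {0..T}"
  shows "(LBINT s:{0..t}. f (cell n s)) = (\<Sum>i<2^n. (min t (gr n (Suc i)) - min t (gr n i)) *\<^sub>R f i)"
proof -
  have "(LBINT s:{0..t}. f (cell n s)) =
      (LBINT s. (\<Sum>i<2^n. indicator {gr n i<..min t (gr n (Suc i))} s *\<^sub>R f i))"
    unfolding set_lebesgue_integral_def
  proof (rule integral_cong_AE)
    show "(\<lambda>s. indicat_real {0..t} s *\<^sub>R f (cell n s)) \<in> borel_measurable lborel"
      using bmf_measurable[OF bmf_cell[of f n]] by measurable
    show "AE s in lborel. indicat_real {0..t} s *\<^sub>R f (cell n s) =
        (\<Sum>i<2^n. indicator {gr n i<..min t (gr n (Suc i))} s *\<^sub>R f i)"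
      using AE_lborel_singleton[of 0]
    proof eventually_elim
      case (elim s)
      show ?case
      proof (cases "s \<in> {0<..t}")
        case False
        then have "s \<notin> {0..t}" using elim by auto
        moreover have "s \<notin> {gr n i<..min t (gr n (Suc i))}" for i
          using False gr_nonneg[of n i] by (auto simp del: gr_nonneg)
        ultimately show ?thesis by simp
      next
        case True
        then have s: "s \<in> {0<..T}" using t by auto
        have "s \<in> {gr n i<..min t (gr n (Suc i))} \<longleftrightarrow> i = cell n s" for i
          using cell_unique[OF s, of n i] cell_bounds[OF s, of n] True by auto
        then have "(\<Sum>i<2^n. indicator {gr n i<..min t (gr n (Suc i))} s *\<^sub>R f i) =
            (\<Sum>i<2^n. if i = cell n s then f i else 0)"
          by (intro sum.cong) (auto simp: indicator_def)
        also have "\<dots> = f (cell n s)" using cell_less by simp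
        finally show ?thesis using True by simp
      qed
    qed
  qed measurable
  also have "\<dots> = (\<Sum>i<2^n. LBINT s. indicator {gr n i<..min t (gr n (Suc i))} s *\<^sub>R f i)"
    by (rule Bochner_Integration.integral_sum, rule integrable_scaleR_left, rule integrable_indicator_Ioc)
  also have "\<dots> = (\<Sum>i<2^n. (min t (gr n (Suc i)) - min t (gr n i)) *\<^sub>R f i)"
  proof (rule sum.cong[OF refl])
    fix i
    have "measure lborel {gr n i<..min t (gr n (Suc i))} = min t (gr n (Suc i)) - min t (gr n i)"
      using gr_mono[of i "Suc i" n] by (cases "gr n i \<le> min t (gr n (Suc i))") (auto simp: min_def split: if_splits)
    then show "(LBINT s. indicator {gr n i<..min t (gr n (Suc i))} s *\<^sub>R f i) =
        (min t (gr n (Suc i)) - min t (gr n i)) *\<^sub>R f i"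
      by (subst integral_scaleR_left) (auto intro: integrable_indicator_Ioc)
  qed
  finally show ?thesis .
qed

definition SI :: "nat => (nat => 'w => 'b::euclidean_space) => real => 'w => 'b" where
  "SI n \<xi> t w = (\<Sum>i<2^n. (W (min t (gr n (Suc i))) w - W (min t (gr n i)) w) *\<^sub>R \<xi> i w)"

definition DI :: "nat => (nat => 'w => 'b::euclidean_space) => real => 'w => 'b" where
  "DI n \<xi> t w = (\<Sum>i<2^n. (min t (gr n (Suc i)) - min t (gr n i)) *\<^sub>R \<xi> i w)"

definition adapted :: "nat => (nat => 'w => 'b::euclidean_space) => bool" where
  "adapted n \<xi> \<longleftrightarrow> (\<forall>i<2^n. \<xi> i \<in> borel_measurable (FS (gr n i)) \<and> L2 (\<xi> i))"

lemma SI_props: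
  assumes \<xi>: "adapted n \<xi>" and t: "t \<in> {0..T}"
  shows "L2 (SI n \<xi> t)" "SI n \<xi> t \<in> borel_measurable (FS t)"
    "n2 (SI n \<xi> t) = (LBINT s:{0..t}. n2 (\<xi> (cell n s)))" "expectation (SI n \<xi> t) = 0"
proof -
  \<comment> \<open>A step that keeps positive length after the cut at \<open>t\<close> still starts
    at its grid point, where \<open>\<xi> i\<close> is measurable.\<close>
  have a: "0 \<le> min t (gr n 0)" "\<And>i. i < 2^n ==> min t (gr n i) \<le> min t (gr n (Suc i))"
    "\<And>i. i < 2^n ==> min t (gr n i) < min t (gr n (Suc i)) ==> \<xi> i \<in> borel_measurable (FS (min t (gr n i))) \<and> L2 (\<xi> i)"
    using t \<xi> min_gr_le[of t n] by (auto simp: adapted_def min_def split: if_splits)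
  note * = ito_sum[of "\<lambda>i. min t (gr n i)" "2^n" \<xi>, OF a]
  have e: "min t (gr n (2^n)) = t" using t by simp
  show "L2 (SI n \<xi> t)" "SI n \<xi> t \<in> borel_measurable (FS t)"
    "n2 (SI n \<xi> t) = (LBINT s:{0..t}. n2 (\<xi> (cell n s)))"
    using * unfolding SI_def[abs_def] step_integral[OF t, of "\<lambda>i. n2 (\<xi> i)" n] e by simp_all
  show "expectation (SI n \<xi> t) = 0"
    using ito_sum_expectation[of "\<lambda>i. min t (gr n i)" "2^n" \<xi>, OF a] unfolding SI_def[abs_def] .
qed

lemma DI_props:
  assumes \<xi>: "adapted n \<xi>" and t: "t \<in> {0..T}"
  shows "L2 (DI n \<xi> t)" "DI n \<xi> t \<in> borel_measurable (FS t)"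
    "n2 (DI n \<xi> t) \<le> T * (LBINT s:{0..t}. n2 (\<xi> (cell n s)))"
proof -
  define d where "d i = min t (gr n (Suc i)) - min t (gr n i)" for i
  have w: "0 \<le> d i" for i using min_gr_le[of t n i] by (simp add: d_def)
  have ws: "(\<Sum>i<2^n. d i) = t"
    unfolding d_def using sum_lessThan_telescope[of "\<lambda>i. min t (gr n i)" "2^n"] t by simp
  have D: "DI n \<xi> t = (\<lambda>w. \<Sum>i<2^n. d i *\<^sub>R \<xi> i w)" by (simp add: DI_def[abs_def] d_def)
  have m: "\<xi> i \<in> borel_measurable M" "L2 (\<xi> i)" if "i < 2^n" for i
    using \<xi> that by (auto simp: adapted_def L2_def)
  show "L2 (DI n \<xi> t)" unfolding D by (intro L2_sum L2_scaleR m) auto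
  show "DI n \<xi> t \<in> borel_measurable (FS t)" unfolding D
  proof (rule borel_measurable_sum)
    fix i :: nat assume i: "i \<in> {..<2^n}"
    show "(\<lambda>w. d i *\<^sub>R \<xi> i w) \<in> borel_measurable (FS t)"
    proof (cases "d i = 0")
      case False
      then have "gr n i \<le> t" using gr_mono[of i "Suc i" n] by (auto simp: d_def min_def split: if_splits)
      then have "\<xi> i \<in> borel_measurable (FS t)" using \<xi> i FS_measurable_mono by (auto simp: adapted_def)
      then show ?thesis by simp
    qed simp
  qed
  have "(norm (DI n \<xi> t w))^2 \<le> T * (\<Sum>i<2^n. d i * (norm (\<xi> i w))^2)" for w
  proof -
    \<comment> \<open>Splitting the weight \<open>d i\<close> into two square roots prepares
      Cauchy-Schwarz; the squares of the first factors sum to \<open>t\<close>.\<close>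
    have "norm (DI n \<xi> t w) \<le> (\<Sum>i<2^n. sqrt (d i) * (sqrt (d i) * norm (\<xi> i w)))"
      unfolding D by (rule sum_norm_le) (simp add: w mult.assoc[symmetric])
    then have "(norm (DI n \<xi> t w))^2 \<le> (\<Sum>i<2^n. sqrt (d i) * (sqrt (d i) * norm (\<xi> i w)))^2"
      by (rule power_mono) simp
    also have "\<dots> \<le> (\<Sum>i<2^n. (sqrt (d i))^2) * (\<Sum>i<2^n. (sqrt (d i) * norm (\<xi> i w))^2)"
      by (rule Cauchy_Schwarz_ineq_sum)
    also have "\<dots> = t * (\<Sum>i<2^n. d i * (norm (\<xi> i w))^2)"
      by (simp add: w ws power_mult_distrib)
    also have "\<dots> \<le> T * (\<Sum>i<2^n. d i * (norm (\<xi> i w))^2)"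
      using t w by (intro mult_right_mono sum_nonneg) auto
    finally show ?thesis .
  qed
  moreover have "integrable M (\<lambda>w. T * (\<Sum>i<2^n. d i * (norm (\<xi> i w))^2))"
    using L2_int[OF m(2)] by auto
  ultimately have "n2 (DI n \<xi> t) \<le> expectation (\<lambda>w. T * (\<Sum>i<2^n. d i * (norm (\<xi> i w))^2))"
    by (intro L2I_bound(2) L2_measurable[OF \<open>L2 (DI n \<xi> t)\<close>])
  also have "\<dots> = T * (\<Sum>i<2^n. d i * n2 (\<xi> i))"
    unfolding n2_def using L2_int[OF m(2)] by simp
  also have "\<dots> = T * (LBINT s:{0..t}. n2 (\<xi> (cell n s)))"
    unfolding step_integral[OF t, of "\<lambda>i. n2 (\<xi> i)" n] d_def by simp
  finally show "n2 (DI n \<xi> t) \<le> T * (LBINT s:{0..t}. n2 (\<xi> (cell n s)))" .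
qed

text \<open>Telescoping within blocks of length \<open>q\<close>. The integrator \<open>w\<close> is
  arbitrary so that Brownian paths and time itself are both covered.\<close>

lemma sum_refine:
  fixes x :: "nat => 'c::real_vector"
  assumes "0 < q"
  shows "(\<Sum>i<k*q. (w (Suc i) - w i) *\<^sub>R x (i div q)) = (\<Sum>i<k. (w (Suc i * q) - w (i * q)) *\<^sub>R x i)"
proof (induction k)
  case (Suc k)
  have "(\<Sum>i<k*q+r. (w (Suc i) - w i) *\<^sub>R x (i div q)) =
     (\<Sum>i<k*q. (w (Suc i) - w i) *\<^sub>R x (i div q)) + (w (k*q+r) - w (k*q)) *\<^sub>R x k" if "r \<le> q" for r
    using that
  proof (induction r)
    case (Suc r)
    have "(k*q + r) div q = k" using Suc.prems assms by simp
    then show ?case using Suc by (simp add: algebra_simps)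
  qed simp
  from this[of q] show ?case using Suc.IH by (simp add: add.commute)
qed simp

lemma refine_bound: "n \<le> m ==> (2::nat)^n * 2^(m-n) = 2^m"
  by (simp flip: power_add)

lemma SI_refine:
  assumes "n \<le> m" shows "SI n \<xi> t = SI m (\<lambda>i. \<xi> (i div 2^(m-n))) t"
proof
  fix w
  show "SI n \<xi> t w = SI m (\<lambda>i. \<xi> (i div 2^(m-n))) t w"
    using sum_refine[of "2^(m-n)" "\<lambda>i. W (min t (gr m i)) w" "\<lambda>i. \<xi> i w" "2^n"]
    unfolding SI_def refine_bound[OF assms] gr_refine[OF assms] by simp
qed

lemma DI_refine:
  assumes "n \<le> m" shows "DI n \<xi> t = DI m (\<lambda>i. \<xi> (i div 2^(m-n))) t"
proof
  fix w
  show "DI n \<xi> t w = DI m (\<lambda>i. \<xi> (i div 2^(m-n))) t w"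
    using sum_refine[of "2^(m-n)" "\<lambda>i. min t (gr m i)" "\<lambda>i. \<xi> i w" "2^n"]
    unfolding DI_def refine_bound[OF assms] gr_refine[OF assms] by simp
qed

lemma adapted_refine:
  assumes "n \<le> m" "adapted n \<xi>" shows "adapted m (\<lambda>i. \<xi> (i div 2^(m-n)))"
  unfolding adapted_def
proof (intro allI impI)
  fix i :: nat assume i: "i < 2^m"
  let ?q = "2^(m-n) :: nat"
  have "i < 2^n * ?q" using i refine_bound[OF assms(1)] by simp
  then have j: "i div ?q < 2^n" by (rule less_mult_imp_div_less)
  have "gr n (i div ?q) \<le> gr m i"
    unfolding gr_refine[OF assms(1), symmetric] by (rule gr_mono) simp
  then show "\<xi> (i div ?q) \<in> borel_measurable (FS (gr m i)) \<and> L2 (\<xi> (i div ?q))"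
    using assms(2) j FS_measurable_mono unfolding adapted_def by blast
qed

lemma adapted_diff: "adapted n \<xi> ==> adapted n \<eta> ==> adapted n (\<lambda>i w. \<xi> i w - \<eta> i w)"
  by (auto simp: adapted_def intro!: L2_diff borel_measurable_diff)

lemma adapted_L2: "adapted n \<xi> ==> L2 (\<xi> (cell n s))"
  using cell_less by (auto simp: adapted_def)

lemma refine_integral:
  assumes nm: "n \<le> m" and t: "t \<in> {0..T}"
  shows "(LBINT s:{0..t}. n2 (\<lambda>w. \<xi> (cell m s div 2^(m-n)) w - \<eta> (cell m s) w)) =
    (LBINT s:{0..t}. n2 (\<lambda>w. \<xi> (cell n s) w - \<eta> (cell m s) w))"
  unfolding set_lebesgue_integral_def
proof (rule integral_cong_AE)
  show "(\<lambda>s. indicator {0..t} s *\<^sub>R n2 (\<lambda>w. \<xi> (cell m s div 2^(m-n)) w - \<eta> (cell m s) w)) \<in> borel_measurable lborel"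
    using bmf_measurable[OF bmf_cell[of "\<lambda>i. n2 (\<lambda>w. \<xi> (i div 2^(m-n)) w - \<eta> i w)" m]] by measurable
  have "(\<lambda>s. (\<lambda>(i, j). n2 (\<lambda>w. \<xi> i w - \<eta> j w)) (cell n s, cell m s)) \<in> borel_measurable borel"
    by (rule measurable_compose[where N = "count_space UNIV \<Otimes>\<^sub>M count_space UNIV"])
      (auto intro!: measurable_Pair simp: pair_measure_countable)
  then show "(\<lambda>s. indicator {0..t} s *\<^sub>R n2 (\<lambda>w. \<xi> (cell n s) w - \<eta> (cell m s) w)) \<in> borel_measurable lborel"
    by simp
  show "AE s in lborel. indicator {0..t} s *\<^sub>R n2 (\<lambda>w. \<xi> (cell m s div 2^(m-n)) w - \<eta> (cell m s) w) =
    indicator {0..t} s *\<^sub>R n2 (\<lambda>w. \<xi> (cell n s) w - \<eta> (cell m s) w)"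
    using AE_lborel_singleton[of 0]
    by eventually_elim (use t cell_refine[OF nm] in \<open>auto simp: indicator_def\<close>)
qed

text \<open>Read on the finer grid, the two integrands differ by a single adapted step process, to
  which the isometry applies.\<close>

lemma SI_diff:
  assumes nm: "n \<le> m" and \<xi>: "adapted n \<xi>" and \<eta>: "adapted m \<eta>" and t: "t \<in> {0..T}"
  shows "n2 (\<lambda>w. SI n \<xi> t w - SI m \<eta> t w) = (LBINT s:{0..t}. n2 (\<lambda>w. \<xi> (cell n s) w - \<eta> (cell m s) w))"
proof -
  have "(\<lambda>w. SI n \<xi> t w - SI m \<eta> t w) = SI m (\<lambda>i w. \<xi> (i div 2^(m-n)) w - \<eta> i w) t"
    unfolding SI_refine[OF nm] by (simp add: SI_def[abs_def] sum_subtractf[symmetric] scaleR_diff_right)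
  then show ?thesis
    using SI_props(3)[OF adapted_diff[OF adapted_refine[OF nm \<xi>] \<eta>] t] refine_integral[OF nm t, of \<xi> \<eta>] by simp
qed

lemma DI_diff:
  assumes nm: "n \<le> m" and \<xi>: "adapted n \<xi>" and \<eta>: "adapted m \<eta>" and t: "t \<in> {0..T}"
  shows "n2 (\<lambda>w. DI n \<xi> t w - DI m \<eta> t w) \<le> T * (LBINT s:{0..t}. n2 (\<lambda>w. \<xi> (cell n s) w - \<eta> (cell m s) w))"
proof -
  have "(\<lambda>w. DI n \<xi> t w - DI m \<eta> t w) = DI m (\<lambda>i w. \<xi> (i div 2^(m-n)) w - \<eta> i w) t"
    unfolding DI_refine[OF nm] by (simp add: DI_def[abs_def] sum_subtractf[symmetric] scaleR_diff_right)
  then show ?thesis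
    using DI_props(3)[OF adapted_diff[OF adapted_refine[OF nm \<xi>] \<eta>] t] refine_integral[OF nm t, of \<xi> \<eta>] by simp
qed

lemma sum_min_gr:
  fixes x :: "nat => 'c::real_vector"
  assumes i: "i < 2^n" and t: "gr n i \<le> t" "t \<le> gr n (Suc i)"
  shows "(\<Sum>j<2^n. (w (min t (gr n (Suc j))) - w (min t (gr n j))) *\<^sub>R x j) =
    (\<Sum>j<i. (w (gr n (Suc j)) - w (gr n j)) *\<^sub>R x j) + (w t - w (gr n i)) *\<^sub>R x i"
proof -
  let ?f = "\<lambda>j. (w (min t (gr n (Suc j))) - w (min t (gr n j))) *\<^sub>R x j"
  have "(\<Sum>j<2^n. ?f j) = (\<Sum>j<Suc i. ?f j)"
  proof (rule sum.mono_neutral_right)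
    show "\<forall>j\<in>{..<2^n} - {..<Suc i}. ?f j = 0"
    proof
      fix j assume "j \<in> {..<2^n} - {..<Suc i}"
      then have "t \<le> gr n j" "t \<le> gr n (Suc j)" using t(2) gr_mono[of "Suc i" j n] gr_mono[of "Suc i" "Suc j" n] by auto
      then show "?f j = 0" by simp
    qed
  qed (use i in auto)
  also have "\<dots> = (\<Sum>j<i. ?f j) + ?f i" by simp
  also have "(\<Sum>j<i. ?f j) = (\<Sum>j<i. (w (gr n (Suc j)) - w (gr n j)) *\<^sub>R x j)"
  proof (rule sum.cong[OF refl])
    fix j assume "j \<in> {..<i}"
    then have "gr n (Suc j) \<le> t" "gr n j \<le> t" using t(1) gr_mono[of "Suc j" i n] gr_mono[of j i n] by auto
    then show "?f j = (w (gr n (Suc j)) - w (gr n j)) *\<^sub>R x j" by simp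
  qed
  also have "?f i = (w t - w (gr n i)) *\<^sub>R x i" using t by (simp add: min_absorb1 min_absorb2)
  finally show ?thesis .
qed

end

section \<open>The Euler scheme\<close>

lemma norm_mv: "norm ((A::real^'n^'m) *v x) \<le> norm A * norm x"
proof -
  have "norm (A *v x) = L2_set (\<lambda>i. norm ((A *v x) $ i)) UNIV" by (simp add: norm_vec_def)
  also have "\<dots> \<le> L2_set (\<lambda>i. norm (A $ i) * norm x) UNIV"
    by (rule L2_set_mono) (auto simp: matrix_vector_mul_component Cauchy_Schwarz_ineq2)
  also have "\<dots> = norm A * norm x" by (simp add: norm_vec_def L2_set_left_distrib)
  finally show ?thesis .
qed

lemma norm_mv_le: "norm (A::real^'n^'m) \<le> K ==> norm (A *v x) \<le> K * norm x"
  by (rule order_trans[OF norm_mv]) (simp add: mult_right_mono)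

lemma bmf_integral_mono:
  fixes f g :: "real => real"
  assumes "bmf f" "bmf g" "\<And>s. s \<in> {a..b} ==> f s \<le> g s"
  shows "(LBINT s:{a..b}. f s) \<le> (LBINT s:{a..b}. g s)"
  by (rule set_integral_mono[OF bmf_set_integrable[OF assms(1)] bmf_set_integrable[OF assms(2)] assms(3)])

lemma bmf_integral_nonneg:
  fixes f :: "real => real"
  assumes "bmf f" "\<And>s. 0 \<le> f s" shows "0 \<le> (LBINT s:{a..b}. f s)"
  using bmf_integral_mono[OF bmf_const[of 0] assms(1)] assms(2) by simp

lemma bmf_integral_mono_set:
  fixes f :: "real => real"
  assumes "bmf f" "\<And>s. 0 \<le> f s" "a \<le> b" "b \<le> c"
  shows "(LBINT s:{a..b}. f s) \<le> (LBINT s:{a..c}. f s)"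
  using bmf_integral_combine[OF assms(1,3,4)] bmf_integral_nonneg[OF assms(1,2), of b c] by linarith

lemma bmf_integral_const: "a \<le> b ==> (LBINT s:{a..b}. (c::real)) = c * (b - a)"
  using bmf_integral[OF bmf_const[of c], of a b] by simp

lemma bmf_integral_add: "bmf f ==> bmf g ==>
  (LBINT s:{a..b}. f s + g s) = (LBINT s:{a..b}. f s) + (LBINT s:{a..b}. g s)"
  by (simp add: set_integral_add bmf_set_integrable)

lemma bmf_mult: "bmf f ==> bmf g ==> bmf (\<lambda>s. f s * g s :: real)"
  using bmf_inner[of f g] by simp

lemma bmf_power2: "bmf f ==> bmf (\<lambda>s. (f s :: real)^2)"
  by (simp add: power2_eq_square bmf_mult)

context brownian_T begin

lemma bmf_cell2: "bmf (\<lambda>s. f (cell n s) (cell m s))"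
proof (rule bmfI)
  have "(\<lambda>s. (\<lambda>(i, j). f i j) (cell n s, cell m s)) \<in> borel_measurable borel"
    by (rule measurable_compose[where N = "count_space UNIV \<Otimes>\<^sub>M count_space UNIV"])
      (auto intro!: measurable_Pair simp: pair_measure_countable)
  then show "(\<lambda>s. f (cell n s) (cell m s)) \<in> borel_measurable borel" by simp
  fix s
  have "norm (f (cell n s) (cell m s)) \<le> (\<Sum>j<2^m. norm (f (cell n s) j))"
    by (rule member_le_sum) (auto simp: cell_less)
  also have "\<dots> \<le> (\<Sum>i<2^n. \<Sum>j<2^m. norm (f i j))"
    by (rule member_le_sum) (auto simp: cell_less intro: sum_nonneg)
  finally show "norm (f (cell n s) (cell m s)) \<le> (\<Sum>i<2^n. \<Sum>j<2^m. norm (f i j))" .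
qed

lemma cell_0 [simp]: "cell n 0 = 0"
  by (simp add: cell_def)

context
  fixes n :: nat and a c :: "nat => real^'n^'n" and v :: "nat => real^'n"
begin

text \<open>Euler scheme for \<open>dZ = a Z dt + (c Z + v) dW\<close>, \<open>Z 0 = 0\<close>, with
  coefficients constant on cells.\<close>

primrec Eu :: "nat => 'w => real^'n" where
  "Eu 0 = (\<lambda>w. 0)"
| "Eu (Suc i) = (\<lambda>w. Eu i w + (gr n (Suc i) - gr n i) *\<^sub>R (a i *v Eu i w)
     + (W (gr n (Suc i)) w - W (gr n i) w) *\<^sub>R (c i *v Eu i w + v i))"

definition dE :: "nat => 'w => real^'n" where "dE i w = a i *v Eu i w"
definition sE :: "nat => 'w => real^'n" where "sE i w = c i *v Eu i w + v i"
text \<open>Interpolation of the scheme between grid points along the Brownian path itself. It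
  agrees with \<open>Eu\<close> at the grid points and, being a sum of integrals, can be compared
  across grids.\<close>

definition In :: "real => 'w => real^'n" where "In t w = DI n dE t w + SI n sE t w"

lemma mv_measurable: "f \<in> borel_measurable N ==> (\<lambda>w. (A::real^'n^'m) *v f w) \<in> borel_measurable N"
  by (rule measurable_compose[where g = "\<lambda>x. A *v x" and N = borel])
    (auto intro!: borel_measurable_continuous_onI linear_continuous_on matrix_vector_mul_bounded_linear)

lemma Eu_adapted: "Eu i \<in> borel_measurable (FS (gr n i)) \<and> L2 (Eu i)"
proof (induction i)
  case 0 show ?case by (simp add: L2_const)
next
  case (Suc i)
  let ?s = "\<lambda>w. c i *v Eu i w + v i"
  have s: "?s \<in> borel_measurable (FS (gr n i))" "L2 ?s"
    using Suc by (auto intro!: borel_measurable_add mv_measurable L2_add L2_mv L2_const)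
  have le: "gr n i \<le> gr n (Suc i)" by (rule gr_mono) simp
  have m: "Eu i \<in> borel_measurable (FS (gr n (Suc i)))" "?s \<in> borel_measurable (FS (gr n (Suc i)))"
    using Suc s FS_measurable_mono[OF _ le] by auto
  have w: "W (gr n (Suc i)) \<in> borel_measurable (FS (gr n (Suc i)))" "W (gr n i) \<in> borel_measurable (FS (gr n (Suc i)))"
    using le by (auto intro!: W_FS)
  have i: "L2 (\<lambda>w. (W (gr n (Suc i)) w - W (gr n i) w) *\<^sub>R ?s w)"
    by (rule incr_L2(1)[OF _ _ s]) (auto intro: gr_strict)
  show ?case
  proof
    show "Eu (Suc i) \<in> borel_measurable (FS (gr n (Suc i)))"
      unfolding Eu.simps by (intro borel_measurable_add borel_measurable_scaleR borel_measurable_diff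
          borel_measurable_const m w mv_measurable)
    show "L2 (Eu (Suc i))"
      unfolding Eu.simps using Suc i by (intro L2_add L2_scaleR L2_mv) auto
  qed
qed

lemma dE_adapted: "adapted n dE"
  using Eu_adapted by (auto simp: adapted_def dE_def[abs_def] intro!: mv_measurable L2_mv)

lemma sE_adapted: "adapted n sE"
  using Eu_adapted by (auto simp: adapted_def sE_def[abs_def] intro!: borel_measurable_add mv_measurable L2_add L2_mv L2_const)

lemma In_L2: "t \<in> {0..T} ==> L2 (In t)"
  unfolding In_def[abs_def] using DI_props(1)[OF dE_adapted] SI_props(1)[OF sE_adapted] L2_add(1) by blast

lemma Eu_sum: "Eu i w = (\<Sum>j<i. (gr n (Suc j) - gr n j) *\<^sub>R dE j w)
   + (\<Sum>j<i. (W (gr n (Suc j)) w - W (gr n j) w) *\<^sub>R sE j w)"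
  by (induction i) (auto simp: dE_def sE_def)

lemma In_eq:
  assumes "i < 2^n" "gr n i \<le> t" "t \<le> gr n (Suc i)"
  shows "In t w = Eu i w + ((t - gr n i) *\<^sub>R dE i w + (W t w - W (gr n i) w) *\<^sub>R sE i w)"
  unfolding In_def DI_def SI_def Eu_sum
  using sum_min_gr[OF assms, of "\<lambda>x. x" "\<lambda>j. dE j w"] sum_min_gr[OF assms, of "\<lambda>x. W x w" "\<lambda>j. sE j w"]
  by simp

lemma In_gr: "i < 2^n ==> In (gr n i) = Eu i"
  using In_eq[of i "gr n i"] gr_mono[of i "Suc i" n] by (auto intro!: ext)

context
  fixes K :: real
  assumes K: "\<And>i. norm (a i) \<le> K" "\<And>i. norm (c i) \<le> K" "\<And>i. norm (v i) \<le> K"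
begin

lemma K0: "0 \<le> K" using K(1)[of 0] norm_ge_zero order_trans by blast

lemma dE_n2: "n2 (dE i) \<le> K^2 * n2 (Eu i)"
  unfolding dE_def[abs_def]
  by (rule L2_bounded(2)) (use Eu_adapted L2_mv norm_mv_le[OF K(1)] in \<open>auto intro: L2_measurable\<close>)

lemma sE_n2: "n2 (sE i) \<le> 2 * K^2 * n2 (Eu i) + 2 * K^2"
proof -
  have L: "L2 (Eu i)" using Eu_adapted by blast
  have "n2 (sE i) \<le> 2 * n2 (\<lambda>w. c i *v Eu i w) + 2 * n2 (\<lambda>w. v i)"
    unfolding sE_def[abs_def] by (intro L2_add L2_mv L2_const L)
  moreover have "n2 (\<lambda>w. c i *v Eu i w) \<le> K^2 * n2 (Eu i)"
    by (rule L2_bounded(2)) (use L L2_mv norm_mv_le[OF K(2)] in \<open>auto intro: L2_measurable\<close>)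
  moreover have "n2 (\<lambda>w. v i) \<le> K^2" unfolding n2_const by (rule power_mono) (auto simp: K)
  ultimately show ?thesis by linarith
qed

text \<open>The outcome of \<open>gronwall\<close> for the second moments of the scheme. It involves
  only \<open>K\<close> and \<open>T\<close>, hence serves every grid; the summand 1 keeps the
  Gronwall constant positive when \<open>K = 0\<close>.\<close>

definition BK :: real where "BK = 2 * (4 * K^2 * T) * exp (2 * (2 * T * K^2 + 4 * K^2 + 1) * T)"

lemma Eu_bound:
  assumes t: "t \<in> {0..T}"
  shows "n2 (Eu (cell n t)) \<le> BK"
proof -
  define \<phi> where "\<phi> s = n2 (Eu (cell n s))" for s
  have b\<phi>: "bmf \<phi>" unfolding \<phi>_def[abs_def] by (rule bmf_cell)
  have \<phi>0: "0 \<le> \<phi> s" for s by (simp add: \<phi>_def)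
  have "\<phi> s \<le> 4 * K^2 * T + (2 * T * K^2 + 4 * K^2 + 1) * (LBINT r:{0..s}. \<phi> r)" if s: "s \<in> {0..T}" for s
  proof (cases "s = 0")
    case True
    have "\<phi> 0 = 0" by (simp add: \<phi>_def n2_const)
    then show ?thesis using True Tpos b\<phi> by simp
  next
    case False
    then have s': "s \<in> {0<..T}" using s by auto
    \<comment> \<open>The scheme at time \<open>s\<close> is frozen at the grid point
      \<open>r\<close> before \<open>s\<close>; integrals up to \<open>r\<close> are enlarged to
      \<open>s\<close> at the end.\<close>
    define r where "r = gr n (cell n s)"
    have r: "0 \<le> r" "r \<le> s" using cell_bounds(1)[OF s', of n] by (auto simp: r_def)
    then have rT: "r \<in> {0..T}" using s by auto
    have "\<phi> s = n2 (In r)" by (simp add: \<phi>_def r_def In_gr cell_less)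
    also have "\<dots> \<le> 2 * n2 (DI n dE r) + 2 * n2 (SI n sE r)"
      unfolding In_def[abs_def] by (rule L2_add(2)[OF DI_props(1)[OF dE_adapted rT] SI_props(1)[OF sE_adapted rT]])
    also have "n2 (DI n dE r) \<le> T * (LBINT u:{0..r}. K^2 * \<phi> u)"
    proof (rule order_trans[OF DI_props(3)[OF dE_adapted rT]], rule mult_left_mono)
      show "(LBINT s:{0..r}. n2 (dE (cell n s))) \<le> (LBINT u:{0..r}. K^2 * \<phi> u)"
        by (intro bmf_integral_mono bmf_cell bmf_mult bmf_const b\<phi>) (simp add: \<phi>_def dE_n2)
    qed (use Tpos in simp)
    also have "n2 (SI n sE r) \<le> (LBINT u:{0..r}. 2 * K^2 * \<phi> u + 2 * K^2)"
      unfolding SI_props(3)[OF sE_adapted rT]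
      by (intro bmf_integral_mono bmf_cell bmf_add bmf_mult bmf_const b\<phi>) (simp add: \<phi>_def sE_n2)
    also have "\<dots> = 2 * K^2 * (LBINT u:{0..r}. \<phi> u) + 2 * K^2 * r"
      using r by (subst bmf_integral_add) (auto intro!: bmf_mult bmf_const b\<phi> simp: bmf_integral_const)
    finally have "\<phi> s \<le> (2 * T * K^2 + 4 * K^2) * (LBINT u:{0..r}. \<phi> u) + 4 * K^2 * r"
      by (simp add: algebra_simps)
    also have "\<dots> \<le> (2 * T * K^2 + 4 * K^2 + 1) * (LBINT u:{0..s}. \<phi> u) + 4 * K^2 * T"
    proof (rule add_mono)
      show "(2 * T * K^2 + 4 * K^2) * (LBINT u:{0..r}. \<phi> u)
          \<le> (2 * T * K^2 + 4 * K^2 + 1) * (LBINT u:{0..s}. \<phi> u)"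
        by (rule mult_mono) (use bmf_integral_mono_set[OF b\<phi> \<phi>0 r] bmf_integral_nonneg[OF b\<phi> \<phi>0] Tpos in auto)
    qed (use rT in \<open>auto intro!: mult_left_mono\<close>)
    finally show ?thesis by simp
  qed
  from gronwall[OF b\<phi> _ _ this t] have "\<phi> t \<le> 2 * (4 * K^2 * T) * exp (2 * (2 * T * K^2 + 4 * K^2 + 1) * t)"
    using Tpos by (simp add: add_nonneg_pos)
  also have "\<dots> \<le> BK" unfolding BK_def
    using t Tpos by (intro mult_left_mono) (auto intro!: mult_left_mono)
  finally show ?thesis by (simp add: \<phi>_def)
qed

text \<open>Collects the bounds for drift and diffusion over a partial step of length
  \<open>h \<le> T / 2^n\<close>, with one factor of \<open>h * h\<close> estimated by
  \<open>T\<close>.\<close>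

definition EK :: real where "EK = 2 * T * K^2 * BK + 4 * K^2 * BK + 4 * K^2"

lemma BK_nonneg: "0 \<le> BK" using Tpos by (simp add: BK_def)
lemma EK_nonneg: "0 \<le> EK" using Tpos BK_nonneg by (simp add: EK_def)

lemma In_cell:
  assumes t: "t \<in> {0<..T}"
  shows "n2 (\<lambda>w. In t w - Eu (cell n t) w) \<le> T / 2^n * EK"
proof -
  define i where "i = cell n t"
  have i: "i < 2^n" "gr n i < t" "t \<le> gr n (Suc i)" using cell_less cell_bounds[OF t] by (auto simp: i_def)
  define h where "h = t - gr n i"
  have h: "0 < h" "h \<le> T / 2^n" "T / 2^n \<le> T" using i gr_Suc[of n i] Tpos by (auto simp: h_def field_simps)
  have B: "n2 (Eu i) \<le> BK" unfolding i_def by (rule Eu_bound) (use t in auto)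
  have ad: "sE i \<in> borel_measurable (FS (gr n i))" "L2 (sE i)" "L2 (dE i)"
    using sE_adapted dE_adapted i(1) by (auto simp: adapted_def)
  note inc = incr_L2[OF gr_nonneg i(2) ad(1,2)]
  have "n2 (\<lambda>w. In t w - Eu i w) = n2 (\<lambda>w. h *\<^sub>R dE i w + (W t w - W (gr n i) w) *\<^sub>R sE i w)"
    using In_eq[OF i(1) less_imp_le[OF i(2)] i(3)] by (simp add: h_def)
  also have "\<dots> \<le> 2 * n2 (\<lambda>w. h *\<^sub>R dE i w) + 2 * n2 (\<lambda>w. (W t w - W (gr n i) w) *\<^sub>R sE i w)"
    by (rule L2_add(2)[OF L2_scaleR[OF ad(3)] inc(1)])
  also have "\<dots> = 2 * (h * h * n2 (dE i)) + 2 * (h * n2 (sE i))"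
    unfolding n2_scaleR inc(2) by (simp add: h_def power2_eq_square)
  also have "\<dots> \<le> 2 * (T * (T / 2^n) * (K^2 * BK)) + 2 * (T / 2^n * (2 * K^2 * BK + 2 * K^2))"
  proof -
    have d: "n2 (dE i) \<le> K^2 * BK"
      by (rule order_trans[OF dE_n2]) (simp add: B mult_left_mono)
    have s: "n2 (sE i) \<le> 2 * K^2 * BK + 2 * K^2"
      by (rule order_trans[OF sE_n2]) (simp add: B mult_left_mono)
    show ?thesis
      by (intro add_mono mult_left_mono mult_mono d s) (use h Tpos BK_nonneg in auto)
  qed
  also have "\<dots> = T / 2^n * EK" by (simp add: EK_def algebra_simps)
  finally show ?thesis by (simp add: i_def)
qed

end
end

text \<open>Stability under a change of grid and of coefficients, obtained by comparing the
  interpolations of both schemes. It yields the Cauchy property directly, before any limit equation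
  is available.\<close>

lemma Eu_diff:
  fixes a c a' c' :: "nat => real^'n^'n" and v v' :: "nat => real^'n"
  assumes nm: "n \<le> m" 
    and K: "\<And>i. norm (a i) \<le> K" "\<And>i. norm (c i) \<le> K" "\<And>i. norm (v i) \<le> K"
    and K': "\<And>i. norm (a' i) \<le> K" "\<And>i. norm (c' i) \<le> K" "\<And>i. norm (v' i) \<le> K"
    and t: "t \<in> {0..T}"
  shows "n2 (\<lambda>w. Eu n a c v (cell n t) w - Eu m a' c' v' (cell m t) w) \<le>
    2 * (6 * (T / 2^n) * EK K + (16 * T * BK K + 32 * BK K + 32) *
      (LBINT s:{0..T}. (norm (a (cell n s) - a' (cell m s)))^2 + (norm (c (cell n s) - c' (cell m s)))^2
         + (norm (v (cell n s) - v' (cell m s)))^2)) * exp (2 * (16 * T * K^2 + 16 * K^2 + 1) * T)"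
proof -
  let ?E = "EK K" and ?B = "BK K" and ?C = "16 * T * K^2 + 16 * K^2 + 1"
  define x where "x s = Eu n a c v (cell n s)" for s
  define y where "y s = Eu m a' c' v' (cell m s)" for s
  define \<phi> where "\<phi> s = n2 (\<lambda>w. x s w - y s w)" for s
  define ea where "ea s = (norm (a (cell n s) - a' (cell m s)))^2" for s
  define ec where "ec s = (norm (c (cell n s) - c' (cell m s)))^2" for s
  define ev where "ev s = (norm (v (cell n s) - v' (cell m s)))^2" for s
  have b: "bmf \<phi>" "bmf ea" "bmf ec" "bmf ev"
    unfolding \<phi>_def[abs_def] x_def y_def ea_def[abs_def] ec_def[abs_def] ev_def[abs_def] by (rule bmf_cell2)+
  have nn: "0 \<le> \<phi> s" "0 \<le> ea s" "0 \<le> ec s" "0 \<le> ev s" for s by (auto simp: \<phi>_def ea_def ec_def ev_def)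
  have B0: "0 \<le> ?B" "0 \<le> ?E" using BK_nonneg[of a K c v] EK_nonneg[of a K c v] K by auto
  have Lx: "L2 (x s)" and Ly: "L2 (y s)" for s by (simp_all add: x_def y_def Eu_adapted)
  have Bx: "n2 (x s) \<le> ?B" and By: "n2 (y s) \<le> ?B" if "s \<in> {0..T}" for s
    using Eu_bound[OF K that] Eu_bound[OF K' that] by (auto simp: x_def y_def)
  define A where "A = 6 * (T / 2^n) * ?E + (16 * T * ?B + 32 * ?B + 32) * (LBINT s:{0..T}. ea s + ec s + ev s)"
  have A0: "0 \<le> A" unfolding A_def
    using Tpos B0 nn by (intro add_nonneg_nonneg mult_nonneg_nonneg bmf_integral_nonneg bmf_add b) auto
  have "\<phi> s \<le> A + ?C * (LBINT r:{0..s}. \<phi> r)" if s: "s \<in> {0..T}" for s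
  proof (cases "s = 0")
    case True
    have "\<phi> 0 = 0" by (simp add: \<phi>_def x_def y_def n2_const)
    then show ?thesis using True A0 b by simp
  next
    case False
    then have s': "s \<in> {0<..T}" using s by auto
    let ?I = "In n a c v s" and ?J = "In m a' c' v' s"
    have LI: "L2 ?I" "L2 ?J" by (rule In_L2[OF s])+
    note D = dE_adapted[of n a c v] dE_adapted[of m a' c' v'] and S = sE_adapted[of n a c v] sE_adapted[of m a' c' v']
    \<comment> \<open>Two uses of the factor-2 inequality: the interpolation errors count 2 and 4
      times, hence the 6. The difference of the interpolations counts 4 times, which becomes 8 once
      drift and diffusion are separated.\<close>
    have "\<phi> s = n2 (\<lambda>w. (x s w - ?I w) + ((?I w - ?J w) + (?J w - y s w)))" by (simp add: \<phi>_def)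
    also have "\<dots> \<le> 2 * n2 (\<lambda>w. x s w - ?I w) + 2 * n2 (\<lambda>w. (?I w - ?J w) + (?J w - y s w))"
      by (intro L2_add L2_diff LI Lx Ly)
    also have "n2 (\<lambda>w. (?I w - ?J w) + (?J w - y s w)) \<le> 2 * n2 (\<lambda>w. ?I w - ?J w) + 2 * n2 (\<lambda>w. ?J w - y s w)"
      by (intro L2_add L2_diff LI Lx Ly)
    also have "n2 (\<lambda>w. x s w - ?I w) \<le> T / 2^n * ?E"
      using In_cell[OF K s'] by (simp add: x_def n2_minus_commute)
    also have "n2 (\<lambda>w. ?J w - y s w) \<le> T / 2^n * ?E"
    proof -
      have "n2 (\<lambda>w. ?J w - y s w) \<le> T / 2^m * ?E" using In_cell[OF K' s'] by (simp add: y_def)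
      also have "\<dots> \<le> T / 2^n * ?E"
        using nm Tpos B0 by (intro mult_right_mono divide_left_mono) auto
      finally show ?thesis .
    qed
    also have "n2 (\<lambda>w. ?I w - ?J w) \<le> 2 * (T * (LBINT r:{0..s}. 2 * K^2 * \<phi> r + 2 * ?B * ea r))
        + 2 * (LBINT r:{0..s}. 2 * K^2 * \<phi> r + (4 * ?B * ec r + 4 * ev r))"
    proof -
      have "n2 (\<lambda>w. ?I w - ?J w) = n2 (\<lambda>w. (DI n (dE n a c v) s w - DI m (dE m a' c' v') s w) +
          (SI n (sE n a c v) s w - SI m (sE m a' c' v') s w))"
        by (simp add: In_def algebra_simps)
      also have "\<dots> \<le> 2 * n2 (\<lambda>w. DI n (dE n a c v) s w - DI m (dE m a' c' v') s w) +
          2 * n2 (\<lambda>w. SI n (sE n a c v) s w - SI m (sE m a' c' v') s w)"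
        using DI_props(1)[OF D(1) s] DI_props(1)[OF D(2) s] SI_props(1)[OF S(1) s] SI_props(1)[OF S(2) s]
        by (intro L2_add(2) L2_diff)
      also have "n2 (\<lambda>w. DI n (dE n a c v) s w - DI m (dE m a' c' v') s w) \<le>
          T * (LBINT r:{0..s}. 2 * K^2 * \<phi> r + 2 * ?B * ea r)"
      proof (rule order_trans[OF DI_diff[OF nm D s]], rule mult_left_mono, rule bmf_integral_mono)
        fix r assume r: "r \<in> {0..s}"
        have eq: "dE n a c v (cell n r) w - dE m a' c' v' (cell m r) w =
            a (cell n r) *v (x r w - y r w) + (a (cell n r) - a' (cell m r)) *v y r w" for w
          by (simp add: dE_def x_def y_def matrix_vector_mult_diff_distrib matrix_vector_mult_diff_rdistrib)
        have "n2 (\<lambda>w. a (cell n r) *v (x r w - y r w) + (a (cell n r) - a' (cell m r)) *v y r w) \<le>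
            2 * n2 (\<lambda>w. a (cell n r) *v (x r w - y r w)) + 2 * n2 (\<lambda>w. (a (cell n r) - a' (cell m r)) *v y r w)"
          by (intro L2_add L2_mv L2_diff Lx Ly)
        also have "n2 (\<lambda>w. a (cell n r) *v (x r w - y r w)) \<le> K^2 * \<phi> r"
          unfolding \<phi>_def
          by (rule L2_bounded(2)[OF L2_measurable[OF L2_mv[OF L2_diff[OF Lx Ly]]] L2_diff[OF Lx Ly] norm_mv_le[OF K(1)]])
        also have "n2 (\<lambda>w. (a (cell n r) - a' (cell m r)) *v y r w) \<le> ea r * ?B"
        proof (rule order_trans[OF L2_bounded(2)[OF _ Ly[of r] norm_mv]])
          show "(norm (a (cell n r) - a' (cell m r)))^2 * n2 (y r) \<le> ea r * ?B"
            unfolding ea_def by (rule mult_left_mono) (use By r s in auto)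
        qed (intro L2_measurable L2_mv Ly)
        finally show "n2 (\<lambda>w. dE n a c v (cell n r) w - dE m a' c' v' (cell m r) w) \<le> 2 * K^2 * \<phi> r + 2 * ?B * ea r"
          unfolding eq by (simp add: algebra_simps)
      next
        show "bmf (\<lambda>r. n2 (\<lambda>w. dE n a c v (cell n r) w - dE m a' c' v' (cell m r) w))"
          by (rule bmf_cell2[of "\<lambda>i j. n2 (\<lambda>w. dE n a c v i w - dE m a' c' v' j w)"])
        show "bmf (\<lambda>r. 2 * K^2 * \<phi> r + 2 * ?B * ea r)" by (intro bmf_add bmf_mult bmf_const b)
      qed (use Tpos in simp)
      also have "n2 (\<lambda>w. SI n (sE n a c v) s w - SI m (sE m a' c' v') s w) \<le>
          (LBINT r:{0..s}. 2 * K^2 * \<phi> r + (4 * ?B * ec r + 4 * ev r))"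
        unfolding SI_diff[OF nm S s]
      proof (rule bmf_integral_mono)
        fix r assume r: "r \<in> {0..s}"
        let ?c = "c (cell n r) - c' (cell m r)" and ?v = "v (cell n r) - v' (cell m r)"
        have eq: "sE n a c v (cell n r) w - sE m a' c' v' (cell m r) w =
            c (cell n r) *v (x r w - y r w) + (?c *v y r w + ?v)" for w
          by (simp add: sE_def x_def y_def matrix_vector_mult_diff_distrib matrix_vector_mult_diff_rdistrib)
        have "n2 (\<lambda>w. c (cell n r) *v (x r w - y r w) + (?c *v y r w + ?v)) \<le>
            2 * n2 (\<lambda>w. c (cell n r) *v (x r w - y r w)) + 2 * n2 (\<lambda>w. ?c *v y r w + ?v)"
          by (intro L2_add L2_mv L2_diff L2_const Lx Ly)
        also have "n2 (\<lambda>w. ?c *v y r w + ?v) \<le> 2 * n2 (\<lambda>w. ?c *v y r w) + 2 * n2 (\<lambda>w. ?v)"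
          by (intro L2_add L2_mv L2_const Ly)
        also have "n2 (\<lambda>w. c (cell n r) *v (x r w - y r w)) \<le> K^2 * \<phi> r"
          unfolding \<phi>_def
          by (rule L2_bounded(2)[OF L2_measurable[OF L2_mv[OF L2_diff[OF Lx Ly]]] L2_diff[OF Lx Ly] norm_mv_le[OF K(2)]])
        also have "n2 (\<lambda>w. ?c *v y r w) \<le> ec r * ?B"
        proof (rule order_trans[OF L2_bounded(2)[OF _ Ly[of r] norm_mv]])
          show "(norm ?c)^2 * n2 (y r) \<le> ec r * ?B"
            unfolding ec_def by (rule mult_left_mono) (use By r s in auto)
        qed (intro L2_measurable L2_mv Ly)
        also have "n2 (\<lambda>w. ?v) = ev r" by (simp add: n2_const ev_def)
        finally show "n2 (\<lambda>w. sE n a c v (cell n r) w - sE m a' c' v' (cell m r) w) \<le>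
            2 * K^2 * \<phi> r + (4 * ?B * ec r + 4 * ev r)"
          unfolding eq by (simp add: algebra_simps)
      qed (intro bmf_cell2[of "\<lambda>i j. n2 (\<lambda>w. sE n a c v i w - sE m a' c' v' j w)"] bmf_add bmf_mult bmf_const b)+
      finally show ?thesis by simp
    qed
    finally have "\<phi> s \<le> 6 * (T / 2^n) * ?E + (8 * T * (LBINT r:{0..s}. 2 * K^2 * \<phi> r + 2 * ?B * ea r)
        + 8 * (LBINT r:{0..s}. 2 * K^2 * \<phi> r + (4 * ?B * ec r + 4 * ev r)))"
      by simp
    also have "\<dots> = 6 * (T / 2^n) * ?E + ((16 * T * K^2 + 16 * K^2) * (LBINT r:{0..s}. \<phi> r)
        + (16 * T * ?B * (LBINT r:{0..s}. ea r) + 32 * ?B * (LBINT r:{0..s}. ec r) + 32 * (LBINT r:{0..s}. ev r)))"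
      by (simp add: bmf_integral_add bmf_mult bmf_const b bmf_add algebra_simps)
    also have "\<dots> \<le> 6 * (T / 2^n) * ?E + (?C * (LBINT r:{0..s}. \<phi> r)
        + (16 * T * ?B + 32 * ?B + 32) * (LBINT s:{0..T}. ea s + ec s + ev s))"
    proof (intro add_left_mono add_mono)
      show "(16 * T * K^2 + 16 * K^2) * (LBINT r:{0..s}. \<phi> r) \<le> ?C * (LBINT r:{0..s}. \<phi> r)"
        by (intro mult_right_mono bmf_integral_nonneg b nn) auto
      have e: "0 \<le> (LBINT r:{0..s}. f r) \<and> (LBINT r:{0..s}. f r) \<le> (LBINT s:{0..T}. ea s + ec s + ev s)"
        if "f \<in> {ea, ec, ev}" for f
      proof -
        have f: "bmf f" "\<And>s. 0 \<le> f s" "\<And>s. f s \<le> ea s + ec s + ev s"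
          using that b nn by (auto simp: add_nonneg_nonneg)
        have "(LBINT r:{0..s}. f r) \<le> (LBINT r:{0..T}. f r)"
          by (rule bmf_integral_mono_set[OF f(1,2)]) (use s in auto)
        also have "\<dots> \<le> (LBINT s:{0..T}. ea s + ec s + ev s)"
          by (rule bmf_integral_mono) (use f b in \<open>auto intro!: bmf_add\<close>)
        finally show ?thesis using bmf_integral_nonneg[OF f(1,2)] by auto
      qed
      let ?L = "LBINT s:{0..T}. ea s + ec s + ev s"
      have "16 * T * ?B * (LBINT r:{0..s}. ea r) + 32 * ?B * (LBINT r:{0..s}. ec r) + 32 * (LBINT r:{0..s}. ev r)
        \<le> 16 * T * ?B * ?L + 32 * ?B * ?L + 32 * ?L"
        using e[of ea] e[of ec] e[of ev] Tpos B0 by (intro add_mono mult_left_mono) auto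
      then show "16 * T * ?B * (LBINT r:{0..s}. ea r) + 32 * ?B * (LBINT r:{0..s}. ec r) + 32 * (LBINT r:{0..s}. ev r)
        \<le> (16 * T * ?B + 32 * ?B + 32) * ?L" by (simp add: algebra_simps)
    qed
    finally show ?thesis by (simp add: A_def)
  qed
  from gronwall[OF b(1) _ A0 this t] have "\<phi> t \<le> 2 * A * exp (2 * ?C * t)"
    using Tpos by (simp add: add_nonneg_pos)
  also have "\<dots> \<le> 2 * A * exp (2 * ?C * T)"
    using t Tpos A0 by (intro mult_left_mono) (auto intro!: mult_left_mono)
  finally show ?thesis by (simp add: \<phi>_def x_def y_def A_def ea_def ec_def ev_def)
qed

end

section \<open>Mean-square estimates, almost sure limits and step approximation\<close>

lemma integral_Cauchy_Schwarz_Icc: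
  fixes g :: "real => real"
  assumes t: "0 \<le> t" and g: "set_integrable lborel {0..t} g" "set_integrable lborel {0..t} (\<lambda>s. (g s)^2)"
  shows "(LBINT s:{0..t}. g s)^2 \<le> t * (LBINT s:{0..t}. (g s)^2)"
proof (cases "t = 0")
  case True
  have "AE s in lborel. indicator {0..t} s *\<^sub>R g s = 0"
    using AE_lborel_singleton[of 0] by eventually_elim (auto simp: True)
  then have "(LBINT s:{0..t}. g s) = 0"
    unfolding set_lebesgue_integral_def by (rule integral_eq_zero_AE)
  then show ?thesis using True by simp
next
  case False
  then have t: "t > 0" using t by simp
  let ?I = "LBINT s:{0..t}. g s" and ?J = "LBINT s:{0..t}. (g s)^2"
  \<comment> \<open>The claim is the nonnegativity of the variance of \<open>g\<close> about its
    mean value \<open>m\<close>.\<close>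
  define m where "m = ?I / t"
  have c: "set_integrable lborel {0..t} (\<lambda>s. m^2)" using bmf_set_integrable[OF bmf_const] .
  have "0 \<le> (LBINT s:{0..t}. (g s)^2 - 2 * m * g s + m^2)"
    unfolding set_lebesgue_integral_def
  proof (rule Bochner_Integration.integral_nonneg)
    fix s
    have "(g s)^2 - 2 * m * g s + m^2 = (g s - m)^2" by (simp add: power2_diff)
    then show "0 \<le> indicat_real {0..t} s *\<^sub>R ((g s)^2 - 2 * m * g s + m^2)" by simp
  qed
  also have "\<dots> = ?J - 2 * m * ?I + m^2 * t"
    using g c t by (simp add: set_integral_add set_integral_diff bmf_integral_const)
  also have "\<dots> = ?J - ?I^2 / t" using t by (simp add: m_def power2_eq_square field_simps)
  finally show ?thesis using t by (simp add: field_simps)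
qed

context brownian_T begin

lemma fubini_step:
  fixes q :: "real => 'w => 'b::euclidean_space"
  assumes m: "(\<lambda>(s, w). q s w) \<in> borel_measurable LM"
    and q: "\<forall>s\<in>{0..t}. integrable M (q s) \<and> expectation (\<lambda>w. norm (q s w)) \<le> B"
  shows "AE w in M. set_integrable lborel {0..t} (\<lambda>s. q s w)"
    "integrable M (\<lambda>w. LBINT s:{0..t}. q s w)"
    "expectation (\<lambda>w. LBINT s:{0..t}. q s w) = (LBINT s:{0..t}. expectation (q s))"
proof -
  interpret P: pair_sigma_finite lborel M ..
  define f where "f s w = indicator {0..t} s *\<^sub>R q s w" for s w
  have fm: "case_prod f \<in> borel_measurable LM"
  proof -
    have "(\<lambda>z. indicator {0..t} (fst z) *\<^sub>R (case z of (s, w) => q s w)) \<in> borel_measurable LM"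
      using m by measurable
    then show ?thesis by (simp add: f_def split_def)
  qed
  have "(\<integral>\<^sup>+ z. norm (case_prod f z) \<partial>LM) = (\<integral>\<^sup>+ s. \<integral>\<^sup>+ w. norm (f s w) \<partial>M \<partial>lborel)"
    using nn_integral_fst[of "\<lambda>z. ennreal (norm (case_prod f z))" lborel] fm by simp
  also have "\<dots> \<le> (\<integral>\<^sup>+ s. ennreal (max B 0) * indicator {0..t} s \<partial>lborel)"
  proof (rule nn_integral_mono)
    fix s
    show "(\<integral>\<^sup>+ w. norm (f s w) \<partial>M) \<le> ennreal (max B 0) * indicator {0..t} s"
    proof (cases "s \<in> {0..t}")
      case True
      have "(\<integral>\<^sup>+ w. norm (f s w) \<partial>M) = ennreal (expectation (\<lambda>w. norm (q s w)))"
        using True q by (simp add: f_def nn_integral_eq_integral)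
      also have "\<dots> \<le> ennreal (max B 0)" using q True by (intro ennreal_leI max.coboundedI1) auto
      finally show ?thesis using True by simp
    qed (simp add: f_def)
  qed
  also have "\<dots> = ennreal (max B 0) * emeasure lborel {0..t}" by (simp add: nn_integral_cmult_indicator)
  also have "\<dots> < \<infinity>" by (simp add: emeasure_lborel_Icc_eq ennreal_mult_less_top)
  finally have fi: "integrable LM (case_prod f)"
    using fm by (intro integrableI_bounded) auto
  show "AE w in M. set_integrable lborel {0..t} (\<lambda>s. q s w)"
    using P.AE_integrable_snd[OF fi] by (simp add: set_integrable_def f_def)
  show "integrable M (\<lambda>w. LBINT s:{0..t}. q s w)"
    using P.integrable_snd[OF fi] by (simp add: set_lebesgue_integral_def f_def)
  have "expectation (\<lambda>w. LBINT s:{0..t}. q s w) = (LBINT s. expectation (f s))"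
    unfolding set_lebesgue_integral_def using P.Fubini_integral[OF fi] by (simp add: f_def[abs_def])
  also have "\<dots> = (LBINT s:{0..t}. expectation (q s))"
    unfolding set_lebesgue_integral_def by (intro Bochner_Integration.integral_cong) (auto simp: f_def[abs_def] indicator_def)
  finally show "expectation (\<lambda>w. LBINT s:{0..t}. q s w) = (LBINT s:{0..t}. expectation (q s))" .
qed

lemma expectation_norm_le: "L2 f ==> expectation (\<lambda>w. norm (f w)) \<le> 1 + n2 f"
proof -
  assume f: "L2 f"
  have "t \<le> 1 + t^2" for t :: real
  proof -
    have "2 * t \<le> t^2 + 1" using zero_le_power2[of "t - 1"] by (simp add: power2_diff)
    then show ?thesis using zero_le_power2[of t] by linarith
  qed
  then have "expectation (\<lambda>w. norm (f w)) \<le> expectation (\<lambda>w. 1 + (norm (f w))^2)"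
    using f L2_integrable[OF f] by (intro integral_mono) (auto simp: L2_def)
  then show ?thesis using f by (simp add: n2_def L2_def prob_space)
qed

text \<open>Cauchy-Schwarz in time for each outcome, followed by Fubini; the uniform bound
  \<open>B\<close> provides the integrability for both.\<close>

lemma n2_integral:
  fixes h :: "real => 'w => 'b::euclidean_space"
  assumes m: "(\<lambda>(s, w). h s w) \<in> borel_measurable LM" and t: "t \<in> {0..T}"
    and h: "\<forall>s\<in>{0..t}. L2 (h s) \<and> n2 (h s) \<le> B"
  shows "AE w in M. set_integrable lborel {0..t} (\<lambda>s. h s w)"
    "L2 (\<lambda>w. LBINT s:{0..t}. h s w)"
    "n2 (\<lambda>w. LBINT s:{0..t}. h s w) \<le> T * (LBINT s:{0..t}. n2 (h s))"
proof -
  have m2: "(\<lambda>(s, w). (norm (h s w))^2) \<in> borel_measurable LM"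
  proof -
    have "(\<lambda>z. (norm (case z of (s, w) => h s w))^2) \<in> borel_measurable LM" using m by measurable
    then show ?thesis by (simp add: split_def)
  qed
  have h1: "\<forall>s\<in>{0..t}. integrable M (h s) \<and> expectation (\<lambda>w. norm (h s w)) \<le> 1 + B"
  proof
    fix s assume "s \<in> {0..t}"
    then have "L2 (h s)" "n2 (h s) \<le> B" using h by auto
    then show "integrable M (h s) \<and> expectation (\<lambda>w. norm (h s w)) \<le> 1 + B"
      using L2_integrable expectation_norm_le[of "h s"] by auto
  qed
  have h2: "\<forall>s\<in>{0..t}. integrable M (\<lambda>w. (norm (h s w))^2) \<and> expectation (\<lambda>w. norm ((norm (h s w))^2)) \<le> B"
    using h by (auto simp: n2_def L2_def)
  note F1 = fubini_step[OF m h1] and F2 = fubini_step[OF m2 h2]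
  show i: "AE w in M. set_integrable lborel {0..t} (\<lambda>s. h s w)" by (rule F1)
  have le: "AE w in M. (norm (LBINT s:{0..t}. h s w))^2 \<le> T * (LBINT s:{0..t}. (norm (h s w))^2)"
    using i F2(1)
  proof eventually_elim
    case (elim w)
    have n: "set_integrable lborel {0..t} (\<lambda>s. norm (h s w))"
      using elim(1) by (rule set_integrable_norm)
    have "norm (LBINT s:{0..t}. h s w) \<le> (LBINT s:{0..t}. norm (h s w))"
      by (rule set_integral_norm_bound[OF elim(1)])
    then have "(norm (LBINT s:{0..t}. h s w))^2 \<le> (LBINT s:{0..t}. norm (h s w))^2"
      by (rule power_mono) simp
    also have "\<dots> \<le> t * (LBINT s:{0..t}. (norm (h s w))^2)"
      by (rule integral_Cauchy_Schwarz_Icc) (use t n elim(2) in auto)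
    also have "\<dots> \<le> T * (LBINT s:{0..t}. (norm (h s w))^2)"
      using t by (intro mult_right_mono) (auto simp: set_lebesgue_integral_def intro!: Bochner_Integration.integral_nonneg)
    finally show ?case .
  qed
  have I: "integrable M (\<lambda>w. T * (LBINT s:{0..t}. (norm (h s w))^2))" using F2(2) by simp
  have "integrable M (\<lambda>w. (norm (LBINT s:{0..t}. h s w))^2)"
    by (rule Bochner_Integration.integrable_bound[OF I])
      (use F1(2) le in \<open>auto intro: borel_measurable_integrable elim!: eventually_mono\<close>)
  then show L: "L2 (\<lambda>w. LBINT s:{0..t}. h s w)"
    unfolding L2_def using F1(2) by (auto intro: borel_measurable_integrable)
  have "n2 (\<lambda>w. LBINT s:{0..t}. h s w) \<le> expectation (\<lambda>w. T * (LBINT s:{0..t}. (norm (h s w))^2))"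
    unfolding n2_def by (rule integral_mono_AE[OF L2_int[OF L] I le])
  also have "\<dots> = T * (LBINT s:{0..t}. n2 (h s))"
    using F2(3) by (simp add: n2_def)
  finally show "n2 (\<lambda>w. LBINT s:{0..t}. h s w) \<le> T * (LBINT s:{0..t}. n2 (h s))" .
qed

lemma nn_integral_n2: "L2 f ==> (\<integral>\<^sup>+ w. ennreal ((norm (f w))^2) \<partial>M) = ennreal (n2 f)"
  unfolding n2_def by (rule nn_integral_eq_integral) (auto simp: L2_def)

text \<open>The rate \<open>(1/4)^k\<close> for squared distances makes the first moments of
  consecutive differences summable, which yields almost sure convergence. The distance to the limit
  is then estimated by Fatou's lemma in the second index.\<close>

lemma L2_limit:
  fixes f :: "nat => 'w => 'b::euclidean_space"
  assumes f: "\<And>k. L2 (f k)" and d: "\<And>j k. n2 (\<lambda>w. f j w - f k w) \<le> \<delta> j + \<delta> k"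
    and \<delta>: "\<And>k. \<delta> k \<le> (1/4)^k" "\<And>k. 0 \<le> \<delta> k"
  shows "AE w in M. (\<lambda>k. f k w) \<longlonglongrightarrow> lim (\<lambda>k. f k w)" "L2 (\<lambda>w. lim (\<lambda>k. f k w))"
    "n2 (\<lambda>w. f k w - lim (\<lambda>k. f k w)) \<le> \<delta> k"
proof -
  let ?g = "\<lambda>w. lim (\<lambda>k. f k w)"
  note fm = L2_measurable[OF f]
  have gm: "?g \<in> borel_measurable M" using fm by measurable
  define D where "D k w = norm (f (Suc k) w - f k w)" for k w
  have Dk: "(\<integral>\<^sup>+ w. ennreal (D k w) \<partial>M) \<le> ennreal (2 * (1/2)^k)" for k
  proof -
    have L: "L2 (\<lambda>w. f (Suc k) w - f k w)" by (intro L2_diff f)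
    have "0 \<le> (1/4::real)^k" by simp
    then have "\<delta> (Suc k) \<le> (1/4)^k" using \<delta>(1)[of "Suc k"] unfolding power_Suc by linarith
    then have n: "n2 (\<lambda>w. f (Suc k) w - f k w) \<le> 2 * (1/4)^k"
      using d[of "Suc k" k] \<delta>(1)[of k] by linarith
    have i: "integrable M (D k)" unfolding D_def[abs_def] by (intro integrable_norm L2_integrable L)
    \<comment> \<open>Young's inequality with weight \<open>2^k\<close>, which balances a squared
      distance of order \<open>(1/4)^k\<close> into order \<open>(1/2)^k\<close>.\<close>
    have "D k w \<le> 2^k * (D k w)^2 / 2 + (1/2)^k / 2" for w
    proof -
      have "0 \<le> 2^k * (D k w - (1/2)^k)^2" by simp
      also have "\<dots> = 2^k * (D k w)^2 - 2 * D k w + (1/2)^k"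
        by (simp add: power2_diff algebra_simps power_divide power2_eq_square)
      finally show ?thesis by simp
    qed
    then have "expectation (D k) \<le> expectation (\<lambda>w. 2^k * (D k w)^2 / 2 + (1/2)^k / 2)"
      using i L by (intro integral_mono) (auto simp: D_def L2_def)
    also have "\<dots> = 2^k * n2 (\<lambda>w. f (Suc k) w - f k w) / 2 + (1/2)^k / 2"
      using L by (simp add: D_def n2_def L2_def prob_space)
    also have "\<dots> \<le> 2^k * (2 * (1/4)^k) / 2 + (1/2)^k / 2"
      by (intro add_mono divide_right_mono mult_left_mono n) auto
    also have "\<dots> = 3/2 * (1/2)^k" by (simp add: power_divide field_simps flip: power_mult_distrib)
    also have "\<dots> \<le> 2 * (1/2)^k" by (intro mult_right_mono) auto
    finally show ?thesis
      using i by (subst nn_integral_eq_integral) (auto simp: D_def intro!: ennreal_leI)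
  qed
  have "(\<integral>\<^sup>+ w. (\<Sum>k. ennreal (D k w)) \<partial>M) = (\<Sum>k. \<integral>\<^sup>+ w. ennreal (D k w) \<partial>M)"
    by (rule nn_integral_suminf) (use fm in \<open>simp add: D_def\<close>)
  also have "\<dots> \<le> (\<Sum>k. ennreal (2 * (1/2)^k))" by (intro suminf_le Dk) auto
  also have "\<dots> < \<infinity>"
  proof -
    have "summable (\<lambda>k. 2 * (1/2::real)^k)" by (intro summable_mult summable_geometric) simp
    then show ?thesis by (subst suminf_ennreal2) auto
  qed
  finally have "AE w in M. (\<Sum>k. ennreal (D k w)) \<noteq> \<infinity>"
    by (intro nn_integral_PInf_AE) (use fm in \<open>auto simp: D_def\<close>)
  then show ae: "AE w in M. (\<lambda>k. f k w) \<longlonglongrightarrow> ?g w"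
  proof eventually_elim
    case (elim w)
    then have "summable (\<lambda>k. D k w)"
      by (intro summable_suminf_not_top) (auto simp: D_def)
    then have "summable (\<lambda>k. f (Suc k) w - f k w)"
      unfolding D_def by (rule summable_norm_cancel)
    then have "convergent (\<lambda>n. \<Sum>k<n. f (Suc k) w - f k w)" by (simp add: summable_iff_convergent)
    then have "convergent (\<lambda>n. (f n w - f 0 w) + f 0 w)"
      unfolding sum_lessThan_telescope[of "\<lambda>k. f k w"] by (intro convergent_add convergent_const)
    then show ?case by (simp add: convergent_LIMSEQ_iff)
  qed
  have bound: "(\<integral>\<^sup>+ w. ennreal ((norm (f k w - ?g w))^2) \<partial>M) \<le> ennreal (\<delta> k)" for k
  proof -
    have "(\<integral>\<^sup>+ w. ennreal ((norm (f k w - ?g w))^2) \<partial>M) =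
        (\<integral>\<^sup>+ w. liminf (\<lambda>l. ennreal ((norm (f k w - f l w))^2)) \<partial>M)"
    proof (rule nn_integral_cong_AE, use ae in eventually_elim)
      case (elim w)
      have "(\<lambda>l. ennreal ((norm (f k w - f l w))^2)) \<longlonglongrightarrow> ennreal ((norm (f k w - ?g w))^2)"
        by (intro tendsto_intros elim)
      from lim_imp_Liminf[OF _ this] show ?case by simp
    qed
    also have "\<dots> \<le> liminf (\<lambda>l. \<integral>\<^sup>+ w. ennreal ((norm (f k w - f l w))^2) \<partial>M)"
      by (rule nn_integral_liminf) (use fm in simp)
    also have "\<dots> \<le> liminf (\<lambda>l. ennreal (\<delta> k + (1/4)^l))"
    proof (intro Liminf_mono eventually_mono[OF eventually_ge_at_top[of 0]])
      fix l
      have "n2 (\<lambda>w. f k w - f l w) \<le> \<delta> k + (1/4)^l" using d[of k l] \<delta>(1)[of l] by linarith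
      then show "(\<integral>\<^sup>+ w. ennreal ((norm (f k w - f l w))^2) \<partial>M) \<le> ennreal (\<delta> k + (1/4)^l)"
        by (subst nn_integral_n2[OF L2_diff[OF f f]]) (rule ennreal_leI)
    qed
    also have "\<dots> = ennreal (\<delta> k + 0)"
      by (intro lim_imp_Liminf tendsto_ennrealI tendsto_intros LIMSEQ_realpow_zero) auto
    finally show ?thesis by simp
  qed
  have Ld: "L2 (\<lambda>w. f k w - ?g w)" for k
    unfolding L2_def
  proof
    show "integrable M (\<lambda>w. (norm (f k w - ?g w))^2)"
      by (rule integrableI_bounded) (use fm gm le_less_trans[OF bound[of k]] in auto)
  qed (use fm gm in measurable)
  show "L2 ?g" using L2_diff[OF f Ld, of 0 0] by simp
  show "n2 (\<lambda>w. f k w - ?g w) \<le> \<delta> k"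
    using bound[of k] unfolding nn_integral_n2[OF Ld] using \<delta>(2)[of k] by simp
qed

text \<open>Radial projection onto the ball of radius \<open>K\<close>: continuous and the identity
  on the ball, so continuous approximants inherit the bound of their limit.\<close>

definition clip :: "real => 'b::real_normed_vector => 'b" where
  "clip K x = (K / max K (norm x)) *\<^sub>R x"

lemma clip_props:
  fixes x :: "'b::real_normed_vector"
  assumes "0 < K"
  shows "norm (clip K x) \<le> K" "norm x \<le> K ==> clip K x = x" "continuous_on UNIV (clip K :: 'b => 'b)"
proof -
  have "0 < max K (norm x)" using assms by simp
  then show "norm (clip K x) \<le> K"
    using assms by (simp add: clip_def field_simps) 
  show "norm x \<le> K ==> clip K x = x" using assms by (simp add: clip_def max_def)
  have nz: "max K (norm y) \<noteq> 0" for y :: 'b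
  proof -
    have "0 < max K (norm y)" using assms by (simp add: less_max_iff_disj)
    then show ?thesis by simp
  qed
  show "continuous_on UNIV (clip K :: 'b => 'b)" unfolding clip_def[abs_def]
    by (intro continuous_intros ballI nz)
qed

text \<open>Continuous functions converge to \<open>f\<close> almost everywhere; uniform continuity
  of the \<open>j\<close>-th one selects a grid level \<open>L j\<close> on which sampling at left
  endpoints costs at most \<open>1 / real (Suc j)\<close>.\<close>

lemma step_approx:
  fixes f :: "real => 'b::euclidean_space"
  assumes f: "f \<in> borel_measurable borel" and K: "0 < K" "\<And>t. norm (f t) \<le> K"
  shows "\<exists>(L :: nat => nat) g. (\<forall>j. j \<le> L j) \<and> (\<forall>j i. norm (g j i :: 'b) \<le> K) \<and>
    (AE s in lborel. s \<in> {0..T} \<longrightarrow> (\<lambda>j. g j (cell (L j) s)) \<longlonglongrightarrow> f s)"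
proof -
  have "f \<in> borel_measurable lebesgue" using f by (simp add: measurable_completion)
  then have "f measurable_on UNIV" by (rule lebesgue_measurable_imp_measurable_on) simp
  then obtain N h where N: "negligible N" and h: "\<And>n. continuous_on UNIV (h n)"
    "\<And>x. x \<notin> N ==> (\<lambda>n. h n x) \<longlonglongrightarrow> f x"
    unfolding measurable_on_def by auto
  define h' where "h' n x = clip K (h n x)" for n x
  have h'c: "continuous_on UNIV (h' n)" for n
    unfolding h'_def by (rule continuous_on_compose2[OF clip_props(3)[OF K(1)] h(1)]) auto
  have h'l: "(\<lambda>n. h' n x) \<longlonglongrightarrow> f x" if "x \<notin> N" for x
  proof -
    have "isCont (clip K) (f x)" using clip_props(3)[OF K(1)] continuous_on_eq_continuous_at by blast
    from isCont_tendsto_compose[OF this h(2)[OF that]]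
    show ?thesis by (simp add: h'_def clip_props(2)[OF K(1) K(2)])
  qed
  have "\<exists>l\<ge>j. \<forall>x\<in>{0..T}. \<forall>y\<in>{0..T}. \<bar>x - y\<bar> \<le> T / 2^l \<longrightarrow> norm (h' j x - h' j y) < 1 / real (Suc j)" for j
  proof -
    have "uniformly_continuous_on {0..T} (h' j)"
      by (rule compact_uniformly_continuous) (auto intro: continuous_on_subset[OF h'c])
    moreover have "0 < 1 / real (Suc j)" by simp
    ultimately obtain d where d: "d > 0" "\<And>x y. x \<in> {0..T} ==> y \<in> {0..T} ==> dist y x < d ==> dist (h' j y) (h' j x) < 1 / real (Suc j)"
      unfolding uniformly_continuous_on_def by metis
    have "(\<lambda>l. T * (1/2)^l) \<longlonglongrightarrow> T * 0" by (intro tendsto_intros LIMSEQ_realpow_zero) auto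
    then have "eventually (\<lambda>l. T * (1/2)^l < d) sequentially" using d(1) by (auto dest: order_tendstoD(2))
    then obtain l0 where "\<And>l. l \<ge> l0 ==> T * (1/2)^l < d" by (auto simp: eventually_sequentially)
    then have l: "T / 2^(max l0 j) < d" by (metis max.cobounded1 divide_inverse power_one_over inverse_eq_divide)
    show ?thesis
    proof (intro exI[of _ "max l0 j"] conjI ballI impI)
      fix x y assume "x \<in> {0..T}" "y \<in> {0..T}" "\<bar>x - y\<bar> \<le> T / 2^(max l0 j)"
      then show "norm (h' j x - h' j y) < 1 / real (Suc j)"
        using d(2)[of y x] l by (auto simp: dist_norm)
    qed simp
  qed
  then obtain L where L: "\<And>j. j \<le> L j"
    "\<And>j x y. x \<in> {0..T} ==> y \<in> {0..T} ==> \<bar>x - y\<bar> \<le> T / 2^(L j) ==> norm (h' j x - h' j y) < 1 / real (Suc j)"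
    by metis
  define g where "g j i = h' j (gr (L j) i)" for j i
  show ?thesis
  proof (intro exI conjI allI)
    show "j \<le> L j" for j by (rule L)
    show "norm (g j i) \<le> K" for j i unfolding g_def h'_def by (rule clip_props(1)[OF K(1)])
    have "AE s in lebesgue. s \<notin> N" using N unfolding negligible_iff_null_sets by (rule AE_not_in)
    then have "AE s in lborel. s \<notin> N" by (simp only: AE_completion_iff)
    with AE_lborel_singleton[of 0]
    show "AE s in lborel. s \<in> {0..T} \<longrightarrow> (\<lambda>j. g j (cell (L j) s)) \<longlonglongrightarrow> f s"
    proof eventually_elim
      case (elim s)
      show ?case
      proof
        assume "s \<in> {0..T}"
        with elim have s: "s \<in> {0<..T}" by auto
        have 1: "norm (g j (cell (L j) s) - h' j s) \<le> 1 / real (Suc j)" for j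
        proof -
          have "gr (L j) (cell (L j) s) \<in> {0..T}" "\<bar>gr (L j) (cell (L j) s) - s\<bar> \<le> T / 2^(L j)"
            using cell_bounds[OF s, of "L j"] s gr_Suc[of "L j" "cell (L j) s"] by auto
          then show ?thesis unfolding g_def using L(2)[of _ s j] s by (intro less_imp_le) auto
        qed
        have 2: "(\<lambda>j. 1 / real (Suc j)) \<longlonglongrightarrow> 0" using LIMSEQ_inverse_real_of_nat by (simp add: inverse_eq_divide)
        have "(\<lambda>j. g j (cell (L j) s) - h' j s) \<longlonglongrightarrow> 0"
          by (rule Lim_null_comparison[OF always_eventually 2]) (use 1 in blast)
        from tendsto_add[OF this h'l[OF elim(2)]] show "(\<lambda>j. g j (cell (L j) s)) \<longlonglongrightarrow> f s" by simp
      qed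
    qed
  qed
qed

end

lemma bilinear_measurable:
  fixes B :: "'a::euclidean_space => 'b::euclidean_space => 'c::euclidean_space"
  assumes B: "bounded_bilinear B" and f: "f \<in> borel_measurable N" and g: "g \<in> borel_measurable N"
  shows "(\<lambda>x. B (f x) (g x)) \<in> borel_measurable N"
proof -
  interpret bounded_bilinear B by fact
  have "continuous_on UNIV (\<lambda>p. B (fst p) (snd p))"
    by (intro continuous_on continuous_intros)
  then have "(\<lambda>p. B (fst p) (snd p)) \<in> borel_measurable borel"
    by (rule borel_measurable_continuous_onI)
  from measurable_compose[OF borel_measurable_Pair[OF f g] this] show ?thesis by simp
qed

context brownian begin

lemma n2_cong_AE:
  assumes "f \<in> borel_measurable M" "g \<in> borel_measurable M" "AE w in M. f w = g w"
  shows "n2 f = n2 g"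
  unfolding n2_def
  by (rule integral_cong_AE) (use assms in \<open>auto elim: eventually_mono\<close>)

lemma expectation_sq_le:
  fixes f :: "'w => 'b::euclidean_space"
  assumes f: "L2 f" shows "(norm (expectation f))^2 \<le> n2 f"
proof -
  let ?m = "expectation f"
  have i: "integrable M (\<lambda>w. f w \<bullet> ?m)" using L2_integrable[OF f] by simp
  have "0 \<le> expectation (\<lambda>w. (norm (f w - ?m))^2)" by simp
  also have "\<dots> = expectation (\<lambda>w. (norm (f w))^2 - 2 * (f w \<bullet> ?m) + (norm ?m)^2)"
    by (intro Bochner_Integration.integral_cong)
      (auto simp: power2_norm_eq_inner inner_diff_left inner_diff_right inner_commute)
  also have "\<dots> = n2 f - 2 * (?m \<bullet> ?m) + (norm ?m)^2"
  proof -
    have "expectation (\<lambda>w. f w \<bullet> ?m) = ?m \<bullet> ?m"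
      by (rule integral_inner_left) (use L2_integrable[OF f] in auto)
    then show ?thesis using L2_int[OF f] i by (simp add: n2_def prob_space)
  qed
  finally show ?thesis by (simp add: power2_norm_eq_inner)
qed

end

section \<open>Bounded step processes and closure of the Ito integral\<close>

context brownian_T begin

lemma tonelli_n2:
  fixes h :: "real => 'w => 'b::euclidean_space"
  assumes m: "(\<lambda>(s, w). h s w) \<in> borel_measurable LM" and h: "\<forall>s\<in>{0..T}. L2 (h s)"
  shows "(\<integral>\<^sup>+ w. (\<integral>\<^sup>+ s\<in>{0..T}. ennreal ((norm (h s w))^2) \<partial>lborel) \<partial>M) = (\<integral>\<^sup>+ s\<in>{0..T}. ennreal (n2 (h s)) \<partial>lborel)"
proof -
  interpret P: pair_sigma_finite lborel M ..
  define F where "F z = ennreal ((norm (case z of (s, w) => h s w))^2) * indicator {0..T} (fst z)" for z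
  have F: "F \<in> borel_measurable LM" unfolding F_def[abs_def] using m by measurable
  have "(\<integral>\<^sup>+ w. (\<integral>\<^sup>+ s. F (s, w) \<partial>lborel) \<partial>M) = (\<integral>\<^sup>+ s. (\<integral>\<^sup>+ w. F (s, w) \<partial>M) \<partial>lborel)"
    by (rule P.Fubini') (use F in \<open>simp add: split_def\<close>)
  also have "\<dots> = (\<integral>\<^sup>+ s\<in>{0..T}. ennreal (n2 (h s)) \<partial>lborel)"
  proof (rule nn_integral_cong)
    fix s
    show "(\<integral>\<^sup>+ w. F (s, w) \<partial>M) = ennreal (n2 (h s)) * indicator {0..T} s"
      using h nn_integral_n2[of "h s"] by (cases "s \<in> {0..T}") (auto simp: F_def)
  qed
  finally show ?thesis by (simp add: F_def)
qed

lemma cell_joint_measurable: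
  assumes "\<And>i. \<xi> i \<in> borel_measurable M"
  shows "(\<lambda>(s, w). \<xi> (cell n s) w) \<in> borel_measurable LM"
proof -
  have c: "(\<lambda>z. cell n (fst z)) \<in> measurable LM (count_space UNIV)"
    by (rule measurable_compose[OF measurable_fst]) (simp add: cell_measurable)
  have x: "(\<lambda>z. \<xi> i (snd z)) \<in> borel_measurable LM" for i
    by (rule measurable_compose[OF measurable_snd assms])
  show ?thesis
    using measurable_compose_countable[OF x c] by (simp add: split_def)
qed

text \<open>\<open>simple_integrand\<close> asks for bounded values, while Euler values are only
  square integrable. Cutting off by size preserves adaptedness, and dominated convergence makes the
  error small on the finitely many cells.\<close>

lemma truncate:
  fixes \<xi> :: "nat => 'w => 'b::euclidean_space"
  assumes \<xi>: "adapted n \<xi>" and e: "0 < e"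
  obtains \<eta> R where "\<And>i w. norm (\<eta> i w) \<le> (R::real)" "adapted n \<eta>"
    "\<And>i. i < 2^n ==> n2 (\<lambda>w. \<xi> i w - \<eta> i w) \<le> e"
    "(\<And>i. \<xi> i \<in> borel_measurable M) ==> (\<And>i. \<eta> i \<in> borel_measurable M)"
proof -
  define cut where "cut R i w = (if norm (\<xi> i w) \<le> R then \<xi> i w else 0)" for R :: real and i w
  have ex: "\<exists>R0. \<forall>R\<ge>R0. n2 (\<lambda>w. \<xi> i w - cut (real R) i w) \<le> e" if i: "i < 2^n" for i
  proof -
    have L: "L2 (\<xi> i)" using \<xi> i by (auto simp: adapted_def)
    have "(\<lambda>R. n2 (\<lambda>w. \<xi> i w - cut (real R) i w)) \<longlonglongrightarrow> expectation (\<lambda>w. 0)"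
      unfolding n2_def
    proof (rule integral_dominated_convergence)
      show "integrable M (\<lambda>w. (norm (\<xi> i w))^2)" by (rule L2_int[OF L])
      show "(\<lambda>w. (norm (\<xi> i w - cut (real R) i w))^2) \<in> borel_measurable M" for R
        using L2_measurable[OF L] unfolding cut_def by measurable
      show "AE w in M. norm ((norm (\<xi> i w - cut (real R) i w))^2) \<le> (norm (\<xi> i w))^2" for R
        by (auto simp: cut_def)
      show "AE w in M. (\<lambda>R. (norm (\<xi> i w - cut (real R) i w))^2) \<longlonglongrightarrow> 0"
      proof (intro AE_I2 tendsto_eventually)
        fix w
        obtain N :: nat where "norm (\<xi> i w) \<le> real N" using real_arch_simple by blast
        then show "\<forall>\<^sub>F R in sequentially. (norm (\<xi> i w - cut (real R) i w))^2 = 0"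
          unfolding eventually_sequentially by (intro exI[of _ N]) (auto simp: cut_def)
      qed
    qed simp
    then have "(\<lambda>R. n2 (\<lambda>w. \<xi> i w - cut (real R) i w)) \<longlonglongrightarrow> 0" by simp
    from order_tendstoD(2)[OF this e] show ?thesis
      by (auto simp: eventually_sequentially intro: less_imp_le)
  qed
  then obtain R0 where R0: "\<And>i R. i < 2^n ==> R0 i \<le> R ==> n2 (\<lambda>w. \<xi> i w - cut (real R) i w) \<le> e" by metis
  define R where "R = Max (R0 ` {..<2^n})"
  have R: "R0 i \<le> R" if "i < 2^n" for i using that unfolding R_def by (intro Max_ge) auto
  have m: "cut R' i \<in> borel_measurable N" if "\<xi> i \<in> borel_measurable N" for R' i and N :: "'w measure"
    using that unfolding cut_def[abs_def] by measurable
  have ad: "adapted n (cut (real R))"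
    unfolding adapted_def
  proof (intro allI impI conjI)
    fix i :: nat assume i: "i < 2^n"
    then have x: "\<xi> i \<in> borel_measurable (FS (gr n i))" "L2 (\<xi> i)" using \<xi> by (auto simp: adapted_def)
    show "cut (real R) i \<in> borel_measurable (FS (gr n i))" by (rule m[OF x(1)])
    show "L2 (cut (real R) i)"
      by (rule L2_bounded(1)[OF m[OF L2_measurable[OF x(2)]] x(2), of _ 1]) (auto simp: cut_def)
  qed
  show thesis
    by (rule that[of "cut (real R)" "real R"]) (use ad R0 R m in \<open>auto simp: cut_def\<close>)
qed

lemma step_proc_cell:
  assumes "s \<in> {0<..T}"
  shows "step_proc (2^n) (gr n) \<xi> s w = \<xi> (cell n s) w"
proof -
  have "s \<in> {gr n i<..gr n (Suc i)} \<longleftrightarrow> i = cell n s" for i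
    using cell_unique[OF assms, of n i] cell_bounds[OF assms, of n] by auto
  then have "step_proc (2^n) (gr n) \<xi> s w = (\<Sum>i<2^n. if i = cell n s then \<xi> i w else 0)"
    unfolding step_proc_def by (intro sum.cong) (auto simp: indicator_def)
  then show ?thesis using cell_less by simp
qed

text \<open>Limits of adapted square-integrable step integrals are Ito integrals in the sense of
  \<open>ito_integral\<close>: truncating the \<open>j\<close>-th process with error
  \<open>e j\<close> secures boundedness and, by the isometry, affects neither limit.\<close>

lemma ito_closure:
  fixes \<xi> :: "nat => nat => 'w => 'b::euclidean_space"
  assumes H: "(\<lambda>(s, w). H s w) \<in> borel_measurable LM" "\<forall>s\<in>{0..T}. L2 (H s)"
    and \<xi>: "\<And>j. adapted (L j) (\<xi> j)" "\<And>j i. \<xi> j i \<in> borel_measurable M"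
    and \<phi>: "\<And>j. bmf (\<phi> j)" "\<And>j s. s \<in> {0..T} ==> n2 (\<lambda>w. \<xi> j (cell (L j) s) w - H s w) \<le> \<phi> j s"
      "(\<lambda>j. LBINT s:{0..T}. \<phi> j s) \<longlonglongrightarrow> 0"
    and I: "\<And>t. t \<in> {0..T} ==> L2 (I t)" "\<And>t. t \<in> {0..T} ==> (\<lambda>j. n2 (\<lambda>w. SI (L j) (\<xi> j) t w - I t w)) \<longlonglongrightarrow> 0"
  shows "ito_integral M (aug_filtration M W) W T H I"
proof -
  define e where "e j = 1 / real (Suc j)" for j
  have e: "0 < e j" for j by (simp add: e_def)
  have e0: "e \<longlonglongrightarrow> 0" unfolding e_def[abs_def] using LIMSEQ_inverse_real_of_nat by (simp add: inverse_eq_divide)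
  have "\<exists>\<eta>. (\<exists>R. \<forall>i w. norm (\<eta> i w) \<le> (R::real)) \<and> adapted (L j) \<eta> \<and>
      (\<forall>i<2^(L j). n2 (\<lambda>w. \<xi> j i w - \<eta> i w) \<le> e j) \<and> (\<forall>i. \<eta> i \<in> borel_measurable M)" for j
    by (rule truncate[OF \<xi>(1)[of j] e[of j]]) (use \<xi>(2) in blast)
  then obtain \<eta> where \<eta>: "\<And>j. \<exists>R. \<forall>i w. norm (\<eta> j i w) \<le> (R::real)" "\<And>j. adapted (L j) (\<eta> j)"
      "\<And>j i. i < 2^(L j) ==> n2 (\<lambda>w. \<xi> j i w - \<eta> j i w) \<le> e j" "\<And>j i. \<eta> j i \<in> borel_measurable M"
    by metis
  have eq_cell: "n2 (\<lambda>w. \<xi> j (cell (L j) s) w - \<eta> j (cell (L j) s) w) \<le> e j" for j s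
    by (rule \<eta>(3)[OF cell_less])
  show ?thesis unfolding ito_integral_def
  proof (rule exI[of _ "\<lambda>j. 2^(L j)"], rule exI[of _ "\<lambda>j. gr (L j)"], rule exI[of _ \<eta>], intro conjI allI ballI)
    fix j
    show "simple_integrand M (aug_filtration M W) T (2^(L j)) (gr (L j)) (\<eta> j)"
    proof -
      have "\<exists>K. \<forall>w\<in>space M. norm (\<eta> j i w) \<le> K" for i using \<eta>(1)[of j] by blast
      then show ?thesis using \<eta>(2)[of j] unfolding simple_integrand_def adapted_def by (auto simp: gr_strict)
    qed
  next
    have b: "bmf (\<lambda>s. 2 * \<phi> j s + 2 * e j)" for j by (intro bmf_add bmf_mult bmf_const \<phi>)
    have Lb: "L2 (\<xi> j (cell (L j) s))" "L2 (\<eta> j (cell (L j) s))" for j s by (rule adapted_L2[OF \<xi>(1)], rule adapted_L2[OF \<eta>(2)])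
    have n: "n2 (\<lambda>w. \<eta> j (cell (L j) s) w - H s w) \<le> 2 * \<phi> j s + 2 * e j" if s: "s \<in> {0..T}" for j s
    proof -
      have "n2 (\<lambda>w. (\<xi> j (cell (L j) s) w - H s w) + (\<eta> j (cell (L j) s) w - \<xi> j (cell (L j) s) w)) \<le>
         2 * n2 (\<lambda>w. \<xi> j (cell (L j) s) w - H s w) + 2 * n2 (\<lambda>w. \<eta> j (cell (L j) s) w - \<xi> j (cell (L j) s) w)"
        by (intro L2_add L2_diff Lb) (use H(2) s in auto)
      also have "\<dots> \<le> 2 * \<phi> j s + 2 * e j"
        using \<phi>(2)[OF s, of j] eq_cell[of j s]
          n2_minus_commute[of "\<xi> j (cell (L j) s)" "\<eta> j (cell (L j) s)"] by simp
      finally show ?thesis by simp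
    qed
    have int: "(\<lambda>j. LBINT s:{0..T}. 2 * \<phi> j s + 2 * e j) \<longlonglongrightarrow> 0"
    proof -
      have "(LBINT s:{0..T}. 2 * \<phi> j s + 2 * e j) = 2 * (LBINT s:{0..T}. \<phi> j s) + 2 * e j * T" for j
        using Tpos by (subst bmf_integral_add) (auto intro!: bmf_mult bmf_const \<phi> simp: bmf_integral_const)
      moreover have "(\<lambda>j. 2 * (LBINT s:{0..T}. \<phi> j s) + 2 * e j * T) \<longlonglongrightarrow> 2 * 0 + 2 * 0 * T"
        by (intro tendsto_intros \<phi>(3) e0)
      ultimately show ?thesis by simp
    qed
    have le: "(\<integral>\<^sup>+w. (\<integral>\<^sup>+s\<in>{0..T}. ennreal ((norm (step_proc (2^(L j)) (gr (L j)) (\<eta> j) s w - H s w))^2) \<partial>lborel) \<partial>M)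
       \<le> ennreal (LBINT s:{0..T}. 2 * \<phi> j s + 2 * e j)" for j
    proof -
      have "(\<integral>\<^sup>+s\<in>{0..T}. ennreal ((norm (step_proc (2^(L j)) (gr (L j)) (\<eta> j) s w - H s w))^2) \<partial>lborel)
        = (\<integral>\<^sup>+s\<in>{0..T}. ennreal ((norm (\<eta> j (cell (L j) s) w - H s w))^2) \<partial>lborel)" for w
        by (rule nn_integral_cong_AE, use AE_lborel_singleton[of 0] in eventually_elim)
          (auto simp: indicator_def step_proc_cell)
      then have "(\<integral>\<^sup>+w. (\<integral>\<^sup>+s\<in>{0..T}. ennreal ((norm (step_proc (2^(L j)) (gr (L j)) (\<eta> j) s w - H s w))^2) \<partial>lborel) \<partial>M)
        = (\<integral>\<^sup>+w. (\<integral>\<^sup>+s\<in>{0..T}. ennreal ((norm (\<eta> j (cell (L j) s) w - H s w))^2) \<partial>lborel) \<partial>M)" by simp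
      also have "\<dots> = (\<integral>\<^sup>+s\<in>{0..T}. ennreal (n2 (\<lambda>w. \<eta> j (cell (L j) s) w - H s w)) \<partial>lborel)"
      proof (rule tonelli_n2)
        show "(\<lambda>(s, w). \<eta> j (cell (L j) s) w - H s w) \<in> borel_measurable LM"
          using borel_measurable_diff[OF cell_joint_measurable[OF \<eta>(4)] H(1)] by (simp add: split_def)
        show "\<forall>s\<in>{0..T}. L2 (\<lambda>w. \<eta> j (cell (L j) s) w - H s w)" using H(2) Lb by (auto intro: L2_diff)
      qed
      also have "\<dots> \<le> (\<integral>\<^sup>+s. ennreal (indicator {0..T} s *\<^sub>R (2 * \<phi> j s + 2 * e j)) \<partial>lborel)"
        by (intro nn_integral_mono) (use n in \<open>auto simp: indicator_def intro!: ennreal_leI\<close>)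
      also have "\<dots> = ennreal (LBINT s:{0..T}. 2 * \<phi> j s + 2 * e j)"
        unfolding set_lebesgue_integral_def
      proof (rule nn_integral_eq_integral)
        show "integrable lborel (\<lambda>s. indicator {0..T} s *\<^sub>R (2 * \<phi> j s + 2 * e j))"
          using bmf_set_integrable[OF b] by (simp add: set_integrable_def)
        show "AE s in lborel. 0 \<le> indicator {0..T} s *\<^sub>R (2 * \<phi> j s + 2 * e j)"
        proof (rule AE_I2)
          fix s
          show "0 \<le> indicator {0..T} s *\<^sub>R (2 * \<phi> j s + 2 * e j)"
            using order_trans[OF n2_nonneg n[of s j]] by (cases "s \<in> {0..T}") auto
        qed
      qed
      finally show ?thesis .
    qed
    have "(\<lambda>j. ennreal (LBINT s:{0..T}. 2 * \<phi> j s + 2 * e j)) \<longlonglongrightarrow> ennreal 0"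
      by (intro tendsto_ennrealI int)
    then have t0: "(\<lambda>j. ennreal (LBINT s:{0..T}. 2 * \<phi> j s + 2 * e j)) \<longlonglongrightarrow> 0" by simp
    show "(\<lambda>j. \<integral>\<^sup>+w. (\<integral>\<^sup>+s\<in>{0..T}. ennreal ((norm (step_proc (2^(L j)) (gr (L j)) (\<eta> j) s w - H s w))^2) \<partial>lborel) \<partial>M) \<longlonglongrightarrow> 0"
      by (rule tendsto_sandwich[OF _ _ tendsto_const t0]) (use le in auto)
  next
    fix t assume t: "t \<in> {0..T}"
    have Ls: "L2 (SI (L j) (\<eta> j) t)" "L2 (SI (L j) (\<xi> j) t)" for j
      by (rule SI_props(1)[OF \<eta>(2) t], rule SI_props(1)[OF \<xi>(1) t])
    have le: "n2 (\<lambda>w. SI (L j) (\<eta> j) t w - I t w) \<le> 2 * n2 (\<lambda>w. SI (L j) (\<xi> j) t w - I t w) + 2 * (e j * T)" for j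
    proof -
      have "n2 (\<lambda>w. (SI (L j) (\<xi> j) t w - I t w) + (SI (L j) (\<eta> j) t w - SI (L j) (\<xi> j) t w)) \<le>
        2 * n2 (\<lambda>w. SI (L j) (\<xi> j) t w - I t w) + 2 * n2 (\<lambda>w. SI (L j) (\<eta> j) t w - SI (L j) (\<xi> j) t w)"
        by (intro L2_add L2_diff Ls I(1) t)
      also have "n2 (\<lambda>w. SI (L j) (\<eta> j) t w - SI (L j) (\<xi> j) t w) =
          (LBINT s:{0..t}. n2 (\<lambda>w. \<eta> j (cell (L j) s) w - \<xi> j (cell (L j) s) w))"
        by (rule SI_diff[OF order_refl \<eta>(2) \<xi>(1) t])
      also have "\<dots> \<le> (LBINT s:{0..t}. e j)"
        by (intro bmf_integral_mono bmf_cell[of "\<lambda>i. n2 (\<lambda>w. \<eta> j i w - \<xi> j i w)"] bmf_const)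
          (simp add: n2_minus_commute[of "\<eta> j _"] eq_cell)
      also have "\<dots> \<le> e j * T" using t e[of j] by (simp add: bmf_integral_const)
      finally show ?thesis by simp
    qed
    have "(\<lambda>j. 2 * n2 (\<lambda>w. SI (L j) (\<xi> j) t w - I t w) + 2 * (e j * T)) \<longlonglongrightarrow> 2 * 0 + 2 * (0 * T)"
      by (intro tendsto_intros I(2)[OF t] e0)
    then have t0: "(\<lambda>j. 2 * n2 (\<lambda>w. SI (L j) (\<xi> j) t w - I t w) + 2 * (e j * T)) \<longlonglongrightarrow> 0" by simp
    have "(\<lambda>j. n2 (\<lambda>w. SI (L j) (\<eta> j) t w - I t w)) \<longlonglongrightarrow> 0"
      by (rule tendsto_sandwich[OF _ _ tendsto_const t0]) (use le in auto)
    then have "(\<lambda>j. ennreal (n2 (\<lambda>w. SI (L j) (\<eta> j) t w - I t w))) \<longlonglongrightarrow> ennreal 0"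
      by (rule tendsto_ennrealI)
    moreover have "(\<integral>\<^sup>+w. ennreal ((norm (step_ito W (2^(L j)) (gr (L j)) (\<eta> j) t w - I t w))^2) \<partial>M) =
        ennreal (n2 (\<lambda>w. SI (L j) (\<eta> j) t w - I t w))" for j
      using nn_integral_n2[OF L2_diff[OF Ls(1) I(1)[OF t]], of j] by (simp add: step_ito_def SI_def)
    ultimately show "(\<lambda>j. \<integral>\<^sup>+w. ennreal ((norm (step_ito W (2^(L j)) (gr (L j)) (\<eta> j) t w - I t w))^2) \<partial>M) \<longlonglongrightarrow> 0"
      by simp
  qed
qed

lemma n2_integral_le:
  fixes h :: "real => 'w => 'b::euclidean_space"
  assumes m: "(\<lambda>(s, w). h s w) \<in> borel_measurable LM" and t: "t \<in> {0..T}"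
    and h: "\<And>s. s \<in> {0..t} ==> L2 (h s)" "\<And>s. s \<in> {0..t} ==> n2 (h s) \<le> \<phi> s" and \<phi>: "bmf \<phi>"
  shows "n2 (\<lambda>w. LBINT s:{0..t}. h s w) \<le> T * (LBINT s:{0..t}. \<phi> s)"
proof -
  obtain B where B: "B > 0" "\<And>s. norm (\<phi> s) \<le> B" using bmf_bound[OF \<phi>] by blast
  have hB: "\<forall>s\<in>{0..t}. L2 (h s) \<and> n2 (h s) \<le> B"
  proof
    fix s assume "s \<in> {0..t}"
    with h[of s] B(2)[of s] show "L2 (h s) \<and> n2 (h s) \<le> B" by auto
  qed
  have "(\<lambda>s. n2 (h s)) \<in> borel_measurable lborel"
  proof -
    have "(\<lambda>z. (norm (case z of (s, w) => h s w))^2) \<in> borel_measurable LM" using m by measurable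
    then have "(\<lambda>(s, w). (norm (h s w))^2) \<in> borel_measurable LM" by (simp add: split_def)
    then show ?thesis unfolding n2_def by (rule borel_measurable_lebesgue_integral)
  qed
  then have si: "set_integrable lborel {0..t} (\<lambda>s. n2 (h s))"
    by (intro set_integrable_bound[OF bmf_set_integrable[OF bmf_const[of B]]])
      (use hB B(1) in \<open>auto simp: set_borel_measurable_def\<close>)
  have "n2 (\<lambda>w. LBINT s:{0..t}. h s w) \<le> T * (LBINT s:{0..t}. n2 (h s))"
    by (rule n2_integral(3)[OF m t hB])
  also have "\<dots> \<le> T * (LBINT s:{0..t}. \<phi> s)"
    using Tpos by (intro mult_left_mono set_integral_mono si bmf_set_integrable \<phi> h(2)) auto
  finally show ?thesis .
qed

end

text \<open>The geometric rate \<open>\<delta>\<close> makes the Euler approximations converge almost surely at each time, so that their pointwise limit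
  is progressive without passing to a modification.\<close>

locale euler_scheme = brownian_T M W T for M :: "'w measure" and W T +
  fixes a c :: "real => real^'n^'n" and v :: "real => real^'n" and K :: real
    and L :: "nat => nat" and ga gc :: "nat => nat => real^'n^'n" and gv :: "nat => nat => real^'n"
    and \<delta> :: "nat => real"
  assumes bacv: "bmf a" "bmf c" "bmf v"
    and Kb: "\<And>s. norm (a s) \<le> K" "\<And>s. norm (c s) \<le> K" "\<And>s. norm (v s) \<le> K"
    and gK: "\<And>j i. norm (ga j i) \<le> K" "\<And>j i. norm (gc j i) \<le> K" "\<And>j i. norm (gv j i) \<le> K"
    and \<delta>: "\<And>k. \<delta> k \<le> (1/4)^k" "\<And>k. 0 \<le> \<delta> k"
    and LT: "\<And>j. T / 2^(L j) \<le> \<delta> j"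
    and conv: "AE s in lborel. s \<in> {0..T} \<longrightarrow> (\<lambda>j. ga j (cell (L j) s)) \<longlonglongrightarrow> a s \<and>
        (\<lambda>j. gc j (cell (L j) s)) \<longlonglongrightarrow> c s \<and> (\<lambda>j. gv j (cell (L j) s)) \<longlonglongrightarrow> v s"
    and err: "\<And>j. (LBINT s:{0..T}. (norm (ga j (cell (L j) s) - a s))^2 + (norm (gc j (cell (L j) s) - c s))^2
        + (norm (gv j (cell (L j) s) - v s))^2) \<le> \<delta> j"
    and diff: "\<And>j k s. s \<in> {0..T} ==> n2 (\<lambda>w. Eu (L j) (ga j) (gc j) (gv j) (cell (L j) s) w
        - Eu (L k) (ga k) (gc k) (gv k) (cell (L k) s) w) \<le> \<delta> j + \<delta> k"
begin

definition X :: "nat => real => 'w => real^'n" where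
  "X j s = Eu (L j) (ga j) (gc j) (gv j) (cell (L j) s)"

definition Z :: "real => 'w => real^'n" where "Z s w = lim (\<lambda>j. X j s w)"

lemma X_L2: "L2 (X j s)" by (simp add: X_def Eu_adapted)

lemma X_bound: "s \<in> {0..T} ==> n2 (X j s) \<le> BK K"
  unfolding X_def by (rule Eu_bound[OF gK(1,2,3)[of j]])

lemma Z_lim:
  assumes "s \<in> {0..T}"
  shows "AE w in M. (\<lambda>j. X j s w) \<longlonglongrightarrow> Z s w" "L2 (Z s)" "n2 (\<lambda>w. X j s w - Z s w) \<le> \<delta> j"
  using L2_limit[of "\<lambda>j. X j s" \<delta>, OF X_L2 _ \<delta>] diff[OF assms]
  unfolding Z_def[abs_def] X_def by blast+

definition BZ :: real where "BZ = 2 * BK K + 2"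

lemma BZ_nonneg: "0 \<le> BZ" using X_bound[of 0 0] Tpos n2_nonneg[of "X 0 0"] unfolding BZ_def by (smt (verit) atLeastAtMost_iff)

lemma Z_bound: assumes s: "s \<in> {0..T}" shows "n2 (Z s) \<le> BZ"
proof -
  have "n2 (\<lambda>w. X 0 s w + - (X 0 s w - Z s w)) \<le> 2 * n2 (X 0 s) + 2 * n2 (\<lambda>w. - (X 0 s w - Z s w))"
    by (intro L2_add L2_uminus L2_diff X_L2 Z_lim s)
  also have "\<dots> \<le> 2 * BK K + 2 * 1"
    unfolding n2_uminus using X_bound[OF s, of 0] Z_lim(3)[OF s, of 0] \<delta>(1)[of 0] by simp
  finally show ?thesis by (simp add: BZ_def)
qed

lemma X_joint: "(\<lambda>(s, w). X j s w) \<in> borel_measurable LM"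
  unfolding X_def by (rule cell_joint_measurable) (simp add: L2_measurable Eu_adapted)

lemma Z_joint: "(\<lambda>(s, w). Z s w) \<in> borel_measurable LM"
  unfolding Z_def split_def by (rule borel_measurable_lim_metric) (use X_joint in \<open>simp add: split_def\<close>)

lemma Z_progressive: "progressive M (aug_filtration M W) T Z"
  unfolding progressive_def
proof
  fix t assume t: "t \<in> {0..T}"
  let ?N = "restrict_space lborel {0..t} \<Otimes>\<^sub>M FS t"
  have "(\<lambda>z. X j (fst z) (snd z)) \<in> borel_measurable ?N" for j
  proof -
    \<comment> \<open>Zero in place of values at grid points beyond \<open>t\<close> secures
      measurability for \<open>FS t\<close>. Up to time \<open>t\<close> the left end of the cell
      does not exceed \<open>t\<close>, so nothing changes there.\<close>
    let ?x = "\<lambda>i w. if gr (L j) i \<le> t then Eu (L j) (ga j) (gc j) (gv j) i w else 0"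
    have x: "(\<lambda>z. ?x i (snd z)) \<in> borel_measurable ?N" for i
    proof (cases "gr (L j) i \<le> t")
      case True
      then have "Eu (L j) (ga j) (gc j) (gv j) i \<in> borel_measurable (FS t)"
        using FS_measurable_mono Eu_adapted by blast
      from measurable_compose[OF measurable_snd this] True show ?thesis by simp
    qed simp
    have c: "(\<lambda>z. cell (L j) (fst z)) \<in> measurable ?N (count_space UNIV)"
      by (rule measurable_compose[OF measurable_fst], rule measurable_restrict_space1) (simp add: cell_measurable)
    have "(\<lambda>z. ?x (cell (L j) (fst z)) (snd z)) \<in> borel_measurable ?N"
      by (rule measurable_compose_countable[OF x c])
    moreover have "?x (cell (L j) (fst z)) (snd z) = X j (fst z) (snd z)" if "z \<in> space ?N" for z
    proof -
      have z: "fst z \<in> {0..t}" using that by (auto simp: space_pair_measure space_restrict_space)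
      have "gr (L j) (cell (L j) (fst z)) \<le> t"
      proof (cases "fst z = 0")
        case False
        then have "fst z \<in> {0<..T}" using z t by auto
        from cell_bounds(1)[OF this, of "L j"] z show ?thesis by simp
      qed (use t in simp)
      then show ?thesis by (simp add: X_def)
    qed
    ultimately show ?thesis by (simp cong: measurable_cong)
  qed
  then show "(\<lambda>(s, w). Z s w) \<in> borel_measurable ?N"
    unfolding Z_def split_def by (rule borel_measurable_lim_metric)
qed

definition Dr :: "real => 'w => real^'n" where "Dr t w = (LBINT s:{0..t}. a s *v Z s w)"
text \<open>Defined as the remainder of the equation, so that the state equation is an identity for
  every outcome; the content lies in \<open>Z_ito\<close>, that this remainder is the Ito
  integral.\<close>

definition It :: "real => 'w => real^'n" where "It t w = Z t w - Dr t w"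

definition ea :: "nat => real => real" where "ea j s = (norm (ga j (cell (L j) s) - a s))^2"
definition ec :: "nat => real => real" where "ec j s = (norm (gc j (cell (L j) s) - c s))^2"
definition ev :: "nat => real => real" where "ev j s = (norm (gv j (cell (L j) s) - v s))^2"

lemma e_bmf: "bmf (ea j)" "bmf (ec j)" "bmf (ev j)"
  unfolding ea_def[abs_def] ec_def[abs_def] ev_def[abs_def]
  by (intro bmf_power2 bmf_norm bmf_diff bmf_cell bacv)+

lemma e_nonneg: "0 \<le> ea j s" "0 \<le> ec j s" "0 \<le> ev j s"
  by (simp_all add: ea_def ec_def ev_def)

lemma e_int:
  assumes "f \<in> {ea j, ec j, ev j}" "t \<in> {0..T}"
  shows "(LBINT s:{0..t}. f s) \<le> \<delta> j"
proof -
  have f: "bmf f" "\<And>s. 0 \<le> f s" "\<And>s. f s \<le> ea j s + ec j s + ev j s"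
    using assms e_bmf[of j] e_nonneg by (auto simp: add_nonneg_nonneg)
  have "(LBINT s:{0..t}. f s) \<le> (LBINT s:{0..T}. f s)"
    by (rule bmf_integral_mono_set[OF f(1,2)]) (use assms in auto)
  also have "\<dots> \<le> (LBINT s:{0..T}. ea j s + ec j s + ev j s)"
    by (intro bmf_integral_mono bmf_add f(1) f(3) e_bmf)
  also have "\<dots> \<le> \<delta> j" using err[of j] by (simp add: ea_def ec_def ev_def)
  finally show ?thesis .
qed

lemma aZ_joint: "(\<lambda>(s, w). a s *v Z s w) \<in> borel_measurable LM"
proof -
  have "(\<lambda>z. a (fst z)) \<in> borel_measurable LM"
    by (rule measurable_compose[OF measurable_fst]) (use bacv in \<open>simp add: bmf_measurable\<close>)
  from bilinear_measurable[OF bilinear_matrix_vector this Z_joint] show ?thesis by (simp add: split_def)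
qed

lemma aZ_bound: "s \<in> {0..T} ==> L2 (\<lambda>w. a s *v Z s w) \<and> n2 (\<lambda>w. a s *v Z s w) \<le> K^2 * BZ"
  using L2_bounded[OF L2_measurable[OF L2_mv[OF Z_lim(2)]] Z_lim(2) norm_mv_le[OF Kb(1)], of s s] Z_bound[of s]
  by (meson L2_mv Z_lim(2) mult_left_mono order_trans zero_le_power2)

lemma aZ_integrable: "AE w in M. set_integrable lborel {0..T} (\<lambda>s. a s *v Z s w)"
  using n2_integral(1)[OF aZ_joint, of T "K^2 * BZ"] aZ_bound Tpos by auto

lemma Dr_L2: "t \<in> {0..T} ==> L2 (Dr t)"
  using n2_integral(2)[OF aZ_joint, of t "K^2 * BZ"] aZ_bound unfolding Dr_def[abs_def] by auto

lemma It_L2: "t \<in> {0..T} ==> L2 (It t)"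
  unfolding It_def[abs_def] by (intro L2_diff Z_lim Dr_L2)

lemma Z_eq: "Z t w = (LBINT s:{0..t}. a s *v Z s w) + It t w"
  by (simp add: It_def Dr_def)

lemma drift_conv:
  assumes t: "t \<in> {0..T}"
  shows "n2 (\<lambda>w. DI (L j) (dE (L j) (ga j) (gc j) (gv j)) t w - Dr t w) \<le> T * (2 * K^2 * T + 2 * BZ) * \<delta> j"
proof -
  define h where "h s w = ga j (cell (L j) s) *v X j s w - a s *v Z s w" for s w
  have ad: "adapted (L j) (dE (L j) (ga j) (gc j) (gv j))" by (rule dE_adapted)
  have g: "(\<lambda>(s, w). ga j (cell (L j) s) *v X j s w) \<in> borel_measurable LM"
    using cell_joint_measurable[of "dE (L j) (ga j) (gc j) (gv j)" "L j"]
    by (simp add: dE_def[abs_def] X_def L2_measurable L2_mv Eu_adapted)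
  have hm: "(\<lambda>(s, w). h s w) \<in> borel_measurable LM"
    using borel_measurable_diff[OF g aZ_joint] by (simp add: h_def split_def)
  have hL: "L2 (h s)" "n2 (h s) \<le> 2 * K^2 * \<delta> j + 2 * BZ * ea j s" if s: "s \<in> {0..T}" for s
  proof -
    note Zs = Z_lim(2)[OF s]
    \<comment> \<open>The error of the state meets the bounded approximate coefficient, the error of
      the coefficient meets \<open>Z\<close>, whose second moment is bounded.\<close>
    have eq: "h s = (\<lambda>w. ga j (cell (L j) s) *v (X j s w - Z s w) + (ga j (cell (L j) s) - a s) *v Z s w)"
      by (simp add: h_def[abs_def] matrix_vector_mult_diff_distrib matrix_vector_mult_diff_rdistrib)
    show "L2 (h s)" unfolding eq by (intro L2_add L2_mv L2_diff X_L2 Zs)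
    have "n2 (h s) \<le> 2 * n2 (\<lambda>w. ga j (cell (L j) s) *v (X j s w - Z s w)) + 2 * n2 (\<lambda>w. (ga j (cell (L j) s) - a s) *v Z s w)"
      unfolding eq by (intro L2_add L2_mv L2_diff X_L2 Zs)
    moreover have "n2 (\<lambda>w. ga j (cell (L j) s) *v (X j s w - Z s w)) \<le> K^2 * n2 (\<lambda>w. X j s w - Z s w)"
      by (rule L2_bounded(2)[OF L2_measurable[OF L2_mv[OF L2_diff[OF X_L2 Zs]]] L2_diff[OF X_L2 Zs] norm_mv_le[OF gK(1)]])
    moreover have "K^2 * n2 (\<lambda>w. X j s w - Z s w) \<le> K^2 * \<delta> j" by (intro mult_left_mono Z_lim s) simp
    moreover have "n2 (\<lambda>w. (ga j (cell (L j) s) - a s) *v Z s w) \<le> ea j s * n2 (Z s)"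
      unfolding ea_def by (rule L2_bounded(2)[OF L2_measurable[OF L2_mv[OF Zs]] Zs norm_mv])
    moreover have "ea j s * n2 (Z s) \<le> ea j s * BZ" by (intro mult_left_mono Z_bound s e_nonneg)
    ultimately show "n2 (h s) \<le> 2 * K^2 * \<delta> j + 2 * BZ * ea j s" by (simp add: algebra_simps)
  qed
  have DI: "DI (L j) (dE (L j) (ga j) (gc j) (gv j)) t w = (LBINT s:{0..t}. ga j (cell (L j) s) *v X j s w)" for w
    unfolding DI_def using step_integral[OF t, of "\<lambda>i. dE (L j) (ga j) (gc j) (gv j) i w" "L j"]
    by (simp add: dE_def X_def)
  have "n2 (\<lambda>w. DI (L j) (dE (L j) (ga j) (gc j) (gv j)) t w - Dr t w) = n2 (\<lambda>w. LBINT s:{0..t}. h s w)"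
  proof (rule n2_cong_AE)
    show "(\<lambda>w. DI (L j) (dE (L j) (ga j) (gc j) (gv j)) t w - Dr t w) \<in> borel_measurable M"
      by (intro L2_measurable L2_diff DI_props(1)[OF ad t] Dr_L2 t)
    have "\<forall>s\<in>{0..t}. L2 (h s) \<and> n2 (h s) \<le> 2 * K^2 * \<delta> j + 2 * BZ * (2 * K)^2"
    proof
      fix s assume "s \<in> {0..t}"
      then have s: "s \<in> {0..T}" using t by auto
      have "norm (ga j (cell (L j) s) - a s) \<le> 2 * K"
        using norm_triangle_ineq4[of "ga j (cell (L j) s)" "a s"] gK(1)[of j "cell (L j) s"] Kb(1)[of s] by linarith
      then have "ea j s \<le> (2 * K)^2" unfolding ea_def by (rule power_mono) simp
      then have "2 * BZ * ea j s \<le> 2 * BZ * (2 * K)^2" using BZ_nonneg by (intro mult_left_mono) auto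
      with hL[OF s] show "L2 (h s) \<and> n2 (h s) \<le> 2 * K^2 * \<delta> j + 2 * BZ * (2 * K)^2" by auto
    qed
    from n2_integral(2)[OF hm t this] show "(\<lambda>w. LBINT s:{0..t}. h s w) \<in> borel_measurable M" by (rule L2_measurable)
    show "AE w in M. DI (L j) (dE (L j) (ga j) (gc j) (gv j)) t w - Dr t w = (LBINT s:{0..t}. h s w)"
      using aZ_integrable
    proof eventually_elim
      case (elim w)
      have 1: "set_integrable lborel {0..t} (\<lambda>s. a s *v Z s w)"
        by (rule set_integrable_subset[OF elim]) (use t in auto)
      have 2: "set_integrable lborel {0..t} (\<lambda>s. ga j (cell (L j) s) *v X j s w)"
        unfolding X_def by (rule bmf_set_integrable[OF bmf_cell[of "\<lambda>i. ga j i *v Eu (L j) (ga j) (gc j) (gv j) i w"]])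
      show ?case unfolding DI Dr_def h_def by (rule set_integral_diff(2)[OF 2 1, symmetric])
    qed
  qed
  also have "\<dots> \<le> T * (LBINT s:{0..t}. 2 * K^2 * \<delta> j + 2 * BZ * ea j s)"
    by (rule n2_integral_le[OF hm t]) (use hL t in \<open>auto intro!: bmf_add bmf_mult bmf_const e_bmf\<close>)
  also have "\<dots> \<le> T * (2 * K^2 * T * \<delta> j + 2 * BZ * \<delta> j)"
  proof (rule mult_left_mono)
    have "(LBINT s:{0..t}. 2 * K^2 * \<delta> j + 2 * BZ * ea j s) = 2 * K^2 * \<delta> j * t + 2 * BZ * (LBINT s:{0..t}. ea j s)"
      using t by (subst bmf_integral_add) (auto intro!: bmf_mult bmf_const e_bmf simp: bmf_integral_const)
    also have "\<dots> \<le> 2 * K^2 * \<delta> j * T + 2 * BZ * \<delta> j"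
      using t \<delta>(2)[of j] BZ_nonneg e_int[of "ea j" j t] by (intro add_mono mult_left_mono) auto
    finally show "(LBINT s:{0..t}. 2 * K^2 * \<delta> j + 2 * BZ * ea j s) \<le> 2 * K^2 * T * \<delta> j + 2 * BZ * \<delta> j"
      by (simp add: algebra_simps)
  qed (use Tpos in simp)
  finally show ?thesis by (simp add: algebra_simps)
qed

lemma \<delta>_lim: "\<delta> \<longlonglongrightarrow> 0"
  by (rule tendsto_sandwich[OF _ _ tendsto_const LIMSEQ_realpow_zero[of "1/4"]]) (use \<delta> in auto)

text \<open>The step integrals of the Euler diffusion are the interpolated scheme minus its drift
  part; both converge in mean square, to \<open>Z\<close> and to \<open>Dr\<close>.\<close>

lemma Z_ito: "ito_integral M (aug_filtration M W) W T (\<lambda>s w. c s *v Z s w + v s) It"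
proof (rule ito_closure[where \<xi> = "\<lambda>j. sE (L j) (ga j) (gc j) (gv j)" and L = L
      and \<phi> = "\<lambda>j s. 2 * K^2 * \<delta> j + 4 * BZ * ec j s + 4 * ev j s"])
  have "(\<lambda>z. c (fst z)) \<in> borel_measurable LM" "(\<lambda>z. v (fst z)) \<in> borel_measurable LM"
    by (rule measurable_compose[OF measurable_fst], use bacv in \<open>simp add: bmf_measurable\<close>)+
  from borel_measurable_add[OF bilinear_measurable[OF bilinear_matrix_vector this(1) Z_joint] this(2)]
  show "(\<lambda>(s, w). c s *v Z s w + v s) \<in> borel_measurable LM" by (simp add: split_def)
  show "\<forall>s\<in>{0..T}. L2 (\<lambda>w. c s *v Z s w + v s)" by (auto intro!: L2_add L2_mv L2_const Z_lim)
  show "adapted (L j) (sE (L j) (ga j) (gc j) (gv j))" for j by (rule sE_adapted)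
  show "sE (L j) (ga j) (gc j) (gv j) i \<in> borel_measurable M" for j i
    unfolding sE_def[abs_def] by (intro L2_measurable L2_add L2_mv L2_const) (simp add: Eu_adapted)
  show "bmf (\<lambda>s. 2 * K^2 * \<delta> j + 4 * BZ * ec j s + 4 * ev j s)" for j by (intro bmf_add bmf_mult bmf_const e_bmf)
  show "n2 (\<lambda>w. sE (L j) (ga j) (gc j) (gv j) (cell (L j) s) w - (c s *v Z s w + v s)) \<le> 2 * K^2 * \<delta> j + 4 * BZ * ec j s + 4 * ev j s"
    if s: "s \<in> {0..T}" for j s
  proof -
    note Zs = Z_lim(2)[OF s]
    let ?g = "gc j (cell (L j) s)" and ?u = "gv j (cell (L j) s) - v s"
    have eq: "(\<lambda>w. sE (L j) (ga j) (gc j) (gv j) (cell (L j) s) w - (c s *v Z s w + v s)) =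
      (\<lambda>w. ?g *v (X j s w - Z s w) + ((?g - c s) *v Z s w + ?u))"
      by (simp add: sE_def X_def matrix_vector_mult_diff_distrib matrix_vector_mult_diff_rdistrib fun_eq_iff)
    have "n2 (\<lambda>w. ?g *v (X j s w - Z s w) + ((?g - c s) *v Z s w + ?u)) \<le>
        2 * n2 (\<lambda>w. ?g *v (X j s w - Z s w)) + 2 * n2 (\<lambda>w. (?g - c s) *v Z s w + ?u)"
      by (intro L2_add L2_mv L2_diff L2_const X_L2 Zs)
    moreover have "n2 (\<lambda>w. (?g - c s) *v Z s w + ?u) \<le> 2 * n2 (\<lambda>w. (?g - c s) *v Z s w) + 2 * n2 (\<lambda>w. ?u)"
      by (intro L2_add L2_mv L2_const Zs)
    moreover have "n2 (\<lambda>w. ?g *v (X j s w - Z s w)) \<le> K^2 * n2 (\<lambda>w. X j s w - Z s w)"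
      by (rule L2_bounded(2)[OF L2_measurable[OF L2_mv[OF L2_diff[OF X_L2 Zs]]] L2_diff[OF X_L2 Zs] norm_mv_le[OF gK(2)]])
    moreover have "K^2 * n2 (\<lambda>w. X j s w - Z s w) \<le> K^2 * \<delta> j" by (intro mult_left_mono Z_lim s) simp
    moreover have "n2 (\<lambda>w. (?g - c s) *v Z s w) \<le> ec j s * n2 (Z s)"
      unfolding ec_def by (rule L2_bounded(2)[OF L2_measurable[OF L2_mv[OF Zs]] Zs norm_mv])
    moreover have "ec j s * n2 (Z s) \<le> ec j s * BZ" by (intro mult_left_mono Z_bound s e_nonneg)
    moreover have "n2 (\<lambda>w. ?u) = ev j s" by (simp add: n2_const ev_def)
    ultimately show ?thesis unfolding eq by (simp add: algebra_simps)
  qed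
  show "(\<lambda>j. LBINT s:{0..T}. 2 * K^2 * \<delta> j + 4 * BZ * ec j s + 4 * ev j s) \<longlonglongrightarrow> 0"
  proof (rule tendsto_sandwich[OF _ _ tendsto_const])
    show "\<forall>\<^sub>F j in sequentially. 0 \<le> (LBINT s:{0..T}. 2 * K^2 * \<delta> j + 4 * BZ * ec j s + 4 * ev j s)"
      using \<delta>(2) BZ_nonneg e_nonneg by (intro always_eventually allI bmf_integral_nonneg)
        (auto intro!: bmf_add bmf_mult bmf_const e_bmf add_nonneg_nonneg)
    have "(LBINT s:{0..T}. 2 * K^2 * \<delta> j + 4 * BZ * ec j s + 4 * ev j s) \<le> (2 * K^2 * T + 4 * BZ + 4) * \<delta> j" for j
    proof -
      have "(LBINT s:{0..T}. 2 * K^2 * \<delta> j + 4 * BZ * ec j s + 4 * ev j s) =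
         2 * K^2 * \<delta> j * T + 4 * BZ * (LBINT s:{0..T}. ec j s) + 4 * (LBINT s:{0..T}. ev j s)"
        using Tpos by (simp add: bmf_integral_add bmf_mult bmf_const e_bmf bmf_add bmf_integral_const)
      also have "\<dots> \<le> 2 * K^2 * \<delta> j * T + 4 * BZ * \<delta> j + 4 * \<delta> j"
      proof -
        have "4 * BZ * (LBINT s:{0..T}. ec j s) \<le> 4 * BZ * \<delta> j"
          using BZ_nonneg e_int[of "ec j" j T] Tpos by (intro mult_left_mono) auto
        moreover have "(LBINT s:{0..T}. ev j s) \<le> \<delta> j" using e_int[of "ev j" j T] Tpos by auto
        ultimately show ?thesis by linarith
      qed
      finally show ?thesis by (simp add: algebra_simps)
    qed
    then show "\<forall>\<^sub>F j in sequentially. (LBINT s:{0..T}. 2 * K^2 * \<delta> j + 4 * BZ * ec j s + 4 * ev j s) \<le> (2 * K^2 * T + 4 * BZ + 4) * \<delta> j"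
      by simp
    show "(\<lambda>j. (2 * K^2 * T + 4 * BZ + 4) * \<delta> j) \<longlonglongrightarrow> 0"
      using tendsto_mult[OF tendsto_const \<delta>_lim, of "2 * K^2 * T + 4 * BZ + 4"] by simp
  qed
  show "L2 (It t)" if "t \<in> {0..T}" for t by (rule It_L2[OF that])
  show "(\<lambda>j. n2 (\<lambda>w. SI (L j) (sE (L j) (ga j) (gc j) (gv j)) t w - It t w)) \<longlonglongrightarrow> 0" if t: "t \<in> {0..T}" for t
  proof (rule tendsto_sandwich[OF _ _ tendsto_const])
    let ?C = "2 * EK K + 4 + 4 * (T * (2 * K^2 * T + 2 * BZ))"
    have "n2 (\<lambda>w. SI (L j) (sE (L j) (ga j) (gc j) (gv j)) t w - It t w) \<le> ?C * \<delta> j" for j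
    proof -
      let ?I = "In (L j) (ga j) (gc j) (gv j) t" and ?D = "DI (L j) (dE (L j) (ga j) (gc j) (gv j)) t"
      have Ls: "L2 ?I" "L2 ?D" "L2 (Z t)" "L2 (Dr t)" "L2 (X j t)"
        using In_L2[OF t] DI_props(1)[OF dE_adapted t] Z_lim(2)[OF t] Dr_L2[OF t] X_L2 by auto
      have i: "n2 (\<lambda>w. ?I w - X j t w) \<le> EK K * \<delta> j"
      proof (cases "t = 0")
        case True
        have "?I = X j t" using In_gr[of 0 "L j"] True by (simp add: X_def)
        then show ?thesis using EK_nonneg[of "ga j" K "gc j" "gv j"] gK \<delta>(2)[of j] by (simp add: n2_const)
      next
        case False
        then have "n2 (\<lambda>w. ?I w - X j t w) \<le> T / 2^(L j) * EK K"
          unfolding X_def using t by (intro In_cell gK) auto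
        also have "\<dots> \<le> \<delta> j * EK K"
          using LT[of j] EK_nonneg[of "ga j" K "gc j" "gv j"] gK by (intro mult_right_mono) auto
        finally show ?thesis by (simp add: mult.commute)
      qed
      have eq: "(\<lambda>w. SI (L j) (sE (L j) (ga j) (gc j) (gv j)) t w - It t w) =
         (\<lambda>w. (?I w - X j t w) + ((X j t w - Z t w) + - (?D w - Dr t w)))"
        by (simp add: In_def It_def fun_eq_iff)
      have "n2 (\<lambda>w. (?I w - X j t w) + ((X j t w - Z t w) + - (?D w - Dr t w))) \<le>
          2 * n2 (\<lambda>w. ?I w - X j t w) + 2 * n2 (\<lambda>w. (X j t w - Z t w) + - (?D w - Dr t w))"
        by (intro L2_add L2_diff L2_uminus Ls)
      moreover have "n2 (\<lambda>w. (X j t w - Z t w) + - (?D w - Dr t w)) \<le>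
          2 * n2 (\<lambda>w. X j t w - Z t w) + 2 * n2 (\<lambda>w. - (?D w - Dr t w))"
        by (intro L2_add L2_diff L2_uminus Ls)
      ultimately have "n2 (\<lambda>w. SI (L j) (sE (L j) (ga j) (gc j) (gv j)) t w - It t w) \<le>
         2 * (EK K * \<delta> j) + (4 * \<delta> j + 4 * (T * (2 * K^2 * T + 2 * BZ) * \<delta> j))"
      proof -
        have lin: "p \<le> 2 * q + 2 * r ==> r \<le> 2 * x + 2 * y ==> q \<le> e ==> x \<le> f ==> y \<le> g ==>
            p \<le> 2 * e + (4 * f + 4 * g)" for p q r x y e f g :: real by linarith
        assume *: "n2 (\<lambda>w. (?I w - X j t w) + ((X j t w - Z t w) + - (?D w - Dr t w))) \<le>
            2 * n2 (\<lambda>w. ?I w - X j t w) + 2 * n2 (\<lambda>w. (X j t w - Z t w) + - (?D w - Dr t w))"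
          "n2 (\<lambda>w. (X j t w - Z t w) + - (?D w - Dr t w)) \<le>
            2 * n2 (\<lambda>w. X j t w - Z t w) + 2 * n2 (\<lambda>w. - (?D w - Dr t w))"
        show ?thesis unfolding eq
          by (rule lin[OF * i Z_lim(3)[OF t]]) (unfold n2_uminus, rule drift_conv[OF t])
      qed
      then show ?thesis by (simp add: algebra_simps)
    qed
    then show "\<forall>\<^sub>F j in sequentially. n2 (\<lambda>w. SI (L j) (sE (L j) (ga j) (gc j) (gv j)) t w - It t w) \<le> ?C * \<delta> j"
      by simp
    show "(\<lambda>j. ?C * \<delta> j) \<longlonglongrightarrow> 0" using tendsto_mult[OF tendsto_const \<delta>_lim, of ?C] by simp
  qed simp
qed

end

section \<open>Second moments\<close>

definition outer :: "real^'n => real^'n => real^'n^'n" where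
  "outer x y = (\<chi> i j. x $ i * y $ j)"

lemma bilinear_outer: "bounded_bilinear (outer :: real^'n => real^'n => _)"
  by (simp add: bilinear_conv_bounded_bilinear[symmetric] bilinear_def linear_iff outer_def
      vec_eq_iff algebra_simps)

lemma outer_mv_left: "outer (A *v x) y = A ** outer x y"
  by (simp add: outer_def vec_eq_iff matrix_vector_mult_def matrix_matrix_mult_def sum_distrib_right mult.assoc)

lemma outer_mv_right: "outer x (A *v y) = outer x y ** tr A"
  by (simp add: outer_def vec_eq_iff matrix_vector_mult_def matrix_matrix_mult_def transpose_def
      sum_distrib_left algebra_simps)

lemma norm_outer: "norm (outer x y) = norm x * norm y"
proof -
  have "norm (outer x y $ i) = \<bar>x $ i\<bar> * norm y" for i
  proof -
    have "outer x y $ i = (x $ i) *\<^sub>R y" by (simp add: outer_def vec_eq_iff)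
    then show ?thesis by simp
  qed
  then show ?thesis by (simp add: norm_vec_def[of "outer x y"] norm_vec_def[of x] L2_set_left_distrib)
qed

lemma inner_outer: "M \<bullet> outer x y = x \<bullet> (M *v y)"
  by (simp add: inner_vec_def outer_def matrix_vector_mult_def sum_distrib_left algebra_simps)

lemmas mm_simps = bounded_bilinear.add_left[OF bilinear_matrix_mult] bounded_bilinear.add_right[OF bilinear_matrix_mult]
  bounded_bilinear.scaleR_left[OF bilinear_matrix_mult] bounded_bilinear.scaleR_right[OF bilinear_matrix_mult]

lemmas outer_simps = bounded_bilinear.add_left[OF bilinear_outer] bounded_bilinear.add_right[OF bilinear_outer]
  bounded_bilinear.scaleR_left[OF bilinear_outer] bounded_bilinear.scaleR_right[OF bilinear_outer]

context brownian begin

lemma FS_expectation_vec: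
  fixes X :: "'w => 'b::euclidean_space"
  assumes st: "0 \<le> s" "s < t" and X: "X \<in> borel_measurable (FS s)" "integrable M X"
  shows "integrable M (\<lambda>w. (W t w - W s w) *\<^sub>R X w)" "expectation (\<lambda>w. (W t w - W s w) *\<^sub>R X w) = 0"
    "integrable M (\<lambda>w. (W t w - W s w)^2 *\<^sub>R X w)"
    "expectation (\<lambda>w. (W t w - W s w)^2 *\<^sub>R X w) = (t - s) *\<^sub>R expectation X"
proof -
  have nX: "(\<lambda>w. norm (X w)) \<in> borel_measurable (FS s)" "integrable M (\<lambda>w. norm (X w))"
    using X by auto
  have Xm: "X \<in> borel_measurable M" using X(1) by (rule FS_measurable_M)
  note n = FS_expectation[OF st nX]
  show i1: "integrable M (\<lambda>w. (W t w - W s w) *\<^sub>R X w)"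
    by (rule Bochner_Integration.integrable_bound[OF n(1)]) (use Xm in \<open>auto simp: abs_mult mult.commute\<close>)
  show i2: "integrable M (\<lambda>w. (W t w - W s w)^2 *\<^sub>R X w)"
    by (rule Bochner_Integration.integrable_bound[OF n(3)]) (use Xm in \<open>auto simp: abs_mult mult.commute\<close>)
  have c: "(\<lambda>w. X w \<bullet> b) \<in> borel_measurable (FS s)" "integrable M (\<lambda>w. X w \<bullet> b)" for b
    using X by auto
  show "expectation (\<lambda>w. (W t w - W s w) *\<^sub>R X w) = 0"
  proof (rule euclidean_eqI)
    fix b
    have "expectation (\<lambda>w. (W t w - W s w) *\<^sub>R X w) \<bullet> b = expectation (\<lambda>w. ((W t w - W s w) *\<^sub>R X w) \<bullet> b)"
      by (rule integral_inner_left[symmetric], rule i1)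
    then show "expectation (\<lambda>w. (W t w - W s w) *\<^sub>R X w) \<bullet> b = 0 \<bullet> b"
      using FS_expectation(2)[OF st c, of b] by (simp add: mult.commute)
  qed
  show "expectation (\<lambda>w. (W t w - W s w)^2 *\<^sub>R X w) = (t - s) *\<^sub>R expectation X"
  proof (rule euclidean_eqI)
    fix b
    have "expectation (\<lambda>w. (W t w - W s w)^2 *\<^sub>R X w) \<bullet> b = expectation (\<lambda>w. ((W t w - W s w)^2 *\<^sub>R X w) \<bullet> b)"
      by (rule integral_inner_left[symmetric], rule i2)
    moreover have "expectation (\<lambda>w. X w \<bullet> b) = expectation X \<bullet> b"
      by (rule integral_inner_left, rule X(2))
    ultimately show "expectation (\<lambda>w. (W t w - W s w)^2 *\<^sub>R X w) \<bullet> b = ((t - s) *\<^sub>R expectation X) \<bullet> b"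
      using FS_expectation(4)[OF st c, of b] by (simp add: mult.commute)
  qed
qed

lemma L2_outer:
  fixes f g :: "'w => real^'n"
  assumes f: "L2 f" and g: "L2 g"
  shows "integrable M (\<lambda>w. outer (f w) (g w))"
proof (rule Bochner_Integration.integrable_bound)
  show "integrable M (\<lambda>w. (norm (f w))^2 + (norm (g w))^2)" using f g by (auto simp: L2_def)
  show "(\<lambda>w. outer (f w) (g w)) \<in> borel_measurable M"
    by (rule bilinear_measurable[OF bilinear_outer]) (use f g in \<open>auto simp: L2_def\<close>)
  have "x * y \<le> x^2 + y^2" if "0 \<le> x" "0 \<le> y" for x y :: real
    using sum_squares_bound[of x y] mult_nonneg_nonneg[OF that] by linarith
  then show "AE w in M. norm (outer (f w) (g w)) \<le> norm ((norm (f w))^2 + (norm (g w))^2)"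
    by (simp add: norm_outer)
qed

text \<open>Young's inequality with a free weight, to be tuned when one factor is small and the
  other merely bounded.\<close>

lemma expectation_outer_bound:
  fixes f g :: "'w => real^'n"
  assumes f: "L2 f" and g: "L2 g" and e: "0 < e"
  shows "norm (expectation (\<lambda>w. outer (f w) (g w))) \<le> e * n2 f + n2 g / e"
proof -
  have "norm (expectation (\<lambda>w. outer (f w) (g w))) \<le> expectation (\<lambda>w. norm (outer (f w) (g w)))"
    by (rule integral_norm_bound)
  also have "\<dots> \<le> expectation (\<lambda>w. e * (norm (f w))^2 + (norm (g w))^2 / e)"
  proof (rule integral_mono)
    show "integrable M (\<lambda>w. norm (outer (f w) (g w)))" by (intro integrable_norm L2_outer f g)
    show "integrable M (\<lambda>w. e * (norm (f w))^2 + (norm (g w))^2 / e)" using f g by (simp add: L2_def)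
    fix w
    have "0 \<le> (e * norm (f w) - norm (g w))^2" by simp
    then have "2 * e * (norm (f w) * norm (g w)) \<le> e^2 * (norm (f w))^2 + (norm (g w))^2"
      by (simp add: power2_diff power_mult_distrib)
    moreover have "0 \<le> e * (norm (f w) * norm (g w))" using e by simp
    ultimately have "e * (norm (f w) * norm (g w)) \<le> e^2 * (norm (f w))^2 + (norm (g w))^2" by linarith
    then show "norm (outer (f w) (g w)) \<le> e * (norm (f w))^2 + (norm (g w))^2 / e"
      using e by (simp add: norm_outer field_simps power2_eq_square)
  qed
  also have "\<dots> = e * n2 f + n2 g / e" using f g by (simp add: n2_def L2_def)
  finally show ?thesis .
qed

end

context brownian_T begin

context
  fixes n :: nat and a c :: "nat => real^'n^'n" and v :: "nat => real^'n"
begin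

lemma Eu_expectation: "expectation (Eu n a c v i) = 0"
proof (induction i)
  case (Suc i)
  let ?x = "Eu n a c v i"
  have x: "L2 ?x" "?x \<in> borel_measurable (FS (gr n i))" by (simp_all add: Eu_adapted)
  have s: "(\<lambda>w. c i *v ?x w + v i) \<in> borel_measurable (FS (gr n i))" "integrable M (\<lambda>w. c i *v ?x w + v i)"
    using x by (auto intro!: borel_measurable_add mv_measurable L2_integrable L2_add L2_mv L2_const)
  note F = FS_expectation_vec[OF gr_nonneg gr_strict[of i "Suc i"] s]
  have "expectation (\<lambda>w. a i *v ?x w) = a i *v expectation ?x"
    by (rule integral_bounded_linear[OF matrix_vector_mul_bounded_linear L2_integrable[OF x(1)]])
  then show ?case
    using F Suc L2_integrable[OF x(1)] L2_integrable[OF L2_mv[OF x(1), of "a i"]] by simp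
qed simp

definition EV :: "nat => real^'n^'n" where "EV i = expectation (\<lambda>w. outer (Eu n a c v i w) (Eu n a c v i w))"

text \<open>Lyapunov right-hand side for the second moment of the scheme; the last term, of the
  order of the mesh, stems from the square of the drift increment.\<close>

definition EG :: "nat => real^'n^'n" where
  "EG i = a i ** EV i + EV i ** tr (a i) + c i ** EV i ** tr (c i) + outer (v i) (v i)
     + (T / 2^n) *\<^sub>R (a i ** EV i ** tr (a i))"

text \<open>The recursion is exact: the Brownian increment is independent of the past with mean zero
  and variance \<open>T / 2^n\<close>, which removes the terms mixing it with the past, and
  \<open>Eu\<close> has mean zero, which removes the terms linear in \<open>v\<close>.\<close>

lemma EV_Suc: "EV (Suc i) = EV i + (T / 2^n) *\<^sub>R EG i"
proof -
  let ?x = "Eu n a c v i" and ?h = "T / 2^n" and ?w = "\<lambda>w. W (gr n (Suc i)) w - W (gr n i) w"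
  let ?p = "\<lambda>w. ?x w + ?h *\<^sub>R (a i *v ?x w)" and ?s = "\<lambda>w. c i *v ?x w + v i"
  have x: "L2 ?x" "?x \<in> borel_measurable (FS (gr n i))" by (simp_all add: Eu_adapted)
  have h: "gr n (Suc i) - gr n i = ?h" by (simp add: gr_Suc)
  have Lp: "L2 ?p" "L2 ?s" by (intro L2_add L2_scaleR L2_mv L2_const x)+
  have mp: "?p \<in> borel_measurable (FS (gr n i))" "?s \<in> borel_measurable (FS (gr n i))"
    by (intro borel_measurable_add borel_measurable_scaleR borel_measurable_const mv_measurable x)+
  note st = gr_nonneg gr_strict[of i "Suc i" n, simplified]
  have mo: "(\<lambda>w. outer (f w) (g w)) \<in> borel_measurable N"
    if "f \<in> borel_measurable N" "g \<in> borel_measurable N" for f g :: "'w => real^'n" and N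
    by (rule bilinear_measurable[OF bilinear_outer that])
  note ps = FS_expectation_vec[OF st mo[OF mp(1) mp(2)] L2_outer[OF Lp(1) Lp(2)]]
  note sp = FS_expectation_vec[OF st mo[OF mp(2) mp(1)] L2_outer[OF Lp(2) Lp(1)]]
  note ss = FS_expectation_vec[OF st mo[OF mp(2) mp(2)] L2_outer[OF Lp(2) Lp(2)]]
  have eq: "outer (Eu n a c v (Suc i) w) (Eu n a c v (Suc i) w) = outer (?p w) (?p w) + ?w w *\<^sub>R outer (?p w) (?s w)
      + ?w w *\<^sub>R outer (?s w) (?p w) + (?w w)^2 *\<^sub>R outer (?s w) (?s w)" for w
  proof -
    have "outer (p + w *\<^sub>R s) (p + w *\<^sub>R s) = outer p p + w *\<^sub>R outer p s + w *\<^sub>R outer s p + w^2 *\<^sub>R outer s s"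
      for p s :: "real^'n" and w by (simp add: outer_simps power2_eq_square scaleR_add_right)
    from this[of "?p w" "?w w" "?s w"] show ?thesis by (simp add: h)
  qed
  have "EV (Suc i) = expectation (\<lambda>w. outer (?p w) (?p w)) + ?h *\<^sub>R expectation (\<lambda>w. outer (?s w) (?s w))"
    unfolding EV_def eq using ps sp ss L2_outer[OF Lp(1) Lp(1)] by (simp add: h)
  also have "expectation (\<lambda>w. outer (?p w) (?p w)) =
      EV i + ?h *\<^sub>R (a i ** EV i + EV i ** tr (a i)) + (?h * ?h) *\<^sub>R (a i ** EV i ** tr (a i))"
  proof -
    let ?B = "\<lambda>V. V + ?h *\<^sub>R (a i ** V + V ** tr (a i)) + (?h * ?h) *\<^sub>R (a i ** V ** tr (a i))"
    have "outer (?p w) (?p w) = ?B (outer (?x w) (?x w))" for w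
      by (simp add: outer_simps outer_mv_left outer_mv_right matrix_mul_assoc scaleR_add_right mm_simps)
    moreover have "bounded_linear ?B"
      by (intro bounded_linear_intros bounded_linear_compose[OF bounded_bilinear.bounded_linear_left[OF bilinear_matrix_mult]]
        bounded_bilinear.bounded_linear_right[OF bilinear_matrix_mult] bounded_bilinear.bounded_linear_left[OF bilinear_matrix_mult])
    ultimately show ?thesis
      using integral_bounded_linear[of ?B M "\<lambda>w. outer (?x w) (?x w)"] L2_outer[OF x(1) x(1)] by (simp add: EV_def)
  qed
  also have "expectation (\<lambda>w. outer (?s w) (?s w)) = c i ** EV i ** tr (c i) + outer (v i) (v i)"
  proof -
    let ?C = "\<lambda>V. c i ** V ** tr (c i)" and ?D = "\<lambda>y. outer (c i *v y) (v i) + outer (v i) (c i *v y)"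
    have o: "outer (?s w) (?s w) = ?C (outer (?x w) (?x w)) + ?D (?x w) + outer (v i) (v i)" for w
      by (simp add: outer_simps outer_mv_left outer_mv_right matrix_mul_assoc mm_simps)
    have C: "bounded_linear ?C"
      by (intro bounded_linear_compose[OF bounded_bilinear.bounded_linear_left[OF bilinear_matrix_mult]]
        bounded_bilinear.bounded_linear_right[OF bilinear_matrix_mult])
    have D: "bounded_linear ?D"
      by (intro bounded_linear_add bounded_linear_compose[OF bounded_bilinear.bounded_linear_left[OF bilinear_outer]]
        bounded_linear_compose[OF bounded_bilinear.bounded_linear_right[OF bilinear_outer]] matrix_vector_mul_bounded_linear)
    have "expectation (\<lambda>w. ?C (outer (?x w) (?x w))) = ?C (EV i)"
      unfolding EV_def by (rule integral_bounded_linear[OF C L2_outer[OF x(1) x(1)]])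
    moreover have "expectation (\<lambda>w. ?D (?x w)) = ?D 0"
      using integral_bounded_linear[OF D L2_integrable[OF x(1)]] Eu_expectation by simp
    moreover have "?D 0 = 0" by (simp add: bounded_bilinear.zero_left[OF bilinear_outer] bounded_bilinear.zero_right[OF bilinear_outer])
    ultimately show ?thesis
      unfolding o using integrable_bounded_linear[OF C L2_outer[OF x(1) x(1)]] integrable_bounded_linear[OF D L2_integrable[OF x(1)]]
      by (simp add: prob_space)
  qed
  finally show ?thesis by (simp add: EG_def algebra_simps)
qed

lemma EV_0: "EV 0 = 0" by (simp add: EV_def bounded_bilinear.zero_left[OF bilinear_outer])

lemma EV_integral: "i \<le> 2^n ==> EV i = (LBINT s:{0..gr n i}. EG (cell n s))"
proof -
  assume i: "i \<le> 2^n"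
  have "EV i = (\<Sum>j<i. (T / 2^n) *\<^sub>R EG j)" by (induction i) (simp_all add: EV_0 EV_Suc)
  also have "\<dots> = (\<Sum>j<2^n. (min (gr n i) (gr n (Suc j)) - min (gr n i) (gr n j)) *\<^sub>R EG j)"
  proof (rule sum.mono_neutral_cong_left)
    show "\<forall>j\<in>{..<2^n} - {..<i}. (min (gr n i) (gr n (Suc j)) - min (gr n i) (gr n j)) *\<^sub>R EG j = 0"
      using gr_mono[of i _ n] by (auto simp: min_absorb1 le_SucI)
    show "(T / 2^n) *\<^sub>R EG j = (min (gr n i) (gr n (Suc j)) - min (gr n i) (gr n j)) *\<^sub>R EG j" if "j \<in> {..<i}" for j
      using that gr_mono[of "Suc j" i n] gr_mono[of j i n] by (simp add: min_absorb2 gr_Suc)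
  qed (use i in auto)
  also have "\<dots> = (LBINT s:{0..gr n i}. EG (cell n s))"
    by (rule step_integral[symmetric]) (use gr_le_T[OF i] in auto)
  finally show ?thesis .
qed

end
end

context euler_scheme begin

lemma Z_expectation: assumes s: "s \<in> {0..T}" shows "expectation (Z s) = 0"
proof -
  have "(norm (expectation (Z s)))^2 \<le> \<delta> j" for j
  proof -
    have "expectation (\<lambda>w. X j s w - Z s w) = expectation (X j s) - expectation (Z s)"
      by (rule Bochner_Integration.integral_diff) (auto intro: L2_integrable X_L2 Z_lim s)
    also have "expectation (X j s) = 0" unfolding X_def by (rule Eu_expectation)
    finally have "(norm (expectation (Z s)))^2 = (norm (expectation (\<lambda>w. X j s w - Z s w)))^2" by simp
    also have "\<dots> \<le> n2 (\<lambda>w. X j s w - Z s w)" by (intro expectation_sq_le L2_diff X_L2 Z_lim s)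
    also have "\<dots> \<le> \<delta> j" by (rule Z_lim(3)[OF s])
    finally show ?thesis .
  qed
  then have "(norm (expectation (Z s)))^2 \<le> 0" by (intro LIMSEQ_le_const[OF \<delta>_lim]) auto
  then show ?thesis by simp
qed

definition V :: "real => real^'n^'n" where
  "V s = indicator {0..T} s *\<^sub>R expectation (\<lambda>w. outer (Z s w) (Z s w))"

lemma outer_conv:
  assumes s: "s \<in> {0..T}"
  shows "(\<lambda>j. expectation (\<lambda>w. outer (X j s w) (X j s w))) \<longlonglongrightarrow> V s"
proof -
  note Zs = Z_lim(2)[OF s]
  have "norm (expectation (\<lambda>w. outer (X j s w) (X j s w)) - V s) \<le> (1/2)^j * (BK K + BZ + 2)" for j
  proof -
    let ?e = "(1/2::real)^j"
    have d: "n2 (\<lambda>w. X j s w - Z s w) \<le> ?e * ?e"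
      using Z_lim(3)[OF s, of j] \<delta>(1)[of j] by (simp add: power_mult_distrib[symmetric])
    have "norm (expectation (\<lambda>w. outer (X j s w) (X j s w)) - V s) =
       norm (expectation (\<lambda>w. outer (X j s w) (X j s w) - outer (Z s w) (Z s w)))"
      unfolding V_def using s L2_outer[OF X_L2[of j s] X_L2[of j s]] L2_outer[OF Zs Zs] by simp
    also have "\<dots> = norm (expectation (\<lambda>w. outer (X j s w) (X j s w - Z s w) + outer (X j s w - Z s w) (Z s w)))"
      by (simp add: bounded_bilinear.diff_left[OF bilinear_outer] bounded_bilinear.diff_right[OF bilinear_outer])
    also have "\<dots> = norm (expectation (\<lambda>w. outer (X j s w) (X j s w - Z s w)) + expectation (\<lambda>w. outer (X j s w - Z s w) (Z s w)))"
      by (rule arg_cong[of _ _ norm], intro Bochner_Integration.integral_add L2_outer L2_diff X_L2 Zs)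
    \<comment> \<open>The weights \<open>?e\<close> and \<open>1 / ?e\<close> balance a squared
      error of order \<open>?e * ?e\<close> against bounded second moments, so that every term is of
      order \<open>?e\<close>.\<close>
    also have "\<dots> \<le> (?e * n2 (X j s) + n2 (\<lambda>w. X j s w - Z s w) / ?e) + (1 / ?e * n2 (\<lambda>w. X j s w - Z s w) + n2 (Z s) / (1 / ?e))"
    proof (rule norm_triangle_mono)
      show "norm (expectation (\<lambda>w. outer (X j s w) (X j s w - Z s w))) \<le> ?e * n2 (X j s) + n2 (\<lambda>w. X j s w - Z s w) / ?e"
        by (rule expectation_outer_bound[OF X_L2 L2_diff[OF X_L2 Zs]]) simp
      show "norm (expectation (\<lambda>w. outer (X j s w - Z s w) (Z s w))) \<le> 1 / ?e * n2 (\<lambda>w. X j s w - Z s w) + n2 (Z s) / (1 / ?e)"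
        by (rule expectation_outer_bound[OF L2_diff[OF X_L2 Zs] Zs]) simp
    qed
    also have "\<dots> \<le> (?e * BK K + (?e * ?e) / ?e) + (1 / ?e * (?e * ?e) + BZ / (1 / ?e))"
      by (intro add_mono mult_left_mono divide_right_mono d X_bound Z_bound s) auto
    also have "\<dots> = ?e * (BK K + BZ + 2)" by (simp add: algebra_simps)
    finally show ?thesis .
  qed
  moreover have "(\<lambda>j. (1/2)^j * (BK K + BZ + 2)) \<longlonglongrightarrow> 0"
    using tendsto_mult[OF LIMSEQ_realpow_zero[of "1/2"] tendsto_const, of "BK K + BZ + 2"] by simp
  ultimately have "(\<lambda>j. expectation (\<lambda>w. outer (X j s w) (X j s w)) - V s) \<longlonglongrightarrow> 0"
    by (rule Lim_null_comparison[OF always_eventually[OF allI]])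
  then show ?thesis by (simp add: LIM_zero_iff)
qed

lemma outer_bound: "L2 f ==> norm (expectation (\<lambda>w. outer (f w) (f w))) \<le> n2 f"
  using integral_norm_bound[of M "\<lambda>w. outer (f w) (f w)"] by (simp add: norm_outer n2_def power2_eq_square)

lemma V_bmf: "bmf V"
proof (rule bmfI)
  show "norm (V s) \<le> BZ" for s
  proof (cases "s \<in> {0..T}")
    case True
    show ?thesis using order_trans[OF outer_bound[OF Z_lim(2)[OF True]] Z_bound[OF True]] True by (simp add: V_def)
  qed (simp add: V_def BZ_nonneg)
  have zj: "(\<lambda>p. Z (fst p) (snd p)) \<in> borel_measurable LM" using Z_joint by (simp add: split_def)
  have "(\<lambda>p. outer (Z (fst p) (snd p)) (Z (fst p) (snd p))) \<in> borel_measurable LM"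
    by (rule bilinear_measurable[OF bilinear_outer]) (rule zj)+
  then have "(\<lambda>(s, w). outer (Z s w) (Z s w)) \<in> borel_measurable LM" by (simp add: split_def)
  then have "(\<lambda>s. expectation (\<lambda>w. outer (Z s w) (Z s w))) \<in> borel_measurable lborel"
    by (rule borel_measurable_lebesgue_integral)
  then show "V \<in> borel_measurable borel" unfolding V_def[abs_def] by simp
qed

text \<open>Dominated convergence in the exact grid recursion, whose term of mesh order disappears.
  This covariance equation is what Ito's formula would give for \<open>Z\<close>.\<close>

lemma V_prim: "prim_on T V (\<lambda>s. a s ** V s + V s ** tr (a s) + c s ** V s ** tr (c s) + outer (v s) (v s))"
  (is "prim_on T V ?G")
proof -
  have bG: "bmf ?G" by (intro bmf_add bmf_mm bmf_transpose bmf_bilinear[OF bilinear_outer] bacv V_bmf)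
  have V0: "V 0 = 0" using outer_conv[of 0] Tpos by (simp add: X_def bounded_bilinear.zero_left[OF bilinear_outer] LIMSEQ_const_iff)
  define xV where "xV j i = EV (L j) (ga j) (gc j) (gv j) i" for j i
  define xG where "xG j i = EG (L j) (ga j) (gc j) (gv j) i" for j i
  have xV: "xV j (cell (L j) s) = expectation (\<lambda>w. outer (X j s w) (X j s w))" for j s
    by (simp add: xV_def EV_def X_def)
  have K0: "0 \<le> K" using Kb(1)[of 0] norm_ge_zero order_trans by blast
  interpret mm: bounded_bilinear "(**) :: real^'n^'n => real^'n^'n => _" by (rule bilinear_matrix_mult)
  interpret oo: bounded_bilinear "outer :: real^'n => _" by (rule bilinear_outer)
  interpret tr: bounded_linear "tr :: real^'n^'n => _" by (rule linear_transpose)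
  have TL: "(\<lambda>j. T / 2^(L j)) \<longlonglongrightarrow> 0"
    by (rule tendsto_sandwich[OF _ _ tendsto_const \<delta>_lim]) (use LT Tpos in auto)
  have Glim: "AE r in lborel. r \<in> {0..T} \<longrightarrow> (\<lambda>j. xG j (cell (L j) r)) \<longlonglongrightarrow> ?G r"
    using conv
  proof eventually_elim
    case (elim r)
    show ?case
    proof
      assume r: "r \<in> {0..T}"
      with elim have e: "(\<lambda>j. ga j (cell (L j) r)) \<longlonglongrightarrow> a r" "(\<lambda>j. gc j (cell (L j) r)) \<longlonglongrightarrow> c r"
        "(\<lambda>j. gv j (cell (L j) r)) \<longlonglongrightarrow> v r" by auto
      have xv: "(\<lambda>j. xV j (cell (L j) r)) \<longlonglongrightarrow> V r" unfolding xV by (rule outer_conv[OF r])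
      have "(\<lambda>j. xG j (cell (L j) r)) \<longlonglongrightarrow> ?G r + 0 *\<^sub>R (a r ** V r ** tr (a r))"
        unfolding xG_def EG_def xV_def[symmetric]
        by (intro tendsto_add tendsto_scaleR mm.tendsto oo.tendsto tr.tendsto e xv TL)
      then show "(\<lambda>j. xG j (cell (L j) r)) \<longlonglongrightarrow> ?G r" by simp
    qed
  qed
  from mm.nonneg_bounded obtain CM where CM: "CM \<ge> 0" "\<forall>(x :: real^'n^'n) (y :: real^'n^'n). norm (x ** y) \<le> norm x * norm y * CM"
    by (elim exE conjE) (rule that)
  from tr.nonneg_bounded obtain CT where CT: "CT \<ge> 0" "\<forall>x :: real^'n^'n. norm (tr x) \<le> norm x * CT"
    by (elim exE conjE)
  define BV where "BV = BK K"
  have BV: "0 \<le> BV" using order_trans[OF n2_nonneg X_bound[of 0 0]] Tpos by (simp add: BV_def)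
  \<comment> \<open>Dominating constant: the norm bounds for \<open>EG\<close>, summand by summand;
    the factor 1 in the last one bounds the mesh.\<close>
  define BG where "BG = K * BV * CM + BV * (K * CT) * CM + K * BV * CM * (K * CT) * CM + K * K + 1 * (K * BV * CM * (K * CT) * CM)"
  have Gb: "norm (xG j (cell (L j) r)) \<le> BG" if r: "r \<in> {0..T}" for j r
  proof -
    let ?v = "xV j (cell (L j) r)" and ?a = "ga j (cell (L j) r)" and ?c = "gc j (cell (L j) r)" and ?u = "gv j (cell (L j) r)"
    have v: "norm ?v \<le> BV" unfolding xV BV_def using order_trans[OF outer_bound[OF X_L2] X_bound[OF r]] .
    have m: "norm (x ** y) \<le> A * B * CM" if "norm x \<le> A" "norm y \<le> B" for x y :: "real^'n^'n" and A B
    proof -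
      have "norm x * norm y \<le> A * B"
        by (rule mult_mono[OF that]) (use order_trans[OF norm_ge_zero that(1)] in auto)
      then have "norm x * norm y * CM \<le> A * B * CM" by (rule mult_right_mono[OF _ CM(1)])
      then show ?thesis by (rule order_trans[OF CM(2)[rule_format]])
    qed
    have t: "norm (tr x) \<le> A * CT" if "norm x \<le> A" for x :: "real^'n^'n" and A
      by (rule order_trans[OF CT(2)[rule_format]]) (use that CT in \<open>auto intro: mult_right_mono\<close>)
    have o: "norm (outer ?u ?u) \<le> K * K" unfolding norm_outer using gK(3)[of j "cell (L j) r"] K0 by (intro mult_mono) auto
    have h: "norm (T / 2^(L j)) \<le> 1" 
    proof -
      have "(1/4::real)^j \<le> 1" by (rule power_le_one) auto
      then have "T / 2^(L j) \<le> 1" using LT[of j] \<delta>(1)[of j] by linarith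
      then show ?thesis using Tpos by simp
    qed
    have last: "norm ((T / 2^(L j)) *\<^sub>R (?a ** ?v ** tr ?a)) \<le> 1 * (K * BV * CM * (K * CT) * CM)"
      unfolding norm_scaleR using h by (intro mult_mono m[OF m[OF gK(1) v] t[OF gK(1)]]) auto
    show ?thesis unfolding xG_def EG_def xV_def[symmetric] BG_def
      by (rule norm_triangle_mono[OF norm_triangle_mono[OF norm_triangle_mono[OF norm_triangle_mono[OF
          m[OF gK(1) v] m[OF v t[OF gK(1)]]] m[OF m[OF gK(2) v] t[OF gK(2)]]] o] last])
  qed
  have BG0: "0 \<le> BG" using order_trans[OF norm_ge_zero Gb[of 0 0]] Tpos by simp
  show ?thesis unfolding prim_on_def
  proof (intro conjI bG ballI)
    fix s assume s: "s \<in> {0..T}"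
    \<comment> \<open>The recursion is available at grid points only, so the integral runs to the
      grid point \<open>q j\<close> below \<open>s\<close>, which tends to \<open>s\<close>.\<close>
    define q where "q j = gr (L j) (cell (L j) s)" for j
    have q: "0 \<le> q j" "q j \<le> s" "s - T / 2^(L j) \<le> q j" for j
    proof -
      show "0 \<le> q j" by (simp add: q_def)
      show "q j \<le> s" "s - T / 2^(L j) \<le> q j"
        using cell_bounds[of s "L j"] s Tpos gr_Suc[of "L j" "cell (L j) s"] by (cases "s = 0"; auto simp: q_def)+
    qed
    have qlim: "q \<longlonglongrightarrow> s"
    proof (rule tendsto_sandwich[OF _ _ _ tendsto_const])
      show "(\<lambda>j. s - T / 2^(L j)) \<longlonglongrightarrow> s" using tendsto_diff[OF tendsto_const TL, of s] by simp
    qed (use q in auto)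
    have "(\<lambda>j. LBINT r. indicator {0..q j} r *\<^sub>R xG j (cell (L j) r)) \<longlonglongrightarrow> (LBINT r. indicator {0..s} r *\<^sub>R ?G r)"
    proof (rule integral_dominated_convergence)
      show "(\<lambda>r. indicator {0..s} r *\<^sub>R ?G r) \<in> borel_measurable lborel" using bmf_measurable[OF bG] by measurable
      show "(\<lambda>r. indicator {0..q j} r *\<^sub>R xG j (cell (L j) r)) \<in> borel_measurable lborel" for j
        using bmf_measurable[OF bmf_cell[of "xG j" "L j"]] by measurable
      show "integrable lborel (\<lambda>r. indicat_real {0..s} r * BG)" using integrable_indicator_Icc by simp
      show "AE r in lborel. norm (indicator {0..q j} r *\<^sub>R xG j (cell (L j) r)) \<le> indicat_real {0..s} r * BG" for j
        by (rule AE_I2) (use Gb q[of j] s BG0 in \<open>auto simp: indicator_def\<close>)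
      show "AE r in lborel. (\<lambda>j. indicator {0..q j} r *\<^sub>R xG j (cell (L j) r)) \<longlonglongrightarrow> indicator {0..s} r *\<^sub>R ?G r"
        using Glim AE_lborel_singleton[of s]
      proof eventually_elim
        case (elim r)
        consider "r < 0" | "s < r" | "0 \<le> r" "r < s" using elim by linarith
        then show ?case
        proof cases
          case 1 then show ?thesis by simp
        next
          case 2
          then have "r \<notin> {0..q j}" for j using q(2)[of j] by auto
          then show ?thesis using 2 by simp
        next
          case 3
          have "(\<lambda>j. xG j (cell (L j) r)) \<longlonglongrightarrow> ?G r" using elim(1) 3 s by auto
          moreover have "\<forall>\<^sub>F j in sequentially. indicator {0..q j} r *\<^sub>R xG j (cell (L j) r) = xG j (cell (L j) r)"
            using order_tendstoD(1)[OF qlim 3(2)] by eventually_elim (use 3 in auto)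
          ultimately show ?thesis using 3 by (simp add: tendsto_cong)
        qed
      qed
    qed
    moreover have "(LBINT r. indicator {0..q j} r *\<^sub>R xG j (cell (L j) r)) = xV j (cell (L j) s)" for j
      using EV_integral[of "cell (L j) s" "L j" "ga j" "gc j" "gv j"] cell_less[of "L j" s]
      by (simp add: set_lebesgue_integral_def q_def xG_def xV_def)
    moreover have "(\<lambda>j. xV j (cell (L j) s)) \<longlonglongrightarrow> V s" unfolding xV by (rule outer_conv[OF s])
    ultimately have "V s = (LBINT r. indicator {0..s} r *\<^sub>R ?G r)" using LIMSEQ_unique by simp
    then show "V s = V 0 + (LBINT r:{0..s}. ?G r)" by (simp add: V0 set_lebesgue_integral_def)
  qed
qed

end

section \<open>Existence of approximations with a geometric rate\<close>

context brownian_T begin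

lemma Eu_diff_sym:
  fixes a c a' c' :: "nat => real^'n^'n" and v v' :: "nat => real^'n"
  assumes K: "\<And>i. norm (a i) \<le> K" "\<And>i. norm (c i) \<le> K" "\<And>i. norm (v i) \<le> K"
    and K': "\<And>i. norm (a' i) \<le> K" "\<And>i. norm (c' i) \<le> K" "\<And>i. norm (v' i) \<le> K"
    and t: "t \<in> {0..T}"
  shows "n2 (\<lambda>w. Eu n a c v (cell n t) w - Eu m a' c' v' (cell m t) w) \<le>
    2 * (6 * (T / 2^n + T / 2^m) * EK K + (16 * T * BK K + 32 * BK K + 32) *
      (LBINT s:{0..T}. (norm (a (cell n s) - a' (cell m s)))^2 + (norm (c (cell n s) - c' (cell m s)))^2
         + (norm (v (cell n s) - v' (cell m s)))^2)) * exp (2 * (16 * T * K^2 + 16 * K^2 + 1) * T)"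
proof -
  have E0: "0 \<le> EK K" using EK_nonneg[of a K c v] K by auto
  have mono: "2 * (6 * x * EK K + r) * exp z \<le> 2 * (6 * (T / 2^n + T / 2^m) * EK K + r) * exp z"
    if "x \<le> T / 2^n + T / 2^m" for x r z :: real
  proof -
    have "6 * x * EK K \<le> 6 * (T / 2^n + T / 2^m) * EK K" using that E0 by (intro mult_right_mono) auto
    from add_right_mono[OF this, of r] show ?thesis by (intro mult_right_mono mult_left_mono) auto
  qed
  show ?thesis
  proof (cases "n \<le> m")
    case True
    show ?thesis by (rule order_trans[OF Eu_diff[OF True K K' t]], rule mono) (use Tpos in simp)
  next
    case False
    then have mn: "m \<le> n" by simp
    let ?F = "\<lambda>(a :: nat => real^'n^'n) (c :: nat => real^'n^'n) (v :: nat => real^'n) n a' c' v' m.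
      LBINT s:{0..T}. (norm (a (cell n s) - a' (cell m s)))^2 + (norm (c (cell n s) - c' (cell m s)))^2
         + (norm (v (cell n s) - v' (cell m s)))^2"
    have F: "?F a' c' v' m a c v n = ?F a c v n a' c' v' m"
    proof -
      have "(norm (a' j - a i))^2 + (norm (c' j - c i))^2 + (norm (v' j - v i))^2 =
        (norm (a i - a' j))^2 + (norm (c i - c' j))^2 + (norm (v i - v' j))^2" for i j
        by (metis norm_minus_commute)
      then show ?thesis by simp
    qed
    show ?thesis
      unfolding n2_minus_commute[of "Eu n a c v (cell n t)"] F[symmetric]
      by (rule order_trans[OF Eu_diff[OF mn K' K t]], rule mono) (use Tpos in simp)
  qed
qed

text \<open>Stability bounds the distance of two approximations by
  \<open>\<gamma> j + \<gamma> k\<close> with \<open>\<gamma>\<close> tending to zero; a subsequence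
  along which \<open>\<gamma>\<close> is at most \<open>(1/4)^k\<close> supplies the rate that the
  locale demands.\<close>

lemma euler_scheme_exists:
  fixes a c :: "real => real^'n^'n" and v :: "real => real^'n"
  assumes b: "bmf a" "bmf c" "bmf v"
  shows "\<exists>K L ga gc gv \<delta>. euler_scheme M W T a c v K L ga gc gv \<delta>"
proof -
  \<comment> \<open>The three coefficients are approximated as one function so that they share the
    grid levels \<open>L\<close>.\<close>
  define f where "f s = (a s, c s, v s)" for s
  obtain Ka where Ka: "\<And>s. norm (a s) \<le> Ka" using bmf_bound[OF b(1)] by metis
  obtain Kc where Kc: "\<And>s. norm (c s) \<le> Kc" using bmf_bound[OF b(2)] by metis
  obtain Kv where Kv: "\<And>s. norm (v s) \<le> Kv" using bmf_bound[OF b(3)] by metis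
  define K where "K = max 1 (Ka + (Kc + Kv))"
  have K: "0 < K" by (simp add: K_def)
  have fK: "norm (f s) \<le> K" for s
  proof -
    have "norm (f s) \<le> norm (a s) + norm (c s, v s)" unfolding f_def by (rule norm_Pair_le)
    also have "\<dots> \<le> norm (a s) + (norm (c s) + norm (v s))" by (intro add_left_mono norm_Pair_le)
    also have "\<dots> \<le> Ka + (Kc + Kv)" by (intro add_mono Ka Kc Kv)
    also have "\<dots> \<le> K" by (simp add: K_def)
    finally show ?thesis .
  qed
  have fm: "f \<in> borel_measurable borel" unfolding f_def[abs_def] using b by (intro borel_measurable_Pair) (auto simp: bmf_measurable)
  obtain L g where L: "\<And>j. j \<le> L j" and g: "\<And>j i. norm (g j i) \<le> K"
    and gl: "AE s in lborel. s \<in> {0..T} \<longrightarrow> (\<lambda>j. g j (cell (L j) s)) \<longlonglongrightarrow> f s"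
    using step_approx[OF fm K fK] by auto
  define ga gc gv where "ga j i = fst (g j i)" and "gc j i = fst (snd (g j i))" and "gv j i = snd (snd (g j i))" for j i
  have cn: "norm (fst z) \<le> norm z" "norm (fst (snd z)) \<le> norm z" "norm (snd (snd z)) \<le> norm z"
    for z :: "(real^'n^'n) \<times> (real^'n^'n) \<times> (real^'n)"
    using norm_fst_le[of "fst z" "snd z"] norm_snd_le[of "snd z" "fst z"] norm_fst_le[of "fst (snd z)" "snd (snd z)"]
      norm_snd_le[of "snd (snd z)" "fst (snd z)"] by auto
  have gK: "norm (ga j i) \<le> K" "norm (gc j i) \<le> K" "norm (gv j i) \<le> K" for j i
    unfolding ga_def gc_def gv_def by (rule order_trans[OF cn(1) g] order_trans[OF cn(2) g] order_trans[OF cn(3) g])+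
  have Kb: "norm (a s) \<le> K" "norm (c s) \<le> K" "norm (v s) \<le> K" for s
    using order_trans[OF cn(1) fK[of s]] order_trans[OF cn(2) fK[of s]] order_trans[OF cn(3) fK[of s]] by (auto simp: f_def)
  have conv: "AE s in lborel. s \<in> {0..T} \<longrightarrow> (\<lambda>j. ga j (cell (L j) s)) \<longlonglongrightarrow> a s \<and>
        (\<lambda>j. gc j (cell (L j) s)) \<longlonglongrightarrow> c s \<and> (\<lambda>j. gv j (cell (L j) s)) \<longlonglongrightarrow> v s"
    using gl
  proof eventually_elim
    case (elim s)
    show ?case
    proof
      assume "s \<in> {0..T}"
      with elim have l: "(\<lambda>j. g j (cell (L j) s)) \<longlonglongrightarrow> f s" by simp
      show "(\<lambda>j. ga j (cell (L j) s)) \<longlonglongrightarrow> a s \<and> (\<lambda>j. gc j (cell (L j) s)) \<longlonglongrightarrow> c s \<and> (\<lambda>j. gv j (cell (L j) s)) \<longlonglongrightarrow> v s"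
        using tendsto_fst[OF l] tendsto_fst[OF tendsto_snd[OF l]] tendsto_snd[OF tendsto_snd[OF l]]
        by (simp add: ga_def gc_def gv_def f_def)
    qed
  qed
  define err where "err j s = (norm (ga j (cell (L j) s) - a s))^2 + (norm (gc j (cell (L j) s) - c s))^2
        + (norm (gv j (cell (L j) s) - v s))^2" for j s
  have eb: "bmf (err j)" for j unfolding err_def[abs_def] by (intro bmf_add bmf_power2 bmf_norm bmf_diff bmf_cell b)
  have e0: "(\<lambda>j. LBINT s:{0..T}. err j s) \<longlonglongrightarrow> 0"
  proof -
    have "(\<lambda>j. LBINT s. indicator {0..T} s *\<^sub>R err j s) \<longlonglongrightarrow> (LBINT s. indicator {0..T} s *\<^sub>R (0::real))"
    proof (rule integral_dominated_convergence)
      show "(\<lambda>s. indicator {0..T} s *\<^sub>R err j s) \<in> borel_measurable lborel" for j using bmf_measurable[OF eb[of j]] by measurable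
      show "integrable lborel (\<lambda>s. indicat_real {0..T} s * (3 * (2 * K)^2))" using integrable_indicator_Icc by simp
      show "AE s in lborel. norm (indicator {0..T} s *\<^sub>R err j s) \<le> indicat_real {0..T} s * (3 * (2 * K)^2)" for j
      proof (rule AE_I2)
        fix s
        have "(norm (x - y))^2 \<le> (2 * K)^2" if "norm x \<le> K" "norm y \<le> K" for x y :: "'z::real_normed_vector"
          using norm_triangle_ineq4[of x y] that by (intro power_mono) auto
        from this[OF gK(1) Kb(1)] this[OF gK(2) Kb(2)]
        have "(norm (ga j (cell (L j) s) - a s))^2 \<le> (2 * K)^2" "(norm (gc j (cell (L j) s) - c s))^2 \<le> (2 * K)^2" by auto
        moreover have "(norm (gv j (cell (L j) s) - v s))^2 \<le> (2 * K)^2"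
          using norm_triangle_ineq4[of "gv j (cell (L j) s)" "v s"] gK(3)[of j "cell (L j) s"] Kb(3)[of s] by (intro power_mono) auto
        ultimately have "0 \<le> err j s" "err j s \<le> 3 * (2 * K)^2" unfolding err_def by (auto simp: add_nonneg_nonneg)
        then show "norm (indicator {0..T} s *\<^sub>R err j s) \<le> indicat_real {0..T} s * (3 * (2 * K)^2)"
          by (auto simp: indicator_def)
      qed
      show "AE s in lborel. (\<lambda>j. indicator {0..T} s *\<^sub>R err j s) \<longlonglongrightarrow> indicator {0..T} s *\<^sub>R 0"
        using conv
      proof eventually_elim
        case (elim s)
        show ?case
        proof (cases "s \<in> {0..T}")
          case True
          with elim have "(\<lambda>j. ga j (cell (L j) s)) \<longlonglongrightarrow> a s" "(\<lambda>j. gc j (cell (L j) s)) \<longlonglongrightarrow> c s" "(\<lambda>j. gv j (cell (L j) s)) \<longlonglongrightarrow> v s" by auto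
          then have "(\<lambda>j. err j s) \<longlonglongrightarrow> (norm (a s - a s))^2 + (norm (c s - c s))^2 + (norm (v s - v s))^2"
            unfolding err_def by (intro tendsto_intros)
          then show ?thesis using True by simp
        qed simp
      qed
    qed simp
    then show ?thesis by (simp add: set_lebesgue_integral_def)
  qed
  \<comment> \<open>An enlargement of the constant in \<open>Eu_diff_sym\<close>; the summand 1
    gives \<open>C \<ge> 1\<close>, so that \<open>\<gamma>\<close> also dominates the mesh and the
    coefficient error.\<close>
  define C where "C = 1 + 2 * (12 * EK K + 4 * (16 * T * BK K + 32 * BK K + 32)) * exp (2 * (16 * T * K^2 + 16 * K^2 + 1) * T)"
  have B0: "0 \<le> EK K" "0 \<le> BK K" using EK_nonneg[of "ga 0" K "gc 0" "gv 0"] BK_nonneg[of "ga 0" K "gc 0" "gv 0"] gK by auto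
  have C1: "1 \<le> C" unfolding C_def using B0 Tpos by (auto intro!: mult_nonneg_nonneg add_nonneg_nonneg)
  define \<gamma> where "\<gamma> j = C * (T / 2^(L j) + (LBINT s:{0..T}. err j s))" for j
  have en: "0 \<le> (LBINT s:{0..T}. err j s)" for j by (rule bmf_integral_nonneg[OF eb]) (simp add: err_def)
  have TL: "(\<lambda>j. T / 2^(L j)) \<longlonglongrightarrow> 0"
  proof (rule tendsto_sandwich[OF _ _ tendsto_const])
    show "\<forall>\<^sub>F j in sequentially. T / 2^(L j) \<le> T * (1/2)^j"
    proof (rule always_eventually, rule allI)
      fix j show "T / 2^(L j) \<le> T * (1/2)^j"
        using L[of j] Tpos by (simp add: power_one_over divide_inverse[symmetric] divide_left_mono)
    qed
    show "(\<lambda>j. T * (1/2)^j) \<longlonglongrightarrow> 0" using tendsto_mult[OF tendsto_const LIMSEQ_realpow_zero[of "1/2::real"], of T] by simp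
  qed (use Tpos in simp)
  have \<gamma>0: "\<gamma> \<longlonglongrightarrow> 0" unfolding \<gamma>_def[abs_def] using tendsto_mult[OF tendsto_const tendsto_add[OF TL e0], of C] by simp
  have "\<exists>r\<ge>k. \<gamma> r \<le> (1/4)^k" for k :: nat
  proof -
    obtain N where N: "\<And>n. n \<ge> N ==> \<gamma> n < (1/4)^k"
      using order_tendstoD(2)[OF \<gamma>0, of "(1/4)^k"] by (auto simp: eventually_sequentially)
    show ?thesis by (rule exI[of _ "max N k"]) (use N[of "max N k"] in auto)
  qed
  then obtain r where r: "\<And>k::nat. k \<le> r k" "\<And>k. \<gamma> (r k) \<le> (1/4)^k" by metis
  have rl: "filterlim r at_top sequentially" by (rule filterlim_at_top_mono[OF filterlim_ident]) (use r(1) in auto)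
  have diff: "n2 (\<lambda>w. Eu (L j) (ga j) (gc j) (gv j) (cell (L j) s) w - Eu (L k) (ga k) (gc k) (gv k) (cell (L k) s) w) \<le> \<gamma> j + \<gamma> k"
    if s: "s \<in> {0..T}" for j k s
  proof -
    let ?D = "LBINT s:{0..T}. (norm (ga j (cell (L j) s) - ga k (cell (L k) s)))^2 + (norm (gc j (cell (L j) s) - gc k (cell (L k) s)))^2
         + (norm (gv j (cell (L j) s) - gv k (cell (L k) s)))^2"
    let ?e = "exp (2 * (16 * T * K^2 + 16 * K^2 + 1) * T)" and ?m = "16 * T * BK K + 32 * BK K + 32"
    let ?x = "LBINT s:{0..T}. err j s" and ?y = "LBINT s:{0..T}. err k s"
    let ?p = "T / 2^(L j)" and ?q = "T / 2^(L k)"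
    have "?D \<le> (LBINT s:{0..T}. 2 * err j s + 2 * err k s)"
    proof (rule bmf_integral_mono)
      show "bmf (\<lambda>s. 2 * err j s + 2 * err k s)" by (intro bmf_add bmf_mult bmf_const eb)
      show "bmf (\<lambda>s. (norm (ga j (cell (L j) s) - ga k (cell (L k) s)))^2 + (norm (gc j (cell (L j) s) - gc k (cell (L k) s)))^2
         + (norm (gv j (cell (L j) s) - gv k (cell (L k) s)))^2)" by (intro bmf_add bmf_power2 bmf_norm bmf_diff bmf_cell)
      fix s
      show "(norm (ga j (cell (L j) s) - ga k (cell (L k) s)))^2 + (norm (gc j (cell (L j) s) - gc k (cell (L k) s)))^2
         + (norm (gv j (cell (L j) s) - gv k (cell (L k) s)))^2 \<le> 2 * err j s + 2 * err k s"
        unfolding err_def using norm_add_sq[of "ga j (cell (L j) s) - a s" "a s - ga k (cell (L k) s)"]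
          norm_add_sq[of "gc j (cell (L j) s) - c s" "c s - gc k (cell (L k) s)"]
          norm_add_sq[of "gv j (cell (L j) s) - v s" "v s - gv k (cell (L k) s)"]
        by (simp add: norm_minus_commute[of "a s"] norm_minus_commute[of "c s"] norm_minus_commute[of "v s"])
    qed
    also have "\<dots> = 2 * ?x + 2 * ?y" by (simp add: bmf_integral_add bmf_mult bmf_const eb)
    finally have D: "?D \<le> 2 * ?x + 2 * ?y" .
    have "n2 (\<lambda>w. Eu (L j) (ga j) (gc j) (gv j) (cell (L j) s) w - Eu (L k) (ga k) (gc k) (gv k) (cell (L k) s) w) \<le>
       2 * (6 * (?p + ?q) * EK K + ?m * ?D) * ?e"
      by (rule Eu_diff_sym[OF gK gK s])
    also have "\<dots> \<le> 2 * (6 * (?p + ?q) * EK K + ?m * (2 * ?x + 2 * ?y)) * ?e"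
      using D B0 Tpos by (intro mult_right_mono mult_left_mono add_left_mono) auto
    also have "\<dots> \<le> 2 * ((12 * EK K + 4 * ?m) * (?p + ?q + ?x + ?y)) * ?e"
    proof (intro mult_right_mono mult_left_mono)
      have "0 \<le> ?m" using B0 Tpos by simp
      then have *: "0 \<le> 6 * EK K * (?p + ?q)" "0 \<le> 12 * EK K * (?x + ?y)" "0 \<le> 4 * ?m * (?p + ?q)" "0 \<le> 2 * ?m * (?x + ?y)"
        using B0 Tpos en[of j] en[of k] by (auto intro!: mult_nonneg_nonneg add_nonneg_nonneg)
      have "(12 * EK K + 4 * ?m) * (?p + ?q + ?x + ?y) - (6 * (?p + ?q) * EK K + ?m * (2 * ?x + 2 * ?y)) =
         6 * EK K * (?p + ?q) + 12 * EK K * (?x + ?y) + 4 * ?m * (?p + ?q) + 2 * ?m * (?x + ?y)"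
      proof -
        have "(12 * E + 4 * m) * (p + q + x + y) - (6 * (p + q) * E + m * (2 * x + 2 * y)) =
          6 * E * (p + q) + 12 * E * (x + y) + 4 * m * (p + q) + 2 * m * (x + y)" for E m p q x y :: real
          by (simp add: algebra_simps)
        then show ?thesis .
      qed
      with * show "6 * (?p + ?q) * EK K + ?m * (2 * ?x + 2 * ?y) \<le> (12 * EK K + 4 * ?m) * (?p + ?q + ?x + ?y)" by linarith
    qed auto
    also have "\<dots> = (C - 1) * (?p + ?q + ?x + ?y)" by (simp add: C_def mult_ac)
    also have "\<dots> \<le> C * (?p + ?q + ?x + ?y)"
      using Tpos en[of j] en[of k] by (intro mult_right_mono) (auto intro!: add_nonneg_nonneg)
    also have "\<dots> = \<gamma> j + \<gamma> k" by (simp add: \<gamma>_def algebra_simps)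
    finally show ?thesis .
  qed
  have \<gamma>nn: "0 \<le> \<gamma> j" for j unfolding \<gamma>_def using C1 Tpos en[of j] by (intro mult_nonneg_nonneg add_nonneg_nonneg) auto
  have le\<gamma>: "x \<le> C * y" if "x \<le> y" "0 \<le> y" for x y
    using mult_right_mono[OF C1 that(2)] that by linarith
  have "euler_scheme M W T a c v K (\<lambda>k. L (r k)) (\<lambda>k. ga (r k)) (\<lambda>k. gc (r k)) (\<lambda>k. gv (r k)) (\<lambda>k. \<gamma> (r k))"
  proof
    show "AE s in lborel. s \<in> {0..T} \<longrightarrow> (\<lambda>j. ga (r j) (cell (L (r j)) s)) \<longlonglongrightarrow> a s \<and>
        (\<lambda>j. gc (r j) (cell (L (r j)) s)) \<longlonglongrightarrow> c s \<and> (\<lambda>j. gv (r j) (cell (L (r j)) s)) \<longlonglongrightarrow> v s"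
      using conv
    proof eventually_elim
      case (elim s)
      show ?case
      proof
        assume "s \<in> {0..T}"
        with elim have l: "(\<lambda>j. ga j (cell (L j) s)) \<longlonglongrightarrow> a s" "(\<lambda>j. gc j (cell (L j) s)) \<longlonglongrightarrow> c s"
          "(\<lambda>j. gv j (cell (L j) s)) \<longlonglongrightarrow> v s" by auto
        show "(\<lambda>j. ga (r j) (cell (L (r j)) s)) \<longlonglongrightarrow> a s \<and> (\<lambda>j. gc (r j) (cell (L (r j)) s)) \<longlonglongrightarrow> c s \<and>
            (\<lambda>j. gv (r j) (cell (L (r j)) s)) \<longlonglongrightarrow> v s"
          by (intro conjI filterlim_compose[OF l(1) rl] filterlim_compose[OF l(2) rl] filterlim_compose[OF l(3) rl])
      qed
    qed
    show "T / 2^(L (r j)) \<le> \<gamma> (r j)" for j unfolding \<gamma>_def by (rule le\<gamma>) (use en[of "r j"] Tpos in auto)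
    show "(LBINT s:{0..T}. (norm (ga (r j) (cell (L (r j)) s) - a s))^2 + (norm (gc (r j) (cell (L (r j)) s) - c s))^2
        + (norm (gv (r j) (cell (L (r j)) s) - v s))^2) \<le> \<gamma> (r j)" for j
      unfolding err_def[symmetric] \<gamma>_def by (rule le\<gamma>) (use en[of "r j"] Tpos in auto)
  qed (use b Kb gK r \<gamma>nn diff in auto)
  then show ?thesis by blast
qed

end

section \<open>Feedback controls\<close>

lemma inner_transpose: "x \<bullet> (tr A *v y) = (A *v x) \<bullet> y" "(tr A *v y) \<bullet> x = y \<bullet> (A *v x)"
  for A :: "real^'n^'m"
  using dot_lmul_matrix[of y A x] by (simp_all add: inner_commute)

lemma inner_vm: "z \<bullet> (x v* S) = x \<bullet> (S *v z)" for S :: "real^'n^'m"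
  by (metis dot_lmul_matrix inner_commute)

lemma symm_inner: "tr A = A ==> (A *v x) \<bullet> y = (A *v y) \<bullet> x" for A :: "real^'n^'n"
  by (metis inner_commute inner_transpose(1))

lemma inner_mm_left: "M \<bullet> (A ** B) = (tr A ** M) \<bullet> B" for A :: "real^'k^'m" and B :: "real^'n^'k"
proof -
  have "M \<bullet> (A ** B) = (\<Sum>i\<in>UNIV. \<Sum>j\<in>UNIV. \<Sum>k\<in>UNIV. M$i$j * (A$i$k * B$k$j))"
    by (simp add: inner_vec_def matrix_matrix_mult_def sum_distrib_left)
  also have "\<dots> = (\<Sum>k\<in>UNIV. \<Sum>j\<in>UNIV. \<Sum>i\<in>UNIV. M$i$j * (A$i$k * B$k$j))"
  proof -
    have "(\<Sum>i\<in>UNIV. \<Sum>j\<in>UNIV. \<Sum>k\<in>UNIV. M$i$j * (A$i$k * B$k$j)) =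
        (\<Sum>j\<in>UNIV. \<Sum>i\<in>UNIV. \<Sum>k\<in>UNIV. M$i$j * (A$i$k * B$k$j))" by (rule sum.swap)
    also have "\<dots> = (\<Sum>j\<in>UNIV. \<Sum>k\<in>UNIV. \<Sum>i\<in>UNIV. M$i$j * (A$i$k * B$k$j))"
      by (rule sum.cong[OF refl]) (rule sum.swap)
    also have "\<dots> = (\<Sum>k\<in>UNIV. \<Sum>j\<in>UNIV. \<Sum>i\<in>UNIV. M$i$j * (A$i$k * B$k$j))" by (rule sum.swap)
    finally show ?thesis .
  qed
  also have "\<dots> = (tr A ** M) \<bullet> B"
    by (simp add: inner_vec_def matrix_matrix_mult_def transpose_def sum_distrib_left mult_ac)
  finally show ?thesis .
qed

lemma inner_mat_transpose: "tr A \<bullet> tr B = A \<bullet> B" for A :: "real^'n^'m"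
  unfolding inner_vec_def transpose_def by simp (rule sum.swap)

lemma inner_mm_right: "M \<bullet> (A ** B) = (M ** tr B) \<bullet> A" for A :: "real^'k^'m" and B :: "real^'n^'k"
  using inner_mm_left[of "tr M" "tr B" "tr A"]
    inner_mat_transpose[of M "A ** B"] inner_mat_transpose[of "M ** tr B" A]
  by (simp add: matrix_transpose_mul)

text \<open>The form \<open>qform\<close> with the opponent's control zero; \<open>S\<close> and its
  transpose merge into the factor 2.\<close>

definition q1 :: "real^'n^'n => real^'n^'m => real^'m^'m => real^'n => real^'m => real" where
  "q1 Q S R x v = (Q *v x) \<bullet> x + 2 * ((S *v x) \<bullet> v) + (R *v v) \<bullet> v"

lemmas mv_expand = matrix_vector_mul_assoc[symmetric] matrix_vector_mult_add_rdistrib matrix_vector_right_distrib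
  inner_add_left inner_add_right

text \<open>Separates a part free of \<open>z\<close>, a linear part, which has expectation zero for
  \<open>z = Z\<close>, and a quadratic part, which sees \<open>Z\<close> only through its
  covariance.\<close>

lemma q1_affine:
  fixes Q :: "real^'n^'n" and S K :: "real^'n^'m"
  assumes "tr Q = Q" "tr R = R"
  shows "q1 Q S R (y + z) (u + K *v z) = q1 Q S R y u
     + (2 *\<^sub>R (Q *v y + tr S *v u + tr K *v (S *v y + R *v u))) \<bullet> z
     + (Q + tr K ** S + tr S ** K + tr K ** R ** K) \<bullet> outer z z"
proof -
  have "(Q *v z) \<bullet> y = (Q *v y) \<bullet> z" "(R *v (K *v z)) \<bullet> u = (R *v u) \<bullet> (K *v z)"
    by (rule symm_inner; fact assms)+
  then show ?thesis unfolding q1_def inner_outer by (simp add: mv_expand dot_lmul_matrix inner_vm inner_commute algebra_simps)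
qed

lemma bmf_q1:
  fixes Q :: "real => real^'n^'n" and S :: "real => real^'n^'m"
  assumes "bmf Q" "bmf S" "bmf R" "bmf y" "bmf u"
  shows "bmf (\<lambda>s. q1 (Q s) (S s) (R s) (y s) (u s))"
  unfolding q1_def by (intro bmf_add bmf_inner bmf_mv bmf_mult bmf_const assms)

context euler_scheme begin

text \<open>State and control of the feedback problem both have this form, so admissibility and
  moments are treated once for both.\<close>

definition aff :: "(real => real^'m) => (real => real^'n^'m) => real => 'w => real^'m" where
  "aff f F s w = f s + F s *v Z s w"

lemma aff_L2: "s \<in> {0..T} ==> L2 (aff f F s)"
  unfolding aff_def[abs_def] by (intro L2_add L2_const L2_mv Z_lim)

lemma aff_bound:
  assumes "bmf f" "bmf F"
  obtains B where "0 \<le> B" "\<forall>s\<in>{0..T}. n2 (aff f F s) \<le> B"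
proof -
  obtain Kf where Kf: "0 < Kf" "\<And>s. norm (f s) \<le> Kf" using bmf_bound[OF assms(1)] by metis
  obtain KF where KF: "0 < KF" "\<And>s. norm (F s) \<le> KF" using bmf_bound[OF assms(2)] by metis
  have "n2 (aff f F s) \<le> 2 * Kf^2 + 2 * (KF^2 * BZ)" if s: "s \<in> {0..T}" for s
  proof -
    have "n2 (aff f F s) \<le> 2 * n2 (\<lambda>w. f s) + 2 * n2 (\<lambda>w. F s *v Z s w)"
      unfolding aff_def[abs_def] by (intro L2_add L2_const L2_mv Z_lim s)
    also have "\<dots> \<le> 2 * Kf^2 + 2 * (KF^2 * BZ)"
    proof (intro add_mono mult_left_mono)
      show "n2 (\<lambda>w. f s) \<le> Kf^2" unfolding n2_const using Kf(2)[of s] by (intro power_mono) auto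
      have "n2 (\<lambda>w. F s *v Z s w) \<le> KF^2 * n2 (Z s)"
      proof (rule L2_bounded(2))
        show "(\<lambda>w. F s *v Z s w) \<in> borel_measurable M" by (rule L2_measurable, intro L2_mv Z_lim s)
        show "L2 (Z s)" by (rule Z_lim(2)[OF s])
        show "norm (F s *v Z s w) \<le> KF * norm (Z s w)" for w by (rule norm_mv_le[OF KF(2)])
      qed
      also have "\<dots> \<le> KF^2 * BZ" by (intro mult_left_mono Z_bound s) auto
      finally show "n2 (\<lambda>w. F s *v Z s w) \<le> KF^2 * BZ" .
    qed auto
    finally show ?thesis .
  qed
  then show thesis by (intro that[of "2 * Kf^2 + 2 * (KF^2 * BZ)"]) (use BZ_nonneg in auto)
qed

lemma aff_measurable_gen:
  assumes b: "bmf f" "bmf F" and N: "fst \<in> measurable N borel"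
    and Z: "(\<lambda>z. Z (fst z) (snd z)) \<in> borel_measurable N"
  shows "(\<lambda>z. aff f F (fst z) (snd z)) \<in> borel_measurable N"
proof -
  have m: "(\<lambda>z. f (fst z)) \<in> borel_measurable N" "(\<lambda>z. F (fst z)) \<in> borel_measurable N"
    by (rule measurable_compose[OF N bmf_measurable], rule b)+
  show ?thesis unfolding aff_def
    by (rule borel_measurable_add[OF m(1)], rule bilinear_measurable[OF bilinear_matrix_vector], rule m(2), rule Z)
qed

lemma aff_joint: "bmf f ==> bmf F ==> (\<lambda>(s, w). aff f F s w) \<in> borel_measurable LM"
  unfolding split_def by (rule aff_measurable_gen) (use Z_joint in \<open>auto simp: split_def\<close>)

lemma aff_progressive: "bmf f ==> bmf F ==> progressive M (aug_filtration M W) T (aff f F)"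
  unfolding progressive_def split_def
proof
  fix t assume b: "bmf f" "bmf F" and t: "t \<in> {0..T}"
  let ?N = "restrict_space lborel {0..t} \<Otimes>\<^sub>M sigma (space M) (aug_filtration M W t)"
  show "(\<lambda>z. aff f F (fst z) (snd z)) \<in> borel_measurable ?N"
  proof (rule aff_measurable_gen[OF b])
    have i: "(\<lambda>z. z) \<in> measurable (restrict_space lborel {0..t}) borel" by (rule measurable_restrict_space1) simp
    show "fst \<in> measurable ?N borel" by (rule measurable_compose[OF measurable_fst i])
    show "(\<lambda>z. Z (fst z) (snd z)) \<in> borel_measurable ?N"
      using Z_progressive t by (auto simp: progressive_def split_def)
  qed
qed

lemma aff_sq_int: assumes b: "bmf f" "bmf F" shows "sq_int M T (aff f F)"
proof -
  obtain B where B: "0 \<le> B" "\<forall>s\<in>{0..T}. n2 (aff f F s) \<le> B" by (rule aff_bound[OF b])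
  have "(\<integral>\<^sup>+ w. (\<integral>\<^sup>+ s\<in>{0..T}. ennreal ((norm (aff f F s w))^2) \<partial>lborel) \<partial>M) = (\<integral>\<^sup>+ s\<in>{0..T}. ennreal (n2 (aff f F s)) \<partial>lborel)"
    by (rule tonelli_n2[OF aff_joint[OF b]]) (simp add: aff_L2)
  also have "\<dots> \<le> (\<integral>\<^sup>+ s. ennreal B * indicator {0..T} s \<partial>lborel)"
    by (intro nn_integral_mono) (use B in \<open>auto simp: indicator_def intro!: ennreal_leI\<close>)
  also have "\<dots> = ennreal B * emeasure lborel {0..T}" by (simp add: nn_integral_cmult_indicator)
  also have "\<dots> < \<infinity>" by (simp add: emeasure_lborel_Icc_eq ennreal_mult_less_top)
  finally show ?thesis by (simp add: sq_int_def)
qed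

lemma aff_admissible: "bmf f ==> bmf F ==> admissible M (aug_filtration M W) T (aff f F)"
  by (simp add: admissible_def aff_progressive aff_sq_int)

lemma aff_expectation: assumes s: "s \<in> {0..T}" shows "expectation (aff f F s) = f s"
proof -
  have "expectation (\<lambda>w. F s *v Z s w) = F s *v expectation (Z s)"
    by (rule integral_bounded_linear[OF matrix_vector_mul_bounded_linear L2_integrable[OF Z_lim(2)[OF s]]])
  then show ?thesis
    unfolding aff_def[abs_def] using L2_integrable[OF L2_mv[OF Z_lim(2)[OF s], of "F s"]] Z_expectation[OF s]
    by (simp add: prob_space)
qed

lemma aff_section: assumes b: "bmf f" "bmf F" and w: "w \<in> space M" shows "(\<lambda>s. aff f F s w) \<in> borel_measurable borel"
  using measurable_compose_Pair1[OF w, of "\<lambda>(w, s). aff f F s w" lborel borel] aff_joint[OF b]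
  by (simp add: measurable_pair_swap_iff[of _ lborel] split_def)

lemma inner_V:
  assumes s: "s \<in> {0..T}"
  shows "integrable M (\<lambda>w. H \<bullet> outer (Z s w) (Z s w))" "expectation (\<lambda>w. H \<bullet> outer (Z s w) (Z s w)) = H \<bullet> V s"
  using L2_outer[OF Z_lim(2)[OF s] Z_lim(2)[OF s]] s by (simp_all add: V_def)

lemma inner_V_nonpos:
  assumes s: "s \<in> {0..T}" and H: "\<And>z. z \<bullet> (H *v z) \<le> 0"
  shows "H \<bullet> V s \<le> 0"
proof -
  have "expectation (\<lambda>w. - (H \<bullet> outer (Z s w) (Z s w))) \<ge> 0"
    by (rule Bochner_Integration.integral_nonneg) (use H in \<open>simp add: inner_outer\<close>)
  then show ?thesis using inner_V[OF s, of H] by simp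
qed

text \<open>After Fubini only the mean of \<open>Z\<close>, which is zero, and its covariance
  \<open>V\<close> enter; boundedness of the coefficients and of the second moments justifies the
  exchange.\<close>

lemma quadratic_expectation:
  fixes f :: "real => real" and l :: "real => real^'n" and H :: "real => real^'n^'n"
  assumes b: "bmf f" "bmf l" "bmf H"
  defines "q s w \<equiv> f s + l s \<bullet> Z s w + H s \<bullet> outer (Z s w) (Z s w)"
  shows "integrable M (\<lambda>w. LBINT s:{0..T}. q s w)"
    "expectation (\<lambda>w. LBINT s:{0..T}. q s w) = (LBINT s:{0..T}. f s + H s \<bullet> V s)"
proof -
  obtain Kf where Kf: "0 < Kf" "\<And>s. norm (f s) \<le> Kf" using bmf_bound[OF b(1)] by metis
  obtain Kl where Kl: "0 < Kl" "\<And>s. norm (l s) \<le> Kl" using bmf_bound[OF b(2)] by metis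
  obtain KH where KH: "0 < KH" "\<And>s. norm (H s) \<le> KH" using bmf_bound[OF b(3)] by metis
  have zj: "(\<lambda>p. Z (fst p) (snd p)) \<in> borel_measurable LM" using Z_joint by (simp add: split_def)
  have oj: "(\<lambda>p. outer (Z (fst p) (snd p)) (Z (fst p) (snd p))) \<in> borel_measurable LM"
    by (rule bilinear_measurable[OF bilinear_outer]) (rule zj)+
  have bj: "(\<lambda>p. f (fst p)) \<in> borel_measurable LM" "(\<lambda>p. l (fst p)) \<in> borel_measurable LM"
    "(\<lambda>p. H (fst p)) \<in> borel_measurable LM"
    by (rule measurable_compose[OF measurable_fst], use b in \<open>simp add: bmf_measurable\<close>)+
  have qj: "(\<lambda>(s, w). q s w) \<in> borel_measurable LM"
    unfolding q_def split_def by (intro borel_measurable_add borel_measurable_inner bj zj oj)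
  have z: "integrable M (\<lambda>w. (norm (Z s w))^2)" "integrable M (Z s)" if "s \<in> {0..T}" for s
    using Z_lim(2)[OF that] by (auto simp: L2_int L2_integrable)
  have qi: "integrable M (q s)" if s: "s \<in> {0..T}" for s
    unfolding q_def using z(2)[OF s] inner_V(1)[OF s] by (intro Bochner_Integration.integrable_add) auto
  have qb: "expectation (\<lambda>w. norm (q s w)) \<le> Kf + Kl + (Kl + KH) * BZ" if s: "s \<in> {0..T}" for s
  proof -
    have "expectation (\<lambda>w. norm (q s w)) \<le> expectation (\<lambda>w. Kf + Kl + (Kl + KH) * (norm (Z s w))^2)"
    proof (rule integral_mono)
      show "integrable M (\<lambda>w. norm (q s w))" using qi[OF s] by (rule integrable_norm)
      show "integrable M (\<lambda>w. Kf + Kl + (Kl + KH) * (norm (Z s w))^2)" using z(1)[OF s] by simp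
      fix w
      let ?n = "norm (Z s w)"
      have 1: "\<bar>l s \<bullet> Z s w\<bar> \<le> Kl * ?n" 
        by (rule order_trans[OF Cauchy_Schwarz_ineq2]) (use Kl in \<open>auto intro!: mult_right_mono\<close>)
      have "?n \<le> 1 + ?n^2" using sum_squares_bound[of 1 ?n] norm_ge_zero[of "Z s w"] by (simp del: norm_ge_zero)
      then have 2: "Kl * ?n \<le> Kl * (1 + ?n^2)" using Kl by (intro mult_left_mono) auto
      have 3: "\<bar>H s \<bullet> outer (Z s w) (Z s w)\<bar> \<le> KH * ?n^2"
        by (rule order_trans[OF Cauchy_Schwarz_ineq2]) (use KH in \<open>auto intro!: mult_right_mono simp: norm_outer power2_eq_square\<close>)
      have 4: "\<bar>f s\<bar> \<le> Kf" using Kf by simp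
      have "norm (q s w) \<le> \<bar>f s\<bar> + \<bar>l s \<bullet> Z s w\<bar> + \<bar>H s \<bullet> outer (Z s w) (Z s w)\<bar>"
        unfolding q_def by simp
      also have "\<dots> \<le> Kf + Kl * (1 + ?n^2) + KH * ?n^2" using 1 2 3 4 by linarith
      also have "\<dots> = Kf + Kl + (Kl + KH) * ?n^2" by (simp add: algebra_simps)
      finally show "norm (q s w) \<le> \<dots>" .
    qed
    also have "\<dots> = Kf + Kl + (Kl + KH) * n2 (Z s)" using z(1)[OF s] by (simp add: n2_def prob_space)
    also have "\<dots> \<le> Kf + Kl + (Kl + KH) * BZ"
      by (intro add_left_mono mult_left_mono Z_bound s) (use Kl KH in auto)
    finally show ?thesis .
  qed
  have h: "\<forall>s\<in>{0..T}. integrable M (q s) \<and> expectation (\<lambda>w. norm (q s w)) \<le> Kf + Kl + (Kl + KH) * BZ"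
    using qi qb by blast
  show "integrable M (\<lambda>w. LBINT s:{0..T}. q s w)" by (rule fubini_step(2)[OF qj h])
  have "expectation (q s) = f s + H s \<bullet> V s" if s: "s \<in> {0..T}" for s
  proof -
    have "expectation (\<lambda>w. l s \<bullet> Z s w) = 0" using z(2)[OF s] Z_expectation[OF s] by simp
    then show ?thesis unfolding q_def using z(2)[OF s] inner_V[OF s, of "H s"] by (simp add: prob_space)
  qed
  then show "expectation (\<lambda>w. LBINT s:{0..T}. q s w) = (LBINT s:{0..T}. f s + H s \<bullet> V s)"
    unfolding fubini_step(3)[OF qj h] by (intro set_lebesgue_integral_cong) auto
qed

end

text \<open>The state is \<open>y + Z\<close> and the control \<open>ub + F Z\<close>. Since
  \<open>Z\<close> has mean zero, \<open>y\<close> and \<open>ub\<close> are the means, and the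
  mean-field terms reach \<open>Z\<close> only through the inhomogeneity of its diffusion.\<close>

locale feedback = euler_scheme M W T
    "\<lambda>s. A s + B s ** F s" "\<lambda>s. C s + D s ** F s" "\<lambda>s. (C s + Cb s) *v y s + (D s + Db s) *v ub s" K L ga gc gv \<delta>
  for M :: "'w measure" and W T and A Ab C Cb :: "real => real^'n^'n" and B Bb D Db :: "real => real^'m^'n"
    and F :: "real => real^'n^'m" and y :: "real => real^'n" and ub :: "real => real^'m"
    and K L ga gc gv \<delta> +
  assumes b: "bmf A" "bmf Ab" "bmf C" "bmf Cb" "bmf B" "bmf Bb" "bmf D" "bmf Db" "bmf F" "bmf y" "bmf ub"
    and y0: "y 0 = 0" and y: "prim_on T y (\<lambda>s. (A s + Ab s) *v y s + (B s + Bb s) *v ub s)"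
begin

abbreviation "Xf \<equiv> aff y (\<lambda>s. mat 1)"
abbreviation "uf \<equiv> aff ub F"

lemma drift_eq: "A s *v Xf s w + Ab s *v y s + B s *v uf s w + Bb s *v ub s =
    ((A s + Ab s) *v y s + (B s + Bb s) *v ub s) + (A s + B s ** F s) *v Z s w"
  by (simp add: aff_def mv_expand algebra_simps)

lemma diffusion_eq: "C s *v Xf s w + Cb s *v y s + D s *v uf s w + Db s *v ub s =
    (C s + D s ** F s) *v Z s w + ((C s + Cb s) *v y s + (D s + Db s) *v ub s)"
  by (simp add: aff_def mv_expand algebra_simps)

lemma state_drift: "AE w in M. set_integrable lborel {0..T} (\<lambda>s. A s *v Xf s w + Ab s *v y s + B s *v uf s w + Bb s *v ub s)"
  unfolding drift_eq using aZ_integrable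
proof eventually_elim
  case (elim w)
  show ?case by (rule set_integral_add(1)[OF bmf_set_integrable[OF prim_on_bmf[OF y]] elim])
qed

lemma state_ito: "ito_integral M (aug_filtration M W) W T (\<lambda>s w. C s *v Xf s w + Cb s *v y s + D s *v uf s w + Db s *v ub s) It"
  unfolding diffusion_eq by (rule Z_ito)

lemma state_eq:
  assumes t: "t \<in> {0..T}"
  shows "AE w in M. Xf t w = (LBINT s:{0..t}. A s *v Xf s w + Ab s *v y s + B s *v uf s w + Bb s *v ub s) + It t w"
  unfolding drift_eq using aZ_integrable
proof eventually_elim
  case (elim w)
  have "set_integrable lborel {0..t} (\<lambda>s. (A s + B s ** F s) *v Z s w)"
    by (rule set_integrable_subset[OF elim]) (use t in auto)
  from set_integral_add(2)[OF bmf_set_integrable[OF prim_on_bmf[OF y]] this] show ?case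
    using prim_onD[OF y t] Z_eq[of t w] by (simp add: aff_def y0)
qed

text \<open>The centred part of the control adds a nonnegative matrix paired with a covariance, so
  it can only increase the norm.\<close>

lemma sq_norm_uf: "(LBINT s:{0..T}. (norm (ub s))^2) \<le> sq_norm M T uf"
proof -
  let ?l = "\<lambda>s. 2 *\<^sub>R (tr (F s) *v ub s)" and ?H = "\<lambda>s. tr (F s) ** F s"
  have bl: "bmf ?l" "bmf ?H" by (intro bmf_intros b)+
  have eq: "(norm (uf s w))^2 = (norm (ub s))^2 + ?l s \<bullet> Z s w + ?H s \<bullet> outer (Z s w) (Z s w)" for s w
    unfolding power2_norm_eq_inner aff_def inner_outer
    by (simp add: mv_expand dot_lmul_matrix inner_vm inner_commute algebra_simps)
  have bn: "bmf (\<lambda>s. (norm (ub s))^2)" by (intro bmf_power2 bmf_norm b)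
  have bV: "bmf (\<lambda>s. ?H s \<bullet> V s)" by (intro bmf_inner bl V_bmf)
  have "sq_norm M T uf = (LBINT s:{0..T}. (norm (ub s))^2 + ?H s \<bullet> V s)"
    unfolding sq_norm_def eq by (rule quadratic_expectation(2)[OF bn bl])
  moreover have "(LBINT s:{0..T}. (norm (ub s))^2) \<le> \<dots>"
  proof (rule bmf_integral_mono[OF bn bmf_add[OF bn bV]])
    fix s assume s: "s \<in> {0..T}"
    have "(- ?H s) \<bullet> V s \<le> 0"
      by (rule inner_V_nonpos[OF s]) (simp add: mv_expand inner_vm bounded_bilinear.minus_left[OF bilinear_matrix_vector])
    then show "(norm (ub s))^2 \<le> (norm (ub s))^2 + ?H s \<bullet> V s" by simp
  qed
  ultimately show ?thesis by simp
qed

text \<open>Completion of squares in expectation. The product rule for \<open>P \<bullet> V\<close>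
  trades the terminal covariance for an integral, in which \<open>V\<close> is paired with the
  matrix of \<open>neg\<close>; this contribution is nonpositive because \<open>V\<close> is a
  covariance, and it is dropped.\<close>

lemma cost_bound:
  assumes bq: "bmf Q" "bmf Qb" "bmf S" "bmf Sb" "bmf R" "bmf Rb" "bmf P" "bmf P'"
    and sym: "\<And>s. tr (Q s) = Q s" "\<And>s. tr (R s) = R s" "\<And>s. tr (P s) = P s"
    and P: "prim_on T P P'" "P T = G"
    and neg: "\<And>s z. z \<bullet> ((P' s + P s ** (A s + B s ** F s) + tr (A s + B s ** F s) ** P s
        + tr (C s + D s ** F s) ** P s ** (C s + D s ** F s)
        + (Q s + tr (F s) ** S s + tr (S s) ** F s + tr (F s) ** R s ** F s)) *v z) \<le> 0"
  shows "expectation (\<lambda>w. (G *v Xf T w) \<bullet> Xf T w + (Gb *v y T) \<bullet> y T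
        + (LBINT s:{0..T}. q1 (Q s) (S s) (R s) (Xf s w) (uf s w))
        + (LBINT s:{0..T}. q1 (Qb s) (Sb s) (Rb s) (y s) (ub s))) \<le>
     ((G + Gb) *v y T) \<bullet> y T + (LBINT s:{0..T}.
        q1 (Q s + Qb s + tr (C s + Cb s) ** P s ** (C s + Cb s))
           (S s + Sb s + tr (D s + Db s) ** P s ** (C s + Cb s))
           (R s + Rb s + tr (D s + Db s) ** P s ** (D s + Db s)) (y s) (ub s))"
proof -
  let ?a = "\<lambda>s. A s + B s ** F s" and ?c = "\<lambda>s. C s + D s ** F s" and ?N = "\<lambda>s. (C s + Cb s) *v y s + (D s + Db s) *v ub s"
  let ?H = "\<lambda>s. Q s + tr (F s) ** S s + tr (S s) ** F s + tr (F s) ** R s ** F s"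
  let ?l = "\<lambda>s. 2 *\<^sub>R (Q s *v y s + tr (S s) *v ub s + tr (F s) *v (S s *v y s + R s *v ub s))"
  let ?f = "\<lambda>s. q1 (Q s) (S s) (R s) (y s) (ub s)" and ?fb = "\<lambda>s. q1 (Qb s) (Sb s) (Rb s) (y s) (ub s)"
  let ?L = "\<lambda>s. P' s + P s ** ?a s + tr (?a s) ** P s + tr (?c s) ** P s ** ?c s + ?H s"
  have bH: "bmf ?H" and bl: "bmf ?l" by (intro bmf_intros b bq)+
  have bf: "bmf ?f" "bmf ?fb" by (intro bmf_q1 b bq)+
  have bN: "bmf (\<lambda>s. P s \<bullet> outer (?N s) (?N s))" by (intro bmf_inner bmf_bilinear[OF bilinear_outer] bmf_intros b bq)
  have bL: "bmf (\<lambda>s. ?L s \<bullet> V s)" by (intro bmf_inner bmf_intros b bq V_bmf)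
  have eq: "q1 (Q s) (S s) (R s) (Xf s w) (uf s w) = ?f s + ?l s \<bullet> Z s w + ?H s \<bullet> outer (Z s w) (Z s w)" for s w
    unfolding aff_def matrix_vector_mul_lid by (rule q1_affine[OF sym(1,2)])
  have T: "T \<in> {0..T}" using Tpos by simp
  have Xi: "integrable M (\<lambda>w. (G *v Xf T w) \<bullet> Xf T w)" by (intro L2_inner L2_mv aff_L2 T)
  note qi = quadratic_expectation[OF bf(1) bl bH, folded eq]
  have symG: "tr G = G" using sym(3)[of T] P(2) by simp
  have XT: "expectation (\<lambda>w. (G *v Xf T w) \<bullet> Xf T w) = (G *v y T) \<bullet> y T + G \<bullet> V T"
  proof -
    have e: "(G *v Xf T w) \<bullet> Xf T w = (G *v y T) \<bullet> y T + (2 *\<^sub>R (G *v y T)) \<bullet> Z T w + G \<bullet> outer (Z T w) (Z T w)" for w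
      unfolding aff_def inner_outer using symm_inner[OF symG, of "y T" "Z T w"]
      by (simp add: mv_expand inner_commute algebra_simps)
    have "integrable M (\<lambda>w. (2 *\<^sub>R (G *v y T)) \<bullet> Z T w)" using L2_integrable[OF Z_lim(2)[OF T]] by simp
    moreover have "expectation (\<lambda>w. (2 *\<^sub>R (G *v y T)) \<bullet> Z T w) = 0"
      using L2_integrable[OF Z_lim(2)[OF T]] Z_expectation[OF T] by simp
    ultimately show ?thesis unfolding e using inner_V[OF T, of G] by (simp add: prob_space)
  qed
  have V0: "V 0 = 0"
  proof -
    have "\<forall>w. X j 0 w = 0" for j by (simp add: X_def)
    then show ?thesis
      using outer_conv[of 0] Tpos by (simp add: bounded_bilinear.zero_left[OF bilinear_outer] LIMSEQ_const_iff)
  qed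
  have GV: "G \<bullet> V T = (LBINT s:{0..T}. (?L s - ?H s) \<bullet> V s + P s \<bullet> outer (?N s) (?N s))"
  proof -
    let ?V' = "\<lambda>s. ?a s ** V s + V s ** tr (?a s) + ?c s ** V s ** tr (?c s) + outer (?N s) (?N s)"
    have "P T \<bullet> V T = P 0 \<bullet> V 0 + (LBINT s:{0..T}. ext0T T P s \<bullet> ?V' s + P' s \<bullet> ext0T T V s)"
      by (rule prim_onD[OF prim_on_bilinear[OF bounded_bilinear_inner P(1) V_prim] T])
    also have "\<dots> = (LBINT s:{0..T}. (?L s - ?H s) \<bullet> V s + P s \<bullet> outer (?N s) (?N s))"
      unfolding V0 inner_zero_right add_0
    proof (rule set_lebesgue_integral_cong)
      show "\<forall>s. s \<in> {0..T} \<longrightarrow> ext0T T P s \<bullet> ?V' s + P' s \<bullet> ext0T T V s = (?L s - ?H s) \<bullet> V s + P s \<bullet> outer (?N s) (?N s)"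
      proof (intro allI impI)
        fix s assume s: "s \<in> {0..T}"
        have "P s \<bullet> (?c s ** V s ** tr (?c s)) = (tr (?c s) ** P s ** ?c s) \<bullet> V s"
          by (simp add: inner_mm_right[of _ "?c s ** V s"] inner_mm_left[of _ "?c s"] matrix_mul_assoc)
        then show "ext0T T P s \<bullet> ?V' s + P' s \<bullet> ext0T T V s = (?L s - ?H s) \<bullet> V s + P s \<bullet> outer (?N s) (?N s)"
          using inner_mm_left[of "P s" "?a s" "V s"] inner_mm_right[of "P s" "V s" "tr (?a s)"] s
          by (simp add: inner_add_left inner_add_right del: outer_simps)
      qed
    qed simp
    finally show ?thesis by (simp add: P(2))
  qed
  \<comment> \<open>The source of the covariance equation, paired with \<open>P\<close>, is exactly
    the difference between the completed and the original weights.\<close>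
  have detq: "q1 (Q s + Qb s + tr (C s + Cb s) ** P s ** (C s + Cb s))
           (S s + Sb s + tr (D s + Db s) ** P s ** (C s + Cb s))
           (R s + Rb s + tr (D s + Db s) ** P s ** (D s + Db s)) (y s) (ub s) = ?f s + ?fb s + P s \<bullet> outer (?N s) (?N s)" for s
  proof -
    define u v where "u = (C s + Cb s) *v y s" and "v = (D s + Db s) *v ub s"
    have "(P s *v v) \<bullet> u = (P s *v u) \<bullet> v" by (rule symm_inner[OF sym(3)])
    then have N: "P s \<bullet> outer (?N s) (?N s) = (P s *v u) \<bullet> u + 2 * ((P s *v u) \<bullet> v) + (P s *v v) \<bullet> v"
      unfolding inner_outer u_def[symmetric] v_def[symmetric] by (simp add: mv_expand inner_commute algebra_simps)
    have t: "((tr X ** P s ** Y) *v z) \<bullet> w = (P s *v (Y *v z)) \<bullet> (X *v w)"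
      for X :: "real^'x^'n" and Y :: "real^'z^'n" and z w
      by (simp add: matrix_vector_mul_assoc[symmetric] dot_lmul_matrix)
    show ?thesis unfolding N unfolding q1_def matrix_vector_mult_add_rdistrib[of _ _ "y s"] matrix_vector_mult_add_rdistrib[of _ _ "ub s"]
        inner_add_left
      unfolding t
      by (simp add: u_def v_def mv_expand algebra_simps)
  qed
  have i: "integrable M (\<lambda>w. (G *v Xf T w) \<bullet> Xf T w + (Gb *v y T) \<bullet> y T)" using Xi by simp
  have e1: "expectation (\<lambda>w. (G *v Xf T w) \<bullet> Xf T w + (Gb *v y T) \<bullet> y T
        + (LBINT s:{0..T}. q1 (Q s) (S s) (R s) (Xf s w) (uf s w)) + (LBINT s:{0..T}. ?fb s)) =
     (G *v y T) \<bullet> y T + G \<bullet> V T + (Gb *v y T) \<bullet> y T + (LBINT s:{0..T}. ?f s + ?H s \<bullet> V s) + (LBINT s:{0..T}. ?fb s)"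
    using Xi XT qi by (simp add: prob_space)
  have e2: "(LBINT s:{0..T}. (?L s - ?H s) \<bullet> V s + P s \<bullet> outer (?N s) (?N s))
      + (LBINT s:{0..T}. ?f s + ?H s \<bullet> V s) + (LBINT s:{0..T}. ?fb s) =
     (LBINT s:{0..T}. ((?L s - ?H s) \<bullet> V s + P s \<bullet> outer (?N s) (?N s)) + (?f s + ?H s \<bullet> V s) + ?fb s)"
  proof -
    have 1: "bmf (\<lambda>s. (?L s - ?H s) \<bullet> V s + P s \<bullet> outer (?N s) (?N s))"
      by (rule bmf_add[OF bmf_inner[OF bmf_diff V_bmf] bN]) (intro bmf_intros b bq)+
    have 2: "bmf (\<lambda>s. ?f s + ?H s \<bullet> V s)" by (rule bmf_add[OF bf(1) bmf_inner[OF bH V_bmf]])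
    show ?thesis unfolding bmf_integral_add[OF bmf_add[OF 1 2] bf(2)] bmf_integral_add[OF 1 2] ..
  qed
  have e3: "(LBINT s:{0..T}. ((?L s - ?H s) \<bullet> V s + P s \<bullet> outer (?N s) (?N s)) + (?f s + ?H s \<bullet> V s) + ?fb s) \<le>
     (LBINT s:{0..T}. ?f s + ?fb s + P s \<bullet> outer (?N s) (?N s))"
  proof (rule bmf_integral_mono)
    show "bmf (\<lambda>s. ((?L s - ?H s) \<bullet> V s + P s \<bullet> outer (?N s) (?N s)) + (?f s + ?H s \<bullet> V s) + ?fb s)"
      by (intro bmf_add bf bmf_inner[OF bH V_bmf] bN) (rule bmf_inner[OF bmf_diff V_bmf], (intro bmf_intros b bq)+)
    show "bmf (\<lambda>s. ?f s + ?fb s + P s \<bullet> outer (?N s) (?N s))" by (intro bmf_add bf bN)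
    fix s assume s: "s \<in> {0..T}"
    have "?L s \<bullet> V s \<le> 0" by (rule inner_V_nonpos[OF s neg])
    then show "((?L s - ?H s) \<bullet> V s + P s \<bullet> outer (?N s) (?N s)) + (?f s + ?H s \<bullet> V s) + ?fb s \<le> ?f s + ?fb s + P s \<bullet> outer (?N s) (?N s)"
      by (simp only: inner_diff_left)
  qed
  have e4: "((G + Gb) *v y T) \<bullet> y T = (G *v y T) \<bullet> y T + (Gb *v y T) \<bullet> y T"
    by (simp add: matrix_vector_mult_add_rdistrib inner_add_left)
  show ?thesis unfolding detq e1 e4 using e2 e3 GV by linarith
qed

end

section \<open>Deterministic coercivity\<close>

abbreviation sbm :: "real => (real => 'a::real_normed_vector) => bool" where
  "sbm T f \<equiv> set_borel_measurable lborel {0..T} f"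

lemma sbm_borel: "f \<in> borel_measurable borel ==> sbm T f" for f :: "real => 'a::euclidean_space"
  unfolding set_borel_measurable_def by measurable

lemma sbm_bilinear:
  fixes h :: "'a::euclidean_space => 'b::euclidean_space => 'c::euclidean_space"
  assumes h: "bounded_bilinear h" and "sbm T f" "sbm T g"
  shows "sbm T (\<lambda>s. h (f s) (g s))"
proof -
  interpret bounded_bilinear h by fact
  have "(\<lambda>s. h (indicator {0..T} s *\<^sub>R f s) (indicator {0..T} s *\<^sub>R g s)) \<in> borel_measurable lborel"
    by (rule bilinear_measurable[OF h]) (use assms in \<open>auto simp: set_borel_measurable_def\<close>)
  moreover have "(\<lambda>s. h (indicator {0..T} s *\<^sub>R f s) (indicator {0..T} s *\<^sub>R g s)) = (\<lambda>s. indicator {0..T} s *\<^sub>R h (f s) (g s))"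
    by (auto simp: indicator_def fun_eq_iff zero_left zero_right)
  ultimately show ?thesis by (simp add: set_borel_measurable_def)
qed

lemma sbm_add: "sbm T f ==> sbm T g ==> sbm T (\<lambda>s. f s + g s)" for f :: "real => 'a::euclidean_space"
  unfolding set_borel_measurable_def scaleR_add_right by (rule borel_measurable_add)

lemma sbm_cong: "(\<And>s. s \<in> {0..T} ==> f s = g s) ==> sbm T g ==> sbm T f"
proof -
  assume "\<And>s. s \<in> {0..T} ==> f s = g s" and g: "sbm T g"
  then have "(\<lambda>s. indicator {0..T} s *\<^sub>R f s) = (\<lambda>s. indicator {0..T} s *\<^sub>R g s)" by (auto simp: indicator_def fun_eq_iff)
  with g show "sbm T f" by (simp add: set_borel_measurable_def)
qed

text \<open>Measurability of both sides is bundled with the almost-everywhere equality: the relation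
  then propagates along sums and bilinear expressions and still yields equal integrals.\<close>

definition eq_ae :: "real => (real => 'a::euclidean_space) => (real => 'a) => bool" where
  "eq_ae T f f' \<longleftrightarrow> sbm T f \<and> sbm T f' \<and> (AE t in lborel. t \<in> {0..T} \<longrightarrow> f t = f' t)"

lemma eq_ae_bilinear:
  fixes h :: "'a::euclidean_space => 'b::euclidean_space => 'c::euclidean_space"
  assumes h: "bounded_bilinear h" and f: "eq_ae T f f'" and g: "eq_ae T g g'"
  shows "eq_ae T (\<lambda>s. h (f s) (g s)) (\<lambda>s. h (f' s) (g' s))"
  unfolding eq_ae_def
proof (intro conjI)
  have "AE t in lborel. t \<in> {0..T} \<longrightarrow> f t = f' t" "AE t in lborel. t \<in> {0..T} \<longrightarrow> g t = g' t"
    using f g by (auto simp: eq_ae_def)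
  then show "AE t in lborel. t \<in> {0..T} \<longrightarrow> h (f t) (g t) = h (f' t) (g' t)" by eventually_elim simp
qed (use f g in \<open>auto simp: eq_ae_def intro: sbm_bilinear[OF h]\<close>)

lemma eq_ae_add:
  assumes f: "eq_ae T f f'" and g: "eq_ae T g g'"
  shows "eq_ae T (\<lambda>s. f s + g s) (\<lambda>s. f' s + g' s)"
  unfolding eq_ae_def
proof (intro conjI)
  have "AE t in lborel. t \<in> {0..T} \<longrightarrow> f t = f' t" "AE t in lborel. t \<in> {0..T} \<longrightarrow> g t = g' t"
    using f g by (auto simp: eq_ae_def)
  then show "AE t in lborel. t \<in> {0..T} \<longrightarrow> f t + g t = f' t + g' t" by eventually_elim simp
qed (use f g in \<open>auto simp: eq_ae_def intro: sbm_add\<close>)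

lemma eq_ae_minus:
  assumes f: "eq_ae T f f'" shows "eq_ae T (\<lambda>s. - f s) (\<lambda>s. - f' s)"
proof -
  have 0: "eq_ae T (\<lambda>s. -1) (\<lambda>s. -1 :: real)" by (simp add: eq_ae_def sbm_borel)
  show ?thesis using eq_ae_bilinear[OF bounded_bilinear_scaleR 0 f] by simp
qed

lemma eq_ae_refl: "f \<in> borel_measurable borel ==> (\<And>t. t \<in> {0..T} ==> g t = f t) ==> eq_ae T g f"
  unfolding eq_ae_def using sbm_borel[of f T] sbm_cong[of T g f] by auto

lemmas eq_ae_mv = eq_ae_bilinear[OF bilinear_matrix_vector]
lemmas eq_ae_inner = eq_ae_bilinear[OF bounded_bilinear_inner]

lemma eq_ae_LINT:
  fixes f :: "real => 'a::euclidean_space"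
  assumes f: "eq_ae T f f'" and t: "t \<in> {0..T}"
  shows "(LBINT s:{0..t}. f s) = (LBINT s:{0..t}. f' s)"
proof -
  have 1: "(\<lambda>s. indicator {0..t} s *\<^sub>R g s) = (\<lambda>s. indicator {0..t} s *\<^sub>R (indicator {0..T} s *\<^sub>R g s))" for g :: "real => 'a"
    using t by (auto simp: indicator_def fun_eq_iff)
  have m: "(\<lambda>s. indicator {0..t} s *\<^sub>R g s) \<in> borel_measurable lborel" if "sbm T g" for g :: "real => 'a"
    by (subst 1) (rule borel_measurable_scaleR[OF _ that[unfolded set_borel_measurable_def]], simp)
  have "AE s in lborel. s \<in> {0..T} \<longrightarrow> f s = f' s" using f by (simp add: eq_ae_def)
  then have "AE s in lborel. indicator {0..t} s *\<^sub>R f s = indicator {0..t} s *\<^sub>R f' s"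
    by eventually_elim (use t in \<open>auto simp: indicator_def\<close>)
  then show ?thesis unfolding set_lebesgue_integral_def
    by (intro integral_cong_AE m) (use f in \<open>auto simp: eq_ae_def\<close>)
qed

lemma eq_ae_set_integrable:
  assumes f: "eq_ae T f f'" and i: "set_integrable lborel {0..T} f'"
  shows "set_integrable lborel {0..T} f"
  unfolding set_integrable_def
proof (rule integrable_cong_AE_imp[OF i[unfolded set_integrable_def]])
  show "(\<lambda>s. indicator {0..T} s *\<^sub>R f s) \<in> borel_measurable lborel" using f by (simp add: eq_ae_def set_borel_measurable_def)
  have "AE s in lborel. s \<in> {0..T} \<longrightarrow> f s = f' s" using f by (simp add: eq_ae_def)
  then show "AE s in lborel. indicator {0..T} s *\<^sub>R f' s = indicator {0..T} s *\<^sub>R f s"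
    by eventually_elim (auto simp: indicator_def)
qed

lemma eq_ae_q1:
  fixes Q :: "real => real^'n^'n" and S :: "real => real^'n^'m"
  assumes "eq_ae T Q Q'" "eq_ae T S S'" "eq_ae T R R'" "eq_ae T x x'" "eq_ae T v v'"
  shows "eq_ae T (\<lambda>s. q1 (Q s) (S s) (R s) (x s) (v s)) (\<lambda>s. q1 (Q' s) (S' s) (R' s) (x' s) (v' s))"
proof -
  have 2: "eq_ae T (\<lambda>s. 2) (\<lambda>s. 2 :: real)" by (rule eq_ae_refl) auto
  show ?thesis unfolding q1_def
    by (intro eq_ae_add eq_ae_inner eq_ae_mv eq_ae_bilinear[OF bounded_bilinear_mult 2] assms)
qed

text \<open>The state equation with the opponent's control and the initial value zero. Both players
  are instances, the second one with the signs of all weights reversed in the cost.\<close>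

definition state1 ::
  "'w measure => (real => 'w set set) => (real => 'w => real) => real
   => (real => real^'n^'n) => (real => real^'n^'n) => (real => real^'m^'n) => (real => real^'m^'n)
   => (real => real^'n^'n) => (real => real^'n^'n) => (real => real^'m^'n) => (real => real^'m^'n)
   => (real => 'w => real^'m) => (real => 'w => real^'n) => bool" where
  "state1 M F W T A Ab B Bb C Cb D Db u X \<longleftrightarrow>
     progressive M F T X \<and> sq_int M T X \<and>
     (\<forall>t\<in>{0..T}. integrable M (\<lambda>w. (norm (X t w))^2)) \<and>
     (let b = (\<lambda>s w. A s *v X s w + Ab s *v Ex M X s + B s *v u s w + Bb s *v Ex M u s);
          \<sigma> = (\<lambda>s w. C s *v X s w + Cb s *v Ex M X s + D s *v u s w + Db s *v Ex M u s)
      in (AE w in M. set_integrable lborel {0..T} (\<lambda>s. b s w)) \<and>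
         (\<exists>I. ito_integral M F W T \<sigma> I \<and>
            (\<forall>t\<in>{0..T}. AE w in M. X t w = (LBINT s:{0..t}. b s w) + I t w)))"

definition cost1 ::
  "'w measure => real => real^'n^'n => real^'n^'n
   => (real => real^'n^'n) => (real => real^'n^'m) => (real => real^'m^'m)
   => (real => real^'n^'n) => (real => real^'n^'m) => (real => real^'m^'m)
   => (real => 'w => real^'m) => (real => 'w => real^'n) => real" where
  "cost1 M T G Gb Q S R Qb Sb Rb u X =
     (\<integral>w. (G *v X T w) \<bullet> X T w + (Gb *v Ex M X T) \<bullet> Ex M X T
        + (LBINT s:{0..T}. q1 (Q s) (S s) (R s) (X s w) (u s w))
        + (LBINT s:{0..T}. q1 (Qb s) (Sb s) (Rb s) (Ex M X s) (Ex M u s)) \<partial>M)"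

lemma state_player1:
  "mf_state M F W T A Ab B1 B1b B2 B2b C Cb D1 D1b D2 D2b 0 u (\<lambda>s w. 0) X = state1 M F W T A Ab B1 B1b C Cb D1 D1b u X"
  by (simp add: mf_state_def state1_def Ex_def[of _ "\<lambda>s w. 0"])

lemma state_player2:
  "mf_state M F W T A Ab B1 B1b B2 B2b C Cb D1 D1b D2 D2b 0 (\<lambda>s w. 0) u X = state1 M F W T A Ab B2 B2b C Cb D2 D2b u X"
  by (simp add: mf_state_def state1_def Ex_def[of _ "\<lambda>s w. 0"])

lemma qform_player1: "qform Q S1 S2 R11 R12 R21 R22 x v 0 = q1 Q S1 R11 x v"
  by (simp add: qform_def q1_def inner_add_left inner_add_right dot_lmul_matrix inner_vm inner_commute)

lemma qform_player2: "qform Q S1 S2 R11 R12 R21 R22 x 0 v = q1 Q S2 R22 x v"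
  by (simp add: qform_def q1_def inner_add_left inner_add_right dot_lmul_matrix inner_vm inner_commute)

lemma cost_player1:
  "cost M T G Gb Q S1 S2 R11 R12 R21 R22 Qb S1b S2b R11b R12b R21b R22b u (\<lambda>s w. 0) X =
   cost1 M T G Gb Q S1 R11 Qb S1b R11b u X"
  by (simp add: cost_def cost1_def Ex_def[of _ "\<lambda>s w. 0"] qform_player1)

lemma cost_player2:
  "cost M T G Gb Q S1 S2 R11 R12 R21 R22 Qb S1b S2b R11b R12b R21b R22b (\<lambda>s w. 0) u X =
   cost1 M T G Gb Q S2 R22 Qb S2b R22b u X"
  by (simp add: cost_def cost1_def Ex_def[of _ "\<lambda>s w. 0"] qform_player2)

lemmas mv_minus = bounded_bilinear.minus_left[OF bilinear_matrix_vector]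

lemma q1_minus: "q1 (- Q) (- S) (- R) x v = - q1 Q S R x v"
  by (simp add: q1_def mv_minus)

lemma cost1_minus:
  "cost1 M T (- G) (- Gb) (\<lambda>s. - Q s) (\<lambda>s. - S s) (\<lambda>s. - R s) (\<lambda>s. - Qb s) (\<lambda>s. - Sb s) (\<lambda>s. - Rb s) u X =
   - cost1 M T G Gb Q S R Qb Sb Rb u X"
proof -
  have m: "(LBINT s:{0..T}. - f s) = - (LBINT s:{0..T}. f s)" for f :: "real => real"
    by (simp add: set_lebesgue_integral_def)
  have "- a + - b + - c + - d = - (a + b + c + d)" for a b c d :: real by simp
  then show ?thesis unfolding cost1_def q1_minus m mv_minus inner_minus_left by (simp only: integral_minus)
qed

lemma ito_integral_cong:
  assumes "ito_integral M F W T H I" "AE s in lborel. s \<in> {0..T} \<longrightarrow> (\<forall>w\<in>space M. H s w = H' s w)"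
  shows "ito_integral M F W T H' I"
proof -
  have "(\<integral>\<^sup>+w. (\<integral>\<^sup>+s\<in>{0..T}. ennreal ((norm (f s w - H s w))^2) \<partial>lborel) \<partial>M) =
      (\<integral>\<^sup>+w. (\<integral>\<^sup>+s\<in>{0..T}. ennreal ((norm (f s w - H' s w))^2) \<partial>lborel) \<partial>M)" for f
  proof (rule nn_integral_cong, rule nn_integral_cong_AE)
    fix w assume "w \<in> space M"
    then show "AE s in lborel. ennreal ((norm (f s w - H s w))^2) * indicator {0..T} s =
        ennreal ((norm (f s w - H' s w))^2) * indicator {0..T} s"
      using assms(2) by (auto elim!: eventually_mono simp: indicator_def)
  qed
  then show ?thesis using assms(1) unfolding ito_integral_def by simp
qed

context brownian_T begin

text \<open>The stochastic hypothesis becomes a deterministic one: every pair \<open>(y, u)\<close>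
  that solves the mean equation from zero is realised by a state process whose cost is at most the
  completed deterministic cost. Primed coefficients are Borel versions. \<open>F\<close> and
  \<open>P\<close> stay abstract so that player 2 can enter with \<open>- P\<close> and reversed
  weights.\<close>

lemma one_player_coercive:
  fixes A Ab C Cb Q Qb A' Ab' C' Cb' Q' Qb' P P' :: "real => real^'n^'n"
    and B Bb D Db B' Bb' D' Db' :: "real => real^'m^'n" and S Sb S' Sb' F :: "real => real^'n^'m"
    and R Rb R' Rb' :: "real => real^'m^'m" and G Gb :: "real^'n^'n"
  assumes H: "\<And>u X. admissible M (aug_filtration M W) T u ==>
      state1 M (aug_filtration M W) W T A Ab B Bb C Cb D Db u X ==> \<alpha> * sq_norm M T u \<le> cost1 M T G Gb Q S R Qb Sb Rb u X"
    and \<alpha>: "0 < \<alpha>"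
    and eq: "eq_ae T A A'" "eq_ae T Ab Ab'" "eq_ae T C C'" "eq_ae T Cb Cb'" "eq_ae T B B'" "eq_ae T Bb Bb'"
      "eq_ae T D D'" "eq_ae T Db Db'" "eq_ae T Q Q'" "eq_ae T Qb Qb'" "eq_ae T S S'" "eq_ae T Sb Sb'"
      "eq_ae T R R'" "eq_ae T Rb Rb'"
    and b: "bmf A'" "bmf Ab'" "bmf C'" "bmf Cb'" "bmf B'" "bmf Bb'" "bmf D'" "bmf Db'" "bmf F" "bmf y" "bmf u"
    and bq: "bmf Q'" "bmf Qb'" "bmf S'" "bmf Sb'" "bmf R'" "bmf Rb'" "bmf P" "bmf P'"
    and sym: "\<And>s. tr (Q' s) = Q' s" "\<And>s. tr (R' s) = R' s" "\<And>s. tr (P s) = P s"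
    and P: "prim_on T P P'" "P T = G"
    and neg: "\<And>s z. z \<bullet> ((P' s + P s ** (A' s + B' s ** F s) + tr (A' s + B' s ** F s) ** P s
        + tr (C' s + D' s ** F s) ** P s ** (C' s + D' s ** F s)
        + (Q' s + tr (F s) ** S' s + tr (S' s) ** F s + tr (F s) ** R' s ** F s)) *v z) \<le> 0"
    and y: "y 0 = 0" "prim_on T y (\<lambda>s. (A' s + Ab' s) *v y s + (B' s + Bb' s) *v u s)"
  shows "\<alpha> * (LBINT s:{0..T}. (norm (u s))^2) \<le>
     ((G + Gb) *v y T) \<bullet> y T + (LBINT s:{0..T}.
        q1 (Q' s + Qb' s + tr (C' s + Cb' s) ** P s ** (C' s + Cb' s))
           (S' s + Sb' s + tr (D' s + Db' s) ** P s ** (C' s + Cb' s))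
           (R' s + Rb' s + tr (D' s + Db' s) ** P s ** (D' s + Db' s)) (y s) (u s))"
proof -
  obtain K L ga gc gv \<delta> where "euler_scheme M W T (\<lambda>s. A' s + B' s ** F s) (\<lambda>s. C' s + D' s ** F s)
      (\<lambda>s. (C' s + Cb' s) *v y s + (D' s + Db' s) *v u s) K L ga gc gv \<delta>"
    using euler_scheme_exists[of "\<lambda>s. A' s + B' s ** F s" "\<lambda>s. C' s + D' s ** F s" "\<lambda>s. (C' s + Cb' s) *v y s + (D' s + Db' s) *v u s"]
      bmf_add[OF b(1) bmf_mm[OF b(5) b(9)]] bmf_add[OF b(3) bmf_mm[OF b(7) b(9)]]
      bmf_add[OF bmf_mv[OF bmf_add[OF b(3,4)] b(10)] bmf_mv[OF bmf_add[OF b(7,8)] b(11)]] by metis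
  then interpret feedback M W T A' Ab' C' Cb' B' Bb' D' Db' F y u K L ga gc gv \<delta>
    by (simp add: feedback_def feedback_axioms_def b y)
  let ?F = "aug_filtration M W"
  have m1: "bmf (\<lambda>s. mat 1 :: real^'n^'n)" by (rule bmf_const)
  have T: "T \<in> {0..T}" using Tpos by simp
  have EX: "Ex M Xf s = y s" "Ex M uf s = u s" if "s \<in> {0..T}" for s
    using aff_expectation[OF that] by (simp_all add: Ex_def)
  have eX: "eq_ae T (Ex M Xf) y" "eq_ae T (Ex M uf) u"
    by (rule eq_ae_refl[OF bmf_measurable[OF b(10)]], simp add: EX) (rule eq_ae_refl[OF bmf_measurable[OF b(11)]], simp add: EX)
  have sX: "eq_ae T (\<lambda>s. Xf s w) (\<lambda>s. Xf s w)" "eq_ae T (\<lambda>s. uf s w) (\<lambda>s. uf s w)" if "w \<in> space M" for w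
    by (rule eq_ae_refl[OF aff_section[OF _ _ that]], use b m1 in simp_all)+
  let ?b = "\<lambda>s w. A s *v Xf s w + Ab s *v Ex M Xf s + B s *v uf s w + Bb s *v Ex M uf s"
  let ?b' = "\<lambda>s w. A' s *v Xf s w + Ab' s *v y s + B' s *v uf s w + Bb' s *v u s"
  let ?\<sigma> = "\<lambda>s w. C s *v Xf s w + Cb s *v Ex M Xf s + D s *v uf s w + Db s *v Ex M uf s"
  have be: "eq_ae T (\<lambda>s. ?b s w) (\<lambda>s. ?b' s w)" if "w \<in> space M" for w
    by (intro eq_ae_add eq_ae_mv eq eX sX that)
  have "state1 M ?F W T A Ab B Bb C Cb D Db uf Xf"
    unfolding state1_def Let_def
  proof (intro conjI ballI)
    show "progressive M ?F T Xf" "sq_int M T Xf" by (intro aff_progressive aff_sq_int b m1)+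
    show "integrable M (\<lambda>w. (norm (Xf t w))^2)" if "t \<in> {0..T}" for t by (rule L2_int[OF aff_L2[OF that]])
    show "AE w in M. set_integrable lborel {0..T} (\<lambda>s. ?b s w)"
      using state_drift AE_space by eventually_elim (rule eq_ae_set_integrable[OF be])
    show "\<exists>I. ito_integral M ?F W T ?\<sigma> I \<and> (\<forall>t\<in>{0..T}. AE w in M. Xf t w = (LBINT s:{0..t}. ?b s w) + I t w)"
    proof (intro exI conjI ballI)
      have "AE s in lborel. s \<in> {0..T} \<longrightarrow> C s = C' s" "AE s in lborel. s \<in> {0..T} \<longrightarrow> Cb s = Cb' s"
        "AE s in lborel. s \<in> {0..T} \<longrightarrow> D s = D' s" "AE s in lborel. s \<in> {0..T} \<longrightarrow> Db s = Db' s"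
        using eq by (auto simp: eq_ae_def)
      then have "AE s in lborel. s \<in> {0..T} \<longrightarrow>
          (\<forall>w\<in>space M. C' s *v Xf s w + Cb' s *v y s + D' s *v uf s w + Db' s *v u s = ?\<sigma> s w)"
        by eventually_elim (simp add: EX)
      then show "ito_integral M ?F W T ?\<sigma> It" by (rule ito_integral_cong[OF state_ito])
      fix t assume t: "t \<in> {0..T}"
      show "AE w in M. Xf t w = (LBINT s:{0..t}. ?b s w) + It t w"
        using state_eq[OF t] AE_space by eventually_elim (simp add: eq_ae_LINT[OF be t])
    qed
  qed
  then have "\<alpha> * sq_norm M T uf \<le> cost1 M T G Gb Q S R Qb Sb Rb uf Xf"
    by (rule H[OF aff_admissible[OF b(11,9)]])
  also have "\<dots> = expectation (\<lambda>w. (G *v Xf T w) \<bullet> Xf T w + (Gb *v y T) \<bullet> y T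
        + (LBINT s:{0..T}. q1 (Q' s) (S' s) (R' s) (Xf s w) (uf s w))
        + (LBINT s:{0..T}. q1 (Qb' s) (Sb' s) (Rb' s) (y s) (u s)))"
    unfolding cost1_def EX[OF T]
  proof (rule Bochner_Integration.integral_cong[OF refl])
    fix w assume w: "w \<in> space M"
    show "(G *v Xf T w) \<bullet> Xf T w + (Gb *v y T) \<bullet> y T
        + (LBINT s:{0..T}. q1 (Q s) (S s) (R s) (Xf s w) (uf s w))
        + (LBINT s:{0..T}. q1 (Qb s) (Sb s) (Rb s) (Ex M Xf s) (Ex M uf s)) =
      (G *v Xf T w) \<bullet> Xf T w + (Gb *v y T) \<bullet> y T
        + (LBINT s:{0..T}. q1 (Q' s) (S' s) (R' s) (Xf s w) (uf s w))
        + (LBINT s:{0..T}. q1 (Qb' s) (Sb' s) (Rb' s) (y s) (u s))"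
      using eq_ae_LINT[OF eq_ae_q1[OF eq(9,11,13) sX[OF w]] T] eq_ae_LINT[OF eq_ae_q1[OF eq(10,12,14) eX] T] by simp
  qed
  also note cost_bound[OF bq sym P neg]
  finally have "\<alpha> * sq_norm M T uf \<le> ((G + Gb) *v y T) \<bullet> y T + (LBINT s:{0..T}.
        q1 (Q' s + Qb' s + tr (C' s + Cb' s) ** P s ** (C' s + Cb' s))
           (S' s + Sb' s + tr (D' s + Db' s) ** P s ** (C' s + Cb' s))
           (R' s + Rb' s + tr (D' s + Db' s) ** P s ** (D' s + Db' s)) (y s) (u s))" .
  moreover have "\<alpha> * (LBINT s:{0..T}. (norm (u s))^2) \<le> \<alpha> * sq_norm M T uf"
    using sq_norm_uf \<alpha> by (intro mult_left_mono) auto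
  ultimately show ?thesis by linarith
qed

end

section \<open>Needle variations and pointwise coercivity\<close>

lemma prim_on_gronwall:
  fixes y :: "real => 'a::euclidean_space"
  assumes y: "prim_on T y g" and c: "0 < c" and g: "\<And>s. s \<in> {0..T} ==> norm (g s) \<le> c * norm (y s) + \<phi> s"
    and \<phi>: "bmf \<phi>" "\<And>s. 0 \<le> \<phi> s" and m: "norm (y 0) + (LBINT s:{0..T}. \<phi> s) \<le> m" and t: "t \<in> {0..T}"
  shows "norm (y t) \<le> 2 * m * exp (2 * c * T)"
proof -
  have by': "bmf (\<lambda>s. norm (ext0T T y s))" by (intro bmf_norm bmf_ext0T prim_on_continuous[OF y])
  have le: "norm (ext0T T y t) \<le> m + c * (LBINT s:{0..t}. norm (ext0T T y s))" if t: "t \<in> {0..T}" for t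
  proof -
    have "norm (LBINT s:{0..t}. g s) \<le> (LBINT s:{0..t}. norm (g s))"
      by (rule set_integral_norm_bound[OF bmf_set_integrable[OF prim_on_bmf[OF y]]])
    also have "\<dots> \<le> (LBINT s:{0..t}. c * norm (ext0T T y s) + \<phi> s)"
      by (rule bmf_integral_mono)
        (use t g in \<open>auto intro!: bmf_norm prim_on_bmf[OF y] bmf_add bmf_mult bmf_const by'[unfolded norm_conv_dist] \<phi> bmf_ext0T prim_on_continuous[OF y]\<close>)
    also have "\<dots> = c * (LBINT s:{0..t}. norm (ext0T T y s)) + (LBINT s:{0..t}. \<phi> s)"
      by (simp add: bmf_integral_add bmf_mult bmf_const by' \<phi>)
    finally have 1: "norm (LBINT s:{0..t}. g s) \<le> \<dots>" .
    have 2: "(LBINT s:{0..t}. \<phi> s) \<le> (LBINT s:{0..T}. \<phi> s)"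
      by (rule bmf_integral_mono_set[OF \<phi>]) (use t in auto)
    have "norm (y t) \<le> norm (y 0) + norm (LBINT s:{0..t}. g s)"
      unfolding prim_onD[OF y t] by (rule norm_triangle_ineq)
    then show ?thesis using 1 2 m t by simp
  qed
  have "0 \<le> (LBINT s:{0..T}. \<phi> s)" by (rule bmf_integral_nonneg[OF \<phi>])
  then have m0: "0 \<le> m" using m norm_ge_zero[of "y 0"] by linarith
  have "norm (ext0T T y t) \<le> 2 * m * exp (2 * c * t)" by (rule gronwall[OF by' c m0 le t])
  also have "\<dots> \<le> 2 * m * exp (2 * c * T)" using m0 c t by (intro mult_left_mono) auto
  finally show ?thesis using t by simp
qed

lemma prim_on_zero:
  fixes y :: "real => 'a::euclidean_space"
  assumes y: "prim_on T y g" and g: "\<And>s. s \<in> {0..T} ==> norm (g s) \<le> c * norm (y s)" and y0: "y 0 = 0" and t: "t \<in> {0..T}"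
  shows "y t = 0"
proof -
  have "norm (y t) \<le> 2 * 0 * exp (2 * (max c 1) * T)"
  proof (rule prim_on_gronwall[OF y _ _ bmf_const _ _ t])
    show "norm (g s) \<le> max c 1 * norm (y s) + 0" if "s \<in> {0..T}" for s
      using order_trans[OF g[OF that] mult_right_mono[OF max.cobounded1[of c 1] norm_ge_zero]] by simp
  qed (use y0 in auto)
  then show ?thesis by simp
qed

lemma linear_ode_exists:
  fixes A :: "real => real^'n^'n"
  assumes T: "0 \<le> T" and A: "bmf A" and f: "bmf f"
  obtains y where "bmf y" "y 0 = x0" "prim_on T y (\<lambda>s. A s *v y s + f s)"
proof -
  obtain K where K: "0 < K" "\<And>s. norm (A s) \<le> K" using bmf_bound[OF A] by metis
  show thesis
  proof (rule ode_exists[OF T _ K(1), of "\<lambda>s x. A s *v x + f s" x0])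
    show "bmf (\<lambda>s. A s *v y s + f s)" if "bmf y" for y by (intro bmf_add bmf_mv A f that)
    show "norm (A s *v x + f s - (A s *v y + f s)) \<le> K * norm (x - y)" for s x y
      using norm_mv_le[OF K(2), of s "x - y"] by (simp add: matrix_vector_mult_diff_distrib)
  qed (rule that)
qed

text \<open>A control equal to \<open>v\<close> on \<open>E\<close> moves the state by at most a
  multiple of the measure of \<open>E\<close>. All terms containing the state are therefore
  quadratic in that measure, while the pure control term is linear.\<close>

lemma spike_estimate:
  fixes A Q :: "real => real^'n^'n" and B :: "real => real^'m^'n" and S :: "real => real^'n^'m" and R :: "real => real^'m^'m"
  assumes T: "0 < T" and b: "bmf A" "bmf B" "bmf Q" "bmf S" "bmf R"
    and H: "\<And>u y. bmf u ==> bmf y ==> y 0 = 0 ==> prim_on T y (\<lambda>s. A s *v y s + B s *v u s) ==>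
      \<alpha> * (LBINT s:{0..T}. (norm (u s))^2) \<le> (G *v y T) \<bullet> y T + (LBINT s:{0..T}. q1 (Q s) (S s) (R s) (y s) (u s))"
  obtains c where "0 < c" "\<And>E. E \<in> sets borel ==> E \<subseteq> {0..T} ==>
      \<forall>t\<in>E. (R t *v v) \<bullet> v \<le> \<alpha> * (v \<bullet> v) - e ==> e * measure lborel E \<le> c * (measure lborel E)^2"
proof -
  obtain KA where KA: "0 < KA" "\<And>s. norm (A s) \<le> KA" using bmf_bound[OF b(1)] by metis
  obtain KB where KB: "0 < KB" "\<And>s. norm (B s) \<le> KB" using bmf_bound[OF b(2)] by metis
  obtain KQ where KQ: "0 < KQ" "\<And>s. norm (Q s) \<le> KQ" using bmf_bound[OF b(3)] by metis
  obtain KS where KS: "0 < KS" "\<And>s. norm (S s) \<le> KS" using bmf_bound[OF b(4)] by metis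
  \<comment> \<open>By Gronwall the state is at most \<open>k\<close> times the measure of
    \<open>E\<close>; \<open>c\<close> then collects the quadratic terms, with 1 added to make it
    positive.\<close>
  define k where "k = 2 * (KB * norm v) * exp (2 * KA * T)"
  have k0: "0 \<le> k" using KB by (simp add: k_def)
  define c where "c = norm G * k^2 + KQ * k^2 * T + 2 * (KS * k * norm v) + 1"
  have c0: "0 < c" unfolding c_def using KQ KS T k0 by (intro add_nonneg_pos add_nonneg_nonneg mult_nonneg_nonneg) auto
  have "e * measure lborel E \<le> c * (measure lborel E)^2"
    if E: "E \<in> sets borel" "E \<subseteq> {0..T}" and le: "\<forall>t\<in>E. (R t *v v) \<bullet> v \<le> \<alpha> * (v \<bullet> v) - e" for E
  proof -
    let ?m = "measure lborel E"
    define u where "u s = indicator E s *\<^sub>R v" for s :: real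
    have bi: "bmf (indicator E :: real => real)" by (rule bmf_indicator[OF E(1)])
    have bu: "bmf u" unfolding u_def[abs_def] by (intro bmf_scaleR bi bmf_const)
    obtain y where y: "bmf y" "y 0 = 0" "prim_on T y (\<lambda>s. A s *v y s + B s *v u s)"
      by (rule linear_ode_exists[of T A "\<lambda>s. B s *v u s" 0]) (use T b bu in \<open>auto intro: bmf_mv\<close>)
    have int0: "(LBINT s:{0..T}. indicator E s) = ?m"
    proof -
      have "(\<lambda>s. indicator {0..T} s *\<^sub>R indicator E s) = (indicator E :: real => real)"
        using E(2) by (auto simp: indicator_def fun_eq_iff)
      then show ?thesis by (simp only: set_lebesgue_integral_def) simp
    qed
    have int: "(LBINT s:{0..T}. C * indicator E s) = C * ?m" for C by (simp only: set_integral_mult_right int0)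
    have yb: "norm (y t) \<le> k * ?m" if t: "t \<in> {0..T}" for t
    proof -
      have "norm (y t) \<le> 2 * (KB * norm v * ?m) * exp (2 * KA * T)"
      proof (rule prim_on_gronwall[OF y(3) KA(1) _ _ _ _ t])
        show "norm (A s *v y s + B s *v u s) \<le> KA * norm (y s) + KB * norm v * indicator E s" for s
          using norm_triangle_ineq[of "A s *v y s" "B s *v u s"] norm_mv_le[OF KA(2), of s "y s"] norm_mv_le[OF KB(2), of s "u s"]
          by (auto simp: u_def indicator_def split: if_splits)
        show "bmf (\<lambda>s. KB * norm v * indicator E s)" by (intro bmf_mult bmf_const bi)
      qed (use KB y(2) in \<open>auto simp: int0\<close>)
      then show ?thesis by (simp add: k_def mult_ac)
    qed
    have b2: "x \<bullet> y \<le> X * Y" if "norm x \<le> X" "norm y \<le> Y" for x y :: "'z::real_inner" and X Y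
      using norm_cauchy_schwarz[of x y] mult_mono[OF that] norm_ge_zero[of x] norm_ge_zero[of y] that by linarith
    have km: "0 \<le> k * ?m" using k0 by simp
    have "\<alpha> * (LBINT s:{0..T}. (norm (u s))^2) = (\<alpha> * (v \<bullet> v)) * ?m"
    proof -
      have "(\<lambda>s. (norm (u s))^2) = (\<lambda>s. (v \<bullet> v) * indicator E s)"
        by (auto simp: u_def indicator_def power2_norm_eq_inner fun_eq_iff)
      then show ?thesis using int[of "v \<bullet> v"] by simp
    qed
    moreover have "(G *v y T) \<bullet> y T \<le> (norm G * (k * ?m)) * (k * ?m)"
    proof -
      have yT: "norm (y T) \<le> k * ?m" using yb[of T] T by simp
      have "norm (G *v y T) \<le> norm G * (k * ?m)"
        by (rule order_trans[OF norm_mv]) (use yT in \<open>auto intro: mult_left_mono\<close>)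
      from b2[OF this yT] show ?thesis .
    qed
    moreover have "(LBINT s:{0..T}. q1 (Q s) (S s) (R s) (y s) (u s)) \<le>
        KQ * (k * ?m) * (k * ?m) * T + (2 * (KS * (k * ?m) * norm v) + (\<alpha> * (v \<bullet> v) - e)) * ?m"
    proof -
      have "(LBINT s:{0..T}. q1 (Q s) (S s) (R s) (y s) (u s)) \<le>
          (LBINT s:{0..T}. KQ * (k * ?m) * (k * ?m) + (2 * (KS * (k * ?m) * norm v) + (\<alpha> * (v \<bullet> v) - e)) * indicator E s)"
      proof (rule bmf_integral_mono)
        show "bmf (\<lambda>s. q1 (Q s) (S s) (R s) (y s) (u s))" by (intro bmf_q1 b y bu)
        show "bmf (\<lambda>s. KQ * (k * ?m) * (k * ?m) + (2 * (KS * (k * ?m) * norm v) + (\<alpha> * (v \<bullet> v) - e)) * indicator E s)"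
          by (intro bmf_add bmf_mult bmf_const bi)
        fix s assume s: "s \<in> {0..T}"
        have 1: "norm (Q s *v y s) \<le> KQ * (k * ?m)" "norm (S s *v y s) \<le> KS * (k * ?m)"
          by (rule order_trans[OF norm_mv_le[OF KQ(2)] mult_left_mono[OF yb[OF s] less_imp_le[OF KQ(1)]]])
            (rule order_trans[OF norm_mv_le[OF KS(2)] mult_left_mono[OF yb[OF s] less_imp_le[OF KS(1)]]])
        have 2: "(Q s *v y s) \<bullet> y s \<le> KQ * (k * ?m) * (k * ?m)" by (rule b2[OF 1(1) yb[OF s]])
        show "q1 (Q s) (S s) (R s) (y s) (u s) \<le> KQ * (k * ?m) * (k * ?m) + (2 * (KS * (k * ?m) * norm v) + (\<alpha> * (v \<bullet> v) - e)) * indicator E s"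
        proof (cases "s \<in> E")
          case True
          have "(S s *v y s) \<bullet> v \<le> KS * (k * ?m) * norm v" by (rule b2[OF 1(2)]) simp
          moreover have "(R s *v v) \<bullet> v \<le> \<alpha> * (v \<bullet> v) - e" using le True by blast
          ultimately show ?thesis using 2 True by (simp add: q1_def u_def)
        qed (use 2 in \<open>simp add: q1_def u_def\<close>)
      qed
      also have "\<dots> = KQ * (k * ?m) * (k * ?m) * T + (2 * (KS * (k * ?m) * norm v) + (\<alpha> * (v \<bullet> v) - e)) * ?m"
        using T by (subst bmf_integral_add) (simp_all only: int bmf_integral_const less_imp_le diff_zero bmf_const bmf_mult bi)
      finally show ?thesis .
    qed
    ultimately have "(\<alpha> * (v \<bullet> v)) * ?m \<le> (norm G * (k * ?m)) * (k * ?m) + (KQ * (k * ?m) * (k * ?m) * T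
        + (2 * (KS * (k * ?m) * norm v) + (\<alpha> * (v \<bullet> v) - e)) * ?m)"
      using H[OF bu y] by linarith
    then have "e * ?m \<le> (c - 1) * ?m^2" by (simp add: c_def power2_eq_square algebra_simps)
    also have "\<dots> \<le> c * ?m^2" by (intro mult_right_mono) auto
    finally show ?thesis .
  qed
  with c0 show thesis by (rule that)
qed

text \<open>Where the inequality fails by \<open>e\<close> within an interval of length
  \<open>h = e / (2 * c)\<close>, the measure \<open>m\<close> of the failure set satisfies
  \<open>e * m \<le> c * m^2 \<le> e * m / 2\<close>, so \<open>m = 0\<close>. Countably many such
  intervals cover \<open>{0..T}\<close>.\<close>

lemma spike_coercive:
  fixes A Q :: "real => real^'n^'n" and B :: "real => real^'m^'n" and S :: "real => real^'n^'m" and R :: "real => real^'m^'m"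
  assumes T: "0 < T" and b: "bmf A" "bmf B" "bmf Q" "bmf S" "bmf R"
    and H: "\<And>u y. bmf u ==> bmf y ==> y 0 = 0 ==> prim_on T y (\<lambda>s. A s *v y s + B s *v u s) ==>
      \<alpha> * (LBINT s:{0..T}. (norm (u s))^2) \<le> (G *v y T) \<bullet> y T + (LBINT s:{0..T}. q1 (Q s) (S s) (R s) (y s) (u s))"
  shows "AE t in lborel. t \<in> {0..T} \<longrightarrow> (\<forall>v. \<alpha> * (v \<bullet> v) \<le> (R t *v v) \<bullet> v)"
proof -
  have null: "AE t in lborel. t \<in> {0..T} \<longrightarrow> \<alpha> * (v \<bullet> v) - e < (R t *v v) \<bullet> v" if e: "0 < e" for v and e :: real
  proof -
    obtain c where c: "0 < c" and est: "\<And>E. E \<in> sets borel ==> E \<subseteq> {0..T} ==>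
      \<forall>t\<in>E. (R t *v v) \<bullet> v \<le> \<alpha> * (v \<bullet> v) - e ==> e * measure lborel E \<le> c * (measure lborel E)^2"
      by (rule spike_estimate[OF T b H, where v = v and e = e]) auto
    define h where "h = e / (2 * c)"
    have h: "0 < h" using e c by (simp add: h_def)
    define E where "E i = {t \<in> {0..T} \<inter> {real i * h..real i * h + h}. (R t *v v) \<bullet> v \<le> \<alpha> * (v \<bullet> v) - e}" for i :: nat
    have E0: "E i \<in> null_sets lborel" for i
    proof -
      have m: "(\<lambda>t. (R t *v v) \<bullet> v) \<in> borel_measurable borel"
        by (rule bmf_measurable, intro bmf_inner bmf_mv bmf_const b)
      have "{t. (R t *v v) \<bullet> v \<le> \<alpha> * (v \<bullet> v) - e} \<in> sets borel"
        using borel_measurable_le[OF m borel_measurable_const, of "\<alpha> * (v \<bullet> v) - e"] by simp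
      moreover have "E i = {0..T} \<inter> {real i * h..real i * h + h} \<inter> {t. (R t *v v) \<bullet> v \<le> \<alpha> * (v \<bullet> v) - e}"
        by (auto simp: E_def)
      ultimately have Eb: "E i \<in> sets borel" by simp
      have sub: "E i \<subseteq> {real i * h..real i * h + h}" by (auto simp: E_def)
      have "emeasure lborel (E i) \<le> emeasure lborel {real i * h..real i * h + h}" by (rule emeasure_mono[OF sub]) simp
      also have "\<dots> = ennreal h" using h by simp
      finally have em: "emeasure lborel (E i) \<le> ennreal h" .
      then have fin: "emeasure lborel (E i) \<noteq> \<infinity>" by (metis ennreal_less_top infinity_ennreal_def leD)
      have ml: "measure lborel (E i) \<le> h" using em h by (simp add: measure_def enn2real_leI)
      have "e * measure lborel (E i) \<le> c * (measure lborel (E i))^2" by (rule est[OF Eb]) (auto simp: E_def)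
      also have "\<dots> \<le> c * (h * measure lborel (E i))"
        unfolding power2_eq_square using c ml by (intro mult_left_mono mult_right_mono) auto
      also have "\<dots> = e * measure lborel (E i) / 2" using c by (simp add: h_def)
      finally have "e * measure lborel (E i) \<le> 0" by simp
      then have "measure lborel (E i) = 0" using e measure_nonneg[of lborel "E i"] by (simp add: mult_le_0_iff)
      then have "emeasure lborel (E i) = 0" using fin by (simp add: emeasure_eq_ennreal_measure)
      then show ?thesis using Eb by auto
    qed
    then have "(\<Union>i. E i) \<in> null_sets lborel" by (rule null_sets_UN)
    then have "AE t in lborel. t \<notin> (\<Union>i. E i)" by (rule AE_not_in)
    then show ?thesis
    proof eventually_elim
      case (elim t)
      show ?case
      proof (rule impI, rule ccontr)
        assume t: "t \<in> {0..T}" and n: "\<not> \<alpha> * (v \<bullet> v) - e < (R t *v v) \<bullet> v"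
        define i where "i = nat \<lfloor>t / h\<rfloor>"
        have "0 \<le> t / h" using t h by simp
        then have "real i \<le> t / h" "t / h \<le> real i + 1" unfolding i_def by linarith+
        then have "real i * h \<le> t" "t \<le> real i * h + h" using h by (simp_all add: field_simps)
        then have "t \<in> E i" using t n by (simp add: E_def)
        then show False using elim by blast
      qed
    qed
  qed
  \<comment> \<open>The exceptional sets depend on \<open>v\<close> and \<open>e\<close>; a
    countable dense set of directions with slacks \<open>1 / real (Suc k)\<close> suffices because
    the limiting condition is closed in \<open>v\<close>.\<close>
  obtain D :: "(real^'m) set" where D: "countable D" "\<And>X. open X ==> X \<noteq> {} ==> \<exists>d\<in>D. d \<in> X"
    using countable_dense_exists by metis
  have "AE t in lborel. \<forall>v\<in>D. \<forall>k::nat. t \<in> {0..T} \<longrightarrow> \<alpha> * (v \<bullet> v) - 1 / real (Suc k) < (R t *v v) \<bullet> v"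
    unfolding AE_ball_countable[OF D(1)] AE_all_countable using null by simp
  then show ?thesis
  proof eventually_elim
    case (elim t)
    show ?case
    proof (intro impI)
      assume t: "t \<in> {0..T}"
      let ?C = "{v. \<alpha> * (v \<bullet> v) \<le> (R t *v v) \<bullet> v}"
      have "v \<in> ?C" if "v \<in> D" for v
      proof (rule CollectI, rule ccontr)
        assume "\<not> \<alpha> * (v \<bullet> v) \<le> (R t *v v) \<bullet> v"
        then obtain k where "1 / real (Suc k) < \<alpha> * (v \<bullet> v) - (R t *v v) \<bullet> v"
          using reals_Archimedean[of "\<alpha> * (v \<bullet> v) - (R t *v v) \<bullet> v"] by (auto simp: inverse_eq_divide)
        moreover have "\<alpha> * (v \<bullet> v) - 1 / real (Suc k) < (R t *v v) \<bullet> v" using elim that t by blast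
        ultimately show False by linarith
      qed
      moreover have "closed ?C"
        by (intro closed_Collect_le continuous_intros linear_continuous_on matrix_vector_mul_bounded_linear)
      ultimately have "- ?C = {}" using D(2)[of "- ?C"] by (auto simp: closed_def)
      then show "\<forall>v. \<alpha> * (v \<bullet> v) \<le> (R t *v v) \<bullet> v" by auto
    qed
  qed
qed

section \<open>Block matrices\<close>

definition vjoin :: "real^'m1 => real^'m2 => real^('m1::finite + 'm2::finite)" where
  "vjoin a b = (\<chi> k. case k of Inl i => a $ i | Inr j => b $ j)"

definition pl :: "real^('m1::finite + 'm2::finite) => real^'m1" where "pl w = (\<chi> i. w $ Inl i)"
definition pr :: "real^('m1::finite + 'm2::finite) => real^'m2" where "pr w = (\<chi> i. w $ Inr i)"

lemma vjoin_pl_pr [simp]: "vjoin (pl w) (pr w) = w"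
  by (simp add: vjoin_def pl_def pr_def vec_eq_iff split: sum.split)

lemma pl_vjoin [simp]: "pl (vjoin a b) = a" "pr (vjoin a b) = b"
  by (simp_all add: vjoin_def pl_def pr_def vec_eq_iff)

lemma vjoin_eq_iff: "vjoin a b = vjoin a' b' \<longleftrightarrow> a = a' \<and> b = b'"
  by (metis pl_vjoin)

lemma sum_UNIV_Plus: "(\<Sum>k\<in>UNIV. f k) = (\<Sum>i\<in>UNIV. f (Inl i)) + (\<Sum>j\<in>UNIV. f (Inr j))"
  for f :: "'a::finite + 'b::finite => real"
  using sum.Plus[of "UNIV :: 'a set" "UNIV :: 'b set" f] by (simp add: UNIV_Plus_UNIV comp_def)

lemma inner_vjoin: "vjoin a b \<bullet> vjoin c d = a \<bullet> c + b \<bullet> d"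
  by (simp add: inner_vec_def sum_UNIV_Plus vjoin_def)

lemma vjoin_add: "vjoin a b + vjoin c d = vjoin (a + c) (b + d)"
  by (simp add: vjoin_def vec_eq_iff split: sum.split)

lemma hcat_mv: "hcat X Y *v vjoin a b = X *v a + Y *v b"
  by (simp add: hcat_def vjoin_def matrix_vector_mult_def vec_eq_iff sum_UNIV_Plus)

lemma vcat_mv: "vcat X Y *v x = vjoin (X *v x) (Y *v x)"
  by (simp add: vcat_def vjoin_def matrix_vector_mult_def vec_eq_iff split: sum.split)

lemma block_mv: "block X11 X12 X21 X22 *v vjoin a b = vjoin (X11 *v a + X12 *v b) (X21 *v a + X22 *v b)"
  by (simp add: block_def vjoin_def matrix_vector_mult_def vec_eq_iff sum_UNIV_Plus split: sum.split)

lemma hcat_add: "hcat X Y + hcat X' Y' = hcat (X + X') (Y + Y')"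
  by (simp add: hcat_def vec_eq_iff split: sum.split)

lemma vcat_add: "vcat X Y + vcat X' Y' = vcat (X + X') (Y + Y')"
  by (simp add: vcat_def vec_eq_iff split: sum.split)

lemma block_add: "block X11 X12 X21 X22 + block Y11 Y12 Y21 Y22 = block (X11 + Y11) (X12 + Y12) (X21 + Y21) (X22 + Y22)"
  by (simp add: block_def vec_eq_iff split: sum.split)

lemma transpose_hcat: "tr (hcat X Y) = vcat (tr X) (tr Y)"
  by (simp add: hcat_def vcat_def transpose_def vec_eq_iff split: sum.split)

lemma transpose_vcat: "tr (vcat X Y) = hcat (tr X) (tr Y)"
  by (simp add: hcat_def vcat_def transpose_def vec_eq_iff split: sum.split)

lemma transpose_block: "tr (block X11 X12 X21 X22) = block (tr X11) (tr X21) (tr X12) (tr X22)"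
  by (simp add: block_def transpose_def vec_eq_iff split: sum.split)

lemma vcat_mm: "vcat X Y ** Z = vcat (X ** Z) (Y ** Z)"
  by (simp add: vcat_def matrix_matrix_mult_def vec_eq_iff split: sum.split)

lemma vcat_hcat: "vcat U V ** hcat X Y = block (U ** X) (U ** Y) (V ** X) (V ** Y)"
  by (simp add: vcat_def hcat_def block_def matrix_matrix_mult_def vec_eq_iff split: sum.split)

lemma congruence_block:
  "block R11 R12 R21 R22 + tr (hcat D1 D2) ** P ** hcat D1 D2 =
   block (R11 + tr D1 ** P ** D1) (R12 + tr D1 ** P ** D2)
         (R21 + tr D2 ** P ** D1) (R22 + tr D2 ** P ** D2)"
  unfolding transpose_hcat vcat_mm[of _ _ P] vcat_hcat block_add ..

definition mtop :: "real^'n^('m1::finite + 'm2::finite) => real^'n^'m1" where "mtop X = (\<chi> i. X $ Inl i)"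
definition mbot :: "real^'n^('m1::finite + 'm2::finite) => real^'n^'m2" where "mbot X = (\<chi> i. X $ Inr i)"

lemma mtop_mv: "mtop X *v z = pl (X *v z)" "mbot X *v z = pr (X *v z)"
  by (simp_all add: mtop_def mbot_def pl_def pr_def matrix_vector_mult_def vec_eq_iff)

lemma bounded_linear_finite: "linear f ==> bounded_linear f" for f :: "'a::euclidean_space => 'b::euclidean_space"
  by (simp add: linear_conv_bounded_linear)

lemma bmf_mtop: "bmf X ==> bmf (\<lambda>s. mtop (X s))" "bmf X ==> bmf (\<lambda>s. mbot (X s))"
  by (rule bmf_linear[OF bounded_linear_finite]; simp add: linear_iff mtop_def mbot_def vec_eq_iff)+

lemma bmf_pl: "bmf X ==> bmf (\<lambda>s. pl (X s))" "bmf X ==> bmf (\<lambda>s. pr (X s))"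
  by (rule bmf_linear[OF bounded_linear_finite]; simp add: linear_iff pl_def pr_def vec_eq_iff)+

lemma bmf_hcat: assumes "bmf X" "bmf Y" shows "bmf (\<lambda>s. hcat (X s) (Y s))"
proof -
  have "bmf (\<lambda>s. hcat (X s) 0 + hcat 0 (Y s))"
    by (intro bmf_add bmf_linear[OF _ assms(1), where B = "\<lambda>x. hcat x 0"] bmf_linear[OF _ assms(2), where B = "\<lambda>x. hcat 0 x"]
        bounded_linear_finite) (auto simp: linear_iff hcat_def vec_eq_iff split: sum.split)
  then show ?thesis by (simp add: hcat_add)
qed

lemma bmf_vcat: assumes "bmf X" "bmf Y" shows "bmf (\<lambda>s. vcat (X s) (Y s))"
proof -
  have "bmf (\<lambda>s. tr (hcat (tr (X s)) (tr (Y s))))" by (intro bmf_transpose bmf_hcat assms)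
  then show ?thesis by (simp add: transpose_hcat)
qed

lemma block_vcat: "block X11 X12 X21 X22 = vcat (hcat X11 X12) (hcat X21 X22)"
  by (simp add: block_def vcat_def hcat_def vec_eq_iff split: sum.split)

lemma bmf_block: "bmf X11 ==> bmf X12 ==> bmf X21 ==> bmf X22 ==> bmf (\<lambda>s. block (X11 s) (X12 s) (X21 s) (X22 s))"
  unfolding block_vcat by (intro bmf_vcat bmf_hcat)

text \<open>Quantitative injectivity: \<open>c\<close> bounds the inverse in operator norm, and on
  matrices with a common \<open>c\<close> the inverse is Lipschitz.\<close>

definition lower_bounded :: "real => real^'n^'n => bool" where
  "lower_bounded c A \<longleftrightarrow> (\<forall>x. norm x \<le> c * norm (A *v x))"

text \<open>Testing with \<open>vjoin a (- b)\<close> cancels the off-diagonal blocks and lets both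
  diagonal blocks count positively.\<close>

lemma saddle_lower_bounded:
  fixes S11 :: "real^'m1^'m1" and S22 :: "real^'m2^'m2"
  assumes \<alpha>: "0 < \<alpha>" and sym: "tr S12 = S21"
    and 1: "\<And>a. \<alpha> * (a \<bullet> a) \<le> (S11 *v a) \<bullet> a" and 2: "\<And>b. \<alpha> * (b \<bullet> b) \<le> - ((S22 *v b) \<bullet> b)"
  shows "lower_bounded (1 / \<alpha>) (block S11 S12 S21 S22)"
  unfolding lower_bounded_def
proof
  fix w :: "real^('m1 + 'm2)"
  define a b where "a = pl w" and "b = pr w"
  have w: "w = vjoin a b" by (simp add: a_def b_def)
  let ?s = "block S11 S12 S21 S22 *v w"
  have n: "norm (vjoin a (- b)) = norm w" by (simp add: w norm_eq_sqrt_inner inner_vjoin)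
  have "\<alpha> * (norm w)^2 \<le> (S11 *v a) \<bullet> a - (S22 *v b) \<bullet> b"
    unfolding power2_norm_eq_inner w inner_vjoin using 1[of a] 2[of b] by (simp add: algebra_simps)
  also have "\<dots> = ?s \<bullet> vjoin a (- b)"
  proof -
    have "(S21 *v a) \<bullet> b = (S12 *v b) \<bullet> a" unfolding sym[symmetric] by (simp add: dot_lmul_matrix inner_vm inner_commute)
    then show ?thesis by (simp add: w block_mv inner_vjoin inner_add_left)
  qed
  also have "\<dots> \<le> norm ?s * norm w" using norm_cauchy_schwarz[of ?s "vjoin a (- b)"] n by simp
  finally have "\<alpha> * norm w * norm w \<le> norm ?s * norm w" by (simp add: power2_eq_square)
  then have "\<alpha> * norm w \<le> norm ?s" by (cases "w = 0") auto
  then show "norm w \<le> 1 / \<alpha> * norm ?s" using \<alpha> by (simp add: field_simps)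
qed

lemma matrix_inv_mult:
  fixes A :: "real^'n^'n" assumes "invertible A" shows "matrix_inv A ** A = mat 1" "A ** matrix_inv A = mat 1"
proof -
  have "\<exists>A'. A ** A' = mat 1 \<and> A' ** A = mat 1" using assms by (simp add: invertible_def)
  from someI_ex[OF this] show "matrix_inv A ** A = mat 1" "A ** matrix_inv A = mat 1"
    unfolding matrix_inv_def by auto
qed

lemma inverse_transpose:
  fixes A B :: "real^'n^'n" assumes "A ** B = mat 1" "tr A = A" shows "tr B = B"
proof -
  have "tr B ** A = mat 1" using assms by (metis matrix_transpose_mul transpose_mat)
  moreover have "B ** A = mat 1" using assms(1) by (simp add: matrix_left_right_inverse)
  ultimately show ?thesis by (metis assms(1) matrix_mul_assoc matrix_mul_lid matrix_mul_rid)
qed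

lemma matrix_norm_le:
  fixes A :: "real^'n^'m"
  assumes "\<And>x. norm (A *v x) \<le> c * norm x"
  shows "norm A \<le> real CARD('m) * (real CARD('n) * c)"
proof -
  have e: "\<bar>A $ i $ j\<bar> \<le> c" for i j
  proof -
    have "A $ i $ j = (A *v axis j 1) $ i" by (simp add: matrix_vector_mult_basis column_def)
    then show ?thesis using component_le_norm_cart[of "A *v axis j 1" i] assms[of "axis j 1"] by simp
  qed
  have "norm (A $ i) \<le> real CARD('n) * c" for i
    using norm_le_l1_cart[of "A $ i"] sum_bounded_above[of UNIV "\<lambda>j. \<bar>A $ i $ j\<bar>" c] e by simp
  then have "(\<Sum>i\<in>UNIV. norm (A $ i)) \<le> real CARD('m) * (real CARD('n) * c)"
    using sum_bounded_above[of UNIV "\<lambda>i. norm (A $ i)" "real CARD('n) * c"] by simp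
  then show ?thesis using L2_set_le_sum[of UNIV "\<lambda>i. norm (A $ i)"] by (simp add: norm_vec_def[of A])
qed

lemma lower_bounded_inverse:
  fixes A :: "real^'n^'n"
  assumes "lower_bounded c A"
  shows "invertible A" "norm (matrix_inv A) \<le> real CARD('n) * (real CARD('n) * c)"
proof -
  have "x = 0" if "A *v x = 0" for x using assms that by (auto simp: lower_bounded_def dest: spec[of _ x])
  then show inv: "invertible A" by (simp add: invertible_left_inverse matrix_left_invertible_ker)
  show "norm (matrix_inv A) \<le> real CARD('n) * (real CARD('n) * c)"
  proof (rule matrix_norm_le)
    fix x
    have "norm (matrix_inv A *v x) \<le> c * norm (A *v (matrix_inv A *v x))" using assms by (simp add: lower_bounded_def)
    also have "A *v (matrix_inv A *v x) = x" by (simp add: matrix_vector_mul_assoc matrix_inv_mult[OF inv])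
    finally show "norm (matrix_inv A *v x) \<le> c * norm x" .
  qed
qed

text \<open>By \<open>matrix_inv A - matrix_inv B = matrix_inv A ** (B - A) ** matrix_inv B\<close>.
  The continuity is what makes inverses of Borel coefficients Borel.\<close>

lemma continuous_on_matrix_inv: "continuous_on {A. lower_bounded c A} (matrix_inv :: real^'n^'n => _)"
proof -
  interpret mm: bounded_bilinear "(**) :: real^'n^'n => real^'n^'n => _" by (rule bilinear_matrix_mult)
  from mm.nonneg_bounded obtain CM where CM: "CM \<ge> 0" "\<forall>(x :: real^'n^'n) (y :: real^'n^'n). norm (x ** y) \<le> norm x * norm y * CM"
    by (elim exE conjE) (rule that)
  define k where "k = max 0 (real CARD('n) * (real CARD('n) * c))"
  have lip: "norm (matrix_inv A - matrix_inv B) \<le> (k * k * CM * CM) * norm (A - B)"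
    if "lower_bounded c A" "lower_bounded c B" for A B :: "real^'n^'n"
  proof -
    note A = lower_bounded_inverse[OF that(1)] and B = lower_bounded_inverse[OF that(2)]
    have "matrix_inv A - matrix_inv B = matrix_inv A ** (B - A) ** matrix_inv B"
      by (simp add: mm.diff_left mm.diff_right matrix_mul_assoc[symmetric] matrix_inv_mult[OF B(1)])
        (simp add: matrix_mul_assoc matrix_inv_mult[OF A(1)])
    also have "norm \<dots> \<le> norm (matrix_inv A ** (B - A)) * norm (matrix_inv B) * CM" using CM(2) by blast
    also have "\<dots> \<le> (k * norm (A - B) * CM) * k * CM"
    proof (intro mult_mono order_trans[OF CM(2)[rule_format]])
      show "norm (matrix_inv A) \<le> k" "norm (matrix_inv B) \<le> k" using A(2) B(2) by (auto simp: k_def)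
    qed (use CM in \<open>auto simp: norm_minus_commute k_def\<close>)
    also have "\<dots> = (k * k * CM * CM) * norm (A - B)" by simp
    finally show ?thesis .
  qed
  have "(k * k * CM * CM)-lipschitz_on {A. lower_bounded c A} (matrix_inv :: real^'n^'n => _)"
    by (rule lipschitz_onI) (use lip CM in \<open>auto simp: dist_norm\<close>)
  then show ?thesis by (rule lipschitz_on_continuous_on)
qed

lemma bmf_matrix_inv:
  fixes F :: "real => real^'n^'n"
  assumes F: "bmf F" and c: "\<And>t. lower_bounded c (F t)"
  shows "bmf (\<lambda>t. matrix_inv (F t))"
proof (rule bmfI)
  show "norm (matrix_inv (F t)) \<le> real CARD('n) * (real CARD('n) * c)" for t by (rule lower_bounded_inverse[OF c])
  have "F \<in> measurable borel (restrict_space borel {A. lower_bounded c A})"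
    by (rule measurable_restrict_space2) (use c bmf_measurable[OF F] in auto)
  then show "(\<lambda>t. matrix_inv (F t)) \<in> borel_measurable borel"
    by (rule measurable_compose) (rule borel_measurable_continuous_on_restrict[OF continuous_on_matrix_inv])
qed

section \<open>Completion of squares in the Riccati equation\<close>

lemmas mm_minus = bounded_bilinear.minus_left[OF bilinear_matrix_mult] bounded_bilinear.minus_right[OF bilinear_matrix_mult]

text \<open>Expands the closed-loop expression in the gain and exposes a quadratic polynomial in
  \<open>F *v z\<close>, into which the saddle point will be inserted.\<close>

lemma feedback_form:
  fixes P A C Q :: "real^'n^'n" and B D :: "real^'m^'n" and S F :: "real^'n^'m"
  assumes P: "tr P = P"
  shows "z \<bullet> ((P' + P ** (A + B ** F) + tr (A + B ** F) ** P + tr (C + D ** F) ** P ** (C + D ** F)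
      + (Q + tr F ** S + tr S ** F + tr F ** R ** F)) *v z) =
    z \<bullet> ((P' + P ** A + tr A ** P + tr C ** P ** C + Q) *v z)
      + 2 * (((tr B ** P + tr D ** P ** C + S) *v z) \<bullet> (F *v z))
      + ((R + tr D ** P ** D) *v (F *v z)) \<bullet> (F *v z)"
  using symm_inner[OF P, of "B *v (F *v z)" z] symm_inner[OF P, of "D *v (F *v z)" "C *v z"]
  by (simp add: mv_expand dot_lmul_matrix inner_vm inner_commute algebra_simps)

text \<open>\<open>w\<close> is minus the saddle-point control at \<open>z\<close>; in these terms
  the Riccati equation says that the uncontrolled form equals the quadratic form of
  \<open>\<Sigma>\<close> at \<open>w\<close>.\<close>

lemma riccati_form:
  fixes P A C Q :: "real^'n^'n" and B D :: "real^'k^'n" and S :: "real^'n^'k"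
  assumes P: "tr P = P" and \<Sigma>: "\<Sigma> ** Iv = mat 1" and
    ric: "P' + P ** A + tr A ** P + tr C ** P ** C + Q - (P ** B + tr C ** P ** D + tr S)
        ** Iv ** (tr B ** P + tr D ** P ** C + S) = 0"
  shows "\<exists>w. \<Sigma> *v w = (tr B ** P + tr D ** P ** C + S) *v z \<and> w = Iv *v ((tr B ** P + tr D ** P ** C + S) *v z)
    \<and> z \<bullet> ((P' + P ** A + tr A ** P + tr C ** P ** C + Q) *v z) = (\<Sigma> *v w) \<bullet> w"
proof -
  define L where "L = tr B ** P + tr D ** P ** C + S"
  define w where "w = Iv *v (L *v z)"
  have \<Sigma>w: "\<Sigma> *v w = L *v z" by (simp add: w_def matrix_vector_mul_assoc \<Sigma> matrix_mul_assoc)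
  have tL: "tr L = P ** B + tr C ** P ** D + tr S"
    by (simp add: L_def linear_add[OF bounded_linear.linear[OF linear_transpose]] matrix_transpose_mul P matrix_mul_assoc)
  have "P' + P ** A + tr A ** P + tr C ** P ** C + Q = tr L ** Iv ** L"
    unfolding tL unfolding L_def using ric by simp
  then have "z \<bullet> ((P' + P ** A + tr A ** P + tr C ** P ** C + Q) *v z) = (L *v z) \<bullet> w"
    by (simp add: w_def mv_expand inner_vm inner_commute)
  then show ?thesis using \<Sigma>w by (intro exI[of _ w]) (simp add: L_def w_def)
qed

text \<open>With the gain of one player taken from the saddle point, the Riccati equation cancels everything but the diagonal block of
  the other player, whose sign is known.\<close>

lemma player_forms:
  fixes P A C Q :: "real^'n^'n" and B1 D1 :: "real^'m1^'n" and B2 D2 :: "real^'m2^'n" and S1 :: "real^'n^'m1" and S2 :: "real^'n^'m2"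
  assumes P: "tr P = P" and R12: "tr R12 = R21"
    and \<Sigma>: "(block R11 R12 R21 R22 + tr (hcat D1 D2) ** P ** hcat D1 D2) ** Iv = mat 1"
    and ric: "P' + P ** A + tr A ** P + tr C ** P ** C + Q - (P ** hcat B1 B2 + tr C ** P ** hcat D1 D2 + tr (vcat S1 S2))
        ** Iv ** (tr (hcat B1 B2) ** P + tr (hcat D1 D2) ** P ** C + vcat S1 S2) = 0"
  defines "K \<equiv> Iv ** (tr (hcat B1 B2) ** P + tr (hcat D1 D2) ** P ** C + vcat S1 S2)"
  defines "F1 \<equiv> - mtop K" and "F2 \<equiv> - mbot K"
  shows "z \<bullet> ((P' + P ** (A + B1 ** F1) + tr (A + B1 ** F1) ** P + tr (C + D1 ** F1) ** P ** (C + D1 ** F1)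
      + (Q + tr F1 ** S1 + tr S1 ** F1 + tr F1 ** R11 ** F1)) *v z) =
      ((R22 + tr D2 ** P ** D2) *v pr (K *v z)) \<bullet> pr (K *v z)" (is ?g1)
    "z \<bullet> ((P' + P ** (A + B2 ** F2) + tr (A + B2 ** F2) ** P + tr (C + D2 ** F2) ** P ** (C + D2 ** F2)
      + (Q + tr F2 ** S2 + tr S2 ** F2 + tr F2 ** R22 ** F2)) *v z) =
      ((R11 + tr D1 ** P ** D1) *v pl (K *v z)) \<bullet> pl (K *v z)" (is ?g2)
proof -
  define \<Sigma>' where "\<Sigma>' = block R11 R12 R21 R22 + tr (hcat D1 D2) ** P ** hcat D1 D2"
  define a b where "a = pl (K *v z)" and "b = pr (K *v z)"
  have L: "tr (hcat B1 B2) ** P + tr (hcat D1 D2) ** P ** C + vcat S1 S2 =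
      vcat (tr B1 ** P + tr D1 ** P ** C + S1) (tr B2 ** P + tr D2 ** P ** C + S2)"
    by (simp add: transpose_hcat vcat_mm vcat_add)
  from riccati_form[OF P \<Sigma>[folded \<Sigma>'_def] ric, of z] obtain w where w: "\<Sigma>' *v w = (tr (hcat B1 B2) ** P + tr (hcat D1 D2) ** P ** C + vcat S1 S2) *v z"
      "w = Iv *v ((tr (hcat B1 B2) ** P + tr (hcat D1 D2) ** P ** C + vcat S1 S2) *v z)"
      "z \<bullet> ((P' + P ** A + tr A ** P + tr C ** P ** C + Q) *v z) = (\<Sigma>' *v w) \<bullet> w"
    by (elim exE conjE)
  have wK: "w = K *v z" unfolding w(2) K_def by (simp only: matrix_vector_mul_assoc)
  then have wab: "w = vjoin a b" by (simp add: a_def b_def)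
  let ?s11 = "R11 + tr D1 ** P ** D1" and ?s12 = "R12 + tr D1 ** P ** D2"
    and ?s21 = "R21 + tr D2 ** P ** D1" and ?s22 = "R22 + tr D2 ** P ** D2"
  have \<Sigma>w: "\<Sigma>' *v w = vjoin (?s11 *v a + ?s12 *v b) (?s21 *v a + ?s22 *v b)"
    unfolding \<Sigma>'_def congruence_block wab block_mv ..
  have L12: "(tr B1 ** P + tr D1 ** P ** C + S1) *v z = ?s11 *v a + ?s12 *v b"
    "(tr B2 ** P + tr D2 ** P ** C + S2) *v z = ?s21 *v a + ?s22 *v b"
    using w(1) unfolding \<Sigma>w L vcat_mv vjoin_eq_iff by simp_all
  have "tr ?s12 = ?s21"
    by (simp add: linear_add[OF bounded_linear.linear[OF linear_transpose]] matrix_transpose_mul P matrix_mul_assoc R12)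
  then have sym: "(?s21 *v a) \<bullet> b = (?s12 *v b) \<bullet> a" by (metis inner_commute inner_transpose(2))
  have F: "F1 *v z = - a" "F2 *v z = - b" by (simp_all add: F1_def F2_def mv_minus mtop_mv a_def b_def)
  have neg: "M *v (- x) = - (M *v x)" for M :: "real^'i^'j" and x by (rule bounded_bilinear.minus_right[OF bilinear_matrix_vector])
  \<comment> \<open>Insert \<open>F1 *v z = - a\<close> and split the saddle point into
    \<open>a\<close> and \<open>b\<close>: all terms that contain \<open>a\<close> cancel, the mixed
    ones by \<open>sym\<close>, and the form of the opponent's block at \<open>b\<close> is
    left.\<close>
  show ?g1 unfolding feedback_form[OF P] w(3) \<Sigma>w unfolding L12 F wab inner_vjoin a_def[symmetric] b_def[symmetric] neg
    using sym by (simp only: inner_add_left inner_minus_left inner_minus_right) simp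
  show ?g2 unfolding feedback_form[OF P] w(3) \<Sigma>w unfolding L12 F wab inner_vjoin a_def[symmetric] b_def[symmetric] neg
    using sym by (simp only: inner_add_left inner_minus_left inner_minus_right) simp
qed

section \<open>The Hamiltonian system\<close>

lemma bmf_reflect: assumes "bmf f" shows "bmf (\<lambda>t. f (T - t))"
proof -
  obtain K where K: "0 < K" "\<And>t. norm (f t) \<le> K" using bmf_bound[OF assms] by metis
  show ?thesis
  proof (rule bmfI)
    show "(\<lambda>t. f (T - t)) \<in> borel_measurable borel"
      by (rule measurable_compose[OF _ bmf_measurable[OF assms]]) simp
  qed (rule K(2))
qed

lemma LINT_reflect:
  fixes g :: "real => 'a::euclidean_space"
  shows "(LBINT s:{0..t}. g (T - s)) = (LBINT s:{T - t..T}. g s)"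
proof -
  have "(LBINT s:{T - t..T}. g s) = (LBINT s. indicator {T - t..T} (T + -1 * s) *\<^sub>R g (T + -1 * s))"
    unfolding set_lebesgue_integral_def by (subst lborel_integral_real_affine[where c = "-1" and t = T]) auto
  also have "(\<lambda>s. indicator {T - t..T} (T + -1 * s) *\<^sub>R g (T + -1 * s)) = (\<lambda>s. indicator {0..t} s *\<^sub>R g (T - s))"
    by (auto simp: indicator_def fun_eq_iff)
  finally show ?thesis by (simp add: set_lebesgue_integral_def)
qed

lemma prim_on_reverse:
  assumes f: "prim_on T f g"
  shows "prim_on T (\<lambda>t. f (T - t)) (\<lambda>t. - g (T - t))"
  unfolding prim_on_def
proof (intro conjI ballI)
  note g = prim_on_bmf[OF f]
  show "bmf (\<lambda>t. - g (T - t))" by (intro bmf_minus bmf_reflect g)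
  fix t assume t: "t \<in> {0..T}"
  have "f T - f (T - t) = (LBINT s:{T - t..T}. g s)" by (rule prim_on_diff[OF f]) (use t in auto)
  also have "\<dots> = (LBINT s:{0..t}. g (T - s))" by (simp add: LINT_reflect)
  finally show "f (T - t) = f (T - 0) + (LBINT s:{0..t}. - g (T - s))"
    by (simp add: set_lebesgue_integral_def algebra_simps)
qed

lemma prim_on_zero_backward:
  fixes y :: "real => 'a::euclidean_space"
  assumes y: "prim_on T y g" and g: "\<And>s. s \<in> {0..T} ==> norm (g s) \<le> c * norm (y s)" and yT: "y T = 0" and t: "t \<in> {0..T}"
  shows "y t = 0"
proof -
  have "y (T - (T - t)) = 0" by (rule prim_on_zero[OF prim_on_reverse[OF y], of c]) (use g yT t in auto)
  then show ?thesis by simp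
qed

lemma ode_exists_backward:
  fixes F :: "real => 'a::euclidean_space => 'a"
  assumes T: "0 \<le> T" and F: "\<And>y. bmf y ==> bmf (\<lambda>s. F s (y s))"
    and C: "0 < C" "\<And>s x y. norm (F s x - F s y) \<le> C * norm (x - y)"
  obtains y where "bmf y" "y T = xT" "prim_on T y (\<lambda>s. F s (y s))"
proof -
  have 1: "bmf (\<lambda>s. - F (T - s) (y s))" if "bmf y" for y
  proof -
    have "bmf (\<lambda>s. F (T - s) (y (T - (T - s))))" by (rule bmf_reflect[OF F[OF bmf_reflect[OF that]]])
    then show ?thesis by (simp add: bmf_minus)
  qed
  have 2: "norm (- F (T - s) x - - F (T - s) y) \<le> C * norm (x - y)" for s x y
    using C(2)[of "T - s" x y] by (simp add: norm_minus_commute)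
  obtain z where z: "bmf z" "z 0 = xT" "prim_on T z (\<lambda>s. - F (T - s) (z s))"
    by (rule ode_exists[OF T 1 C(1) 2])
  show thesis
  proof (rule that)
    show "bmf (\<lambda>s. z (T - s))" by (rule bmf_reflect[OF z(1)])
    show "prim_on T (\<lambda>s. z (T - s)) (\<lambda>s. F s (z (T - s)))" using prim_on_reverse[OF z(3)] by simp
  qed (use z in simp)
qed

lemma mm_bound:
  obtains CM where "0 < CM" "\<forall>(x :: real^'n^'n) (y :: real^'n^'n). norm (x ** y) \<le> norm x * norm y * CM"
proof -
  from bounded_bilinear.pos_bounded[OF bilinear_matrix_mult[where ?'a = 'n and ?'b = 'n and ?'c = 'n]]
  show thesis by (elim exE conjE) (rule that)
qed

lemma linear_pair_backward:
  fixes a b c d :: "real => real^'n^'n" and X0 Y0 :: "real^'n^'n"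
  assumes T: "0 \<le> T" and bb: "bmf a" "bmf b" "bmf c" "bmf d"
  obtains X Y where "bmf X" "bmf Y" "X T = X0" "Y T = Y0" "prim_on T X (\<lambda>s. a s ** X s + b s ** Y s)"
    "prim_on T Y (\<lambda>s. c s ** X s + d s ** Y s)"
proof -
  obtain CM where CM: "0 < CM" "\<forall>(x :: real^'n^'n) (y :: real^'n^'n). norm (x ** y) \<le> norm x * norm y * CM" by (rule mm_bound)
  obtain Ka where Ka: "0 < Ka" "\<And>s. norm (a s) \<le> Ka" using bmf_bound[OF bb(1)] by metis
  obtain Kb where Kb: "0 < Kb" "\<And>s. norm (b s) \<le> Kb" using bmf_bound[OF bb(2)] by metis
  obtain Kc where Kc: "0 < Kc" "\<And>s. norm (c s) \<le> Kc" using bmf_bound[OF bb(3)] by metis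
  obtain Kd where Kd: "0 < Kd" "\<And>s. norm (d s) \<le> Kd" using bmf_bound[OF bb(4)] by metis
  interpret mm: bounded_bilinear "(**) :: real^'n^'n => real^'n^'n => _" by (rule bilinear_matrix_mult)
  define F :: "real => (real^'n^'n) \<times> (real^'n^'n) => _" where "F s p = (a s ** fst p + b s ** snd p, c s ** fst p + d s ** snd p)" for s p
  have m: "norm (x ** y) \<le> K * CM * N" if "norm x \<le> K" "norm y \<le> N" for x y :: "real^'n^'n" and K N
  proof -
    have "norm x * norm y * CM \<le> K * N * CM"
      using CM that order_trans[OF norm_ge_zero that(1)] by (intro mult_right_mono mult_mono) auto
    with CM(2)[rule_format, of x y] show ?thesis by (simp add: mult_ac)
  qed
  have lin: "F s p - F s q = F s (p - q)" for s p q by (simp add: F_def mm.diff_right algebra_simps)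
  have bound: "norm (F s p) \<le> (Ka * CM + Kb * CM + (Kc * CM + Kd * CM)) * norm p" for s p
  proof -
    have n: "norm (fst p) \<le> norm p" "norm (snd p) \<le> norm p" using norm_fst_le[of "fst p" "snd p"] norm_snd_le[of "snd p" "fst p"] by auto
    have "norm (F s p) \<le> norm (a s ** fst p + b s ** snd p) + norm (c s ** fst p + d s ** snd p)"
      unfolding F_def by (rule norm_Pair_le)
    also have "\<dots> \<le> (Ka * CM * norm p + Kb * CM * norm p) + (Kc * CM * norm p + Kd * CM * norm p)"
      by (rule add_mono[OF norm_triangle_mono[OF m[OF Ka(2) n(1)] m[OF Kb(2) n(2)]] norm_triangle_mono[OF m[OF Kc(2) n(1)] m[OF Kd(2) n(2)]]])
    finally show ?thesis by (simp add: algebra_simps)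
  qed
  have bF: "bmf (\<lambda>s. F s (y s))" if y: "bmf y" for y
  proof -
    have y12: "bmf (\<lambda>s. fst (y s))" "bmf (\<lambda>s. snd (y s))"
      by (rule bmf_linear[OF bounded_linear_fst y], rule bmf_linear[OF bounded_linear_snd y])
    have "bmf (\<lambda>s. (p s, 0) + (0, q s))" if "bmf p" "bmf q" for p q :: "real => real^'n^'n"
      by (intro bmf_add bmf_linear[OF _ that(1), where B = "\<lambda>x. (x, 0)"] bmf_linear[OF _ that(2), where B = "\<lambda>x. (0, x)"]
          bounded_linear_Pair bounded_linear_ident bounded_linear_zero)
    then have pair: "bmf (\<lambda>s. (p s, q s))" if "bmf p" "bmf q" for p q :: "real => real^'n^'n" using that by simp
    show ?thesis unfolding F_def by (intro pair bmf_intros bb y12)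
  qed
  obtain y where y: "bmf y" "y T = (X0, Y0)" "prim_on T y (\<lambda>s. F s (y s))"
  proof (rule ode_exists_backward[where F = F and xT = "(X0, Y0)", OF T bF])
    show "0 < Ka * CM + Kb * CM + (Kc * CM + Kd * CM)" using Ka Kb Kc Kd CM by (intro add_pos_pos mult_pos_pos)
    show "norm (F s x - F s y) \<le> (Ka * CM + Kb * CM + (Kc * CM + Kd * CM)) * norm (x - y)" for s x y
      unfolding lin by (rule bound)
  qed blast+
  show thesis
  proof (rule that)
    show "bmf (\<lambda>s. fst (y s))" "bmf (\<lambda>s. snd (y s))"
      by (rule bmf_linear[OF bounded_linear_fst y(1)], rule bmf_linear[OF bounded_linear_snd y(1)])
    show "prim_on T (\<lambda>s. fst (y s)) (\<lambda>s. a s ** fst (y s) + b s ** snd (y s))"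
      using prim_on_linear[OF bounded_linear_fst y(3)] by (simp add: F_def)
    show "prim_on T (\<lambda>s. snd (y s)) (\<lambda>s. c s ** fst (y s) + d s ** snd (y s))"
      using prim_on_linear[OF bounded_linear_snd y(3)] by (simp add: F_def)
  qed (simp_all add: y(2))
qed

text \<open>The equation of an inverse: if \<open>X' = N X\<close>, then the inverse of
  \<open>X\<close> is a solution.\<close>

lemma matrix_ode_backward:
  fixes N :: "real => real^'n^'n"
  assumes T: "0 \<le> T" and N: "bmf N"
  obtains Z where "bmf Z" "Z T = mat 1" "prim_on T Z (\<lambda>s. - (Z s ** N s))"
proof -
  obtain CM where CM: "0 < CM" "\<forall>(x :: real^'n^'n) (y :: real^'n^'n). norm (x ** y) \<le> norm x * norm y * CM" by (rule mm_bound)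
  obtain K where K: "0 < K" "\<And>s. norm (N s) \<le> K" using bmf_bound[OF N] by metis
  interpret mm: bounded_bilinear "(**) :: real^'n^'n => real^'n^'n => _" by (rule bilinear_matrix_mult)
  show thesis
  proof (rule ode_exists_backward[OF T, of "\<lambda>s x. - (x ** N s)" "K * CM" "mat 1"])
    show "bmf (\<lambda>s. - (y s ** N s))" if "bmf y" for y by (intro bmf_minus bmf_mm that N)
    show "0 < K * CM" using K CM by simp
    fix s and x y :: "real^'n^'n"
    have "norm (- (x ** N s) - - (y ** N s)) = norm ((x - y) ** N s)"
      by (simp add: mm.diff_left norm_minus_commute)
    also have "\<dots> \<le> norm (x - y) * norm (N s) * CM" using CM(2) by blast
    also have "\<dots> \<le> norm (x - y) * K * CM" using CM K by (intro mult_right_mono mult_left_mono) auto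
    finally show "norm (- (x ** N s) - - (y ** N s)) \<le> K * CM * norm (x - y)" by (simp add: mult_ac)
  qed (rule that)
qed

text \<open>Riccati expression without the derivative. Terms with \<open>C\<close>, \<open>D\<close>
  and the known \<open>P\<close> are absorbed into \<open>Q\<close> and \<open>S\<close>, and
  \<open>I\<close> stands for the inverse of the control weight.\<close>

definition ric :: "real^'n^'n => real^'k^'n => real^'n^'n => real^'n^'k => real^'k^'k => real^'n^'n => real^'n^'n" where
  "ric A B Q S I P = P ** A + tr A ** P + Q - (P ** B + tr S) ** I ** (tr B ** P + S)"

lemma transpose_add: "tr (A + B) = tr A + tr B" for A B :: "real^'n^'m"
  by (rule linear_add[OF bounded_linear.linear[OF linear_transpose]])

lemma transpose_diff: "tr (A - B) = tr A - tr B" for A B :: "real^'n^'m"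
  by (rule linear_diff[OF bounded_linear.linear[OF linear_transpose]])

lemma transpose_minus: "tr (- A) = - tr A" for A :: "real^'n^'m"
  by (rule linear_neg[OF bounded_linear.linear[OF linear_transpose]])

lemma transpose_ric:
  "tr Q = Q ==> tr I = I ==> tr (ric A B Q S I P) = ric A B Q S I (tr P)"
  by (simp add: ric_def transpose_add transpose_diff matrix_transpose_mul matrix_mul_assoc add.commute)

lemma bmf_ric:
  "bmf A ==> bmf B ==> bmf Q ==> bmf S ==> bmf I ==> bmf P ==> bmf (\<lambda>s. ric (A s) (B s) (Q s) (S s) (I s) (P s))"
  unfolding ric_def by (intro bmf_intros)

text \<open>The quadratic term is split between the two factors so that the difference of two
  solutions obeys a linear equation; its coefficients contain the bounded solutions themselves,
  which lets Gronwall act.\<close>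

lemma ric_diff:
  "ric A B Q S I P1 - ric A B Q S I P2 = (P1 - P2) ** (A - B ** I ** (tr B ** P1 + S))
     + (tr A - (P2 ** B + tr S) ** I ** tr B) ** (P1 - P2)"
  by (simp add: ric_def mm_simps bounded_bilinear.diff_left[OF bilinear_matrix_mult] bounded_bilinear.diff_right[OF bilinear_matrix_mult]
      matrix_mul_assoc)

lemma ric_unique:
  fixes P1 P2 A :: "real => real^'n^'n" and B :: "real => real^'k^'n"
  assumes b: "bmf A" "bmf B" "bmf Q" "bmf S" "bmf I"
    and P1: "prim_on T P1 (\<lambda>s. - ric (A s) (B s) (Q s) (S s) (I s) (ext0T T P1 s))"
    and P2: "prim_on T P2 (\<lambda>s. - ric (A s) (B s) (Q s) (S s) (I s) (ext0T T P2 s))"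
    and eq: "P1 T = P2 T" and t: "t \<in> {0..T}"
  shows "P1 t = P2 t"
proof -
  obtain CM where CM: "0 < CM" "\<forall>(x :: real^'n^'n) (y :: real^'n^'n). norm (x ** y) \<le> norm x * norm y * CM" by (rule mm_bound)
  have e: "bmf (ext0T T P1)" "bmf (ext0T T P2)" by (rule bmf_ext0T[OF prim_on_continuous[OF P1]], rule bmf_ext0T[OF prim_on_continuous[OF P2]])
  let ?m = "\<lambda>s. A s - B s ** I s ** (tr (B s) ** ext0T T P1 s + S s)"
  let ?n = "\<lambda>s. tr (A s) - (ext0T T P2 s ** B s + tr (S s)) ** I s ** tr (B s)"
  have bm: "bmf ?m" "bmf ?n" by (intro bmf_intros b e)+
  obtain Km where Km: "0 < Km" "\<And>s. norm (?m s) \<le> Km" using bmf_bound[OF bm(1)] by metis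
  obtain Kn where Kn: "0 < Kn" "\<And>s. norm (?n s) \<le> Kn" using bmf_bound[OF bm(2)] by metis
  have "P1 t - P2 t = 0"
  proof (rule prim_on_zero_backward[OF prim_on_diff_fun[OF P1 P2] _ _ t])
    fix s assume s: "s \<in> {0..T}"
    let ?d = "P1 s - P2 s"
    have "ric (A s) (B s) (Q s) (S s) (I s) (ext0T T P1 s) - ric (A s) (B s) (Q s) (S s) (I s) (ext0T T P2 s) =
        ?d ** ?m s + ?n s ** ?d" using s by (simp add: ric_diff)
    moreover have "norm (- x - - y) = norm (x - y)" for x y :: "real^'n^'n" by (simp add: norm_minus_commute)
    ultimately have "norm (- ric (A s) (B s) (Q s) (S s) (I s) (ext0T T P1 s) - - ric (A s) (B s) (Q s) (S s) (I s) (ext0T T P2 s)) =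
        norm (?d ** ?m s + ?n s ** ?d)" by simp
    also have "\<dots> \<le> norm ?d * norm (?m s) * CM + norm (?n s) * norm ?d * CM" using CM(2) by (intro norm_triangle_mono) blast+
    also have "\<dots> \<le> norm ?d * Km * CM + Kn * norm ?d * CM"
      using CM Km Kn by (intro add_mono mult_right_mono mult_left_mono) auto
    finally show "norm (- ric (A s) (B s) (Q s) (S s) (I s) (ext0T T P1 s) - - ric (A s) (B s) (Q s) (S s) (I s) (ext0T T P2 s)) \<le>
        (Km * CM + Kn * CM) * norm ?d" by (simp add: algebra_simps)
  qed (use eq in simp)
  then show ?thesis by simp
qed

lemma prim_on_subset:
  assumes "prim_on T f g" "t \<le> T" shows "prim_on t f g"
  unfolding prim_on_def
proof (intro conjI ballI)
  show "bmf g" by (rule prim_on_bmf[OF assms(1)])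
  show "f s = f 0 + (LBINT r:{0..s}. g r)" if "s \<in> {0..t}" for s
    by (rule prim_onD[OF assms(1)]) (use that assms(2) in auto)
qed

text \<open>The deterministic game left after the noise has been eliminated. \<open>I\<close> is a
  bounded symmetric function that inverts the control weight almost everywhere; both coercivity
  conditions concern trajectories from zero driven by a single player.\<close>

locale lq_game =
  fixes T \<alpha> :: real and A Q :: "real => real^'n^'n" and B1 :: "real => real^'m1^'n" and B2 :: "real => real^'m2^'n"
    and S1 :: "real => real^'n^'m1" and S2 :: "real => real^'n^'m2" and R11 R12 R21 R22
    and I :: "real => real^('m1 + 'm2)^('m1 + 'm2)" and G :: "real^'n^'n"
  assumes T: "0 < T" and \<alpha>: "0 < \<alpha>"
    and b: "bmf A" "bmf Q" "bmf B1" "bmf B2" "bmf S1" "bmf S2" "bmf R11" "bmf R12" "bmf R21" "bmf R22" "bmf I"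
    and sym: "\<And>s. tr (Q s) = Q s" "\<And>s. tr (I s) = I s" "tr G = G"
      "\<And>s. tr (R12 s) = R21 s"
    and inv: "AE t in lborel. t \<in> {0..T} \<longrightarrow> block (R11 t) (R12 t) (R21 t) (R22 t) ** I t = mat 1"
    and H1: "\<And>u y. bmf u ==> bmf y ==> y 0 = 0 ==> prim_on T y (\<lambda>s. A s *v y s + B1 s *v u s) ==>
      \<alpha> * (LBINT s:{0..T}. (norm (u s))^2) \<le> (G *v y T) \<bullet> y T + (LBINT s:{0..T}. q1 (Q s) (S1 s) (R11 s) (y s) (u s))"
    and H2: "\<And>u y. bmf u ==> bmf y ==> y 0 = 0 ==> prim_on T y (\<lambda>s. A s *v y s + B2 s *v u s) ==>
      \<alpha> * (LBINT s:{0..T}. (norm (u s))^2) \<le> - ((G *v y T) \<bullet> y T + (LBINT s:{0..T}. q1 (Q s) (S2 s) (R22 s) (y s) (u s)))"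
begin

definition "B s = hcat (B1 s) (B2 s)"
definition "S s = vcat (S1 s) (S2 s)"

lemma bBS: "bmf B" "bmf S"
  unfolding B_def[abs_def] S_def[abs_def] by (intro bmf_hcat bmf_vcat b)+

lemma prim_on_null_control:
  fixes Bi :: "real => real^'k^'n"
  assumes y: "y 0 = 0" "prim_on T y (\<lambda>s. A s *v y s + Bi s *v u s)" and bu: "bmf u" "bmf y"
    and u: "(LBINT s:{0..T}. (norm (u s))^2) \<le> 0" and t: "t \<in> {0..T}"
  shows "y t = 0"
proof -
  have bn: "bmf (\<lambda>s. (norm (u s))^2)" by (intro bmf_power2 bmf_norm bu)
  have i: "integrable lborel (\<lambda>s. indicator {0..T} s *\<^sub>R (norm (u s))^2)"
    using bmf_set_integrable[OF bn] by (simp add: set_integrable_def)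
  have "(LBINT s:{0..T}. (norm (u s))^2) \<ge> 0" by (rule bmf_integral_nonneg[OF bn]) simp
  with u have "(LBINT s:{0..T}. (norm (u s))^2) = 0" by linarith
  then have "(LBINT s. indicator {0..T} s *\<^sub>R (norm (u s))^2) = 0" by (simp only: set_lebesgue_integral_def)
  then have "AE s in lborel. indicator {0..T} s *\<^sub>R (norm (u s))^2 = 0"
    using integral_nonneg_eq_0_iff_AE[OF i] by simp
  then have ae: "AE s in lborel. s \<in> {0..T} \<longrightarrow> A s *v y s + Bi s *v u s = A s *v y s"
    by eventually_elim auto
  obtain K where K: "0 < K" "\<And>s. norm (A s) \<le> K" using bmf_bound[OF b(1)] by metis
  show ?thesis
  proof (rule prim_on_zero[OF prim_on_cong[OF y(2) refl _ ae] _ y(1) t])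
    show "bmf (\<lambda>s. A s *v y s)" by (intro bmf_mv b bu)
    show "norm (A s *v y s) \<le> K * norm (y s)" for s by (rule norm_mv_le[OF K(2)])
  qed
qed

text \<open>A trajectory that vanishes at \<open>t0\<close> can be replaced by zero before
  \<open>t0\<close>, because the cut creates no jump.\<close>

lemma prim_on_restart:
  fixes y :: "real => 'z::euclidean_space"
  assumes y: "prim_on T y g" "y t0 = 0" and t0: "t0 \<in> {0..T}"
  shows "prim_on T (\<lambda>s. indicator {t0<..T} s *\<^sub>R y s) (\<lambda>s. indicator {t0<..T} s *\<^sub>R g s)"
  unfolding prim_on_def
proof (intro conjI ballI)
  let ?g = "\<lambda>s. indicator {t0<..T} s *\<^sub>R g s"
  show bg: "bmf ?g" by (intro bmf_scaleR bmf_indicator prim_on_bmf[OF y(1)]) simp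
  have z: "(LBINT s:{0..t}. ?g s) = 0" if "t \<le> t0" for t
  proof -
    have "(\<lambda>s. indicator {0..t} s *\<^sub>R ?g s) = (\<lambda>s. 0)" using that by (auto simp: indicator_def fun_eq_iff)
    then show ?thesis by (simp only: set_lebesgue_integral_def integral_zero)
  qed
  fix t assume t: "t \<in> {0..T}"
  show "indicator {t0<..T} t *\<^sub>R y t = indicator {t0<..T} 0 *\<^sub>R y 0 + (LBINT s:{0..t}. ?g s)"
  proof (cases "t \<le> t0")
    case True
    then show ?thesis using t0 z[OF True] by simp
  next
    case False
    have "(LBINT s:{t0..t}. ?g s) = (LBINT s:{t0..t}. g s)"
      unfolding set_lebesgue_integral_def
    proof (rule integral_cong_AE)
      show "(\<lambda>s. indicator {t0..t} s *\<^sub>R ?g s) \<in> borel_measurable lborel" using bmf_measurable[OF bg] by measurable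
      show "(\<lambda>s. indicator {t0..t} s *\<^sub>R g s) \<in> borel_measurable lborel" using bmf_measurable[OF prim_on_bmf[OF y(1)]] by measurable
      show "AE s in lborel. indicator {t0..t} s *\<^sub>R ?g s = indicator {t0..t} s *\<^sub>R g s"
        using AE_lborel_singleton[of t0] by eventually_elim (use t in \<open>auto simp: indicator_def\<close>)
    qed
    also have "\<dots> = y t" using prim_on_diff[OF y(1), of t0 t] t t0 False y(2) by simp
    finally have "(LBINT s:{0..t}. ?g s) = y t"
      using bmf_integral_combine[OF bg, of 0 t0 t] z[of t0] t0 False by simp
    then show ?thesis using t0 t False by simp
  qed
qed

text \<open>The stationarity condition for \<open>w\<close> is tested with
  \<open>vjoin u1 (- u2)\<close>. The off-diagonal blocks cancel by symmetry, and the integrands of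
  the two one-player problems remain with opposite signs.\<close>

lemma hamiltonian_derivative:
  assumes w: "block r11 r12 r21 r22 *v w = - (tr (hcat b1 b2) *v p + vcat s1 s2 *v (y1 + y2))"
    and u: "u1 = pl w" "u2 = pr w" and q: "tr q = q" and r: "tr r12 = r21"
  shows "p \<bullet> ((a *v y1 + b1 *v u1) - (a *v y2 + b2 *v u2)) + (- (tr a *v p + q *v (y1 + y2) + tr (vcat s1 s2) *v w)) \<bullet> (y1 - y2) =
     q1 q s2 r22 y2 u2 - q1 q s1 r11 y1 u1"
proof -
  have wj: "w = vjoin u1 u2" by (simp add: u)
  have "(block r11 r12 r21 r22 *v w) \<bullet> vjoin u1 (- u2) = (- (tr (hcat b1 b2) *v p + vcat s1 s2 *v (y1 + y2))) \<bullet> vjoin u1 (- u2)"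
    unfolding w ..
  then have 1: "(r11 *v u1) \<bullet> u1 + (r12 *v u2) \<bullet> u1 - (r21 *v u1) \<bullet> u2 - (r22 *v u2) \<bullet> u2 =
      - (p \<bullet> (b1 *v u1)) + p \<bullet> (b2 *v u2) - (s1 *v (y1 + y2)) \<bullet> u1 + (s2 *v (y1 + y2)) \<bullet> u2"
    unfolding wj transpose_hcat vcat_mv vjoin_add block_mv
    by (simp add: inner_vjoin inner_add_left inner_diff_left inner_minus_left dot_lmul_matrix)
  have 2: "(r21 *v u1) \<bullet> u2 = (r12 *v u2) \<bullet> u1" unfolding r[symmetric] by (simp add: dot_lmul_matrix inner_vm inner_commute)
  have 3: "(q *v y2) \<bullet> y1 = (q *v y1) \<bullet> y2" by (rule symm_inner[OF q])
  have 4: "(tr (vcat s1 s2) *v w) \<bullet> z = (s1 *v z) \<bullet> u1 + (s2 *v z) \<bullet> u2" for z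
    unfolding wj transpose_vcat hcat_mv by (simp add: inner_add_left dot_lmul_matrix inner_commute[of u1] inner_commute[of u2])
  have 5: "(tr a *v p) \<bullet> z = p \<bullet> (a *v z)" for z by (rule inner_transpose(2))
  have d: "M *v (x - z) = M *v x - M *v z" for M :: "real^'i^'j" and x z by (rule matrix_vector_mult_diff_distrib)
  show ?thesis
    using 1 2 3 unfolding q1_def inner_minus_left inner_add_left 4 5
    by (simp add: d matrix_vector_right_distrib inner_add_left inner_diff_left inner_diff_right inner_add_right)
qed

context
  fixes X Y :: "real => real^'n^'n" and U
  assumes XY: "bmf X" "bmf Y" "X T = mat 1" "Y T = G"
    and U: "\<And>s. U s = - (I s ** (tr (B s) ** Y s + S s ** X s))"
    and X': "prim_on T X (\<lambda>s. A s ** X s + B s ** U s)"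
    and Y': "prim_on T Y (\<lambda>s. - (tr (A s) ** Y s + Q s ** X s + tr (S s) ** U s))"
begin

lemma bU: "bmf U"
proof -
  have "bmf (\<lambda>s. - (I s ** (tr (B s) ** Y s + S s ** X s)))" by (intro bmf_intros b bBS XY)
  then show ?thesis by (simp add: U[symmetric])
qed

lemma X_nonsingular:
  assumes t0: "t0 \<in> {0..T}" and x: "X t0 *v x = 0"
  shows "x = 0"
proof (cases "t0 = T")
  case True
  then show ?thesis using x XY(3) by simp
next
  case False
  define i :: "real => real" where "i = indicator {t0<..T}"
  define y p w where "y s = X s *v x" and "p s = Y s *v x" and "w s = U s *v x" for s
  \<comment> \<open>Both controls act after \<open>t0\<close> only, where \<open>y\<close> starts
    from zero; by linearity \<open>y1 + y2\<close> reproduces \<open>y\<close> from there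
    on.\<close>
  define u1 u2 where "u1 s = i s *\<^sub>R pl (w s)" and "u2 s = i s *\<^sub>R pr (w s)" for s
  have bi: "bmf i" unfolding i_def by (rule bmf_indicator) simp
  have bw: "bmf y" "bmf p" "bmf w" unfolding y_def[abs_def] p_def[abs_def] w_def[abs_def] by (intro bmf_mv bmf_const XY bU)+
  have bu: "bmf u1" "bmf u2" unfolding u1_def[abs_def] u2_def[abs_def] by (intro bmf_scaleR bi bmf_pl bw)+
  have lx: "bounded_linear (\<lambda>M :: real^'n^'n. M *v x)" by (rule bounded_bilinear.bounded_linear_left[OF bilinear_matrix_vector])
  have y': "prim_on T y (\<lambda>s. A s *v y s + B s *v w s)"
    using prim_on_linear[OF lx X'] unfolding y_def[abs_def] w_def[abs_def] by (simp add: mv_expand)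
  have p': "prim_on T p (\<lambda>s. - (tr (A s) *v p s + Q s *v y s + tr (S s) *v w s))"
    using prim_on_linear[OF lx Y'] unfolding y_def[abs_def] w_def[abs_def] p_def[abs_def]
    by (simp add: mv_expand mv_minus bounded_bilinear.diff_left[OF bilinear_matrix_vector])
  obtain y1 where y1: "bmf y1" "y1 0 = 0" "prim_on T y1 (\<lambda>s. A s *v y1 s + B1 s *v u1 s)"
    by (rule linear_ode_exists[of T A "\<lambda>s. B1 s *v u1 s" 0]) (use T b bu in \<open>auto intro: bmf_mv\<close>)
  obtain y2 where y2: "bmf y2" "y2 0 = 0" "prim_on T y2 (\<lambda>s. A s *v y2 s + B2 s *v u2 s)"
    by (rule linear_ode_exists[of T A "\<lambda>s. B2 s *v u2 s" 0]) (use T b bu in \<open>auto intro: bmf_mv\<close>)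
  obtain K where K: "0 < K" "\<And>s. norm (A s) \<le> K" using bmf_bound[OF b(1)] by metis
  have iw: "B1 s *v u1 s + B2 s *v u2 s = i s *\<^sub>R (B s *v w s)" for s
  proof -
    have "B s *v w s = B1 s *v pl (w s) + B2 s *v pr (w s)" using hcat_mv[of "B1 s" "B2 s" "pl (w s)" "pr (w s)"] by (simp add: B_def)
    then show ?thesis by (simp add: u1_def u2_def matrix_vector_mult_scaleR scaleR_add_right)
  qed
  have sum: "i t *\<^sub>R y t = y1 t + y2 t" if t: "t \<in> {0..T}" for t
  proof -
    have r: "prim_on T (\<lambda>s. i s *\<^sub>R y s) (\<lambda>s. i s *\<^sub>R (A s *v y s + B s *v w s))"
      unfolding i_def by (rule prim_on_restart[OF y' _ t0]) (use x in \<open>simp add: y_def\<close>)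
    have "i t *\<^sub>R y t - (y1 t + y2 t) = 0"
    proof (rule prim_on_zero[OF prim_on_diff_fun[OF r prim_on_add[OF y1(3) y2(3)]] _ _ t])
      fix s
      have "i s *\<^sub>R (A s *v y s + B s *v w s) - (A s *v y1 s + B1 s *v u1 s + (A s *v y2 s + B2 s *v u2 s)) =
          A s *v (i s *\<^sub>R y s - (y1 s + y2 s))"
        using iw[of s] by (simp add: matrix_vector_mult_diff_distrib matrix_vector_right_distrib matrix_vector_mult_scaleR scaleR_add_right algebra_simps)
      then show "norm (i s *\<^sub>R (A s *v y s + B s *v w s) - (A s *v y1 s + B1 s *v u1 s + (A s *v y2 s + B2 s *v u2 s))) \<le>
          K * norm (i s *\<^sub>R y s - (y1 s + y2 s))" using norm_mv_le[OF K(2)] by simp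
    qed (use t0 y1 y2 in \<open>simp add: i_def\<close>)
    then show ?thesis by simp
  qed
  have before: "y1 s = 0" "y2 s = 0" if s: "s \<in> {0..t0}" for s
  proof -
    have i0: "i r = 0" if "r \<in> {0..t0}" for r using that by (simp add: i_def)
    have n: "norm (A r *v z r) \<le> K * norm (z r)" for z :: "real => real^'n" and r by (rule norm_mv_le[OF K(2)])
    show "y1 s = 0"
      by (rule prim_on_zero[OF prim_on_subset[OF y1(3)] _ y1(2) s, of K]) (use t0 n i0 in \<open>auto simp: u1_def\<close>)
    show "y2 s = 0"
      by (rule prim_on_zero[OF prim_on_subset[OF y2(3)] _ y2(2) s, of K]) (use t0 n i0 in \<open>auto simp: u2_def\<close>)
  qed
  have TT: "T \<in> {0..T}" using T by simp
  have yT: "y T = y1 T + y2 T" using sum[OF TT] False t0 by (simp add: i_def)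
  let ?q1 = "\<lambda>s. q1 (Q s) (S1 s) (R11 s) (y1 s) (u1 s)" and ?q2 = "\<lambda>s. q1 (Q s) (S2 s) (R22 s) (y2 s) (u2 s)"
  have bq: "bmf ?q1" "bmf ?q2" by (intro bmf_q1 b y1 y2 bu)+
  let ?g = "\<lambda>s. (A s *v y1 s + B1 s *v u1 s) - (A s *v y2 s + B2 s *v u2 s)"
  let ?h = "\<lambda>s. - (tr (A s) *v p s + Q s *v y s + tr (S s) *v w s)"
  let ?H = "\<lambda>s. ext0T T p s \<bullet> ?g s + ?h s \<bullet> ext0T T (\<lambda>s. y1 s - y2 s) s"
  have prod: "prim_on T (\<lambda>s. p s \<bullet> (y1 s - y2 s)) ?H"
    by (rule prim_on_bilinear[OF bounded_bilinear_inner p' prim_on_diff_fun[OF y1(3) y2(3)]])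
  have ae: "AE s in lborel. s \<in> {0..T} \<longrightarrow> ?H s = ?q2 s - ?q1 s"
    using inv
  proof eventually_elim
    case (elim s)
    show ?case
    proof
      assume s: "s \<in> {0..T}"
      show "?H s = ?q2 s - ?q1 s"
      proof (cases "s \<le> t0")
        case True
        then have "s \<in> {0..t0}" using s by simp
        moreover have "i s = 0" using True by (simp add: i_def)
        ultimately show ?thesis using before[of s] s by (simp add: u1_def u2_def q1_def)
      next
        case False
        have i1: "i s = 1" using False s by (simp add: i_def)
        have ys: "y s = y1 s + y2 s" using sum[OF s] i1 by simp
        have "block (R11 s) (R12 s) (R21 s) (R22 s) *v w s =
            - ((block (R11 s) (R12 s) (R21 s) (R22 s) ** I s ** (tr (B s) ** Y s + S s ** X s)) *v x)"
          unfolding w_def U by (simp add: matrix_vector_mul_assoc mv_minus bounded_bilinear.minus_right[OF bilinear_matrix_vector] matrix_mul_assoc)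
        also have "\<dots> = - (tr (B s) *v p s + S s *v y s)"
        proof -
          have "block (R11 s) (R12 s) (R21 s) (R22 s) ** I s = mat 1" using elim s by blast
          then show ?thesis by (simp add: p_def y_def mv_expand)
        qed
        finally have ws: "block (R11 s) (R12 s) (R21 s) (R22 s) *v w s =
            - (tr (hcat (B1 s) (B2 s)) *v p s + vcat (S1 s) (S2 s) *v (y1 s + y2 s))" unfolding B_def S_def ys .
        have us: "u1 s = pl (w s)" "u2 s = pr (w s)" by (simp_all add: u1_def u2_def i1)
        from hamiltonian_derivative[OF ws us sym(1) sym(4), of "A s"] s ys show ?thesis by (simp add: S_def)
      qed
    qed
  qed
  have "p T \<bullet> (y1 T - y2 T) = (LBINT s:{0..T}. ?H s)" using prim_onD[OF prod TT] y1(2) y2(2) by simp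
  also have "\<dots> = (LBINT s:{0..T}. ?q2 s - ?q1 s)"
  proof (rule eq_ae_LINT[OF _ TT])
    show "eq_ae T ?H (\<lambda>s. ?q2 s - ?q1 s)"
      unfolding eq_ae_def
      by (intro conjI ae sbm_borel[OF bmf_measurable[OF prim_on_bmf[OF prod]]] sbm_borel[OF bmf_measurable[OF bmf_diff[OF bq(2,1)]]])
  qed
  also have "\<dots> = (LBINT s:{0..T}. ?q2 s) - (LBINT s:{0..T}. ?q1 s)"
    by (rule set_integral_diff(2)) (intro bmf_set_integrable bq)+
  finally have e1: "p T \<bullet> (y1 T - y2 T) = \<dots>" .
  have "p T = G *v (y1 T + y2 T)" unfolding yT[symmetric] by (simp add: p_def y_def XY)
  then have e2: "p T \<bullet> (y1 T - y2 T) = (G *v y1 T) \<bullet> y1 T - (G *v y2 T) \<bullet> y2 T"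
    using symm_inner[OF sym(3), of "y2 T" "y1 T"] by (simp add: matrix_vector_right_distrib inner_add_left inner_diff_right)
  let ?n1 = "LBINT s:{0..T}. (norm (u1 s))^2" and ?n2 = "LBINT s:{0..T}. (norm (u2 s))^2"
  have n0: "0 \<le> ?n1" "0 \<le> ?n2" by (rule bmf_integral_nonneg, intro bmf_power2 bmf_norm bu, simp)+
  have "\<alpha> * ?n1 + \<alpha> * ?n2 \<le> 0" using H1[OF bu(1) y1] H2[OF bu(2) y2] e1 e2 by linarith
  then have "?n1 + ?n2 \<le> 0" using \<alpha> by (simp add: distrib_left[symmetric] mult_le_0_iff del: distrib_left)
  then have nn: "?n1 \<le> 0" "?n2 \<le> 0" using n0 by auto
  have "y1 T = 0" by (rule prim_on_null_control[OF y1(2,3) bu(1) y1(1) nn(1) TT])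
  moreover have "y2 T = 0" by (rule prim_on_null_control[OF y2(2,3) bu(2) y2(1) nn(2) TT])
  ultimately have "y T = 0" using yT by simp
  then show ?thesis by (simp add: y_def XY)
qed

text \<open>Compactness of \<open>{0..T}\<close> times the unit sphere turns nonsingularity at each
  time into a uniform bound.\<close>

lemma X_lower_bounded: "\<exists>c>0. \<forall>t\<in>{0..T}. lower_bounded c (X t)"
proof -
  interpret mv: bounded_bilinear "(*v) :: real^'n^'n => real^'n => _" by (rule bilinear_matrix_vector)
  let ?K = "{0..T} \<times> sphere (0 :: real^'n) 1"
  have "axis undefined 1 \<in> sphere (0 :: real^'n) 1" by simp
  then have ne: "?K \<noteq> {}" using T by fastforce
  have comp: "compact ?K" by (intro compact_Times) auto
  have "continuous_on ?K (\<lambda>z. norm (X (fst z) *v snd z))"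
    by (intro continuous_on_norm mv.continuous_on continuous_on_compose2[OF prim_on_continuous[OF X']] continuous_intros) auto
  from continuous_attains_inf[OF comp ne this] obtain z where z: "z \<in> ?K" "\<forall>y\<in>?K. norm (X (fst z) *v snd z) \<le> norm (X (fst y) *v snd y)"
    by blast
  let ?m = "norm (X (fst z) *v snd z)"
  have "snd z \<noteq> 0" using z(1) by auto
  then have m: "0 < ?m" using X_nonsingular[of "fst z" "snd z"] z(1) by auto
  have "norm x \<le> 1 / ?m * norm (X t *v x)" if t: "t \<in> {0..T}" for t x
  proof (cases "x = 0")
    case False
    let ?x = "(1 / norm x) *\<^sub>R x"
    have "(t, ?x) \<in> ?K" using t False by simp
    then have "?m \<le> norm (X t *v ?x)" using z(2) by fastforce
    also have "\<dots> = norm (X t *v x) / norm x" by (simp add: matrix_vector_mult_scaleR)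
    finally show ?thesis using m False by (simp add: field_simps)
  qed simp
  then show ?thesis using m by (intro exI[of _ "1 / ?m"]) (auto simp: lower_bounded_def)
qed

text \<open>The inverse of \<open>X\<close> is constructed as the solution \<open>Z\<close> of a linear equation, which provides its derivative.\<close>

lemma riccati_from_hamiltonian:
  "\<exists>P. prim_on T P (\<lambda>s. - ric (A s) (B s) (Q s) (S s) (I s) (ext0T T P s)) \<and> P T = G"
proof -
  from X_lower_bounded obtain c where c: "0 < c" "\<forall>t\<in>{0..T}. lower_bounded c (X t)" by (elim exE conjE)
  \<comment> \<open>\<open>X\<close> is controlled on \<open>{0..T}\<close> only; the identity
    matrix elsewhere keeps \<open>F\<close> uniformly invertible on the whole line.\<close>
  define F where "F t = indicator {0..T} t *\<^sub>R X t + (1 - indicator {0..T} t) *\<^sub>R mat 1" for t :: real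
  have FX: "F t = X t" if "t \<in> {0..T}" for t using that by (simp add: F_def)
  have bF: "bmf F" unfolding F_def[abs_def] by (intro bmf_add bmf_scaleR bmf_diff bmf_const bmf_indicator XY) simp_all
  have lF: "lower_bounded (max c 1) (F t)" for t
  proof (cases "t \<in> {0..T}")
    case True
    then have "norm x \<le> max c 1 * norm (X t *v x)" for x
      using c(2) order_trans[OF _ mult_right_mono[OF max.cobounded1[of c 1] norm_ge_zero]] unfolding lower_bounded_def by blast
    then show ?thesis by (simp add: lower_bounded_def FX[OF True])
  next
    case False
    have "norm x \<le> max c 1 * norm x" for x :: "real^'n" using mult_right_mono[OF max.cobounded2[of 1 c] norm_ge_zero[of x]] by simp
    then show ?thesis using False by (simp add: F_def lower_bounded_def)
  qed
  \<comment> \<open>The pointwise inverse is so far only Borel and bounded; it allows the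
    coefficient \<open>?N\<close> to be written down and is afterwards identified with
    \<open>Z\<close>.\<close>
  define Xi where "Xi t = matrix_inv (F t)" for t
  have bXi: "bmf Xi" unfolding Xi_def[abs_def] by (rule bmf_matrix_inv[OF bF lF])
  have XiX: "Xi t ** X t = mat 1" if "t \<in> {0..T}" for t
    unfolding Xi_def FX[OF that, symmetric] by (rule matrix_inv_mult(1)[OF lower_bounded_inverse(1)[OF lF]])
  let ?N = "\<lambda>s. (A s ** X s + B s ** U s) ** Xi s"
  have bN: "bmf ?N" by (intro bmf_intros b bBS XY bU bXi)
  obtain Z where Z: "bmf Z" "Z T = mat 1" "prim_on T Z (\<lambda>s. - (Z s ** ?N s))"
    by (rule matrix_ode_backward[OF less_imp_le[OF T] bN])
  have ZX: "Z t ** X t = mat 1" if t: "t \<in> {0..T}" for t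
  proof -
    have "Z t ** X t - mat 1 = 0"
    proof (rule prim_on_zero_backward[OF prim_on_diff_fun[OF prim_on_bilinear[OF bilinear_matrix_mult Z(3) X'] prim_on_const] _ _ t])
      show "norm (ext0T T Z s ** (A s ** X s + B s ** U s) + - (Z s ** ?N s) ** ext0T T X s - 0) \<le> 0 * norm (Z s ** X s - mat 1)"
        if s: "s \<in> {0..T}" for s
        using s by (simp add: mm_minus matrix_mul_assoc[symmetric] XiX[OF s])
    qed (simp add: Z XY)
    then show ?thesis by simp
  qed
  have XZ: "X t ** Z t = mat 1" if "t \<in> {0..T}" for t using ZX[OF that] by (simp add: matrix_left_right_inverse)
  have XiZ: "Xi t = Z t" if "t \<in> {0..T}" for t
  proof -
    have "Xi t = Xi t ** (X t ** Z t)" by (simp add: XZ[OF that])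
    also have "\<dots> = Z t" by (simp add: matrix_mul_assoc XiX[OF that])
    finally show ?thesis .
  qed
  define P where "P t = Y t ** Z t" for t
  have P': "prim_on T P (\<lambda>s. ext0T T Y s ** - (Z s ** ?N s) + - (tr (A s) ** Y s + Q s ** X s + tr (S s) ** U s) ** ext0T T Z s)"
    unfolding P_def[abs_def] by (rule prim_on_bilinear[OF bilinear_matrix_mult Y' Z(3)])
  have eP: "bmf (ext0T T P)" by (rule bmf_ext0T[OF prim_on_continuous[OF P']])
  have "prim_on T P (\<lambda>s. - ric (A s) (B s) (Q s) (S s) (I s) (ext0T T P s))"
  proof (rule prim_on_cong[OF P' refl])
    show "bmf (\<lambda>s. - ric (A s) (B s) (Q s) (S s) (I s) (ext0T T P s))" by (intro bmf_minus bmf_ric b bBS eP)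
    show "AE s in lborel. s \<in> {0..T} \<longrightarrow> ext0T T Y s ** - (Z s ** ?N s) +
        - (tr (A s) ** Y s + Q s ** X s + tr (S s) ** U s) ** ext0T T Z s = - ric (A s) (B s) (Q s) (S s) (I s) (ext0T T P s)"
    proof (rule AE_I2, rule impI)
      fix s assume s: "s \<in> {0..T}"
      \<comment> \<open>\<open>V\<close> is minus the gain belonging to \<open>P\<close>; the
        identity \<open>U s ** Z s = - V\<close> puts the Hamiltonian control into feedback
        form.\<close>
      define V where "V = I s ** (tr (B s) ** P s + S s)"
      have UZ: "U s ** Z s = - V"
        using XZ[OF s] by (simp add: U V_def P_def mm_minus mm_simps bounded_bilinear.diff_left[OF bilinear_matrix_mult] matrix_mul_assoc[symmetric])
      have 1: "?N s = A s - B s ** V"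
        using XZ[OF s] UZ by (simp add: XiZ[OF s] mm_minus mm_simps matrix_mul_assoc[symmetric])
      have 2: "- (tr (A s) ** Y s + Q s ** X s + tr (S s) ** U s) ** Z s = - (tr (A s) ** P s + Q s - tr (S s) ** V)"
        using XZ[OF s] UZ
        by (simp only: mm_minus mm_simps matrix_mul_assoc[symmetric] P_def matrix_mul_rid) simp
      have 3: "Y s ** - (Z s ** ?N s) = - (P s ** A s - P s ** (B s ** V))"
        unfolding 1 P_def by (simp add: mm_minus matrix_mul_assoc bounded_bilinear.diff_right[OF bilinear_matrix_mult])
      have 4: "ric (A s) (B s) (Q s) (S s) (I s) (P s) = P s ** A s + tr (A s) ** P s + Q s - (P s ** (B s ** V) + tr (S s) ** V)"
        by (simp add: ric_def V_def mm_simps matrix_mul_assoc)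
      show "ext0T T Y s ** - (Z s ** ?N s) + - (tr (A s) ** Y s + Q s ** X s + tr (S s) ** U s) ** ext0T T Z s =
          - ric (A s) (B s) (Q s) (S s) (I s) (ext0T T P s)"
        unfolding ext0T_in[OF s] 2 3 4 by simp
    qed
  qed
  moreover have "P T = G" by (simp add: P_def Z XY)
  ultimately show ?thesis by blast
qed

end

lemma riccati_exists:
  obtains P where "prim_on T P (\<lambda>s. - ric (A s) (B s) (Q s) (S s) (I s) (ext0T T P s))" "P T = G"
    "\<And>t. t \<in> {0..T} ==> tr (P t) = P t"
proof -
  \<comment> \<open>The Hamiltonian system with the control eliminated through stationarity, which
    leaves a linear equation for the pair.\<close>
  obtain X Y where XY: "bmf X" "bmf Y" "X T = mat 1" "Y T = G"
    "prim_on T X (\<lambda>s. (A s - B s ** I s ** S s) ** X s + - (B s ** I s ** tr (B s)) ** Y s)"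
    "prim_on T Y (\<lambda>s. - (Q s - tr (S s) ** I s ** S s) ** X s + - (tr (A s) - tr (S s) ** I s ** tr (B s)) ** Y s)"
    by (rule linear_pair_backward[of T "\<lambda>s. A s - B s ** I s ** S s" "\<lambda>s. - (B s ** I s ** tr (B s))"
        "\<lambda>s. - (Q s - tr (S s) ** I s ** S s)" "\<lambda>s. - (tr (A s) - tr (S s) ** I s ** tr (B s))" "mat 1" G])
      (use T in \<open>auto intro!: bmf_intros b bBS\<close>)
  define U where "U s = - (I s ** (tr (B s) ** Y s + S s ** X s))" for s
  note dl = bounded_bilinear.diff_left[OF bilinear_matrix_mult] bounded_bilinear.diff_right[OF bilinear_matrix_mult]
  have 1: "(A s - B s ** I s ** S s) ** X s + - (B s ** I s ** tr (B s)) ** Y s = A s ** X s + B s ** U s" for s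
    by (simp add: U_def mm_minus mm_simps dl matrix_mul_assoc)
  have 2: "- (Q s - tr (S s) ** I s ** S s) ** X s + - (tr (A s) - tr (S s) ** I s ** tr (B s)) ** Y s =
      - (tr (A s) ** Y s + Q s ** X s + tr (S s) ** U s)" for s
    by (simp add: U_def mm_minus mm_simps dl matrix_mul_assoc)
  from riccati_from_hamiltonian[OF XY(1-4) U_def XY(5)[unfolded 1] XY(6)[unfolded 2]]
  obtain P where P: "prim_on T P (\<lambda>s. - ric (A s) (B s) (Q s) (S s) (I s) (ext0T T P s))" "P T = G" by (elim exE conjE)
  \<comment> \<open>The transpose solves the same equation with the same terminal value, so
    uniqueness gives symmetry.\<close>
  have "tr (P t) = P t" if t: "t \<in> {0..T}" for t
  proof (rule ric_unique[OF b(1) bBS(1) b(2) bBS(2) b(11) _ P(1) _ t])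
    have "tr (ext0T T P s) = ext0T T (\<lambda>t. tr (P t)) s" for s
      by (simp add: ext0T_def linear_scale[OF bounded_linear.linear[OF linear_transpose]])
    then show "prim_on T (\<lambda>t. tr (P t)) (\<lambda>s. - ric (A s) (B s) (Q s) (S s) (I s) (ext0T T (\<lambda>t. tr (P t)) s))"
      using prim_on_linear[OF linear_transpose P(1)] by (simp add: transpose_minus transpose_ric sym)
    show "tr (P T) = P T" by (simp add: P(2) sym)
  qed
  with P show thesis by (rule that)
qed

end

section \<open>The mean-field game\<close>

lemma abs_cont_on_continuous:
  assumes "abs_cont_on a b f" shows "continuous_on {a..b} f"
  unfolding continuous_on_iff
proof (intro ballI allI impI)
  fix x e :: real assume x: "x \<in> {a..b}" and e: "0 < e"
  from assms[unfolded abs_cont_on_def, rule_format, OF e]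
  obtain d where d: "0 < d" "\<forall>(k::nat) (l::nat => real) (r::nat => real).
      (\<forall>i<k. a \<le> l i \<and> l i \<le> r i \<and> r i \<le> b) \<and> (\<forall>i<k. \<forall>j<k. i \<noteq> j \<longrightarrow> r i \<le> l j \<or> r j \<le> l i) \<and>
      (\<Sum>i<k. r i - l i) < d \<longrightarrow> (\<Sum>i<k. norm (f (r i) - f (l i))) < e" by (elim exE conjE)
  show "\<exists>d>0. \<forall>x'\<in>{a..b}. dist x' x < d \<longrightarrow> dist (f x') (f x) < e"
  proof (intro exI[of _ d] conjI ballI impI d(1))
    fix y assume y: "y \<in> {a..b}" "dist y x < d"
    have "max x y - min x y < d" using y(2) by (auto simp: dist_real_def max_def min_def)
    then have "norm (f (max x y) - f (min x y)) < e"
      using d(2)[rule_format, of "Suc 0" "\<lambda>_. min x y" "\<lambda>_. max x y"] x y(1) by simp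
    then show "dist (f y) (f x) < e" by (cases "x \<le> y") (simp_all add: dist_norm norm_minus_commute max_def min_def)
  qed
qed

text \<open>The default value makes the pointwise identities hold off the good set as well.\<close>

definition patch :: "real set => 'a => (real => 'a) => real => 'a" where
  "patch E d f t = (if t \<in> E then f t else d)"

lemma patch_in [simp]: "t \<in> E ==> patch E d f t = f t" by (simp add: patch_def)
lemma patch_notin [simp]: "t \<notin> E ==> patch E d f t = d" by (simp add: patch_def)

lemma bmf_patch_bounded:
  fixes f :: "real => 'a::euclidean_space"
  assumes E: "E \<in> sets borel" and m: "(\<lambda>t. indicator E t *\<^sub>R f t) \<in> borel_measurable borel" and K: "\<And>t. t \<in> E ==> norm (f t) \<le> K"
  shows "bmf (patch E d f)"
proof (rule bmfI)
  have "patch E d f = (\<lambda>t. indicator E t *\<^sub>R f t + indicator (- E) t *\<^sub>R d)" by (auto simp: patch_def indicator_def fun_eq_iff)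
  then show "patch E d f \<in> borel_measurable borel" using m E by simp
  show "norm (patch E d f t) \<le> max K (norm d)" for t using K[of t] by (auto simp: patch_def le_max_iff_disj)
qed

lemma bmf_patch:
  assumes "bmf f" "E \<in> sets borel" shows "bmf (patch E d f)"
proof -
  obtain K where K: "0 < K" "\<And>t. norm (f t) \<le> K" using bmf_bound[OF assms(1)] by metis
  show ?thesis
    by (rule bmf_patch_bounded[OF assms(2) _ K(2)]) (use assms bmf_measurable[OF assms(1)] in \<open>auto intro: borel_measurable_scaleR\<close>)
qed

lemma AE_null_set:
  assumes "AE t in lborel. t \<in> {0..T} \<longrightarrow> Q t"
  obtains N where "N \<in> null_sets lborel" "\<forall>t\<in>{0..T} - N. Q t"
proof -
  from assms obtain N where "N \<in> null_sets lborel" "{t \<in> space lborel. \<not> (t \<in> {0..T} \<longrightarrow> Q t)} \<subseteq> N"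
    unfolding eventually_ae_filter by blast
  then show thesis by (intro that[of N]) auto
qed

text \<open>The exceptional null set is fixed as a term, so that those of all coefficients can be
  united first and every coefficient is then modified off one common good set.\<close>

definition Linf_bad :: "real => (real => 'a::euclidean_space) => real set" where
  "Linf_bad T f = (SOME N. N \<in> null_sets lborel \<and> (\<exists>K. \<forall>t\<in>{0..T} - N. norm (f t) \<le> K))"

lemma Linf_bad:
  fixes f :: "real => 'a::euclidean_space"
  assumes "Linf T f"
  shows "Linf_bad T f \<in> null_sets lborel" "\<exists>K. \<forall>t\<in>{0..T} - Linf_bad T f. norm (f t) \<le> K"
proof -
  obtain K where "AE t in lborel. t \<in> {0..T} \<longrightarrow> norm (f t) \<le> K" using assms by (auto simp: Linf_def)
  then obtain N where "N \<in> null_sets lborel" "\<forall>t\<in>{0..T} - N. norm (f t) \<le> K" by (rule AE_null_set)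
  then have "\<exists>N. N \<in> null_sets lborel \<and> (\<exists>K. \<forall>t\<in>{0..T} - N. norm (f t) \<le> K)" by blast
  from someI_ex[OF this] show "Linf_bad T f \<in> null_sets lborel" "\<exists>K. \<forall>t\<in>{0..T} - Linf_bad T f. norm (f t) \<le> K"
    unfolding Linf_bad_def by blast+
qed

lemma Linf_patch:
  fixes f :: "real => 'a::euclidean_space"
  assumes f: "Linf T f" and N: "N \<in> null_sets lborel" "Linf_bad T f \<subseteq> N"
  shows "bmf (patch ({0..T} - N) d f)" "eq_ae T f (patch ({0..T} - N) d f)"
proof -
  let ?E = "{0..T} - N"
  have Nb: "N \<in> sets borel" using N(1) null_setsD2 by fastforce
  then have E: "?E \<in> sets borel" by simp
  obtain K where K: "\<forall>t\<in>{0..T} - Linf_bad T f. norm (f t) \<le> K" using Linf_bad(2)[OF f] by blast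
  have sf: "sbm T f" using f by (simp add: Linf_def)
  have "(\<lambda>t. indicator ?E t *\<^sub>R f t) = (\<lambda>t. indicator (- N) t *\<^sub>R (indicator {0..T} t *\<^sub>R f t))"
    by (auto simp: indicator_def fun_eq_iff)
  also have "\<dots> \<in> borel_measurable borel"
    by (rule borel_measurable_scaleR) (use sf Nb in \<open>simp_all add: set_borel_measurable_def del: measurable_lborel2 indicator_simps\<close>)
  finally show b: "bmf (patch ?E d f)" by (rule bmf_patch_bounded[OF E]) (use K N(2) in blast)
  have "AE t in lborel. t \<notin> N" by (rule AE_not_in[OF N(1)])
  then have "AE t in lborel. t \<in> {0..T} \<longrightarrow> f t = patch ?E d f t" by eventually_elim simp
  then show "eq_ae T f (patch ?E d f)" by (simp add: eq_ae_def sf sbm_borel[OF bmf_measurable[OF b]])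
qed

lemma total_sigma:
  "block R11 R12 R21 R22 + block R11b R12b R21b R22b + tr (hcat D1 D2 + hcat D1b D2b) ** P ** (hcat D1 D2 + hcat D1b D2b) =
   block (R11 + R11b + tr (D1 + D1b) ** P ** (D1 + D1b)) (R12 + R12b + tr (D1 + D1b) ** P ** (D2 + D2b))
         (R21 + R21b + tr (D2 + D2b) ** P ** (D1 + D1b)) (R22 + R22b + tr (D2 + D2b) ** P ** (D2 + D2b))"
  unfolding block_add hcat_add congruence_block ..

lemma total_riccati:
  assumes P: "tr P = P"
  shows "ric (A + Ab) (hcat (B1 + B1b) (B2 + B2b)) (Q + Qb + tr (C + Cb) ** P ** (C + Cb))
      (vcat (S1 + S1b + tr (D1 + D1b) ** P ** (C + Cb)) (S2 + S2b + tr (D2 + D2b) ** P ** (C + Cb))) I V =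
    V ** (A + Ab) + tr (A + Ab) ** V + (Q + Qb + tr (C + Cb) ** P ** (C + Cb))
    - (V ** (hcat B1 B2 + hcat B1b B2b) + tr (C + Cb) ** P ** (hcat D1 D2 + hcat D1b D2b) + tr (vcat S1 S2 + vcat S1b S2b))
      ** I ** (tr (hcat B1 B2 + hcat B1b B2b) ** V + tr (hcat D1 D2 + hcat D1b D2b) ** P ** (C + Cb) + vcat S1 S2 + vcat S1b S2b)"
proof -
  let ?D = "hcat (D1 + D1b) (D2 + D2b)"
  have S: "vcat (S1 + S1b + tr (D1 + D1b) ** P ** (C + Cb)) (S2 + S2b + tr (D2 + D2b) ** P ** (C + Cb)) =
      tr ?D ** P ** (C + Cb) + vcat S1 S2 + vcat S1b S2b"
    unfolding transpose_hcat vcat_mm vcat_add by (simp add: ac_simps)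
  have St: "tr (tr ?D ** P ** (C + Cb) + vcat S1 S2 + vcat S1b S2b) =
      tr (C + Cb) ** P ** ?D + tr (vcat S1 S2 + vcat S1b S2b)"
    by (simp only: transpose_add matrix_transpose_mul transpose_transpose P matrix_mul_assoc add.assoc)
  show ?thesis unfolding ric_def S St unfolding hcat_add by (simp only: add.assoc)
qed

section \<open>The game with coefficients patched to bounded Borel functions\<close>

locale mf_game = brownian_T M W T for M :: "'w measure" and W T +
  fixes A Ab C Cb :: "real => real^'n^'n" and B1 B1b D1 D1b :: "real => real^'m1^'n" and B2 B2b D2 D2b :: "real => real^'m2^'n"
    and G Gb :: "real^'n^'n" and Q Qb :: "real => real^'n^'n"
    and S1 S1b :: "real => real^'n^'m1" and S2 S2b :: "real => real^'n^'m2"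
    and R11 R11b :: "real => real^'m1^'m1" and R12 R12b :: "real => real^'m2^'m1"
    and R21 R21b :: "real => real^'m1^'m2" and R22 R22b :: "real => real^'m2^'m2"
    and P :: "real => real^'n^'n" and \<alpha> \<delta> :: real
  assumes Linf: "Linf T A" "Linf T Ab" "Linf T C" "Linf T Cb" "Linf T B1" "Linf T B1b" "Linf T D1" "Linf T D1b"
      "Linf T B2" "Linf T B2b" "Linf T D2" "Linf T D2b" "Linf T Q" "Linf T Qb" "Linf T S1" "Linf T S1b" "Linf T S2" "Linf T S2b"
      "Linf T R11" "Linf T R12" "Linf T R21" "Linf T R22" "Linf T R11b" "Linf T R12b" "Linf T R21b" "Linf T R22b"
    and symG: "tr G = G" "tr Gb = Gb"
    and sym_ae: "AE t in lborel. t \<in> {0..T} \<longrightarrow> tr (Q t) = Q t \<and> tr (Qb t) = Qb t \<and>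
         tr (R11 t) = R11 t \<and> tr (R12 t) = R21 t \<and> tr (R22 t) = R22 t \<and>
         tr (R11b t) = R11b t \<and> tr (R12b t) = R21b t \<and> tr (R22b t) = R22b t"
    and \<alpha>: "0 < \<alpha>"
    and H1: "\<And>u X. admissible M (aug_filtration M W) T u ==>
      state1 M (aug_filtration M W) W T A Ab B1 B1b C Cb D1 D1b u X ==> \<alpha> * sq_norm M T u \<le> cost1 M T G Gb Q S1 R11 Qb S1b R11b u X"
    and H2: "\<And>u X. admissible M (aug_filtration M W) T u ==>
      state1 M (aug_filtration M W) W T A Ab B2 B2b C Cb D2 D2b u X ==> \<alpha> * sq_norm M T u \<le> - cost1 M T G Gb Q S2 R22 Qb S2b R22b u X"
    and SR: "strongly_regular T A C B1 B2 D1 D2 G Q S1 S2 R11 R12 R21 R22 P"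
    and \<delta>: "0 < \<delta>" "\<delta> \<le> 1"
    and pos_ae: "AE t in lborel. t \<in> {0..T} \<longrightarrow> (\<forall>v. \<delta> * (v \<bullet> v) \<le> ((R11 t + tr (D1 t) ** P t ** D1 t) *v v) \<bullet> v) \<and>
      (\<forall>v. \<delta> * (v \<bullet> v) \<le> - (((R22 t + tr (D2 t) ** P t ** D2 t) *v v) \<bullet> v))"
begin

lemma P_ac: "abs_cont_on 0 T P" and symP: "t \<in> {0..T} ==> tr (P t) = P t" and PT: "P T = G"
  using SR by (auto simp: strongly_regular_def symm_def)

definition good :: "real => bool" where
  "good t \<longleftrightarrow> (tr (Q t) = Q t \<and> tr (Qb t) = Qb t \<and>
         tr (R11 t) = R11 t \<and> tr (R12 t) = R21 t \<and> tr (R22 t) = R22 t \<and>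
         tr (R11b t) = R11b t \<and> tr (R12b t) = R21b t \<and> tr (R22b t) = R22b t) \<and>
    (\<forall>v. \<delta> * (v \<bullet> v) \<le> ((R11 t + tr (D1 t) ** P t ** D1 t) *v v) \<bullet> v) \<and>
    (\<forall>v. \<delta> * (v \<bullet> v) \<le> - (((R22 t + tr (D2 t) ** P t ** D2 t) *v v) \<bullet> v))"

definition N0 :: "real set" where "N0 = (SOME N. N \<in> null_sets lborel \<and> (\<forall>t\<in>{0..T} - N. good t))"

lemma N0: "N0 \<in> null_sets lborel" "t \<in> {0..T} - N0 ==> good t"
proof -
  have "AE t in lborel. t \<in> {0..T} \<longrightarrow> good t" using sym_ae pos_ae by eventually_elim (simp add: good_def)
  then obtain N where "N \<in> null_sets lborel" "\<forall>t\<in>{0..T} - N. good t" by (rule AE_null_set)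
  then have "\<exists>N. N \<in> null_sets lborel \<and> (\<forall>t\<in>{0..T} - N. good t)" by blast
  from someI_ex[OF this] show "N0 \<in> null_sets lborel" "t \<in> {0..T} - N0 ==> good t" unfolding N0_def by blast+
qed

definition Nn :: "real set" where
  "Nn = \<Union> {N0, Linf_bad T A, Linf_bad T Ab, Linf_bad T C, Linf_bad T Cb, Linf_bad T B1, Linf_bad T B1b, Linf_bad T D1, Linf_bad T D1b,
      Linf_bad T B2, Linf_bad T B2b, Linf_bad T D2, Linf_bad T D2b, Linf_bad T Q, Linf_bad T Qb, Linf_bad T S1, Linf_bad T S1b,
      Linf_bad T S2, Linf_bad T S2b, Linf_bad T R11, Linf_bad T R12, Linf_bad T R21, Linf_bad T R22,
      Linf_bad T R11b, Linf_bad T R12b, Linf_bad T R21b, Linf_bad T R22b}"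

lemma Nn: "Nn \<in> null_sets lborel"
  unfolding Nn_def Union_insert Union_empty
  by (intro null_sets.Un) (simp_all add: N0(1) Linf[THEN Linf_bad(1)])

definition E :: "real set" where "E = {0..T} - Nn"

lemma E_sub: "t \<in> E ==> t \<in> {0..T}" "t \<in> E ==> good t"
  using N0(2)[of t] by (auto simp: E_def Nn_def)

lemma E_ae: "AE t in lborel. t \<in> {0..T} \<longrightarrow> t \<in> E"
  using AE_not_in[OF Nn] by eventually_elim (simp add: E_def)

abbreviation "z f \<equiv> patch E 0 f"
text \<open>The defaults carry the signs of the two diagonal blocks. Since
  \<open>\<delta> \<le> 1\<close>, the sign conditions then hold with the same
  \<open>\<delta>\<close> at every time, and with them invertibility.\<close>

definition "R1 = patch E (mat 1) R11"
definition "R2 = patch E (- mat 1) R22"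

lemma Nn_upper: "X \<in> {N0, Linf_bad T A, Linf_bad T Ab, Linf_bad T C, Linf_bad T Cb, Linf_bad T B1, Linf_bad T B1b, Linf_bad T D1, Linf_bad T D1b,
      Linf_bad T B2, Linf_bad T B2b, Linf_bad T D2, Linf_bad T D2b, Linf_bad T Q, Linf_bad T Qb, Linf_bad T S1, Linf_bad T S1b,
      Linf_bad T S2, Linf_bad T S2b, Linf_bad T R11, Linf_bad T R12, Linf_bad T R21, Linf_bad T R22,
      Linf_bad T R11b, Linf_bad T R12b, Linf_bad T R21b, Linf_bad T R22b}==> X \<subseteq> Nn"
  unfolding Nn_def by (rule Union_upper)

lemma patched_aux:
  fixes f :: "real => 'z::euclidean_space"
  shows "Linf T f ==> Linf_bad T f \<subseteq> Nn ==> bmf (patch E d f) \<and> eq_ae T f (patch E d f)"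
  unfolding E_def using Linf_patch[OF _ Nn] by blast

lemma patched:
  "bmf (z A) \<and> eq_ae T A (z A)" "bmf (z Ab) \<and> eq_ae T Ab (z Ab)" "bmf (z C) \<and> eq_ae T C (z C)" "bmf (z Cb) \<and> eq_ae T Cb (z Cb)"
  "bmf (z B1) \<and> eq_ae T B1 (z B1)" "bmf (z B1b) \<and> eq_ae T B1b (z B1b)" "bmf (z D1) \<and> eq_ae T D1 (z D1)" "bmf (z D1b) \<and> eq_ae T D1b (z D1b)"
  "bmf (z B2) \<and> eq_ae T B2 (z B2)" "bmf (z B2b) \<and> eq_ae T B2b (z B2b)" "bmf (z D2) \<and> eq_ae T D2 (z D2)" "bmf (z D2b) \<and> eq_ae T D2b (z D2b)"
  "bmf (z Q) \<and> eq_ae T Q (z Q)" "bmf (z Qb) \<and> eq_ae T Qb (z Qb)"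
  "bmf (z S1) \<and> eq_ae T S1 (z S1)" "bmf (z S1b) \<and> eq_ae T S1b (z S1b)" "bmf (z S2) \<and> eq_ae T S2 (z S2)" "bmf (z S2b) \<and> eq_ae T S2b (z S2b)"
  "bmf R1 \<and> eq_ae T R11 R1" "bmf (z R12) \<and> eq_ae T R12 (z R12)" "bmf (z R21) \<and> eq_ae T R21 (z R21)" "bmf R2 \<and> eq_ae T R22 R2"
  "bmf (z R11b) \<and> eq_ae T R11b (z R11b)" "bmf (z R12b) \<and> eq_ae T R12b (z R12b)" "bmf (z R21b) \<and> eq_ae T R21b (z R21b)" "bmf (z R22b) \<and> eq_ae T R22b (z R22b)"
  unfolding R1_def R2_def by (rule patched_aux, rule Linf, rule Nn_upper, simp)+

lemmas bmp = patched[THEN conjunct1]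
lemmas eqp = patched[THEN conjunct2]

definition "Pc = ext0T T P"

lemma Pc_in: "t \<in> E ==> Pc t = P t" using E_sub by (simp add: Pc_def)

lemma bPc: "bmf Pc" unfolding Pc_def by (rule bmf_ext0T[OF abs_cont_on_continuous[OF P_ac]])

lemma z_transpose: "tr (0 :: real^'i^'j) = 0" by (simp add: transpose_def vec_eq_iff)

lemma z_mult: "X ** (0 :: real^'i^'j) = 0" "(0 :: real^'j^'k) ** Y = 0" for X :: "real^'j^'k" and Y :: "real^'i^'j"
  by (simp_all add: matrix_matrix_mult_def vec_eq_iff)

lemma symz:
  "tr (z Q s) = z Q s" "tr (z Qb s) = z Qb s" "tr (R1 s) = R1 s" "tr (R2 s) = R2 s"
  "tr (z R11b s) = z R11b s" "tr (z R22b s) = z R22b s" "tr (z R12 s) = z R21 s" "tr (z R12b s) = z R21b s"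
  "tr (Pc s) = Pc s"
proof -
  show "tr (Pc s) = Pc s" by (cases "s \<in> {0..T}") (simp_all add: Pc_def symP ext0T_def z_transpose)
qed (cases "s \<in> E"; use E_sub(2)[of s] in \<open>simp add: R1_def R2_def good_def z_transpose transpose_minus transpose_mat\<close>)+

lemma pos:
  "\<delta> * (v \<bullet> v) \<le> ((R1 s + tr (z D1 s) ** Pc s ** z D1 s) *v v) \<bullet> v"
  "\<delta> * (w \<bullet> w) \<le> - (((R2 s + tr (z D2 s) ** Pc s ** z D2 s) *v w) \<bullet> w)"
proof -
  have 1: "\<delta> * (x \<bullet> x) \<le> x \<bullet> x" for x :: "'z::real_inner"
    using mult_right_mono[OF \<delta>(2) inner_ge_zero[of x]] by simp
  show "\<delta> * (v \<bullet> v) \<le> ((R1 s + tr (z D1 s) ** Pc s ** z D1 s) *v v) \<bullet> v"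
    by (cases "s \<in> E") (use E_sub(2)[of s] 1 in \<open>simp_all add: Pc_in good_def R1_def z_mult\<close>)
  show "\<delta> * (w \<bullet> w) \<le> - (((R2 s + tr (z D2 s) ** Pc s ** z D2 s) *v w) \<bullet> w)"
    by (cases "s \<in> E") (use E_sub(2)[of s] 1 in \<open>simp_all add: Pc_in good_def R2_def z_mult mv_minus\<close>)
qed

definition "Bz s = hcat (z B1 s) (z B2 s)"
definition "Dz s = hcat (z D1 s) (z D2 s)"
definition "Sz s = vcat (z S1 s) (z S2 s)"
definition "Rz s = block (R1 s) (z R12 s) (z R21 s) (R2 s)"
definition "Iz s = matrix_inv (Rz s + tr (Dz s) ** Pc s ** Dz s)"
text \<open>The derivative of \<open>P\<close> as its Riccati equation dictates it, defined at all
  times so that \<open>riccati_z\<close> holds without exceptions.\<close>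

definition "Pd s = - (Pc s ** z A s + tr (z A s) ** Pc s + tr (z C s) ** Pc s ** z C s + z Q s
   - (Pc s ** Bz s + tr (z C s) ** Pc s ** Dz s + tr (Sz s)) ** Iz s
      ** (tr (Bz s) ** Pc s + tr (Dz s) ** Pc s ** z C s + Sz s))"
text \<open>Minus the saddle-point gain: \<open>- mtop (Kz s)\<close> and
  \<open>- mbot (Kz s)\<close> are the feedbacks of the two players.\<close>

definition "Kz s = Iz s ** (tr (Bz s) ** Pc s + tr (Dz s) ** Pc s ** z C s + Sz s)"

lemma bBDS: "bmf Bz" "bmf Dz" "bmf Sz" "bmf Rz"
  unfolding Bz_def[abs_def] Dz_def[abs_def] Sz_def[abs_def] Rz_def[abs_def] by (intro bmf_hcat bmf_vcat bmf_block bmp)+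

lemma lower: "lower_bounded (1 / \<delta>) (Rz s + tr (Dz s) ** Pc s ** Dz s)"
  unfolding Rz_def Dz_def congruence_block
  by (rule saddle_lower_bounded[OF \<delta>(1) _ pos]) (simp add: transpose_add matrix_transpose_mul symz matrix_mul_assoc)

lemma bIz: "bmf Iz"
  unfolding Iz_def[abs_def] by (rule bmf_matrix_inv[OF _ lower]) (intro bmf_intros bBDS bPc)

lemma Iz: "(Rz s + tr (Dz s) ** Pc s ** Dz s) ** Iz s = mat 1"
  unfolding Iz_def by (rule matrix_inv_mult(2)[OF lower_bounded_inverse(1)[OF lower]])

lemma bPd: "bmf Pd" and bKz: "bmf Kz"
  unfolding Pd_def[abs_def] Kz_def[abs_def] by (intro bmf_intros bmp bBDS bPc bIz)+

lemma P_prim: "prim_on T Pc Pd" "Pc T = G"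
proof -
  have "AE t in lborel. t \<in> {0..T} \<longrightarrow> (P has_vector_derivative Pd t) (at t)"
    using SR[unfolded strongly_regular_def Let_def, THEN conjunct2, THEN conjunct2, THEN conjunct2, THEN conjunct2, THEN conjunct2] E_ae
  proof eventually_elim
    case (elim t)
    show ?case
    proof
      assume t: "t \<in> {0..T}"
      with elim have tE: "t \<in> E" by blast
      from elim(1)[rule_format, OF t] obtain P' where P': "(P has_vector_derivative P') (at t)" "P' = Pd t"
      proof (elim exE conjE, goal_cases)
        case (1 P')
        have "P' - Pd t = 0" unfolding 1(3)[symmetric] Pd_def
          using tE by (simp add: Pc_in Iz_def Bz_def Dz_def Sz_def Rz_def R1_def R2_def)
        then show ?case using 1(1,2) by simp
      qed
      then show "(P has_vector_derivative Pd t) (at t)" using P'(1) by simp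
    qed
  qed
  then have "prim_on T P Pd" by (rule abs_cont_on_prim[OF P_ac bPd])
  then show "prim_on T Pc Pd" by (rule prim_on_cong) (use bPd in \<open>auto simp: Pc_def\<close>)
  show "Pc T = G" using Tpos PT by (simp add: Pc_def)
qed

abbreviation "Ct s \<equiv> z C s + z Cb s"
abbreviation "Qt s \<equiv> z Q s + z Qb s + tr (Ct s) ** Pc s ** Ct s"
abbreviation "St1 s \<equiv> z S1 s + z S1b s + tr (z D1 s + z D1b s) ** Pc s ** Ct s"
abbreviation "St2 s \<equiv> z S2 s + z S2b s + tr (z D2 s + z D2b s) ** Pc s ** Ct s"
abbreviation "Rt11 s \<equiv> R1 s + z R11b s + tr (z D1 s + z D1b s) ** Pc s ** (z D1 s + z D1b s)"
abbreviation "Rt22 s \<equiv> R2 s + z R22b s + tr (z D2 s + z D2b s) ** Pc s ** (z D2 s + z D2b s)"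

lemma riccati_z: "Pd s + Pc s ** z A s + tr (z A s) ** Pc s + tr (z C s) ** Pc s ** z C s + z Q s
   - (Pc s ** hcat (z B1 s) (z B2 s) + tr (z C s) ** Pc s ** hcat (z D1 s) (z D2 s) + tr (vcat (z S1 s) (z S2 s))) ** Iz s
      ** (tr (hcat (z B1 s) (z B2 s)) ** Pc s + tr (hcat (z D1 s) (z D2 s)) ** Pc s ** z C s + vcat (z S1 s) (z S2 s)) = 0"
  by (simp add: Pd_def Bz_def Dz_def Sz_def)

section \<open>Coercivity for both players and invertibility of \<open>Sig\<close>\<close>

lemma player1_coercive:
  assumes u: "bmf u" and y: "bmf y" "y 0 = 0" "prim_on T y (\<lambda>s. (z A s + z Ab s) *v y s + (z B1 s + z B1b s) *v u s)"
  shows "\<alpha> * (LBINT s:{0..T}. (norm (u s))^2) \<le>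
     ((G + Gb) *v y T) \<bullet> y T + (LBINT s:{0..T}. q1 (Qt s) (St1 s) (Rt11 s) (y s) (u s))"
proof (rule one_player_coercive[OF H1 \<alpha> eqp(1,2,3,4,5,6,7,8,13,14,15,16,19,23) bmp(1,2,3,4,5,6,7,8) _ y(1) u bmp(13,14,15,16,19,23) bPc bPd symz(1,3,9) P_prim _ y(2,3)])
  show "bmf (\<lambda>s. - mtop (Kz s))" by (intro bmf_minus bmf_mtop bKz)
  fix s x
  note pf = player_forms(1)[OF symz(9)[of s] symz(7)[of s] Iz[of s, unfolded Rz_def Dz_def] riccati_z[of s], of x]
  have "((R2 s + tr (z D2 s) ** Pc s ** z D2 s) *v w) \<bullet> w \<le> 0" for w
    using pos(2)[of w s] \<delta>(1) inner_ge_zero[of w] mult_nonneg_nonneg[of \<delta> "w \<bullet> w"] by linarith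
  then show "x \<bullet> ((Pd s + Pc s ** (z A s + z B1 s ** - mtop (Kz s)) + tr (z A s + z B1 s ** - mtop (Kz s)) ** Pc s +
       tr (z C s + z D1 s ** - mtop (Kz s)) ** Pc s ** (z C s + z D1 s ** - mtop (Kz s)) +
       (z Q s + tr (- mtop (Kz s)) ** z S1 s + tr (z S1 s) ** - mtop (Kz s) + tr (- mtop (Kz s)) ** R1 s ** - mtop (Kz s))) *v x) \<le> 0"
    unfolding Kz_def Bz_def Dz_def Sz_def pf .
qed

text \<open>Player 2 is treated as a minimiser after reversing the signs of all weights and of
  \<open>P\<close>. The closed-loop matrix is odd under this reversal, so the sign needed now is
  that of the block of player 1.\<close>

lemma player2_coercive:
  assumes u: "bmf u" and y: "bmf y" "y 0 = 0" "prim_on T y (\<lambda>s. (z A s + z Ab s) *v y s + (z B2 s + z B2b s) *v u s)"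
  shows "\<alpha> * (LBINT s:{0..T}. (norm (u s))^2) \<le>
     - (((G + Gb) *v y T) \<bullet> y T + (LBINT s:{0..T}. q1 (Qt s) (St2 s) (Rt22 s) (y s) (u s)))"
proof -
  have "\<alpha> * (LBINT s:{0..T}. (norm (u s))^2) \<le>
     ((- G + - Gb) *v y T) \<bullet> y T + (LBINT s:{0..T}. q1 (- z Q s + - z Qb s + tr (Ct s) ** (- Pc s) ** Ct s)
        (- z S2 s + - z S2b s + tr (z D2 s + z D2b s) ** (- Pc s) ** Ct s)
        (- R2 s + - z R22b s + tr (z D2 s + z D2b s) ** (- Pc s) ** (z D2 s + z D2b s)) (y s) (u s))"
  proof (rule one_player_coercive[OF _ \<alpha> eqp(1,2,3,4,9,10,11,12) eqp(13,14,17,18,22,26)[THEN eq_ae_minus] bmp(1,2,3,4,9,10,11,12) _ y(1) u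
        bmp(13,14,17,18,22,26)[THEN bmf_minus] bPc[THEN bmf_minus] bPd[THEN bmf_minus] _ _ _ _ _ _ y(2,3)])
    show "\<alpha> * sq_norm M T v \<le> cost1 M T (- G) (- Gb) (\<lambda>s. - Q s) (\<lambda>s. - S2 s) (\<lambda>s. - R22 s) (\<lambda>s. - Qb s) (\<lambda>s. - S2b s) (\<lambda>s. - R22b s) v X"
      if "admissible M (aug_filtration M W) T v" "state1 M (aug_filtration M W) W T A Ab B2 B2b C Cb D2 D2b v X" for v X
      unfolding cost1_minus by (rule H2[OF that])
    show "bmf (\<lambda>s. - mbot (Kz s))" by (intro bmf_minus bmf_mtop bKz)
    show "tr (- z Q s) = - z Q s" "tr (- R2 s) = - R2 s" "tr (- Pc s) = - Pc s" for s
      by (simp_all add: transpose_minus symz)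
    show "prim_on T (\<lambda>s. - Pc s) (\<lambda>s. - Pd s)" by (rule prim_on_linear[OF bounded_linear_minus[OF bounded_linear_ident] P_prim(1)])
    show "- Pc T = - G" by (simp add: P_prim)
    fix s x
    note pf = player_forms(2)[OF symz(9)[of s] symz(7)[of s] Iz[of s, unfolded Rz_def Dz_def] riccati_z[of s], of x]
    have neg: "- p + (- q) ** a + tr a ** (- q) + tr c ** (- q) ** c + (- r + tr f ** (- t) + tr (- t) ** f + tr f ** (- k) ** f) =
        - (p + q ** a + tr a ** q + tr c ** q ** c + (r + tr f ** t + tr t ** f + tr f ** k ** f))"
      for p q a c r :: "real^'n^'n" and t f :: "real^'n^'m2" and k
      by (simp add: mm_minus transpose_minus)
    have p1: "0 \<le> ((R1 s + tr (z D1 s) ** Pc s ** z D1 s) *v w) \<bullet> w" for w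
      using pos(1)[of w s] \<delta>(1) inner_ge_zero[of w] mult_nonneg_nonneg[of \<delta> "w \<bullet> w"] by linarith
    have "x \<bullet> ((Pd s + Pc s ** (z A s + z B2 s ** - mbot (Kz s)) + tr (z A s + z B2 s ** - mbot (Kz s)) ** Pc s +
       tr (z C s + z D2 s ** - mbot (Kz s)) ** Pc s ** (z C s + z D2 s ** - mbot (Kz s)) +
       (z Q s + tr (- mbot (Kz s)) ** z S2 s + tr (z S2 s) ** - mbot (Kz s) + tr (- mbot (Kz s)) ** R2 s ** - mbot (Kz s))) *v x) \<ge> 0"
      unfolding Kz_def Bz_def Dz_def Sz_def pf by (rule p1)
    then show "x \<bullet> ((- Pd s + - Pc s ** (z A s + z B2 s ** - mbot (Kz s)) + tr (z A s + z B2 s ** - mbot (Kz s)) ** - Pc s +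
       tr (z C s + z D2 s ** - mbot (Kz s)) ** - Pc s ** (z C s + z D2 s ** - mbot (Kz s)) +
       (- z Q s + tr (- mbot (Kz s)) ** - z S2 s + tr (- z S2 s) ** - mbot (Kz s) + tr (- mbot (Kz s)) ** - R2 s ** - mbot (Kz s))) *v x) \<le> 0"
      unfolding neg mv_minus by simp
  qed
  also have "\<dots> = - (((G + Gb) *v y T) \<bullet> y T) + (LBINT s:{0..T}. - q1 (Qt s) (St2 s) (Rt22 s) (y s) (u s))"
  proof -
    have n: "- a + - b + x ** (- Pc s) ** w = - (a + b + x ** Pc s ** w)" for a b :: "real^'i^'j" and x w s
      by (simp add: mm_minus)
    have "- G + - Gb = - (G + Gb)" by simp
    then show ?thesis unfolding n q1_minus by (simp only: mv_minus inner_minus_left)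
  qed
  finally show ?thesis by (simp add: set_lebesgue_integral_def)
qed

abbreviation "Rt12 s \<equiv> z R12 s + z R12b s + tr (z D1 s + z D1b s) ** Pc s ** (z D2 s + z D2b s)"
abbreviation "Rt21 s \<equiv> z R21 s + z R21b s + tr (z D2 s + z D2b s) ** Pc s ** (z D1 s + z D1b s)"
abbreviation "Rt s \<equiv> block (Rt11 s) (Rt12 s) (Rt21 s) (Rt22 s)"

lemma bt: "bmf Qt" "bmf St1" "bmf St2" "bmf Rt11" "bmf Rt12" "bmf Rt21" "bmf Rt22"
  by (intro bmf_intros bmp bPc)+

lemma symt: "tr (Qt s) = Qt s" "tr (Rt12 s) = Rt21 s" "tr (Rt11 s) = Rt11 s" "tr (Rt22 s) = Rt22 s"
  by (simp_all add: transpose_add matrix_transpose_mul symz matrix_mul_assoc)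

text \<open>Needle variations transfer coercivity to the diagonal blocks with the same constant
  \<open>\<alpha>\<close> as in (H3); the bound for the inverse thus depends only on
  \<open>\<alpha>\<close> and the dimensions.\<close>

lemma lower_ae: "AE t in lborel. t \<in> {0..T} \<longrightarrow> lower_bounded (1 / \<alpha>) (Rt t)"
proof -
  have b1: "bmf (\<lambda>s. z A s + z Ab s)" "bmf (\<lambda>s. z B1 s + z B1b s)" "bmf (\<lambda>s. z B2 s + z B2b s)" by (intro bmf_add bmp)+
  have 1: "AE t in lborel. t \<in> {0..T} \<longrightarrow> (\<forall>v. \<alpha> * (v \<bullet> v) \<le> (Rt11 t *v v) \<bullet> v)"
    by (rule spike_coercive[OF Tpos b1(1,2) bt(1,2,4) player1_coercive])
  have 2: "AE t in lborel. t \<in> {0..T} \<longrightarrow> (\<forall>v. \<alpha> * (v \<bullet> v) \<le> (- Rt22 t *v v) \<bullet> v)"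
  proof (rule spike_coercive[OF Tpos b1(1,3) bmf_minus[OF bt(1)] bmf_minus[OF bt(3)] bmf_minus[OF bt(7)]])
    fix u :: "real => real^'m2" and y
    assume "bmf u" "bmf y" "y 0 = 0" "prim_on T y (\<lambda>s. (z A s + z Ab s) *v y s + (z B2 s + z B2b s) *v u s)"
    from player2_coercive[OF this]
    show "\<alpha> * (LBINT s:{0..T}. (norm (u s))^2) \<le>
       (- (G + Gb) *v y T) \<bullet> y T + (LBINT s:{0..T}. q1 (- Qt s) (- St2 s) (- Rt22 s) (y s) (u s))"
      unfolding q1_minus mv_minus inner_minus_left by (simp add: set_lebesgue_integral_def)
  qed
  from 1 2 show ?thesis
  proof eventually_elim
    case (elim t)
    show ?case
    proof
      assume "t \<in> {0..T}"
      with elim have "\<forall>v. \<alpha> * (v \<bullet> v) \<le> (Rt11 t *v v) \<bullet> v" "\<forall>v. \<alpha> * (v \<bullet> v) \<le> (- Rt22 t *v v) \<bullet> v" by blast+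
      then show "lower_bounded (1 / \<alpha>) (Rt t)"
        by (intro saddle_lower_bounded[OF \<alpha> symt(2)]) (simp_all only: mv_minus inner_minus_left)
    qed
  qed
qed

definition "Sig t = block (R11 t) (R12 t) (R21 t) (R22 t) + block (R11b t) (R12b t) (R21b t) (R22b t)
  + tr (hcat (D1 t) (D2 t) + hcat (D1b t) (D2b t)) ** P t ** (hcat (D1 t) (D2 t) + hcat (D1b t) (D2b t))"

lemma Sig_Rt: "t \<in> E ==> Sig t = Rt t"
  unfolding Sig_def total_sigma by (simp add: Pc_in R1_def R2_def)

lemma Sig_inverse: "\<exists>K. AE t in lborel. t \<in> {0..T} \<longrightarrow> invertible (Sig t) \<and> norm (matrix_inv (Sig t)) \<le> K"
proof (rule exI)
  show "AE t in lborel. t \<in> {0..T} \<longrightarrow> invertible (Sig t) \<and>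
      norm (matrix_inv (Sig t)) \<le> real CARD('m1 + 'm2) * (real CARD('m1 + 'm2) * (1 / \<alpha>))"
    using lower_ae E_ae
  proof eventually_elim
    case (elim t)
    show ?case
    proof
      assume "t \<in> {0..T}"
      with elim have "lower_bounded (1 / \<alpha>) (Sig t)" by (metis Sig_Rt)
      from lower_bounded_inverse[OF this] show "invertible (Sig t) \<and>
          norm (matrix_inv (Sig t)) \<le> real CARD('m1 + 'm2) * (real CARD('m1 + 'm2) * (1 / \<alpha>))" by (rule conjI)
    qed
  qed
qed

section \<open>Existence and uniqueness for the equation of \<open>Pi\<close>\<close>

abbreviation "residual t X V \<equiv> X + V ** (A t + Ab t) + tr (A t + Ab t) ** V + Q t + Qb t
        + tr (C t + Cb t) ** P t ** (C t + Cb t)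
        - (V ** (hcat (B1 t) (B2 t) + hcat (B1b t) (B2b t)) + tr (C t + Cb t) ** P t ** (hcat (D1 t) (D2 t) + hcat (D1b t) (D2b t))
             + tr (vcat (S1 t) (S2 t) + vcat (S1b t) (S2b t)))
          ** matrix_inv (Sig t)
          ** (tr (hcat (B1 t) (B2 t) + hcat (B1b t) (B2b t)) ** V + tr (hcat (D1 t) (D2 t) + hcat (D1b t) (D2b t)) ** P t ** (C t + Cb t)
             + vcat (S1 t) (S2 t) + vcat (S1b t) (S2b t))"

definition sol :: "(real => real^'n^'n) => bool" where
  "sol V \<longleftrightarrow> abs_cont_on 0 T V \<and> (\<forall>t\<in>{0..T}. symm (V t)) \<and> V T = G + Gb \<and>
     (AE t in lborel. t \<in> {0..T} \<longrightarrow> (\<exists>V'. (V has_vector_derivative V') (at t) \<and>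
        residual t V' (V t) = 0))"

lemma sol_unique: "\<exists>V. sol V \<and> (\<forall>V'. sol V' \<longrightarrow> (\<forall>t\<in>{0..T}. V' t = V t))"
proof -
  obtain N where N: "N \<in> null_sets lborel" "\<forall>t\<in>{0..T} - N. lower_bounded (1 / \<alpha>) (Rt t)"
    using lower_ae by (rule AE_null_set)
  \<comment> \<open>\<open>Rt\<close> is known to be invertible only almost everywhere, also on
    \<open>E\<close>: its exceptional set comes from the needle variations. Hence a second patch
    with the identity matrix.\<close>
  define E' where "E' = {0..T} - N"
  have E'b: "E' \<in> sets borel" using null_setsD2[OF N(1)] by (simp add: E'_def)
  have E'_ae: "AE t in lborel. t \<in> {0..T} \<longrightarrow> t \<in> E'" using AE_not_in[OF N(1)] by eventually_elim (simp add: E'_def)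
  define F where "F = patch E' (mat 1) Rt"
  have bF: "bmf F" unfolding F_def by (rule bmf_patch[OF bmf_block[OF bt(4-7)] E'b])
  have lF: "lower_bounded (max (1 / \<alpha>) 1) (F t)" for t
  proof (cases "t \<in> E'")
    case True
    have "norm x \<le> max (1 / \<alpha>) 1 * norm (Rt t *v x)" for x
      using N(2) True order_trans[OF _ mult_right_mono[OF max.cobounded1[of "1 / \<alpha>" 1] norm_ge_zero[of "Rt t *v x"]]]
      unfolding lower_bounded_def E'_def by blast
    then show ?thesis using True by (simp add: lower_bounded_def F_def)
  next
    case False
    have "norm x \<le> max (1 / \<alpha>) 1 * norm x" for x :: "real^('m1 + 'm2)"
      using mult_right_mono[OF max.cobounded2[of 1 "1 / \<alpha>"] norm_ge_zero[of x]] by simp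
    then show ?thesis using False by (simp add: F_def lower_bounded_def)
  qed
  define It where "It t = matrix_inv (F t)" for t
  have bIt: "bmf It" unfolding It_def[abs_def] by (rule bmf_matrix_inv[OF bF lF])
  have FIt: "F t ** It t = mat 1" for t unfolding It_def by (rule matrix_inv_mult(2)[OF lower_bounded_inverse(1)[OF lF]])
  have symF: "tr (F t) = F t" for t
  proof (cases "t \<in> E'")
    case True
    have "tr (Rt21 t) = Rt12 t" using symt(2)[of t] by (metis transpose_transpose)
    then show ?thesis using True unfolding F_def patch_in[OF True] transpose_block symt by simp
  qed (simp add: F_def transpose_mat)
  interpret lq: lq_game T \<alpha> "\<lambda>s. z A s + z Ab s" Qt "\<lambda>s. z B1 s + z B1b s" "\<lambda>s. z B2 s + z B2b s" St1 St2 Rt11 Rt12 Rt21 Rt22 It "G + Gb"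
  proof
    show "0 < T" "0 < \<alpha>" by (rule Tpos \<alpha>)+
    show "bmf (\<lambda>s. z A s + z Ab s)" "bmf (\<lambda>s. z B1 s + z B1b s)" "bmf (\<lambda>s. z B2 s + z B2b s)" by (intro bmf_add bmp)+
    show "bmf Qt" "bmf St1" "bmf St2" "bmf Rt11" "bmf Rt12" "bmf Rt21" "bmf Rt22" "bmf It" by (rule bt bIt)+
    show "tr (Qt s) = Qt s" "tr (Rt12 s) = Rt21 s" for s by (rule symt)+
    show "tr (It s) = It s" for s by (rule inverse_transpose[OF FIt symF])
    show "tr (G + Gb) = G + Gb" by (simp add: transpose_add symG)
    show "AE t in lborel. t \<in> {0..T} \<longrightarrow> Rt t ** It t = mat 1"
      using E'_ae
    proof eventually_elim
      case (elim t)
      show ?case using elim FIt[of t] by (auto simp: F_def)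
    qed
  qed (fact player1_coercive player2_coercive)+
  let ?ric = "\<lambda>s. ric (z A s + z Ab s) (lq.B s) (Qt s) (lq.S s) (It s)"
  \<comment> \<open>On the intersection of both good sets the equation of the statement coincides
    with the Riccati equation of the deterministic game, so solutions can be carried over in both
    directions.\<close>
  have key: "residual t X V = X + ?ric t V"
    if t: "t \<in> E" "t \<in> E'" for t X V
  proof -
    have "It t = matrix_inv (Sig t)" using t by (simp add: It_def F_def Sig_Rt)
    then have "?ric t V = ric (A t + Ab t) (hcat (B1 t + B1b t) (B2 t + B2b t)) (Q t + Qb t + tr (C t + Cb t) ** P t ** (C t + Cb t))
      (vcat (S1 t + S1b t + tr (D1 t + D1b t) ** P t ** (C t + Cb t)) (S2 t + S2b t + tr (D2 t + D2b t) ** P t ** (C t + Cb t)))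
      (matrix_inv (Sig t)) V"
      unfolding lq.B_def lq.S_def using t by (simp add: Pc_in)
    then show ?thesis unfolding total_riccati[OF symP[OF E_sub(1)[OF t(1)]]] by simp
  qed
  \<comment> \<open>Every competitor in the sense of the statement is brought into integral form,
    where \<open>ric_unique\<close> applies to it.\<close>
  have sol_prim: "prim_on T V (\<lambda>s. - ?ric s (ext0T T V s))" if "sol V" for V
  proof (rule abs_cont_on_prim)
    show ac: "abs_cont_on 0 T V" using that by (simp add: sol_def)
    show "bmf (\<lambda>s. - ?ric s (ext0T T V s))"
      by (intro bmf_minus bmf_ric lq.b lq.bBS bmf_ext0T abs_cont_on_continuous ac)
    show "AE t in lborel. t \<in> {0..T} \<longrightarrow> (V has_vector_derivative - ?ric t (ext0T T V t)) (at t)"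
      using that[unfolded sol_def, THEN conjunct2, THEN conjunct2, THEN conjunct2] E_ae E'_ae
    proof eventually_elim
      case (elim t)
      show ?case
      proof
        assume t: "t \<in> {0..T}"
        then have tE: "t \<in> E" "t \<in> E'" using elim by blast+
        from elim(1)[rule_format, OF t, unfolded key[OF tE]] obtain V' where
          V': "(V has_vector_derivative V') (at t)" "V' + ?ric t (V t) = 0" by (elim exE conjE)
        from V'(2) have "V' = - ?ric t (ext0T T V t)" using t by (simp add: eq_neg_iff_add_eq_0)
        with V'(1) show "(V has_vector_derivative - ?ric t (ext0T T V t)) (at t)" by simp
      qed
    qed
  qed
  obtain V where V: "prim_on T V (\<lambda>s. - ?ric s (ext0T T V s))" "V T = G + Gb" "\<And>t. t \<in> {0..T} ==> tr (V t) = V t"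
    by (rule lq.riccati_exists) blast
  have "sol V"
    unfolding sol_def
  proof (intro conjI ballI)
    show "abs_cont_on 0 T V" by (rule prim_on_abs_cont[OF V(1)])
    show "symm (V t)" if "t \<in> {0..T}" for t using V(3)[OF that] by (simp add: symm_def)
    have d: "AE t in lborel. t \<in> {0..T} \<longrightarrow> (V has_vector_derivative - ?ric t (ext0T T V t)) (at t)" by (rule prim_on_AE_derivative[OF V(1)])
    show "AE t in lborel. t \<in> {0..T} \<longrightarrow> (\<exists>V'. (V has_vector_derivative V') (at t) \<and>
        residual t V' (V t) = 0)"
      using d E_ae E'_ae
    proof eventually_elim
      case (elim t)
      show ?case
      proof
        assume t: "t \<in> {0..T}"
        then have tE: "t \<in> E" "t \<in> E'" using elim by blast+
        show "\<exists>V'. (V has_vector_derivative V') (at t) \<and>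
        residual t V' (V t) = 0"
        proof (intro exI conjI)
          show "(V has_vector_derivative - ?ric t (ext0T T V t)) (at t)" using elim(1) t by blast
        qed (unfold key[OF tE], use t in simp)
      qed
    qed
  qed (rule V(2))
  moreover have "V' t = V t" if "sol V'" "t \<in> {0..T}" for V' t
  proof (rule ric_unique[OF lq.b(1) lq.bBS(1) lq.b(2) lq.bBS(2) lq.b(11) sol_prim[OF that(1)] V(1) _ that(2)])
    show "V' T = V T" using that(1) V(2) by (simp add: sol_def)
  qed
  ultimately show ?thesis by blast
qed

end

theorem mainTheorem6:
  fixes M :: "'w measure" and W :: "real \<Rightarrow> 'w \<Rightarrow> real" and T :: real
    and A Ab C Cb :: "real \<Rightarrow> real^'n^'n"
    and B1 B1b D1 D1b :: "real \<Rightarrow> real^'m1^'n"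
    and B2 B2b D2 D2b :: "real \<Rightarrow> real^'m2^'n"
    and G Gb :: "real^'n^'n"
    and Q Qb :: "real \<Rightarrow> real^'n^'n"
    and S1 S1b :: "real \<Rightarrow> real^'n^'m1" and S2 S2b :: "real \<Rightarrow> real^'n^'m2"
    and R11 R11b :: "real \<Rightarrow> real^'m1^'m1" and R12 R12b :: "real \<Rightarrow> real^'m2^'m1"
    and R21 R21b :: "real \<Rightarrow> real^'m1^'m2" and R22 R22b :: "real \<Rightarrow> real^'m2^'m2"
    and P :: "real \<Rightarrow> real^'n^'n"
  assumes prob: "prob_space M" and compl: "complete_measure M"
    and BM: "brownian_motion M W"
    and Tpos: "T > 0"
    \<comment> \<open>(H1)\<close>
    and H1: "Linf T A" "Linf T Ab" "Linf T C" "Linf T Cb"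
      "Linf T B1" "Linf T B1b" "Linf T D1" "Linf T D1b"
      "Linf T B2" "Linf T B2b" "Linf T D2" "Linf T D2b"
    \<comment> \<open>(H2)\<close>
    and H2G: "symm G" "symm Gb"
    and H2Q: "Linf T Q" "Linf T Qb"
      "AE t in lborel. t \<in> {0..T} \<longrightarrow> symm (Q t) \<and> symm (Qb t)"
    and H2S: "Linf T S1" "Linf T S1b" "Linf T S2" "Linf T S2b"
    and H2R: "Linf T R11" "Linf T R12" "Linf T R21" "Linf T R22"
      "Linf T R11b" "Linf T R12b" "Linf T R21b" "Linf T R22b"
      "AE t in lborel. t \<in> {0..T} \<longrightarrow>
         transpose (R11 t) = R11 t \<and> transpose (R12 t) = R21 t \<and>
         transpose (R21 t) = R12 t \<and> transpose (R22 t) = R22 t \<and>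
         transpose (R11b t) = R11b t \<and> transpose (R12b t) = R21b t \<and>
         transpose (R21b t) = R12b t \<and> transpose (R22b t) = R22b t"
    \<comment> \<open>(H3)\<close>
    and H3: "\<exists>\<alpha>>0.
      (\<forall>u1 X. admissible M (aug_filtration M W) T u1 \<longrightarrow>
         mf_state M (aug_filtration M W) W T A Ab B1 B1b B2 B2b C Cb D1 D1b D2 D2b 0 u1 (\<lambda>s \<omega>. 0) X \<longrightarrow>
         cost M T G Gb Q S1 S2 R11 R12 R21 R22 Qb S1b S2b R11b R12b R21b R22b u1 (\<lambda>s \<omega>. 0) X
           \<ge> \<alpha> * sq_norm M T u1) \<and>
      (\<forall>u2 X. admissible M (aug_filtration M W) T u2 \<longrightarrow>
         mf_state M (aug_filtration M W) W T A Ab B1 B1b B2 B2b C Cb D1 D1b D2 D2b 0 (\<lambda>s \<omega>. 0) u2 X \<longrightarrow>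
         cost M T G Gb Q S1 S2 R11 R12 R21 R22 Qb S1b S2b R11b R12b R21b R22b (\<lambda>s \<omega>. 0) u2 X
           \<le> - \<alpha> * sq_norm M T u2)"
    \<comment> \<open>P is the strongly regular solution of the Riccati equation (*)\<close>
    and SR: "strongly_regular T A C B1 B2 D1 D2 G Q S1 S2 R11 R12 R21 R22 P"
  shows
    "let B = (\<lambda>t. hcat (B1 t) (B2 t)); Bb = (\<lambda>t. hcat (B1b t) (B2b t));
         D = (\<lambda>t. hcat (D1 t) (D2 t)); Db = (\<lambda>t. hcat (D1b t) (D2b t));
         S = (\<lambda>t. vcat (S1 t) (S2 t)); Sb = (\<lambda>t. vcat (S1b t) (S2b t));
         R = (\<lambda>t. block (R11 t) (R12 t) (R21 t) (R22 t));
         Rb = (\<lambda>t. block (R11b t) (R12b t) (R21b t) (R22b t));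
         Sig = (\<lambda>t. R t + Rb t + transpose (D t + Db t) ** P t ** (D t + Db t));
         solPi = (\<lambda>Pi. abs_cont_on 0 T Pi \<and> (\<forall>t\<in>{0..T}. symm (Pi t)) \<and> Pi T = G + Gb \<and>
           (AE t in lborel. t \<in> {0..T} \<longrightarrow> (\<exists>Pi'. (Pi has_vector_derivative Pi') (at t) \<and>
              Pi' + Pi t ** (A t + Ab t) + transpose (A t + Ab t) ** Pi t + Q t + Qb t
              + transpose (C t + Cb t) ** P t ** (C t + Cb t)
              - (Pi t ** (B t + Bb t) + transpose (C t + Cb t) ** P t ** (D t + Db t)
                   + transpose (S t + Sb t))
                ** matrix_inv (Sig t)
                ** (transpose (B t + Bb t) ** Pi t + transpose (D t + Db t) ** P t ** (C t + Cb t)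
                   + S t + Sb t) = 0)))
     in (\<exists>K. AE t in lborel. t \<in> {0..T} \<longrightarrow> invertible (Sig t) \<and> norm (matrix_inv (Sig t)) \<le> K)
        \<and> (\<exists>Pi. solPi Pi \<and> (\<forall>Pi'. solPi Pi' \<longrightarrow> (\<forall>t\<in>{0..T}. Pi' t = Pi t)))"
proof -
  from SR obtain \<delta>1 \<delta>2 where \<delta>: "0 < \<delta>1" "0 < \<delta>2"
      "AE t in lborel. t \<in> {0..T} \<longrightarrow> (\<forall>v. \<delta>1 * (v \<bullet> v) \<le> v \<bullet> ((R11 t + tr (D1 t) ** P t ** D1 t) *v v))"
      "AE t in lborel. t \<in> {0..T} \<longrightarrow> (\<forall>v. \<delta>2 * (v \<bullet> v) \<le> v \<bullet> (- (R22 t + tr (D2 t) ** P t ** D2 t) *v v))"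
    unfolding strongly_regular_def unif_pos_def by (elim exE conjE)
  \<comment> \<open>With the opponent's control zero, state equation and cost reduce to their
    one-player forms, and (H3) splits into one condition for each player.\<close>
  from H3 obtain \<alpha> where \<alpha>: "0 < \<alpha>"
    "\<forall>u1 X. admissible M (aug_filtration M W) T u1 \<longrightarrow>
         state1 M (aug_filtration M W) W T A Ab B1 B1b C Cb D1 D1b u1 X \<longrightarrow>
         \<alpha> * sq_norm M T u1 \<le> cost1 M T G Gb Q S1 R11 Qb S1b R11b u1 X"
    "\<forall>u2 X. admissible M (aug_filtration M W) T u2 \<longrightarrow>
         state1 M (aug_filtration M W) W T A Ab B2 B2b C Cb D2 D2b u2 X \<longrightarrow>
         cost1 M T G Gb Q S2 R22 Qb S2b R22b u2 X \<le> - \<alpha> * sq_norm M T u2"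
    unfolding state_player1 state_player2 cost_player1 cost_player2 by (elim exE conjE)
  interpret prob_space M by (rule prob)
  \<comment> \<open>One constant for both diagonal blocks, cut off at 1 on account of the default
    values.\<close>
  interpret mf_game M W T A Ab C Cb B1 B1b D1 D1b B2 B2b D2 D2b G Gb Q Qb S1 S1b S2 S2b
    R11 R11b R12 R12b R21 R21b R22 R22b P \<alpha> "min 1 (min \<delta>1 \<delta>2)"
  proof
    show "brownian_motion M W" "0 < T" by (fact BM Tpos)+
    show "tr G = G" "tr Gb = Gb" using H2G by (simp_all add: symm_def)
    show "AE t in lborel. t \<in> {0..T} \<longrightarrow> tr (Q t) = Q t \<and> tr (Qb t) = Qb t \<and>
         tr (R11 t) = R11 t \<and> tr (R12 t) = R21 t \<and> tr (R22 t) = R22 t \<and>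
         tr (R11b t) = R11b t \<and> tr (R12b t) = R21b t \<and> tr (R22b t) = R22b t"
      using H2Q(3) H2R(9) by eventually_elim (simp add: symm_def)
    show "0 < min 1 (min \<delta>1 \<delta>2)" "min 1 (min \<delta>1 \<delta>2) \<le> 1" using \<delta> by auto
    show "AE t in lborel. t \<in> {0..T} \<longrightarrow>
        (\<forall>v. min 1 (min \<delta>1 \<delta>2) * (v \<bullet> v) \<le> ((R11 t + tr (D1 t) ** P t ** D1 t) *v v) \<bullet> v) \<and>
        (\<forall>v. min 1 (min \<delta>1 \<delta>2) * (v \<bullet> v) \<le> - (((R22 t + tr (D2 t) ** P t ** D2 t) *v v) \<bullet> v))"
      using \<delta>(3,4)
    proof eventually_elim
      case (elim t)
      have le: "min 1 (min \<delta>1 \<delta>2) * (v \<bullet> v) \<le> \<delta>1 * (v \<bullet> v)" "min 1 (min \<delta>1 \<delta>2) * (v \<bullet> v) \<le> \<delta>2 * (v \<bullet> v)"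
        for v :: "'z::real_inner" by (auto intro!: mult_right_mono)
      show ?case
      proof (intro impI conjI allI)
        fix v :: "real^'m1" assume "t \<in> {0..T}"
        with elim(1) have "\<delta>1 * (v \<bullet> v) \<le> ((R11 t + tr (D1 t) ** P t ** D1 t) *v v) \<bullet> v"
          by (simp add: inner_commute)
        with le(1)[of v] show "min 1 (min \<delta>1 \<delta>2) * (v \<bullet> v) \<le> ((R11 t + tr (D1 t) ** P t ** D1 t) *v v) \<bullet> v" by linarith
      next
        fix v :: "real^'m2" assume "t \<in> {0..T}"
        with elim(2) have "\<delta>2 * (v \<bullet> v) \<le> v \<bullet> (- (R22 t + tr (D2 t) ** P t ** D2 t) *v v)" by blast
        then have "\<delta>2 * (v \<bullet> v) \<le> - (((R22 t + tr (D2 t) ** P t ** D2 t) *v v) \<bullet> v)"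
          unfolding mv_minus inner_minus_right by (subst inner_commute)
        with le(2)[of v] show "min 1 (min \<delta>1 \<delta>2) * (v \<bullet> v) \<le> - (((R22 t + tr (D2 t) ** P t ** D2 t) *v v) \<bullet> v)" by linarith
      qed
    qed
    show "\<alpha> * sq_norm M T u \<le> cost1 M T G Gb Q S1 R11 Qb S1b R11b u X"
      if "admissible M (aug_filtration M W) T u" "state1 M (aug_filtration M W) W T A Ab B1 B1b C Cb D1 D1b u X" for u X
      using \<alpha>(2) that by blast
    show "\<alpha> * sq_norm M T u \<le> - cost1 M T G Gb Q S2 R22 Qb S2b R22b u X"
      if "admissible M (aug_filtration M W) T u" "state1 M (aug_filtration M W) W T A Ab B2 B2b C Cb D2 D2b u X" for u X
      using \<alpha>(3)[rule_format, OF that] by simp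
  qed (fact \<alpha>(1) SR H1 H2Q(1,2) H2S H2R(1-8))+
  show ?thesis
    using Sig_inverse sol_unique unfolding Let_def Sig_def sol_def by (rule conjI)
qed

end
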